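(* Let $0<p<\infty$, let $\omega=\omega_1\cdots\omega_s$ on $[-1,1]$, where the function $t\mapsto\omega_i(\cos t)$ belongs to $\Omega$ for $i=1,\dots,s$, and let $u$ be a doubling weight on $[-1,1]$. Then there exists a constant $C=C(p,\omega,u)$ such that for every integer $n\ge1$ and every algebraic polynomial $P_n$ of degree at most $n$, $$\int_{-1}^1|P_n'(x)|^p\,\omega(x)u(x)\,dx\le C\,n^{2p}\int_{-1}^1|P_n(x)|^p\,\omega(x)u(x)\,dx.$$
   Context: $\mathbb{T}=\mathbb{R}/2\pi\mathbb{Z}$. Weights on $[-1,1]$ are nonnegative integrable functions $[-1,1]\to[0,\infty)$. A weight $u$ on $[-1,1]$ is doubling if there is a constant $L$ with $\int_{2I\cap[-1,1]}u\le L\int_Iu$ for all intervals $I\subset[-1,1]$, where $2I$ is the interval with the same midpoint as $I$ and twice its length. Class $\Omega$: a function $w$ on $\mathbb{T}$ belongs to $\Omega$ if $w(t)=\exp(-F(g(t)))$, $t\in\mathbb{T}$ (with $w(t)=0$ where $g(t)=0$), where for some $A>0$: - $g:\mathbb{T}\to[-A,A]$ is real analytic, i.e. for some $D>0$, $|g^{(n)}(t)|\le D^n n!$ for all $t\in\mathbb{T}$, $n\ge 1$; each zero of $g$ has multiplicity one; and $g$ has at least one zero on $\mathbb{T}$; - $F:[-A,A]\setminus\{0\}\to(0,\infty)$ is even, $C^\infty$ on $(0,A]$, and satisfies: (F1) $F(x)\to\infty$ as $x\to0+$; (F2) $F$ is decreasing on $(0,A]$; (F3) for some $B>0$, $|F^{(n)}(x)|\le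 B^n n^n F(x)/x^n$ for $x\in(0,A]$, $n=1,2,\dots$; (F4) there exist $A_1,A_2>0$ with $A_2\le |F'(x)|x/F(x)\le A_1$ for $x\in(0,A]$. *)

theory Defs
  imports "HOL-Analysis.Analysis" "HOL-Computational_Algebra.Polynomial"
begin

definition weight :: "(real \<Rightarrow> real) \<Rightarrow> bool" where
  "weight u \<longleftrightarrow> (\<forall>x\<in>{-1..1}. 0 \<le> u x) \<and> u absolutely_integrable_on {-1..1}"

(* For I = [a,b], the interval 2I is [a - (b-a)/2, b + (b-a)/2]. *)
definition doubling :: "(real \<Rightarrow> real) \<Rightarrow> bool" where
  "doubling u \<longleftrightarrow> (\<exists>L. \<forall>a b. -1 \<le> a \<and> a \<le> b \<and> b \<le> 1 \<longrightarrow>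
     (LINT x:{a - (b - a) / 2 .. b + (b - a) / 2} \<inter> {-1..1}|lebesgue. u x)
       \<le> L * (LINT x:{a..b}|lebesgue. u x))"

(* Iterated derivatives relative to S; they depend only on the values of f on S and are
   one-sided at an endpoint belonging to S. *)
primrec nth_deriv_within :: "real set \<Rightarrow> nat \<Rightarrow> (real \<Rightarrow> real) \<Rightarrow> real \<Rightarrow> real" where
  "nth_deriv_within S 0 f = f"
| "nth_deriv_within S (Suc n) f =
     (\<lambda>x. vector_derivative (nth_deriv_within S n f) (at x within S))"

definition smooth_on :: "real set \<Rightarrow> (real \<Rightarrow> real) \<Rightarrow> bool" where
  "smooth_on S f \<longleftrightarrow> (\<forall>n. nth_deriv_within S n f differentiable_on S)"

(* Functions on the circle are functions on the reals of period 2 * pi. *)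
definition Omega_inner :: "real \<Rightarrow> (real \<Rightarrow> real) \<Rightarrow> bool" where
  "Omega_inner A g \<longleftrightarrow>
     (\<forall>t. g (t + 2 * pi) = g t) \<and>
     (\<forall>t. g t \<in> {-A..A}) \<and>
     (\<forall>n t. (deriv ^^ n) g field_differentiable (at t)) \<and>
     (\<exists>D>0. \<forall>n\<ge>1. \<forall>t. \<bar>(deriv ^^ n) g t\<bar> \<le> D ^ n * fact n) \<and>
     (\<forall>t. g t = 0 \<longrightarrow> deriv g t \<noteq> 0) \<and>
     (\<exists>t. g t = 0)"

definition Omega_outer :: "real \<Rightarrow> (real \<Rightarrow> real) \<Rightarrow> bool" where
  "Omega_outer A F \<longleftrightarrow>
     (\<forall>x\<in>{-A..A} - {0}. 0 < F x) \<and>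
     (\<forall>x\<in>{-A..A} - {0}. F (-x) = F x) \<and>
     smooth_on {0<..A} F \<and>
     filterlim F at_top (at_right 0) \<and>
     antimono_on {0<..A} F \<and>
     (\<exists>B>0. \<forall>n\<ge>1. \<forall>x\<in>{0<..A}.
        \<bar>nth_deriv_within {0<..A} n F x\<bar> \<le> B ^ n * real n ^ n * F x / x ^ n) \<and>
     (\<exists>A1>0. \<exists>A2>0. \<forall>x\<in>{0<..A}.
        A2 \<le> \<bar>nth_deriv_within {0<..A} 1 F x\<bar> * x / F x \<and>
        \<bar>nth_deriv_within {0<..A} 1 F x\<bar> * x / F x \<le> A1)"

definition Omega :: "(real \<Rightarrow> real) set" where
  "Omega = {w. \<exists>A>0. \<exists>g F. Omega_inner A g \<and> Omega_outer A F \<and>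
                 (\<forall>t. w t = (if g t = 0 then 0 else exp (- F (g t))))}"

end

theory Submission
  imports Defs "HOL-Complex_Analysis.Complex_Analysis" "HOL-Real_Asymp.Real_Asymp"
begin

text \<open>
  Put \<open>x = cos t\<close>, so that \<open>P (cos t)\<close> is a trigonometric polynomial of degree \<open>n\<close> and the weight becomes
  \<open>exp (- V t)\<close> with a potential \<open>V\<close> that blows up like a power at finitely many points \<open>\<tau>\<close>.
  Truncate \<open>V\<close> near each \<open>\<tau>\<close> at height \<open>C n \<rho>\<close>, where \<open>\<rho>\<close> is the radius at which \<open>V\<close> equals \<open>n \<rho>\<close>.
  At each point \<open>t\<close> the truncated potential \<open>U\<close> is touched from above by a parabola of curvature \<open>O(n / d)\<close>
  living at some scale \<open>d\<close>, and there is a trigonometric polynomial \<open>Q\<close> of degree \<open>O(n)\<close>, a tilted power of a Fejer-type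
  kernel, with \<open>|Q| \<approx> 1\<close> within \<open>O(1 / n)\<close> of \<open>t\<close> and \<open>|Q s|\<^sup>p \<le> C exp (U t - U s) (1 + n |s - t|)\<^sup>-\<^sup>r\<close> on the circle.
  Applying an unweighted Nikolskii inequality to \<open>P Q\<close> bounds \<open>|P|\<^sup>p exp (- U)\<close> in a complex disc of radius \<open>O(1 / n)\<close>
  about \<open>t\<close> by a rapidly decaying average of \<open>|P|\<^sup>p exp (- U)\<close> over a grid of mesh \<open>O(1 / n)\<close>. Cauchy's estimate turns
  this into a bound for \<open>P'\<close> with the factor \<open>n\<^sup>2\<close>. The doubling property makes the masses of cells of length \<open>1 / n\<close>
  comparable up to powers of their distance, which the decay absorbs; a second grid, finer by a large constant factor,
  replaces grid values by minima over cells. Where \<open>U < V\<close>, the Remez inequality lets \<open>P\<close> grow by at most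
  \<open>exp (O(n \<rho>))\<close>, which the factor \<open>exp (- C n \<rho>)\<close> of the truncated weight beats.
\<close>

section \<open>Trigonometric polynomials\<close>

text \<open>The weight \<open>u\<close> may be arbitrarily irregular inside a cell, so it enters
  only through masses of cells. The factor \<open>exp (- V)\<close> vanishes to infinite order at
  the points \<tau> and admits no comparison of masses across them, so polynomials have to carry it.
  At distance \<delta> from \<tau> the curvature of \<open>V\<close> is of order
  \<open>V / \<delta>^2\<close>, while kernels of degree \<open>O(n)\<close> match only
  \<open>n / \<delta>\<close>; the two agree where \<open>V\<close> is about
  \<open>n \<delta>\<close>, which is the critical radius and forces the truncation. The constants
  are chosen in an order that avoids a circle: the Remez growth uses only \<open>U \<le> n\<close>
  and the bound \<open>\<Gamma> n \<rho>\<close> for \<open>U\<close> just outside the critical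
  radius, neither of which involves the height of truncation, so that height is fixed afterwards.
  The pointwise bound is uniform in the refinement \<open>b\<close> of the grid, so \<open>b\<close>
  comes next, and last the threshold for \<open>n\<close>, beyond which
  \<open>n \<rho> \<ge> n powr \<gamma>\<close> makes the remaining powers of \<open>n\<close>
  harmless. The weighted sum over the nodes returns on the right with total factor
  \<open>1 / 2\<close>; being finite, it is absorbed.\<close>

definition trigp :: "nat \<Rightarrow> (complex \<Rightarrow> complex) \<Rightarrow> bool" where
  "trigp m f \<longleftrightarrow> (\<exists>q::complex poly. degree q \<le> 2 * m \<and>
     (\<forall>z. f z * exp (\<i> * of_nat m * z) = poly q (exp (\<i> * z))))"

text \<open>Multiplying by \<open>exp (\<i> m z)\<close> clears the negative frequencies, so
  products of trigonometric polynomials become products of ordinary polynomials in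
  \<open>exp (\<i> z)\<close>, and the variable may be complex throughout.\<close>

lemma trigp_mult:
  assumes "trigp m f" "trigp k g"
  shows "trigp (m + k) (\<lambda>z. f z * g z)"
proof -
  obtain q r where q: "degree q \<le> 2 * m" "\<And>z. f z * exp (\<i> * of_nat m * z) = poly q (exp (\<i> * z))"
    and r: "degree r \<le> 2 * k" "\<And>z. g z * exp (\<i> * of_nat k * z) = poly r (exp (\<i> * z))"
    using assms unfolding trigp_def by blast
  have "degree (q * r) \<le> 2 * (m + k)"
    using degree_mult_le[of q r] q(1) r(1) by simp
  moreover have "f z * g z * exp (\<i> * of_nat (m + k) * z) = poly (q * r) (exp (\<i> * z))" for z
  proof -
    have "exp (\<i> * of_nat (m + k) * z) = exp (\<i> * of_nat m * z) * exp (\<i> * of_nat k * z)"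
      by (simp add: exp_add[symmetric] algebra_simps)
    then have "f z * g z * exp (\<i> * of_nat (m + k) * z)
        = (f z * exp (\<i> * of_nat m * z)) * (g z * exp (\<i> * of_nat k * z))" by simp
    then show ?thesis by (simp only: q(2) r(2) poly_mult)
  qed
  ultimately show ?thesis unfolding trigp_def by blast
qed

lemma trigp_mono:
  assumes "trigp m f" "m \<le> k"
  shows "trigp k f"
proof -
  obtain q where q: "degree q \<le> 2 * m" "\<And>z. f z * exp (\<i> * of_nat m * z) = poly q (exp (\<i> * z))"
    using assms unfolding trigp_def by blast
  have "degree (q * monom 1 (k - m)) \<le> 2 * k"
    using degree_mult_le[of q "monom 1 (k-m)"] q(1) assms(2) degree_monom_le[of "1::complex" "k-m"]
    by linarith
  moreover have "f z * exp (\<i> * of_nat k * z) = poly (q * monom 1 (k - m)) (exp (\<i> * z))" for z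
  proof -
    have "exp (\<i> * of_nat k * z) = exp (\<i> * of_nat m * z) * exp (of_nat (k - m) * (\<i> * z))"
      using assms(2) by (simp add: exp_add[symmetric] algebra_simps of_nat_diff)
    then have "exp (\<i> * of_nat k * z) = exp (\<i> * of_nat m * z) * exp (\<i> * z) ^ (k - m)"
      by (simp only: exp_of_nat_mult)
    then have "f z * exp (\<i> * of_nat k * z) = (f z * exp (\<i> * of_nat m * z)) * exp (\<i> * z) ^ (k - m)" by simp
    then show ?thesis by (simp only: q(2) poly_mult poly_monom) simp
  qed
  ultimately show ?thesis unfolding trigp_def by blast
qed

lemma trigp_add:
  assumes "trigp m f" "trigp m g"
  shows "trigp m (\<lambda>z. f z + g z)"
proof -
  obtain q r where q: "degree q \<le> 2 * m" "\<And>z. f z * exp (\<i> * of_nat m * z) = poly q (exp (\<i> * z))"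
    and r: "degree r \<le> 2 * m" "\<And>z. g z * exp (\<i> * of_nat m * z) = poly r (exp (\<i> * z))"
    using assms unfolding trigp_def by blast
  have "degree (q + r) \<le> 2 * m" using q r by (simp add: degree_add_le)
  then show ?thesis unfolding trigp_def
    by (intro exI[of _ "q + r"]) (simp add: distrib_right q r)
qed

lemma trigp_const: "trigp 0 (\<lambda>z. c)"
  unfolding trigp_def by (intro exI[of _ "[:c:]"]) simp

lemma trigp_cmult: "trigp m f \<Longrightarrow> trigp m (\<lambda>z. c * f z)"
  using trigp_mult[OF trigp_const[of c], of m f] by simp

lemma trigp_diff: "trigp m f \<Longrightarrow> trigp m g \<Longrightarrow> trigp m (\<lambda>z. f z - g z)"
  using trigp_add[of m f "\<lambda>z. (-1) * g z"] trigp_cmult[of m g "-1"] by simp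

lemma trigp_power: "trigp m f \<Longrightarrow> trigp (k * m) (\<lambda>z. f z ^ k)"
proof (induction k)
  case 0 then show ?case using trigp_const[of 1] by simp
next
  case (Suc k) then show ?case using trigp_mult[of m f "k * m" "\<lambda>z. f z ^ k"] by simp
qed

lemma trigp_sum:
  assumes "\<And>i. i \<in> A \<Longrightarrow> trigp m (f i)"
  shows "trigp m (\<lambda>z. \<Sum>i\<in>A. f i z)"
proof (cases "finite A")
  case True
  then show ?thesis using assms
  proof (induction A)
    case empty then show ?case using trigp_mono[OF trigp_const[of 0]] by simp
  next
    case (insert x A) then show ?case by (simp add: trigp_add)
  qed
next
  case False then show ?thesis using trigp_mono[OF trigp_const[of 0]] by simp
qed

lemma trigp_expi: "k \<le> 2 * m \<Longrightarrow> trigp m (\<lambda>z. c * exp (\<i> * (of_nat k - of_nat m) * z))"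
  unfolding trigp_def
  by (intro exI[of _ "monom c k"] conjI)
     (auto simp: poly_monom degree_monom_le order.trans[OF degree_monom_le]
        exp_add[symmetric] exp_of_nat_mult[symmetric] algebra_simps)

text \<open>The Fourier form, with frequencies \<open>k - m\<close>; shifts, reflections and the
  period are read off from it.\<close>

lemma trigp_expand:
  assumes "trigp m f"
  obtains c where "\<And>z. f z = (\<Sum>k\<le>2*m. c k * exp (\<i> * (of_nat k - of_nat m) * z))"
proof -
  obtain q where q: "degree q \<le> 2 * m" "\<And>z. f z * exp (\<i> * of_nat m * z) = poly q (exp (\<i> * z))"
    using assms unfolding trigp_def by blast
  have "f z = (\<Sum>k\<le>2*m. coeff q k * exp (\<i> * (of_nat k - of_nat m) * z))" for z
  proof -
    have "poly q (exp (\<i> * z)) = (\<Sum>k\<le>2*m. coeff q k * exp (\<i> * z) ^ k)"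
      unfolding poly_altdef using q(1)
      by (intro sum.mono_neutral_left) (auto simp: coeff_eq_0)
    then have "f z * exp (\<i> * of_nat m * z) * exp (- (\<i> * of_nat m * z))
        = (\<Sum>k\<le>2*m. coeff q k * exp (\<i> * z) ^ k) * exp (- (\<i> * of_nat m * z))"
      using q(2) by simp
    moreover have "exp (\<i> * of_nat m * z) * exp (- (\<i> * of_nat m * z)) = 1"
      by (simp add: exp_add[symmetric])
    ultimately have "f z = (\<Sum>k\<le>2*m. coeff q k * exp (\<i> * z) ^ k) * exp (- (\<i> * of_nat m * z))"
      by (metis mult.assoc mult.right_neutral)
    then have "f z = (\<Sum>k\<le>2*m. coeff q k * (exp (of_nat k * (\<i> * z)) * exp (- (\<i> * of_nat m * z))))"
      by (simp add: sum_distrib_right exp_of_nat_mult mult.assoc)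
    also have "\<dots> = (\<Sum>k\<le>2*m. coeff q k * exp (\<i> * (of_nat k - of_nat m) * z))"
      by (intro sum.cong refl arg_cong2[where f="(*)"]) (simp add: exp_add[symmetric] algebra_simps)
    finally show ?thesis .
  qed
  then show ?thesis using that by blast
qed

lemma trigp_affine:
  assumes "trigp m f"
  shows "trigp m (\<lambda>z. f (z + a))"
proof -
  obtain c where c: "\<And>z. f z = (\<Sum>k\<le>2*m. c k * exp (\<i> * (of_nat k - of_nat m) * z))"
    using trigp_expand[OF assms] by blast
  have "(\<lambda>z. f (z + a)) = (\<lambda>z. \<Sum>k\<le>2*m. (c k * exp (\<i> * (of_nat k - of_nat m) * a)) * exp (\<i> * (of_nat k - of_nat m) * z))"
    by (simp add: c mult.assoc exp_add[symmetric] algebra_simps)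
  moreover have "trigp m \<dots>" by (intro trigp_sum trigp_expi) auto
  ultimately show ?thesis by simp
qed

lemma trigp_minus:
  assumes "trigp m f"
  shows "trigp m (\<lambda>z. f (- z))"
proof -
  obtain c where c: "\<And>z. f z = (\<Sum>k\<le>2*m. c k * exp (\<i> * (of_nat k - of_nat m) * z))"
    using trigp_expand[OF assms] by blast
  have "(\<lambda>z. f (- z)) = (\<lambda>z. \<Sum>k\<le>2*m. c k * exp (\<i> * (of_nat (2*m - k) - of_nat m) * z))"
    by (intro ext) (auto simp: c of_nat_diff algebra_simps intro!: sum.cong)
  moreover have "trigp m \<dots>" by (intro trigp_sum trigp_expi) auto
  ultimately show ?thesis by simp
qed

lemma trigp_cos: "trigp k (\<lambda>z. cos (of_nat k * z))"
proof -
  have "(\<lambda>z::complex. cos (of_nat k * z)) =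
    (\<lambda>z. 1/2 * exp (\<i> * (of_nat (2*k) - of_nat k) * z) + 1/2 * exp (\<i> * (of_nat 0 - of_nat k) * z))"
    by (auto simp: fun_eq_iff cos_exp_eq algebra_simps)
  moreover have "trigp k \<dots>" by (intro trigp_add trigp_expi) auto
  ultimately show ?thesis by simp
qed

lemma trigp_sin: "trigp k (\<lambda>z. sin (of_nat k * z))"
proof -
  have "(\<lambda>z::complex. sin (of_nat k * z)) =
    (\<lambda>z. 1/(2*\<i>) * exp (\<i> * (of_nat (2*k) - of_nat k) * z) + (-1/(2*\<i>)) * exp (\<i> * (of_nat 0 - of_nat k) * z))"
    by (auto simp: fun_eq_iff sin_exp_eq algebra_simps diff_divide_distrib)
  moreover have "trigp k \<dots>" by (intro trigp_add trigp_expi) auto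
  ultimately show ?thesis by simp
qed

lemma trigp_cos1: "trigp 1 cos"
  using trigp_cos[of 1] by simp

lemma trigp_poly_of:
  assumes "trigp 1 f" "degree P \<le> n"
  shows "trigp n (\<lambda>z. poly P (f z))"
proof -
  have "trigp n (\<lambda>z. \<Sum>i\<le>degree P. coeff P i * f z ^ i)"
  proof (intro trigp_sum trigp_cmult)
    fix i assume "i \<in> {..degree P}"
    then show "trigp n (\<lambda>z. f z ^ i)"
      using trigp_mono[OF trigp_power[OF assms(1), of i], of n] assms(2) by simp
  qed
  then show ?thesis by (simp add: poly_altdef)
qed

text \<open>The coefficients are read off by the discrete Fourier transform on \<open>N > 2m\<close> equidistant nodes.\<close>

lemma trigp_grid_bound:
  assumes "trigp m f" "2 * m < N"
  shows "cmod (f z) \<le> (2 * real m + 1) * exp (real m * \<bar>Im z\<bar>) / real N *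
           (\<Sum>j<N. cmod (f (of_real (x0 + 2 * pi * real j / real N))))"
proof -
  obtain c where c: "\<And>z. f z = (\<Sum>k\<le>2*m. c k * exp (\<i> * (of_nat k - of_nat m) * z))"
    using trigp_expand[OF assms(1)] by blast
  define s where "s j = x0 + 2 * pi * real j / real N" for j :: nat
  have N: "N > 0" using assms by simp
  have orth: "(\<Sum>j<N. exp (\<i> * (of_nat k - of_nat l) * of_real (s j))) = (if k = l then of_nat N else 0)"
    if "k \<le> 2 * m" "l \<le> 2 * m" for k l
  proof (cases "k = l")
    case False
    define w where "w = exp (2 * of_real pi * \<i> * of_int (int k - int l) / of_nat N)"
    have e: "exp (\<i> * (of_nat k - of_nat l) * of_real (s j)) = exp (\<i> * (of_nat k - of_nat l) * of_real x0) * w ^ j" for j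
      unfolding w_def s_def
      by (simp add: exp_of_nat_mult[symmetric] exp_add[symmetric] algebra_simps)
    have wN: "w ^ N = 1"
    proof -
      have "w ^ N = exp (of_nat N * (2 * of_real pi * \<i> * of_int (int k - int l) / of_nat N))"
        unfolding w_def by (rule exp_of_nat_mult[symmetric])
      also have "of_nat N * (2 * of_real pi * \<i> * of_int (int k - int l) / of_nat N) = 2 * of_int (int k - int l) * of_real pi * \<i>" using N by simp
      also have "exp (2 * of_int (int k - int l) * of_real pi * \<i>) = 1"
        unfolding exp_eq_1 by (auto intro!: exI[of _ "int k - int l"])
      finally show ?thesis .
    qed
    \<comment> \<open>No aliasing: \<open>k - l\<close> is nonzero and at most
      \<open>2 * m < N\<close> in absolute value, so it is no multiple of \<open>N\<close>.\<close>
    have w1: "w \<noteq> 1"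
    proof
      assume "w = 1"
      then obtain r :: int where "2 * pi * (real k - real l) / real N = real_of_int (2 * r) * pi"
        unfolding w_def exp_eq_1 by auto
      then have "2 * pi * (real k - real l) = 2 * pi * (real_of_int r * real N)"
        using N by (simp add: divide_eq_eq mult_ac)
      then have "real k - real l = real_of_int r * real N" by simp
      then have "real_of_int (int k - int l) = real_of_int (r * int N)" by simp
      then have eq: "int k - int l = r * int N" by linarith
      have "r \<noteq> 0" using eq False by auto
      then have "\<bar>r * int N\<bar> \<ge> int N" using mult_right_mono[of 1 "\<bar>r\<bar>" "int N"] by (simp add: abs_mult)
      then show False using eq that assms by linarith
    qed
    show ?thesis using geometric_sum[OF w1, of N] wN False
      by (simp add: e sum_distrib_left[symmetric])
  qed simp
  define S where "S = (\<Sum>j<N. cmod (f (of_real (s j))))"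
  have cb: "cmod (c l) \<le> S / real N" if l: "l \<le> 2 * m" for l
  proof -
    have "(\<Sum>j<N. f (of_real (s j)) * exp (\<i> * (of_nat m - of_nat l) * of_real (s j)))
       = (\<Sum>j<N. \<Sum>k\<le>2*m. c k * exp (\<i> * (of_nat k - of_nat l) * of_real (s j)))"
      unfolding c sum_distrib_right mult.assoc exp_add[symmetric]
      by (intro sum.cong refl arg_cong2[where f="(*)"] arg_cong[where f=exp]) (simp add: algebra_simps)
    also have "\<dots> = (\<Sum>k\<le>2*m. c k * (\<Sum>j<N. exp (\<i> * (of_nat k - of_nat l) * of_real (s j))))"
      by (subst sum.swap) (simp add: sum_distrib_left)
    also have "\<dots> = (\<Sum>k\<le>2*m. c k * (if k = l then of_nat N else 0))"
      using orth l by (intro sum.cong) auto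
    also have "\<dots> = c l * of_nat N" using l by (simp add: if_distrib[where f="\<lambda>x. c _ * x"] cong: if_cong)
    finally have "cmod (c l) * real N = cmod (\<Sum>j<N. f (of_real (s j)) * exp (\<i> * (of_nat m - of_nat l) * of_real (s j)))"
      by (metis norm_mult norm_of_nat)
    also have "\<dots> \<le> (\<Sum>j<N. cmod (f (of_real (s j)) * exp (\<i> * (of_nat m - of_nat l) * of_real (s j))))"
      by (rule norm_sum)
    also have "\<dots> = S" unfolding S_def by (intro sum.cong) (auto simp: norm_mult)
    finally show ?thesis using N by (simp add: field_simps)
  qed
  have "cmod (f z) \<le> (\<Sum>k\<le>2*m. cmod (c k * exp (\<i> * (of_nat k - of_nat m) * z)))"
    unfolding c by (rule norm_sum)
  also have "\<dots> \<le> (\<Sum>k\<le>2*m. S / real N * exp (real m * \<bar>Im z\<bar>))"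
  proof (intro sum_mono)
    fix k assume "k \<in> {..2*m}"
    then have k: "k \<le> 2 * m" by simp
    have "\<bar>real k - real m\<bar> * \<bar>Im z\<bar> \<le> real m * \<bar>Im z\<bar>"
      using k by (intro mult_right_mono) auto
    then have "- ((real k - real m) * Im z) \<le> real m * \<bar>Im z\<bar>"
      using abs_ge_minus_self[of "(real k - real m) * Im z"] by (simp add: abs_mult)
    then have "cmod (exp (\<i> * (of_nat k - of_nat m) * z)) \<le> exp (real m * \<bar>Im z\<bar>)"
      by (simp add: norm_exp_eq_Re)
    then show "cmod (c k * exp (\<i> * (of_nat k - of_nat m) * z)) \<le> S / real N * exp (real m * \<bar>Im z\<bar>)"
      unfolding norm_mult using cb[OF k] order.trans[OF norm_ge_zero cb[OF k]] by (intro mult_mono) auto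
  qed
  also have "\<dots> = (2 * real m + 1) * exp (real m * \<bar>Im z\<bar>) / real N * S"
    by simp
  finally show ?thesis unfolding S_def s_def .
qed

text \<open>Powers \<open>f ^ k\<close> with \<open>k \<ge> p\<close> are again trigonometric
  polynomials, which reduces every \<open>p > 0\<close> to the sup bound above. For
  \<open>q = p / k \<le> 1\<close> the sum of \<open>|f| ^ k\<close> over the nodes is at most
  \<open>Y powr (1 - q)\<close> times the sum of \<open>|f| powr p\<close>, with \<open>Y\<close>
  the largest value of \<open>|f| ^ k\<close> at a node, and the bound at that node controls
  \<open>Y\<close> itself.\<close>

lemma trigp_grid_bound_powr:
  fixes p :: real
  assumes "trigp m f" "0 < p" "p \<le> real k" "2 * (k * m) < N"
  shows "cmod (f z) powr p \<le> exp (p * real m * \<bar>Im z\<bar>) * (2 * real (k * m) + 1) / real N *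
           (\<Sum>j<N. cmod (f (of_real (x0 + 2 * pi * real j / real N))) powr p)"
proof -
  define q where "q = p / real k"
  have k: "k > 0" using assms by (cases k) auto
  have q: "0 < q" "q \<le> 1" "q * real k = p" using assms k unfolding q_def by auto
  have tr: "trigp (k * m) (\<lambda>z. f z ^ k)" by (rule trigp_power[OF assms(1)])
  define s where "s j = complex_of_real (x0 + 2 * pi * real j / real N)" for j :: nat
  define Y where "Y = Max ((\<lambda>j. cmod (f (s j)) ^ k) ` {..<N})"
  have N: "N > 0" using assms by simp
  have Yj: "cmod (f (s j)) ^ k \<le> Y" if "j < N" for j unfolding Y_def using that by (intro Max_ge) auto
  have Y0: "0 \<le> Y" using Yj[OF N] by (meson norm_ge_zero order_trans zero_le_power)
  have pw: "(cmod w ^ k) powr q = cmod w powr p" for w :: complex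
    using q(3) k by (cases "w = 0") (auto simp: powr_realpow[symmetric] powr_powr mult.commute)
  define S where "S = (\<Sum>j<N. cmod (f (s j)) powr p)"
  have S0: "0 \<le> S" unfolding S_def by (simp add: sum_nonneg)
  define D where "D = 2 * real (k * m) + 1"
  have D: "D > 0" unfolding D_def by (metis add_nonneg_pos mult_nonneg_nonneg of_nat_0_le_iff zero_le_numeral zero_less_one)
  have sm: "(\<Sum>j<N. cmod (f (s j)) ^ k) \<le> Y powr (1 - q) * S"
    unfolding S_def sum_distrib_left
  proof (intro sum_mono)
    fix j assume "j \<in> {..<N}"
    then have j: "cmod (f (s j)) ^ k \<le> Y" using Yj by simp
    have "cmod (f (s j)) ^ k = (cmod (f (s j)) ^ k) powr (1 - q) * (cmod (f (s j)) ^ k) powr q"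
      using powr_add[of "cmod (f (s j)) ^ k" "1 - q" q] by (cases "f (s j) = 0") (use k in auto)
    also have "\<dots> \<le> Y powr (1 - q) * (cmod (f (s j)) ^ k) powr q"
      using j q by (intro mult_right_mono powr_mono2) auto
    finally show "cmod (f (s j)) ^ k \<le> Y powr (1 - q) * cmod (f (s j)) powr p" using pw by simp
  qed
  have gb: "cmod (f z) ^ k \<le> D * exp (real (k * m) * \<bar>Im z\<bar>) / real N * (Y powr (1 - q) * S)" for z
  proof -
    have "cmod (f z) ^ k \<le> D * exp (real (k * m) * \<bar>Im z\<bar>) / real N * (\<Sum>j<N. cmod (f (s j)) ^ k)"
      using trigp_grid_bound[OF tr assms(4), of z x0] unfolding s_def D_def by (simp add: norm_power)
    also have "\<dots> \<le> D * exp (real (k * m) * \<bar>Im z\<bar>) / real N * (Y powr (1 - q) * S)"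
      using sm D by (intro mult_left_mono) auto
    finally show ?thesis .
  qed
  \<comment> \<open>At a node attaining \<open>Y\<close> the bound \<open>gb\<close> reads
    \<open>Y \<le> D / N * Y powr (1 - q) * S\<close>; dividing leaves a bound for
    \<open>Y powr q\<close>.\<close>
  have Yq: "Y powr q \<le> D / real N * S"
  proof (cases "Y = 0")
    case False
    have "Y \<in> (\<lambda>j. cmod (f (s j)) ^ k) ` {..<N}"
      unfolding Y_def using N by (intro Max_in) auto
    then obtain j where j: "j < N" "Y = cmod (f (s j)) ^ k" by auto
    have "Im (s j) = 0" unfolding s_def by (simp only: Im_complex_of_real)
    then have "Y \<le> D / real N * (Y powr (1 - q) * S)"
      using gb[of "s j"] j(2) by simp
    moreover have "Y powr q * Y powr (1 - q) = Y"
      using Y0 False by (simp flip: powr_add)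
    ultimately have "Y powr q * Y powr (1 - q) \<le> (D / real N * S) * Y powr (1 - q)"
      by (metis mult.assoc mult.commute)
    moreover have "0 < Y powr (1 - q)" using Y0 False by simp
    ultimately show ?thesis by (rule mult_right_le_imp_le)
  qed (use q D S0 in auto)
  have "cmod (f z) powr p = (cmod (f z) ^ k) powr q" by (simp add: pw)
  also have "\<dots> \<le> (D * exp (real (k * m) * \<bar>Im z\<bar>) / real N * (Y powr (1 - q) * S)) powr q"
    using gb q by (intro powr_mono2) auto
  also have "\<dots> = (D / real N * S) powr q * exp (real (k * m) * \<bar>Im z\<bar>) powr q * (Y powr q) powr (1 - q)"
    using D S0 by (simp add: powr_mult powr_divide powr_powr mult_ac)
  also have "\<dots> \<le> (D / real N * S) powr q * exp (real (k * m) * \<bar>Im z\<bar>) powr q * (D / real N * S) powr (1 - q)"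
    using Yq q by (intro mult_left_mono powr_mono2) auto
  also have "\<dots> = exp (real (k * m) * \<bar>Im z\<bar>) powr q * ((D / real N * S) powr q * (D / real N * S) powr (1 - q))"
    by simp
  also have "(D / real N * S) powr q * (D / real N * S) powr (1 - q) = D / real N * S"
    using D S0 by (subst powr_add[symmetric]) simp
  also have "exp (real (k * m) * \<bar>Im z\<bar>) powr q = exp (p * real m * \<bar>Im z\<bar>)"
    using q(3) by (simp add: exp_powr_real algebra_simps flip: q(3))
  finally show ?thesis unfolding S_def D_def s_def by (simp add: mult_ac)
qed

section \<open>Peak polynomials\<close>

lemma sin_ge_half: "y / 2 \<le> sin y" if "0 \<le> y" "y \<le> 1" for y :: real
proof -
  have "\<bar>sin y - y\<bar> \<le> \<bar>y\<bar> ^ 3 / 6"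
    using Maclaurin_sin_bound[of y 3] by (simp add: sin_coeff_def eval_nat_numeral)
  moreover have "y ^ 3 \<le> y" using that power_decreasing[of 1 3 y] by simp
  ultimately show ?thesis using that by (auto simp: abs_if split: if_splits)
qed

lemma sin_ge_quarter: "y / 4 \<le> sin y" if "0 \<le> y" "y \<le> pi / 2" for y :: real
proof (cases "y \<le> 1")
  case True then show ?thesis using sin_ge_half[of y] that by simp
next
  case False
  have "sin 1 \<le> sin y" using False that by (intro sin_monotone_2pi_le) auto
  moreover have "1 / 2 \<le> sin (1::real)" using sin_ge_half[of 1] by simp
  moreover have "y \<le> 2" using that pi_less_4 by simp
  ultimately show ?thesis by simp
qed

lemma abs_sin_half_ge: "\<bar>x\<bar> / 8 \<le> \<bar>sin (x / 2)\<bar>" if "\<bar>x\<bar> \<le> pi" for x :: real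
proof (cases "0 \<le> x")
  case True then show ?thesis using sin_ge_quarter[of "x/2"] that by simp
next
  case False then show ?thesis using sin_ge_quarter[of "-x/2"] that by simp
qed

lemma abs_sin_diff_le: "\<bar>sin y - y\<bar> \<le> y\<^sup>2 / 2" for y :: real
  using Maclaurin_sin_bound[of y 2] by (simp add: sin_coeff_def eval_nat_numeral)

lemma cmod_sin_le: "cmod (sin z) \<le> 3 * cmod z" if "cmod z \<le> 1"
proof -
  have "cmod (sin z - sin 0) \<le> 3 * cmod (z - 0)"
  proof (rule field_differentiable_bound[where S = "cball 0 1" and f' = cos])
    fix w :: complex assume "w \<in> cball 0 1"
    then have "cmod (cos w) \<le> exp 1" by (intro order.trans[OF norm_cos_le]) auto
    then show "cmod (cos w) \<le> 3" using exp_le by linarith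
  qed (use that in \<open>auto intro!: derivative_eq_intros\<close>)
  then show ?thesis by simp
qed

text \<open>The normalised Fejer kernel of order \<open>2 ^ q\<close>, with value 1 at the origin.
  The product form makes single factors available as upper bounds and allows induction on the scale
  at complex arguments.\<close>

definition peak_kernel :: "nat \<Rightarrow> complex \<Rightarrow> complex" where
  "peak_kernel q z = (\<Prod>l<q. (1 + cos (2 ^ l * z)) / 2)"

lemma trigp_peak_kernel: "trigp (2 ^ q) (peak_kernel q)"
proof -
  have "trigp (2 ^ q - 1) (peak_kernel q)"
  proof (induction q)
    case 0 show ?case unfolding peak_kernel_def using trigp_const by simp
  next
    case (Suc q)
    have "trigp (2 ^ q) (\<lambda>z. 1 + cos (of_nat (2 ^ q) * z))"
      by (intro trigp_add trigp_cos trigp_mono[OF trigp_const]) auto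
    from trigp_cmult[OF this, of "1/2"]
    have "trigp (2 ^ q) (\<lambda>z. (1 + cos (2 ^ q * z)) / 2)" by (simp add: field_simps)
    from trigp_mult[OF Suc this]
    have "trigp (2 ^ q - 1 + 2 ^ q) (\<lambda>z. peak_kernel q z * ((1 + cos (2 ^ q * z)) / 2))" .
    moreover have "2 ^ q - 1 + 2 ^ q = 2 ^ Suc q - (1::nat)"
      by (metis Nat.add_diff_assoc2 mult_2 one_le_numeral one_le_power power_Suc)
    moreover have "(\<lambda>z. peak_kernel q z * ((1 + cos (2 ^ q * z)) / 2)) = peak_kernel (Suc q)"
      by (auto simp: peak_kernel_def fun_eq_iff)
    ultimately show ?case by simp
  qed
  then show ?thesis by (rule trigp_mono) simp
qed

definition real_peak :: "nat \<Rightarrow> real \<Rightarrow> real" where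
  "real_peak q x = (\<Prod>l<q. (cos (2 ^ l * x / 2))\<^sup>2)"

lemma one_plus_cos_half: "(1 + cos x) / 2 = (cos (x / 2))\<^sup>2" for x :: real
  using cos_double_cos[of "x/2"] by simp

lemma peak_kernel_of_real: "peak_kernel q (of_real x) = of_real (real_peak q x)"
proof -
  have "(1 + cos (2 ^ l * complex_of_real x)) / 2 = complex_of_real ((cos (2 ^ l * x / 2))\<^sup>2)" for l
  proof -
    have "complex_of_real ((cos (2 ^ l * x / 2))\<^sup>2) = of_real ((1 + cos (2 ^ l * x)) / 2)"
      by (simp only: one_plus_cos_half)
    moreover have "cos (2 ^ l * complex_of_real x) = of_real (cos (2 ^ l * x))" by (simp flip: cos_of_real)
    ultimately show ?thesis by simp
  qed
  then show ?thesis unfolding peak_kernel_def real_peak_def by simp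
qed

lemma real_peak_nonneg: "0 \<le> real_peak q x"
  unfolding real_peak_def by (intro prod_nonneg) auto

lemma cos_sq_le_1: "(cos x)\<^sup>2 \<le> 1" for x :: real
  using abs_square_le_1[of "cos x"] by simp

lemma real_peak_le_factor:
  assumes "l < q"
  shows "real_peak q x \<le> (cos (2 ^ l * x / 2))\<^sup>2"
proof -
  have "real_peak q x = (cos (2 ^ l * x / 2))\<^sup>2 * (\<Prod>l\<in>{..<q} - {l}. (cos (2 ^ l * x / 2))\<^sup>2)"
    unfolding real_peak_def using assms by (intro prod.remove) auto
  moreover have "(\<Prod>l\<in>{..<q} - {l}. (cos (2 ^ l * x / 2))\<^sup>2) \<le> 1"
    by (intro prod_le_1) (auto simp: cos_sq_le_1)
  ultimately show ?thesis by (simp add: mult_left_le)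
qed

lemma real_peak_le_1: "real_peak q x \<le> 1"
  unfolding real_peak_def by (intro prod_le_1) (auto simp: cos_sq_le_1)

text \<open>Telescoping by the duplication formula of the sine; this identifies the product with the
  Fejer kernel.\<close>

lemma real_peak_closed: "real_peak q x * (2 ^ q)\<^sup>2 * (sin (x / 2))\<^sup>2 = (sin (2 ^ q * x / 2))\<^sup>2"
proof (induction q)
  case 0 show ?case by (simp add: real_peak_def)
next
  case (Suc q)
  have "(sin (2 ^ Suc q * x / 2))\<^sup>2 = (2 * sin (2 ^ q * x / 2) * cos (2 ^ q * x / 2))\<^sup>2"
    using sin_double[of "2 ^ q * x / 2"] by (simp add: mult.assoc)
  also have "\<dots> = 4 * (cos (2 ^ q * x / 2))\<^sup>2 * (sin (2 ^ q * x / 2))\<^sup>2"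
    by (simp add: power_mult_distrib)
  also have "\<dots> = 4 * (cos (2 ^ q * x / 2))\<^sup>2 * (real_peak q x * (2 ^ q)\<^sup>2 * (sin (x / 2))\<^sup>2)"
    by (simp only: Suc)
  also have "\<dots> = real_peak (Suc q) x * (2 ^ Suc q)\<^sup>2 * (sin (x / 2))\<^sup>2"
    by (simp add: real_peak_def power_mult_distrib)
  finally show ?case by simp
qed

lemma real_peak_decay:
  assumes "\<bar>x\<bar> \<le> pi"
  shows "real_peak q x * (2 ^ q * x)\<^sup>2 \<le> 64"
proof -
  have "(\<bar>x\<bar> / 8)\<^sup>2 \<le> \<bar>sin (x / 2)\<bar>\<^sup>2" using abs_sin_half_ge[OF assms] by (intro power_mono) auto
  then have "x\<^sup>2 / 64 \<le> (sin (x / 2))\<^sup>2" by (simp add: power_divide)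
  then have "real_peak q x * (2 ^ q)\<^sup>2 * (x\<^sup>2 / 64) \<le> real_peak q x * (2 ^ q)\<^sup>2 * (sin (x / 2))\<^sup>2"
    using real_peak_nonneg by (intro mult_left_mono) auto
  also have "\<dots> \<le> 1" unfolding real_peak_closed
    using abs_square_le_1[of "sin (2 ^ q * x / 2)"] by simp
  finally show ?thesis by (simp add: power_mult_distrib)
qed

text \<open>The last factor alone suffices: its cosine has argument \<open>2 ^ q * x / 4\<close>,
  where \<open>1 - cos^2 = sin^2\<close> is quadratic from below.\<close>

lemma real_peak_near:
  assumes "1 \<le> q" "\<bar>2 ^ q * x\<bar> \<le> 1"
  shows "real_peak q x \<le> 1 - (2 ^ q * x)\<^sup>2 / 64"
proof -
  obtain r where r: "q = Suc r" using assms by (cases q) auto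
  define y where "y = 2 ^ r * x / 2"
  have y: "2 ^ q * x = 4 * y" unfolding y_def r by simp
  have "\<bar>y\<bar> \<le> 1" using assms(2) y by simp
  then have "\<bar>y\<bar> / 2 \<le> \<bar>sin y\<bar>"
    using sin_ge_half[of "\<bar>y\<bar>"] by (cases "0 \<le> y") auto
  then have "(\<bar>y\<bar> / 2)\<^sup>2 \<le> \<bar>sin y\<bar>\<^sup>2" by (intro power_mono) auto
  then have "y\<^sup>2 / 4 \<le> (sin y)\<^sup>2" by (simp add: power_divide)
  moreover have "real_peak q x \<le> (cos y)\<^sup>2" unfolding y_def using r by (intro real_peak_le_factor) auto
  moreover have "(cos y)\<^sup>2 = 1 - (sin y)\<^sup>2" by (simp add: cos_squared_eq)
  moreover have "(2 ^ q * x)\<^sup>2 / 64 = y\<^sup>2 / 4" unfolding y by (simp add: power_mult_distrib)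
  ultimately show ?thesis by linarith
qed

text \<open>Some dyadic multiple \<open>2 ^ l * |x| / 2\<close> with \<open>l < q\<close> falls into
  \<open>[1/4, pi/2]\<close>, since this interval is longer than one doubling; there
  \<open>cos^2 \<le> 1 - 1/64\<close>, and the other factors are at most 1.\<close>

lemma real_peak_far:
  assumes "1 \<le> q" "\<bar>x\<bar> \<le> pi" "1 \<le> \<bar>2 ^ q * x\<bar>"
  shows "real_peak q x \<le> 63 / 64"
proof -
  have "\<exists>l<q. 1 / 4 \<le> 2 ^ l * \<bar>x\<bar> / 2 \<and> 2 ^ l * \<bar>x\<bar> / 2 \<le> pi / 2"
    using assms(1,3)
  proof (induction q rule: dec_induct)
    case base
    then show ?case using assms(2) by (intro exI[of _ 0]) (auto simp: abs_mult)
  next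
    case (step r)
    show ?case
    proof (cases "1 \<le> \<bar>2 ^ r * x\<bar>")
      case True
      then obtain l where "l < r" "1 / 4 \<le> 2 ^ l * \<bar>x\<bar> / 2 \<and> 2 ^ l * \<bar>x\<bar> / 2 \<le> pi / 2"
        using step by auto
      then show ?thesis by (intro exI[of _ l]) auto
    next
      case False
      then have "2 ^ r * \<bar>x\<bar> \<le> 1" "1 \<le> 2 * (2 ^ r * \<bar>x\<bar>)" using step by (auto simp: abs_mult)
      moreover have "1 / 2 \<le> pi / 2" using pi_ge_two by simp
      ultimately show ?thesis by (intro exI[of _ r]) auto
    qed
  qed
  then obtain l where l: "l < q" "1 / 4 \<le> 2 ^ l * \<bar>x\<bar> / 2" "2 ^ l * \<bar>x\<bar> / 2 \<le> pi / 2" by blast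
  define y where "y = 2 ^ l * \<bar>x\<bar> / 2"
  have "sin (1/4) \<le> sin y" using l unfolding y_def by (intro sin_monotone_2pi_le) auto
  moreover have "1 / 8 \<le> sin (1/4::real)" using sin_ge_half[of "1/4"] by simp
  ultimately have "(1 / 8)\<^sup>2 \<le> (sin y)\<^sup>2" by (intro power_mono) auto
  moreover have "(cos (2 ^ l * x / 2))\<^sup>2 = (cos y)\<^sup>2" unfolding y_def by (cases "0 \<le> x") auto
  moreover have "(cos y)\<^sup>2 = 1 - (sin y)\<^sup>2" by (simp add: cos_squared_eq)
  ultimately show ?thesis using real_peak_le_factor[OF l(1), of x] by (simp add: power2_eq_square)
qed

text \<open>With \<open>a = (2 ^ q * |z|)^2\<close> the next factor loses at most
  \<open>9/4 * a\<close> on top of the loss \<open>a\<close>, while doubling the scale allows a loss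
  of \<open>4 * a\<close>; so the induction closes with constant 1.\<close>

lemma peak_kernel_lower:
  assumes "2 ^ q * cmod z \<le> 1"
  shows "1 - (2 ^ q * cmod z)\<^sup>2 \<le> cmod (peak_kernel q z)"
  using assms
proof (induction q)
  case 0 then show ?case by (simp add: peak_kernel_def)
next
  case (Suc q)
  define a where "a = (2 ^ q * cmod z)\<^sup>2"
  have h: "2 ^ q * cmod z \<le> 1 / 2" using Suc by simp
  have a: "0 \<le> a" "a \<le> 1/4" using power_mono[OF h, of 2] unfolding a_def by (auto simp: power2_eq_square)
  have IH: "1 - a \<le> cmod (peak_kernel q z)" using Suc h unfolding a_def by simp
  define w where "w = 2 ^ q * z / 2"
  have w: "cmod w = 2 ^ q * cmod z / 2" unfolding w_def by (simp add: norm_mult norm_power)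
  have "(cmod (sin w))\<^sup>2 \<le> (3 * cmod w)\<^sup>2" using w h by (intro power_mono cmod_sin_le) auto
  also have "\<dots> = 9/4 * a" unfolding w a_def by (simp add: power_mult_distrib power_divide)
  finally have s: "(cmod (sin w))\<^sup>2 \<le> 9/4 * a" .
  have "(1 + cos (2 ^ q * z)) / 2 = 1 - (sin w)\<^sup>2"
    using cos_double_sin[of w] unfolding w_def by (simp add: field_simps)
  moreover have "1 - 9/4 * a \<le> cmod (1 - (sin w)\<^sup>2)"
    using s norm_triangle_ineq2[of 1 "(sin w)\<^sup>2"] by (simp add: norm_power)
  ultimately have "1 - 9/4 * a \<le> cmod ((1 + cos (2 ^ q * z)) / 2)" by (simp only:)
  then have "(1 - a) * (1 - 9/4 * a) \<le> cmod (peak_kernel q z) * cmod ((1 + cos (2 ^ q * z)) / 2)"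
    using IH a by (intro mult_mono) auto
  also have "\<dots> = cmod (peak_kernel (Suc q) z)" by (simp add: peak_kernel_def norm_mult)
  finally have "(1 - a) * (1 - 9/4 * a) \<le> cmod (peak_kernel (Suc q) z)" .
  moreover have "(1 - a) * (1 - 9/4 * a) = 1 - 13/4 * a + 9/4 * (a * a)" by (simp add: field_simps)
  moreover have "0 \<le> a * a" by simp
  ultimately have "1 - 13/4 * a \<le> cmod (peak_kernel (Suc q) z)" by linarith
  moreover have "(2 ^ Suc q * cmod z)\<^sup>2 = 4 * a" unfolding a_def by (simp add: power_mult_distrib)
  ultimately show ?case using a by simp
qed

text \<open>The factor \<open>1 + \<beta> sin\<close> tilts the kernel, so that its powers can match a prescribed slope at the peak.\<close>

definition tilted_peak :: "nat \<Rightarrow> real \<Rightarrow> complex \<Rightarrow> complex" where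
  "tilted_peak q \<beta> z = (1 + of_real \<beta> * sin (2 ^ q * z)) * peak_kernel q z ^ 128"

lemma trigp_tilted_peak: "trigp (129 * 2 ^ q) (tilted_peak q \<beta>)"
proof -
  have "trigp (2 ^ q) (\<lambda>z. 1 + of_real \<beta> * sin (of_nat (2 ^ q) * z))"
    by (intro trigp_add trigp_cmult trigp_sin trigp_mono[OF trigp_const]) auto
  from trigp_mult[OF this trigp_power[OF trigp_peak_kernel[of q], of 128]]
  show ?thesis unfolding tilted_peak_def by simp
qed

text \<open>The exponent 128 is chosen for this estimate: with \<open>y = 2 ^ q * x\<close> the
  kernel contributes \<open>exp (- 128 * y^2 / 64) = exp (- 2 * y^2)\<close>, replacing
  \<open>\<beta> * sin y\<close> by \<open>\<beta> * y\<close> costs at most \<open>y^2 / 4\<close>,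
  and a full \<open>- y^2\<close> remains.\<close>

lemma tilted_peak_near:
  assumes "1 \<le> q" "\<bar>2 ^ q * x\<bar> \<le> 1" "\<bar>\<beta>\<bar> \<le> 1/2"
  shows "cmod (tilted_peak q \<beta> (of_real x)) \<le> exp (\<beta> * (2 ^ q * x) - (2 ^ q * x)\<^sup>2)"
proof -
  define y where "y = 2 ^ q * x"
  have s1: "\<bar>\<beta> * sin y\<bar> \<le> 1/2"
    using mult_mono[of "\<bar>\<beta>\<bar>" "1/2" "\<bar>sin y\<bar>" 1] assms by (simp add: abs_mult)
  have "\<bar>\<beta> * (sin y - y)\<bar> \<le> 1/2 * (y\<^sup>2 / 2)" unfolding abs_mult
    using assms abs_sin_diff_le[of y] by (intro mult_mono) auto
  then have "\<beta> * (sin y - y) \<le> y\<^sup>2 / 4" by linarith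
  then have s2: "\<beta> * sin y \<le> \<beta> * y + y\<^sup>2 / 4" by (simp add: right_diff_distrib)
  have e: "1 + of_real \<beta> * sin (2 ^ q * complex_of_real x) = of_real (1 + \<beta> * sin y)"
    by (simp add: y_def flip: sin_of_real)
  have "real_peak q x ^ 128 \<le> (exp (- (y\<^sup>2 / 64))) ^ 128"
    using real_peak_near[OF assms(1,2)] exp_ge_add_one_self[of "- (y\<^sup>2/64)"]
    by (intro power_mono real_peak_nonneg) (auto simp: y_def)
  also have "\<dots> = exp (- 2 * y\<^sup>2)" by (simp add: exp_of_nat_mult[symmetric])
  finally have p: "real_peak q x ^ 128 \<le> exp (- 2 * y\<^sup>2)" .
  have "cmod (tilted_peak q \<beta> (of_real x)) = (1 + \<beta> * sin y) * real_peak q x ^ 128"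
    unfolding tilted_peak_def e peak_kernel_of_real using s1 real_peak_nonneg[of q x]
    by (simp add: norm_mult norm_power del: of_real_add of_real_mult)
  also have "\<dots> \<le> exp (\<beta> * y + y\<^sup>2 / 4) * exp (- 2 * y\<^sup>2)"
    using p s2 exp_ge_add_one_self[of "\<beta> * sin y"] s1 real_peak_nonneg[of q x]
    by (intro mult_mono) (auto intro: order_trans[where y = "exp (\<beta> * sin y)"])
  also have "\<dots> \<le> exp (\<beta> * y - y\<^sup>2)" by (simp flip: exp_add)
  finally show ?thesis unfolding y_def .
qed

text \<open>The 128th power of \<open>63 / 64\<close> is at most \<open>exp (- 2)\<close>, which
  leaves room for the tilt, itself at most \<open>3 / 2 \<le> exp 1\<close>.\<close>

lemma tilted_peak_far:
  assumes "1 \<le> q" "\<bar>x\<bar> \<le> pi" "1 \<le> \<bar>2 ^ q * x\<bar>" "\<bar>\<beta>\<bar> \<le> 1/2"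
  shows "cmod (tilted_peak q \<beta> (of_real x)) \<le> exp (-1)"
proof -
  define y where "y = 2 ^ q * x"
  have s1: "\<bar>\<beta> * sin y\<bar> \<le> 1/2"
    using mult_mono[of "\<bar>\<beta>\<bar>" "1/2" "\<bar>sin y\<bar>" 1] assms by (simp add: abs_mult)
  have e: "1 + of_real \<beta> * sin (2 ^ q * complex_of_real x) = of_real (1 + \<beta> * sin y)"
    by (simp add: y_def flip: sin_of_real)
  have "real_peak q x ^ 128 \<le> (exp (- (1 / 64))) ^ 128"
    using real_peak_far[OF assms(1,2,3)] exp_ge_add_one_self[of "- (1/64)"]
    by (intro power_mono real_peak_nonneg) auto
  also have "\<dots> = exp (- 2)" by (simp add: exp_of_nat_mult[symmetric])
  finally have p: "real_peak q x ^ 128 \<le> exp (- 2)" .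
  have "cmod (tilted_peak q \<beta> (of_real x)) = (1 + \<beta> * sin y) * real_peak q x ^ 128"
    unfolding tilted_peak_def e peak_kernel_of_real using s1 real_peak_nonneg[of q x]
    by (simp add: norm_mult norm_power del: of_real_add of_real_mult)
  also have "\<dots> \<le> exp 1 * exp (- 2)"
    using p exp_ge_add_one_self[of 1] s1 real_peak_nonneg[of q x] by (intro mult_mono) auto
  also have "\<dots> = exp (-1)" by (simp flip: exp_add)
  finally show ?thesis .
qed

text \<open>This is needed at complex points, since polynomials are bounded in discs for Cauchy's
  estimate. The loss is 128 from Bernoulli's inequality plus \<open>3 / 2\<close> from the tilt,
  rounded up to 130.\<close>

lemma tilted_peak_lower:
  assumes "2 ^ q * cmod z \<le> 1" "\<bar>\<beta>\<bar> \<le> 1/2"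
  shows "1 - 130 * (2 ^ q * cmod z) \<le> cmod (tilted_peak q \<beta> z)"
proof -
  define y where "y = 2 ^ q * cmod z"
  have y: "0 \<le> y" "y \<le> 1" using assms unfolding y_def by auto
  have "cmod (of_real \<beta> * sin (2 ^ q * z)) \<le> 1/2 * (3 * y)" unfolding norm_mult
    using assms cmod_sin_le[of "2 ^ q * z"] y by (intro mult_mono) (auto simp: y_def norm_mult norm_power)
  then have 1: "1 - 3/2 * y \<le> cmod (1 + of_real \<beta> * sin (2 ^ q * z))"
    using norm_diff_ineq[of 1 "of_real \<beta> * sin (2 ^ q * z)"] by simp
  have "1 - 128 * y\<^sup>2 \<le> (1 - y\<^sup>2) ^ 128"
    using Bernoulli_inequality[of "- y\<^sup>2" 128] y power_le_one[of y 2] by simp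
  also have "\<dots> \<le> cmod (peak_kernel q z) ^ 128"
    using peak_kernel_lower[OF assms(1)] y power_le_one[of y 2] unfolding y_def by (intro power_mono) auto
  finally have 2: "1 - 128 * y\<^sup>2 \<le> cmod (peak_kernel q z) ^ 128" .
  show ?thesis
  proof (cases "130 * y \<le> 1")
    case True
    have yy: "y\<^sup>2 \<le> y" using y power_decreasing[of 1 2 y] by simp
    have "(1 - 3/2 * y) * (1 - 128 * y) \<le> cmod (1 + of_real \<beta> * sin (2 ^ q * z)) * cmod (peak_kernel q z) ^ 128"
      using 1 2 True y yy by (intro mult_mono) auto
    also have "\<dots> = cmod (tilted_peak q \<beta> z)" by (simp add: tilted_peak_def norm_mult norm_power)
    finally have "(1 - 3/2 * y) * (1 - 128 * y) \<le> cmod (tilted_peak q \<beta> z)" .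
    moreover have "(1 - 3/2 * y) * (1 - 128 * y) = 1 - 129.5 * y + 192 * (y * y)" by (simp add: algebra_simps)
    moreover have "0 \<le> y * y" using y by simp
    ultimately show ?thesis using y unfolding y_def[symmetric] by linarith
  next
    case False then show ?thesis unfolding y_def[symmetric] using norm_ge_zero[of "tilted_peak q \<beta> z"] by linarith
  qed
qed

lemma cmod_power_lower:
  assumes "1 - e \<le> cmod w" "e \<le> 1"
  shows "1 - real j * e \<le> cmod w ^ j"
proof -
  have "1 - real j * e \<le> (1 - e) ^ j"
    using Bernoulli_inequality[of "-e" j] assms by simp
  also have "\<dots> \<le> cmod w ^ j" using assms by (intro power_mono) auto
  finally show ?thesis .
qed

lemma power_two_between:
  fixes x :: real
  assumes "1 \<le> x"
  obtains q :: nat where "x \<le> 2 ^ q" "2 ^ q < 2 * x"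
proof -
  define q where "q = (LEAST q. x \<le> 2 ^ q)"
  have "\<exists>q. x \<le> 2 ^ q" using real_arch_pow[of 2 x] by (auto intro: less_imp_le)
  then have 1: "x \<le> 2 ^ q" unfolding q_def by (rule LeastI_ex)
  moreover have "2 ^ q < 2 * x"
  proof (cases q)
    case 0 then show ?thesis using assms by simp
  next
    case (Suc r)
    then have "\<not> x \<le> 2 ^ r" using not_less_Least[of r "\<lambda>q. x \<le> 2 ^ q"] unfolding q_def by auto
    then show ?thesis using Suc by simp
  qed
  ultimately show ?thesis using that by blast
qed

text \<open>Farther than \<kappa> from the peak only the global bound \<open>V \<le> n\<close> is
  known; a factor of degree \<open>b * n\<close> whose \<open>p\<close>-th power is at most
  \<open>exp (- n)\<close> there compensates it.\<close>

lemma cosine_kernel_decay: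
  fixes \<kappa> p :: real
  assumes "0 < \<kappa>" "\<kappa> \<le> 1" "0 < p"
  obtains b :: nat where
    "\<And>n x. \<kappa> \<le> \<bar>x\<bar> \<Longrightarrow> \<bar>x\<bar> \<le> pi \<Longrightarrow> (((1 + cos x) / 2) ^ (b * n)) powr p \<le> exp (- real n)"
proof -
  define \<eta> where "\<eta> = (1 + cos \<kappa>) / 2"
  have eta: "0 < \<eta>" "\<eta> < 1"
  proof -
    have "cos \<kappa> < cos 0" using assms pi_gt3 by (intro cos_monotone_0_pi) auto
    then show "\<eta> < 1" unfolding \<eta>_def by simp
    have "0 < cos \<kappa>" using assms pi_gt3 by (intro cos_gt_zero_pi) auto
    then show "0 < \<eta>" unfolding \<eta>_def by simp
  qed
  define b where "b = nat \<lceil>1 / (p * - ln \<eta>)\<rceil>"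
  have b: "real b * p * ln \<eta> \<le> -1"
  proof -
    have pos: "0 < p * - ln \<eta>" using assms eta by (intro mult_pos_pos) auto
    have "1 / (p * - ln \<eta>) \<le> real b" unfolding b_def by linarith
    then have "1 \<le> real b * (p * - ln \<eta>)" using pos by (simp only: divide_le_eq if_True)
    then show ?thesis by simp
  qed
  have "(((1 + cos x) / 2) ^ (b * n)) powr p \<le> exp (- real n)" if "\<kappa> \<le> \<bar>x\<bar>" "\<bar>x\<bar> \<le> pi" for n :: nat and x
  proof -
    have c0: "0 \<le> (1 + cos x) / 2" using cos_ge_minus_one[of x] by (simp del: cos_ge_minus_one)
    have "cos x \<le> cos \<kappa>" using that assms cos_monotone_0_pi_le[of \<kappa> "\<bar>x\<bar>"] by simp
    then have "(1 + cos x) / 2 \<le> \<eta>" unfolding \<eta>_def by simp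
    then have "((1 + cos x) / 2) ^ (b * n) \<le> \<eta> ^ (b * n)" using c0 by (intro power_mono) auto
    then have "(((1 + cos x) / 2) ^ (b * n)) powr p \<le> (\<eta> ^ (b * n)) powr p"
      using c0 assms by (intro powr_mono2) auto
    also have "\<dots> = exp (real n * (real b * p * ln \<eta>))"
      using eta by (simp add: powr_def ln_realpow mult_ac)
    also have "\<dots> \<le> exp (real n * (-1))" using b by (intro exp_mono mult_left_mono) auto
    finally show ?thesis by simp
  qed
  then show ?thesis using that by blast
qed

text \<open>Here \<open>\<Delta> x\<close> plays the role of \<open>V (t + x) - V t\<close> for a potential \<open>V\<close> that at scale \<open>d\<close> is touched
  at \<open>t\<close> from above by a parabola of slope \<open>\<sigma>\<close>.\<close>

lemma peak_polynomial_exists: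
  fixes A a0 \<kappa> p r :: real
  assumes "1 \<le> A" "0 < a0" "a0 \<le> 1" "0 < \<kappa>" "\<kappa> \<le> 1" "0 < p" "0 < r"
  obtains m0 c C where "0 < c" "0 < C"
    "\<And>n d \<sigma> \<Delta>. \<lbrakk>1 \<le> n; 0 < d; d \<le> 1; a0 \<le> real n * d; \<bar>\<sigma>\<bar> \<le> A * real n;
        \<And>x. \<bar>x\<bar> \<le> d \<Longrightarrow> \<Delta> x \<le> \<sigma> * x + A * real n * x\<^sup>2 / d + A;
        \<And>x. \<bar>x\<bar> \<le> \<kappa> \<Longrightarrow> \<Delta> x \<le> A * real n * d + A;
        \<And>x. \<Delta> x \<le> real n\<rbrakk> \<Longrightarrow>
      \<exists>Q. trigp (m0 * n) Q \<and> (\<forall>z. cmod z \<le> c / real n \<longrightarrow> 1 / C \<le> cmod (Q z)) \<and>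
        (\<forall>x. \<bar>x\<bar> \<le> pi \<longrightarrow> cmod (Q (of_real x)) powr p \<le> C * exp (- \<Delta> x) * (1 + real n * \<bar>x\<bar>) powr (- r))"
proof -
  \<comment> \<open>The power \<open>j\<close> of the kernel will satisfy
    \<open>j * K \<ge> B * n\<close> with \<open>K * d \<le> 4\<close>; the 8 then gives
    \<open>p * j \<ge> 2 * A * n * d\<close>, enough to cover the growth of \<Delta> up to the
    distances \<open>d\<close> and \<kappa>.\<close>
  define B where "B = 8 * A / p"
  have B: "0 < B" "B * p = 8 * A" unfolding B_def using assms by auto
  \<comment> \<open>Rounding \<open>j\<close> up costs one extra \<open>K\<close>, and
    \<open>K \<le> 4 / d \<le> 4 * n / a0\<close>; hence \<open>j * K\<close> stays below
    \<open>B' * n\<close>.\<close>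
  define B' where "B' = B + 4 / a0"
  have B': "0 < B'" unfolding B'_def using assms B by (intro add_pos_pos) auto
  obtain b0 :: nat where
    b0: "\<And>n x. \<kappa> \<le> \<bar>x\<bar> \<Longrightarrow> \<bar>x\<bar> \<le> pi \<Longrightarrow> (((1 + cos x) / 2) ^ (b0 * n)) powr p \<le> exp (- real n)"
    using cosine_kernel_decay[OF assms(4-6)] by blast
  \<comment> \<open>The Fejer kernel decays quadratically, so its power \<open>k3\<close>, raised to
    \<open>p\<close>, decays with exponent \<open>2 * k3 * p \<ge> r\<close>.\<close>
  define k3 where "k3 = nat \<lceil>r / (2 * p)\<rceil>"
  have k3: "r \<le> 2 * real k3 * p"
  proof -
    have "r / (2 * p) \<le> real k3" unfolding k3_def by linarith
    then show ?thesis using assms by (simp add: field_simps)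
  qed
  \<comment> \<open>Small enough that each of the three factors of \<open>Q\<close> keeps modulus at
    least \<open>1 / 2\<close> in the disc of radius \<open>c / n\<close>.\<close>
  define c where "c = min (min (1 / (260 * B')) (1 / (2 * (real b0 + 1)))) (1 / (8 * (real k3 + 1)))"
  have c0: "0 < c" unfolding c_def using B' by simp
  have cB: "260 * B' * c \<le> 1"
  proof -
    have "c \<le> 1 / (260 * B')" unfolding c_def by linarith
    then show ?thesis using B' by (simp add: field_simps)
  qed
  have cb: "real b0 * c \<le> 1/2" "c \<le> 1/2"
  proof -
    have "c \<le> 1 / (2 * (real b0 + 1))" unfolding c_def by linarith
    then have *: "(real b0 + 1) * c \<le> 1/2" by (simp add: field_simps)
    then show "real b0 * c \<le> 1/2" "c \<le> 1/2" using c0 by (auto simp: distrib_right intro: order.trans[rotated])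
  qed
  have ck: "real k3 * (4 * c) \<le> 1/2" "4 * c \<le> 1/2"
  proof -
    have "c \<le> 1 / (8 * (real k3 + 1))" unfolding c_def by linarith
    then have *: "(real k3 + 1) * (4 * c) \<le> 1/2" by (simp add: field_simps)
    then show "real k3 * (4 * c) \<le> 1/2" "4 * c \<le> 1/2" using c0 by (auto simp: distrib_right intro: order.trans[rotated])
  qed
  define R where "R = 2 * real k3 * p"
  define C where "C = 8 * exp (2 * A) * 9 powr R"
  have R: "r \<le> R" "0 < R" using k3 assms(7) unfolding R_def by linarith+
  have C8: "8 \<le> C"
  proof -
    have "1 * 1 \<le> exp (2 * A) * 9 powr R" using assms R by (intro mult_mono ge_one_powr_ge_zero) auto
    then show ?thesis unfolding C_def by simp
  qed
  define m0 where "m0 = nat \<lceil>129 * B'\<rceil> + b0 + 2 * k3"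
  show ?thesis
  proof (rule that[of c C m0])
    show "0 < c" "0 < C" using c0 C8 by auto
    fix n :: nat and d \<sigma> :: real and \<Delta> :: "real \<Rightarrow> real"
    assume n: "1 \<le> n" and d: "0 < d" "d \<le> 1" "a0 \<le> real n * d" and l: "\<bar>\<sigma>\<bar> \<le> A * real n"
      and D1: "\<And>x. \<bar>x\<bar> \<le> d \<Longrightarrow> \<Delta> x \<le> \<sigma> * x + A * real n * x\<^sup>2 / d + A"
      and D2: "\<And>x. \<bar>x\<bar> \<le> \<kappa> \<Longrightarrow> \<Delta> x \<le> A * real n * d + A"
      and D3: "\<And>x. \<Delta> x \<le> real n"
    \<comment> \<open>The width of the kernel matches the scale of the parabola:
      \<open>K = 2 ^ q\<close> lies between \<open>2 / d\<close> and \<open>4 / d\<close>.\<close>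
    obtain q where q: "2 / d \<le> 2 ^ q" "2 ^ q < 2 * (2 / d)"
      using power_two_between[of "2 / d"] d by auto
    define K :: real where "K = 2 ^ q"
    have K: "2 \<le> K * d" "K * d \<le> 4" "0 < K" using q d unfolding K_def by (auto simp: field_simps)
    have q1: "1 \<le> q" using K d unfolding K_def by (cases q) auto
    have Kn: "K \<le> 4 / a0 * real n"
    proof -
      have "K * a0 \<le> K * (real n * d)" using d K by (intro mult_left_mono) auto
      also have "\<dots> \<le> 4 * real n" using mult_right_mono[OF K(2), of "real n"] by (simp add: mult_ac)
      finally show ?thesis using assms by (simp add: field_simps)
    qed
    define j where "j = nat \<lceil>B * real n / K\<rceil>"
    have BnK: "0 < B * real n / K" using B n K by simp
    have j: "B * real n \<le> real j * K" "real j * K \<le> B' * real n" "0 < j"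
    proof -
      have "B * real n / K \<le> real j" unfolding j_def by linarith
      then show "B * real n \<le> real j * K" using K by (simp add: field_simps)
      have "real j \<le> B * real n / K + 1" unfolding j_def using BnK by linarith
      then have "real j * K \<le> (B * real n / K + 1) * K" using K by (intro mult_right_mono) auto
      also have "\<dots> = B * real n + K" using K by (simp add: field_simps)
      also have "\<dots> \<le> B' * real n" unfolding B'_def using Kn by (simp add: distrib_right)
      finally show "real j * K \<le> B' * real n" .
      show "0 < j" unfolding j_def using BnK by simp
    qed
    \<comment> \<open>The \<open>j\<close>-th power of the tilt has logarithmic slope
      \<open>j * K * \<beta>\<close> at the peak; after the \<open>p\<close>-th power this becomes
      \<open>- \<sigma>\<close>, the slope of the parabola that bounds \<open>- \<Delta>\<close>
      from below.\<close>
    define \<beta> where "\<beta> = - \<sigma> / (p * (real j * K))"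
    have jK: "0 < p * (real j * K)" using assms j K by simp
    have bl: "p * (real j * K) * \<beta> = - \<sigma>" 
    unfolding \<beta>_def using jK by (metis less_irrefl mult.commute nonzero_eq_divide_eq)
    have pjK: "8 * A * real n \<le> p * (real j * K)"
    proof -
      have "8 * A * real n = p * (B * real n)" unfolding B(2)[symmetric] by simp
      also have "\<dots> \<le> p * (real j * K)" using j(1) assms by (intro mult_left_mono) auto
      finally show ?thesis .
    qed
    have An: "0 \<le> A * real n" using assms by simp
    have bh: "\<bar>\<beta>\<bar> \<le> 1/2"
    proof -
      have "\<bar>\<sigma>\<bar> \<le> 1/2 * (p * (real j * K))" using l pjK An by linarith
      then show ?thesis 
        unfolding \<beta>_def abs_divide abs_minus_cancel abs_of_pos[OF jK] using jK by (simp only: divide_le_eq if_True)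
    qed
    obtain q' where q': "real n \<le> 2 ^ q'" "2 ^ q' < 2 * real n"
      using power_two_between[of "real n"] n by auto
    \<comment> \<open>\<open>Q1\<close> takes care of the parabola and of the range up to \<kappa>,
      \<open>Q2\<close> of the distances beyond \<kappa>, and \<open>Q3\<close> supplies the power
      decay.\<close>
    define Q1 where "Q1 z = tilted_peak q \<beta> z ^ j" for z
    define Q2 where "Q2 z = ((1 + cos z) / 2) ^ (b0 * n)" for z :: complex
    define Q3 where "Q3 z = peak_kernel q' z ^ k3" for z
    define Q where "Q z = Q1 z * Q2 z * Q3 z" for z
    have tr: "trigp (m0 * n) Q"
    proof -
      have t1: "trigp (j * (129 * 2 ^ q)) Q1" unfolding Q1_def by (intro trigp_power trigp_tilted_peak)
      have "trigp 1 (\<lambda>z. 1/2 * (1 + cos z))"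
        by (intro trigp_cmult trigp_add trigp_cos1 trigp_mono[OF trigp_const]) auto
      from trigp_power[OF this, of "b0 * n"]
      have t2: "trigp (b0 * n) Q2" unfolding Q2_def by simp
      have t3: "trigp (k3 * 2 ^ q') Q3" unfolding Q3_def by (intro trigp_power trigp_peak_kernel)
      have "real (j * (129 * 2 ^ q)) \<le> real (nat \<lceil>129 * B'\<rceil> * n)"
      proof -
        have "real (j * (129 * 2 ^ q)) = 129 * (real j * K)" by (simp add: K_def)
        also have "\<dots> \<le> 129 * B' * real n" using j by simp
        also have "\<dots> \<le> real (nat \<lceil>129 * B'\<rceil>) * real n" by (intro mult_right_mono real_nat_ceiling_ge) auto
        finally show ?thesis by simp
      qed
      then have e1: "j * (129 * 2 ^ q) \<le> nat \<lceil>129 * B'\<rceil> * n" by (simp only: of_nat_le_iff)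
      have "real (2 ^ q') \<le> real (2 * n)" using q' by simp
      then have "2 ^ q' \<le> 2 * n" by (simp only: of_nat_le_iff)
      then have "k3 * 2 ^ q' \<le> k3 * (2 * n)" by (rule mult_le_mono2)
      from add_mono[OF add_right_mono[OF e1, of "b0 * n"] this]
      have "j * (129 * 2 ^ q) + b0 * n + k3 * 2 ^ q' \<le> m0 * n"
        unfolding m0_def by (simp add: distrib_right)
      with trigp_mult[OF trigp_mult[OF t1 t2] t3] show ?thesis
        unfolding Q_def by (auto intro: trigp_mono)
    qed
    have low: "1 / C \<le> cmod (Q z)" if z: "cmod z \<le> c / real n" for z
    proof -
      have nz: "real n * cmod z \<le> c" using z n by (simp add: field_simps)
      have z1: "cmod z \<le> c" using nz n mult_right_mono[of 1 "real n" "cmod z"] by simp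
      have jz: "130 * (real j * (K * cmod z)) \<le> 1/2"
      proof -
        have "real j * K * cmod z \<le> B' * real n * cmod z" using j by (intro mult_right_mono) auto
        also have "\<dots> \<le> B' * c" using nz B' by (simp add: mult.assoc)
        finally show ?thesis using cB by (simp add: mult_ac)
      qed
      have kz: "130 * (K * cmod z) \<le> 1/2"
      proof -
        have "1 * (K * cmod z) \<le> real j * (K * cmod z)" using j K by (intro mult_right_mono) auto
        then show ?thesis using jz by linarith
      qed
      have "1 - 130 * (K * cmod z) \<le> cmod (tilted_peak q \<beta> z)"
        using tilted_peak_lower[of q z \<beta>] kz bh unfolding K_def by simp
      from cmod_power_lower[OF this, of j] kz jz
      have l1: "1/2 \<le> cmod (Q1 z)" unfolding Q1_def norm_power by linarith
      have l2: "1/2 \<le> cmod (Q2 z)"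
      proof -
        have "cmod (sin (z/2)) \<le> 3 * cmod (z/2)" using z1 cb by (intro cmod_sin_le) auto
        then have "(cmod (sin (z/2)))\<^sup>2 \<le> (3/2 * cmod z)\<^sup>2" by (intro power_mono) auto
        also have "\<dots> = 9/4 * cmod z * cmod z" by (simp add: power2_eq_square)
        also have "\<dots> \<le> 9/4 * c * cmod z" using z1 by (intro mult_right_mono) auto
        also have "\<dots> \<le> 1 * cmod z" using ck(2) by (intro mult_right_mono) auto
        finally have s: "(cmod (sin (z/2)))\<^sup>2 \<le> cmod z" by simp
        have e: "(1 + cos z) / 2 = 1 - (sin (z/2))\<^sup>2"
          using cos_double_sin[of "z/2"] by (simp add: field_simps)
        have "1 - cmod z \<le> cmod ((1 + cos z) / 2)" unfolding e
          using s norm_triangle_ineq2[of 1 "(sin (z/2))\<^sup>2"] by (simp add: norm_power)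
        from cmod_power_lower[OF this, of "b0 * n"] z1 cb
        have "1 - real (b0 * n) * cmod z \<le> cmod (Q2 z)" unfolding Q2_def norm_power by simp
        moreover have "real b0 * (real n * cmod z) \<le> real b0 * c" using nz by (intro mult_left_mono) auto
        ultimately show ?thesis using cb by (simp add: mult.assoc)
      qed
      have l3: "1/2 \<le> cmod (Q3 z)"
      proof -
        have qz: "2 ^ q' * cmod z \<le> 2 * c"
          using mult_right_mono[of "2 ^ q'" "2 * real n" "cmod z"] q' nz by simp
        then have "(2 ^ q' * cmod z)\<^sup>2 \<le> (2 * c)\<^sup>2" by (intro power_mono) auto
        also have "\<dots> = 4 * c * c" by (simp add: power2_eq_square)
        also have "\<dots> \<le> 4 * c * 1" using c0 cb by (intro mult_left_mono) auto
        finally have "1 - 4 * c \<le> cmod (peak_kernel q' z)"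
          using peak_kernel_lower[of q' z] qz cb by simp
        from cmod_power_lower[OF this, of k3] ck show ?thesis unfolding Q3_def norm_power by linarith
      qed
      have "1/2 * (1/2) * (1/2) \<le> cmod (Q1 z) * cmod (Q2 z) * cmod (Q3 z)"
        using l1 l2 l3 by (intro mult_mono) auto
      moreover have "1 / C \<le> 1 / 8" using C8 by (simp add: frac_le)
      ultimately show ?thesis unfolding Q_def by (simp add: norm_mult)
    qed
    have up: "cmod (Q (of_real x)) powr p \<le> C * exp (- \<Delta> x) * (1 + real n * \<bar>x\<bar>) powr (- r)"
      if x: "\<bar>x\<bar> \<le> pi" for x
    proof -
      define X where "X = real n * \<bar>x\<bar>"
      have X0: "0 \<le> X" unfolding X_def by simp
      have u3: "cmod (Q3 (of_real x)) powr p \<le> 9 powr R * (1 + X) powr (- r)"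
      proof -
        have h: "real_peak q' x \<le> (9 / (1 + X))\<^sup>2"
        proof (cases "X \<le> 8")
          case True
          then have "1 \<le> (9 / (1 + X))" using X0 by (simp add: field_simps)
          then have "1 \<le> (9 / (1 + X))\<^sup>2" by (rule one_le_power)
          then show ?thesis using real_peak_le_1[of q' x] by linarith
        next
          case False
          have "X \<le> 2 ^ q' * \<bar>x\<bar>" unfolding X_def using q' by (intro mult_right_mono) auto
          then have "X\<^sup>2 \<le> (2 ^ q' * x)\<^sup>2" using X0 power_mono[of X "2 ^ q' * \<bar>x\<bar>" 2] by (simp add: power_mult_distrib)
          then have "real_peak q' x * X\<^sup>2 \<le> real_peak q' x * (2 ^ q' * x)\<^sup>2"
            by (intro mult_left_mono real_peak_nonneg)
          also have "\<dots> \<le> 64" by (rule real_peak_decay[OF x])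
          finally have "real_peak q' x \<le> (8 / X)\<^sup>2" using False by (simp add: field_simps power_divide)
          also have "8 / X \<le> 9 / (1 + X)" using False by (simp add: field_simps)
          then have "(8 / X)\<^sup>2 \<le> (9 / (1 + X))\<^sup>2" using X0 by (intro power_mono) auto
          finally show ?thesis .
        qed
        have "cmod (Q3 (of_real x)) = real_peak q' x ^ k3"
          unfolding Q3_def peak_kernel_of_real using real_peak_nonneg by (simp add: norm_power)
        also have "\<dots> \<le> ((9 / (1 + X))\<^sup>2) ^ k3" by (intro power_mono h real_peak_nonneg)
        also have "\<dots> = (9 / (1 + X)) powr real (2 * k3)"
          unfolding power_mult[symmetric] using X0 by (intro powr_realpow[symmetric]) auto
        also have "\<dots> = (9 / (1 + X)) powr (2 * real k3)" by simp
        finally have "cmod (Q3 (of_real x)) powr p \<le> ((9 / (1 + X)) powr (2 * real k3)) powr p"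
          using assms by (intro powr_mono2) auto
        also have "\<dots> = 9 powr R * (1 + X) powr (- R)"
          unfolding powr_powr R_def[symmetric] using X0 by (simp add: powr_divide powr_minus_divide)
        also have "\<dots> \<le> 9 powr R * (1 + X) powr (- r)" using R X0 by (intro mult_left_mono powr_mono) auto
        finally show ?thesis .
      qed
      have Q2r: "cmod (Q2 (of_real x)) = ((1 + cos x) / 2) ^ (b0 * n)"
      proof -
        have "(1 + cos (complex_of_real x)) / 2 = of_real ((1 + cos x) / 2)" by (simp add: cos_of_real)
        then have "cmod ((1 + cos (complex_of_real x)) / 2) = \<bar>(1 + cos x) / 2\<bar>" by (simp only: norm_of_real)
        moreover have "0 \<le> 1 + cos x" using cos_ge_minus_one[of x] by linarith
        ultimately show ?thesis unfolding Q2_def norm_power by simp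
      qed
      have c1: "0 \<le> (1 + cos x) / 2" "(1 + cos x) / 2 \<le> 1" using cos_ge_minus_one[of x] cos_le_one[of x]
        by (auto simp del: cos_ge_minus_one cos_le_one)
      have u2: "cmod (Q2 (of_real x)) powr p \<le> 1"
        unfolding Q2r using power_le_one[OF c1, of "b0 * n"] c1 assms by (intro powr_le1) auto
      have u12: "cmod (Q1 (of_real x)) powr p * cmod (Q2 (of_real x)) powr p \<le> exp (2 * A) * exp (- \<Delta> x)"
      proof (cases "\<bar>K * x\<bar> \<le> 1")
        case True
        have xd: "\<bar>x\<bar> \<le> d"
        proof -
          have "K * \<bar>x\<bar> \<le> 1" using True K by (simp add: abs_mult)
          then have "K * \<bar>x\<bar> \<le> K * d" using K by linarith
          then show ?thesis using K(3) by (simp only: mult_le_cancel_left_pos)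
        qed
        have "cmod (tilted_peak q \<beta> (of_real x)) \<le> exp (\<beta> * (K * x) - (K * x)\<^sup>2)"
          using tilted_peak_near[OF q1 _ bh, of x] True unfolding K_def by simp
        then have "cmod (Q1 (of_real x)) \<le> exp (\<beta> * (K * x) - (K * x)\<^sup>2) ^ j"
          unfolding Q1_def norm_power by (intro power_mono) auto
        then have "cmod (Q1 (of_real x)) powr p \<le> (exp (\<beta> * (K * x) - (K * x)\<^sup>2) ^ j) powr p"
          using assms by (intro powr_mono2) auto
        also have "\<dots> = exp (p * real j * (\<beta> * (K * x) - (K * x)\<^sup>2))"
          by (simp add: exp_of_nat_mult[symmetric] powr_def mult_ac)
        also have "p * real j * (\<beta> * (K * x) - (K * x)\<^sup>2) = (p * (real j * K) * \<beta>) * x - p * (real j * K) * (K * x\<^sup>2)"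
          by (simp add: algebra_simps power2_eq_square)
        also have "\<dots> = - \<sigma> * x - p * (real j * K) * (K * x\<^sup>2)" unfolding bl ..
        also have "exp \<dots> \<le> exp (A - \<Delta> x)"
        proof -
          have "A * real n \<le> p * (real j * K)" using pjK An by linarith
          moreover have "x\<^sup>2 / d \<le> K * x\<^sup>2"
          proof -
            have "1 / d \<le> K" using K d by (simp add: field_simps)
            then show ?thesis using mult_right_mono[of "1/d" K "x\<^sup>2"] by simp
          qed
          ultimately have "A * real n * (x\<^sup>2 / d) \<le> p * (real j * K) * (K * x\<^sup>2)"
            using jK d by (intro mult_mono[of "A * real n"]) auto
          then show ?thesis using D1[OF xd] by simp
        qed
        finally have 1: "cmod (Q1 (of_real x)) powr p \<le> exp (A - \<Delta> x)" .
        have "cmod (Q1 (of_real x)) powr p * cmod (Q2 (of_real x)) powr p \<le> exp (A - \<Delta> x) * 1"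
          using 1 u2 by (intro mult_mono) auto
        also have "\<dots> \<le> exp (2 * A) * exp (- \<Delta> x)" using assms by (simp flip: exp_add)
        finally show ?thesis .
      next
        case False
        have "cmod (tilted_peak q \<beta> (of_real x)) \<le> exp (-1)"
          using tilted_peak_far[OF q1 x _ bh] False unfolding K_def by simp
        then have "cmod (Q1 (of_real x)) \<le> exp (-1) ^ j"
          unfolding Q1_def norm_power by (intro power_mono) auto
        then have "cmod (Q1 (of_real x)) powr p \<le> (exp (-1) ^ j) powr p"
          using assms by (intro powr_mono2) auto
        also have "\<dots> = exp (- (p * real j))"
          by (simp add: exp_of_nat_mult[symmetric] powr_def mult_ac)
        finally have 1: "cmod (Q1 (of_real x)) powr p \<le> exp (- (p * real j))" .
        have pj: "2 * A * real n * d \<le> p * real j"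
        proof -
          have "8 * A * real n * d \<le> p * (real j * K) * d" using pjK d by (intro mult_right_mono) auto
          also have "\<dots> = p * real j * (K * d)" by simp
          also have "\<dots> \<le> p * real j * 4" using assms K by (intro mult_left_mono) auto
          finally show ?thesis by (simp add: mult_ac)
        qed
        have AN: "0 \<le> A * real n * d" using assms d by simp
        show ?thesis
        proof (cases "\<bar>x\<bar> \<le> d \<or> \<bar>x\<bar> \<le> \<kappa>")
          case True
          \<comment> \<open>For \<open>|x| \<le> \<kappa>\<close> the second bound on \<Delta>
            applies directly; otherwise \<open>|x| \<le> d\<close>, and the linear and the quadratic
            term of the parabola are at most \<open>A * n * d\<close> each.\<close>
          have "\<Delta> x \<le> 2 * A * real n * d + A"
          proof (cases "\<bar>x\<bar> \<le> \<kappa>")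
            case True then show ?thesis using D2[of x] AN by simp
          next
            case False
            with True have xd: "\<bar>x\<bar> \<le> d" by simp
            have "\<sigma> * x \<le> \<bar>\<sigma>\<bar> * \<bar>x\<bar>" by (metis abs_ge_self abs_mult)
            also have "\<dots> \<le> A * real n * d" using l xd assms by (intro mult_mono) auto
            finally have a: "\<sigma> * x \<le> A * real n * d" .
            have "x\<^sup>2 \<le> d\<^sup>2" using xd d by (simp add: abs_le_square_iff[symmetric])
            then have "A * real n * x\<^sup>2 / d \<le> A * real n * d\<^sup>2 / d"
              using assms d by (intro divide_right_mono mult_left_mono) auto
            also have "\<dots> = A * real n * d" using d by (simp add: power2_eq_square)
            finally show ?thesis using D1[OF xd] a by simp
          qed
          then have "exp (- (p * real j)) \<le> exp (A - \<Delta> x)" using pj by simp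
          from order.trans[OF 1 this] have "cmod (Q1 (of_real x)) powr p \<le> exp (A - \<Delta> x)" .
          then have "cmod (Q1 (of_real x)) powr p * cmod (Q2 (of_real x)) powr p \<le> exp (A - \<Delta> x) * 1"
            using u2 by (intro mult_mono) auto
          also have "\<dots> \<le> exp (2 * A) * exp (- \<Delta> x)" using assms by (simp flip: exp_add)
          finally show ?thesis .
        next
          case F: False
          have "cmod (Q2 (of_real x)) powr p \<le> exp (- real n)" unfolding Q2r using F x by (intro b0) auto
          also have "\<dots> \<le> exp (- \<Delta> x)" using D3[of x] by simp
          finally have 2: "cmod (Q2 (of_real x)) powr p \<le> exp (- \<Delta> x)" .
          have "exp (- (p * real j)) \<le> 1" using assms by simp
          from order.trans[OF 1 this] have "cmod (Q1 (of_real x)) powr p * cmod (Q2 (of_real x)) powr p \<le> 1 * exp (- \<Delta> x)"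
            using 2 by (intro mult_mono) auto
          also have "\<dots> \<le> exp (2 * A) * exp (- \<Delta> x)" using assms by (intro mult_right_mono) auto
          finally show ?thesis .
        qed
      qed
      have "cmod (Q (of_real x)) powr p
          = cmod (Q1 (of_real x)) powr p * cmod (Q2 (of_real x)) powr p * cmod (Q3 (of_real x)) powr p"
        unfolding Q_def by (simp add: norm_mult powr_mult)
      also have "\<dots> \<le> (exp (2 * A) * exp (- \<Delta> x)) * (9 powr R * (1 + X) powr (- r))"
        by (rule mult_mono[OF u12 u3]) auto
      also have "\<dots> = (exp (2 * A) * 9 powr R) * (exp (- \<Delta> x) * (1 + X) powr (- r))" by simp
      also have "\<dots> \<le> C * (exp (- \<Delta> x) * (1 + X) powr (- r))"
        unfolding C_def by (intro mult_right_mono) auto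
      finally show ?thesis unfolding X_def by (simp add: mult_ac)
    qed
    show "\<exists>Q. trigp (m0 * n) Q \<and> (\<forall>z. cmod z \<le> c / real n \<longrightarrow> 1 / C \<le> cmod (Q z)) \<and>
        (\<forall>x. \<bar>x\<bar> \<le> pi \<longrightarrow> cmod (Q (of_real x)) powr p \<le> C * exp (- \<Delta> x) * (1 + real n * \<bar>x\<bar>) powr (- r))"
      using tr low up by blast
  qed
qed

section \<open>The Remez inequality for one arc\<close>

text \<open>The Chebyshev recurrence.\<close>

lemma cos_multiple_poly: "\<exists>P::complex poly. degree P \<le> k \<and> (\<forall>z. cos (of_nat k * z) = poly P (cos z))"
proof (induction k rule: induct_nat_012)
  case 0 show ?case by (intro exI[of _ 1]) simp
next
  case 1 show ?case by (intro exI[of _ "[:0, 1:]"]) simp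
next
  case (ge2 k)
  then obtain P Q :: "complex poly" where P: "degree P \<le> k" "\<And>z. cos (of_nat k * z) = poly P (cos z)"
    and Q: "degree Q \<le> Suc k" "\<And>z. cos (of_nat (Suc k) * z) = poly Q (cos z)" by blast
  have "degree ([:0, 2:] * Q - P) \<le> Suc (Suc k)"
    using P(1) Q(1) degree_mult_le[of "[:0, 2:]" Q] by (intro degree_diff_le) auto
  moreover have "cos (of_nat (Suc (Suc k)) * z) = poly ([:0, 2:] * Q - P) (cos z)" for z
  proof -
    have "cos (of_nat (Suc (Suc k)) * z) + cos (of_nat k * z) = 2 * cos (of_nat (Suc k) * z) * cos z"
      using cos_add[of "of_nat (Suc k) * z" z] cos_diff[of "of_nat (Suc k) * z" z] by (simp add: algebra_simps)
    then have "cos (of_nat (Suc (Suc k)) * z) = 2 * cos (of_nat (Suc k) * z) * cos z - cos (of_nat k * z)"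
      by (simp only: eq_diff_eq)
    then show ?thesis by (simp only: P(2) Q(2)) simp
  qed
  ultimately show ?case by blast
qed

text \<open>Averaging the Fourier form over \<open>z\<close> and \<open>- z\<close> leaves only
  cosines of integer multiples.\<close>

lemma even_trigp_poly_cos:
  assumes "trigp m f" "\<And>z. f (- z) = f z"
  obtains P where "degree P \<le> m" "\<And>z. f z = poly P (cos z)"
proof -
  obtain c where c: "\<And>z. f z = (\<Sum>k\<le>2*m. c k * exp (\<i> * (of_nat k - of_nat m) * z))"
    using trigp_expand[OF assms(1)] by blast
  define r where "r k = (if k \<le> m then m - k else k - m)" for k
  have "\<forall>k. \<exists>P::complex poly. degree P \<le> r k \<and> (\<forall>z. cos (of_nat (r k) * z) = poly P (cos z))"
    using cos_multiple_poly by blast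
  from choice[OF this] obtain Q where "\<forall>k. degree (Q k) \<le> r k \<and> (\<forall>z::complex. cos (of_nat (r k) * z) = poly (Q k) (cos z))"
    by blast
  then have Q: "\<And>k. degree (Q k) \<le> r k" "\<And>k z. cos (of_nat (r k) * z :: complex) = poly (Q k) (cos z)"
    by auto
  have "f z = poly (\<Sum>k\<le>2*m. smult (c k) (Q k)) (cos z)" for z
  proof -
    have "2 * f z = f z + f (- z)" using assms(2) by simp
    also have "\<dots> = (\<Sum>k\<le>2*m. c k * (exp (\<i> * (of_nat k - of_nat m) * z) + exp (\<i> * (of_nat k - of_nat m) * (- z))))"
      unfolding c sum.distrib[symmetric] by (simp add: distrib_left)
    also have "\<dots> = (\<Sum>k\<le>2*m. 2 * (c k * poly (Q k) (cos z)))"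
    proof (intro sum.cong refl)
      fix k assume k: "k \<in> {..2*m}"
      have "exp (\<i> * (of_nat k - of_nat m) * z) + exp (\<i> * (of_nat k - of_nat m) * (- z)) = 2 * cos ((of_nat k - of_nat m) * z)"
        by (simp add: cos_exp_eq mult.assoc)
      also have "cos ((of_nat k - of_nat m) * z) = cos (of_nat (r k) * z)"
      proof (cases "k \<le> m")
        case True
        then have "(of_nat k - of_nat m) * z = - (of_nat (r k) * z)" by (simp add: r_def of_nat_diff algebra_simps)
        then show ?thesis by (simp only: cos_minus)
      qed (simp add: r_def of_nat_diff)
      finally show "c k * (exp (\<i> * (of_nat k - of_nat m) * z) + exp (\<i> * (of_nat k - of_nat m) * (- z))) = 2 * (c k * poly (Q k) (cos z))"
        using Q(2) by simp
    qed
    also have "\<dots> = 2 * poly (\<Sum>k\<le>2*m. smult (c k) (Q k)) (cos z)"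
      by (simp add: poly_sum sum_distrib_left)
    finally show ?thesis by simp
  qed
  moreover have "degree (\<Sum>k\<le>2*m. smult (c k) (Q k)) \<le> m"
  proof (intro degree_sum_le)
    fix k assume "k \<in> {..2*m}"
    then have "r k \<le> m" unfolding r_def by auto
    then show "degree (smult (c k) (Q k)) \<le> m" using Q(1)[of k] degree_smult_le[of "c k" "Q k"] by linarith
  qed simp
  ultimately show ?thesis using that by blast
qed

text \<open>With \<open>f = P \<circ> cos\<close>, stretching \<open>[-1, cos \<rho>]\<close> to \<open>[-1, 1]\<close>
  turns the arc into a segment of the imaginary axis of length \<open>O(\<rho>)\<close>.\<close>

lemma even_trigp_remez:
  assumes "trigp m f" "\<And>z. f (- z) = f z" "0 < \<rho>" "\<rho> \<le> 1"
    and S: "\<And>s. \<rho> \<le> s \<Longrightarrow> s \<le> pi \<Longrightarrow> cmod (f (of_real s)) \<le> S"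
    and s: "\<bar>s\<bar> \<le> \<rho>"
  shows "cmod (f (of_real s)) \<le> (2 * real m + 1) * exp (4 * real m * \<rho>) * S"
proof -
  obtain P where P: "degree P \<le> m" "\<And>z. f z = poly P (cos z)"
    using even_trigp_poly_cos[OF assms(1,2)] by blast
  \<comment> \<open>The affine map \<open>y \<mapsto> c * (1 + y) - 1\<close> sends
    \<open>[-1, 1]\<close> onto \<open>[-1, cos \<rho>]\<close>; its inverse sends
    \<open>cos s\<close> with \<open>|s| \<le> \<rho>\<close> to a point
    \<open>w \<ge> 1\<close>.\<close>
  define c where "c = (1 + cos \<rho>) / 2"
  have cc: "c = (cos (\<rho>/2))\<^sup>2" unfolding c_def using cos_double_cos[of "\<rho>/2"] by simp
  have r2: "\<rho> \<le> pi / 2" using assms(4) pi_ge_two by linarith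
  have c0: "0 < c" "c \<le> 1" unfolding c_def using cos_ge_zero[of \<rho>] assms r2 by (auto intro: add_pos_nonneg)
  define h where "h = (\<lambda>z. poly P (of_real c * (1 + cos z) - 1))"
  have trh: "trigp m h"
    unfolding h_def
    by (intro trigp_poly_of P(1) trigp_diff trigp_cmult trigp_add trigp_cos1 trigp_mono[OF trigp_const]) auto
  have hr: "cmod (h (of_real x)) \<le> S" for x
  proof -
    define y where "y = c * (1 + cos x) - 1"
    have "- 1 \<le> y" unfolding y_def using c0 cos_ge_minus_one[of x] by (simp del: cos_ge_minus_one)
    moreover have "c * (1 + cos x) \<le> c * 2" using c0 by (intro mult_left_mono) auto
    then have "y \<le> cos \<rho>" unfolding y_def c_def by simp
    ultimately have y: "- 1 \<le> y" "y \<le> cos \<rho>" "y \<le> 1" by (auto intro: order_trans)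
    have "arccos (cos \<rho>) \<le> arccos y" using y by (intro arccos_le_arccos) auto
    then have "\<rho> \<le> arccos y" using assms r2 by (simp add: arccos_cos)
    moreover have "arccos y \<le> pi" using y by (intro arccos_ubound) auto
    moreover have "f (of_real (arccos y)) = h (of_real x)"
      unfolding P(2) h_def using y by (simp add: cos_of_real y_def)
    ultimately show ?thesis using S[of "arccos y"] by simp
  qed
  define w where "w = (1 + cos s) / c - 1"
  have cs: "cos \<rho> \<le> cos s" using cos_monotone_0_pi_le[of "\<bar>s\<bar>" \<rho>] s assms r2 by simp
  have w1: "1 \<le> w" using c0 cs unfolding w_def c_def by (simp add: field_simps)
  \<comment> \<open>A point \<open>w \<ge> 1\<close> is \<open>cosh y = cos (\<i> * y)\<close>, and
    since \<open>w - 1 \<le> \<rho>^2\<close> the height \<open>y\<close> is at most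
    \<open>4 * \<rho>\<close>.\<close>
  define y where "y = arcosh w"
  have y0: "0 \<le> y" "cosh y = w" using w1 unfolding y_def by (auto simp: cosh_arcosh_real)
  have "(sin (\<rho>/2))\<^sup>2 \<le> (\<rho>/2)\<^sup>2"
    using abs_sin_x_le_abs_x[of "\<rho>/2"] abs_le_square_iff by blast
  then have c1: "1 - c \<le> \<rho>\<^sup>2 / 4" using cc sin_squared_eq[of "\<rho>/2"] by (simp add: power_divide)
  have rr: "\<rho>\<^sup>2 \<le> \<rho>" "\<rho>\<^sup>2 \<le> 1" using assms by (auto simp: power2_eq_square mult_le_one mult_left_le)
  have "w - 1 \<le> 2 / c - 2" unfolding w_def using c0 by (simp add: divide_right_mono)
  also have "\<dots> = 2 * (1 - c) / c" using c0 by (simp add: field_simps)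
  also have "\<dots> \<le> 2 * (\<rho>\<^sup>2 / 4) / (1/2)" using c0 c1 rr by (intro frac_le) auto
  finally have wr: "w - 1 \<le> \<rho>\<^sup>2" by simp
  have "w\<^sup>2 - 1 = (w - 1) * (w + 1)" by (simp add: power2_eq_square algebra_simps)
  also have "\<dots> \<le> \<rho>\<^sup>2 * 3" using wr w1 rr by (intro mult_mono) auto
  also have "\<dots> \<le> (2 * \<rho>)\<^sup>2" by (simp add: power_mult_distrib)
  finally have "sqrt (w\<^sup>2 - 1) \<le> 2 * \<rho>" using assms by (intro real_le_lsqrt) auto
  then have "w + sqrt (w\<^sup>2 - 1) \<le> 1 + 4 * \<rho>" using wr rr assms(3) by linarith
  moreover have "0 < w + sqrt (w\<^sup>2 - 1)" using w1 by (intro add_pos_nonneg) auto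
  ultimately have ty: "y \<le> 4 * \<rho>"
    unfolding y_def arcosh_real_def[OF w1] using ln_le_minus_one[of "w + sqrt (w\<^sup>2 - 1)"] by linarith
  have "cos (\<i> * of_real y) = of_real w"
  proof -
    have "cos (\<i> * of_real y) = (exp (- of_real y) + exp (of_real y)) / (2::complex)"
      by (simp add: cos_exp_eq mult.assoc[symmetric])
    also have "\<dots> = of_real (cosh y)" by (simp add: cosh_field_def exp_of_real flip: of_real_minus)
    finally show ?thesis using y0 by simp
  qed
  then have "h (\<i> * of_real y) = f (of_real s)"
    unfolding P(2) h_def w_def using c0 by (simp add: cos_of_real)
  \<comment> \<open>The crude factor \<open>2 * m + 1\<close> is affordable: in the end it meets a
    factor \<open>exp (- (n powr \<gamma>))\<close>.\<close>
  moreover have "cmod (h (\<i> * of_real y)) \<le> (2 * real m + 1) * exp (real m * y) * S"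
  proof -
    have "cmod (h (\<i> * of_real y)) \<le> (2 * real m + 1) * exp (real m * \<bar>y\<bar>) / real (2*m+1) *
           (\<Sum>j<2*m+1. cmod (h (of_real (0 + 2 * pi * real j / real (2*m+1)))))"
      using trigp_grid_bound[OF trh, of "2*m+1" "\<i> * of_real y" 0] by simp
    also have "\<dots> \<le> (2 * real m + 1) * exp (real m * \<bar>y\<bar>) / real (2*m+1) * (\<Sum>j<2*m+1. S)"
      by (intro mult_left_mono sum_mono hr) auto
    also have "\<dots> = (2 * real m + 1) * exp (real m * y) * S" using y0 by (simp add: field_simps)
    finally show ?thesis .
  qed
  moreover have "(2 * real m + 1) * exp (real m * y) * S \<le> (2 * real m + 1) * exp (4 * real m * \<rho>) * S"
  proof -
    have "real m * y \<le> real m * (4 * \<rho>)" using ty by (intro mult_left_mono) auto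
    then show ?thesis
      using order.trans[OF norm_ge_zero hr[of 0]] by (intro mult_right_mono mult_left_mono) auto
  qed
  ultimately show ?thesis using order.trans by fastforce
qed

section \<open>Doubling weights on the cosine grid\<close>

definition mass :: "(real \<Rightarrow> real) \<Rightarrow> real \<Rightarrow> real \<Rightarrow> real" where
  "mass u a b = (LINT x:{a..b}|lebesgue. u x)"

lemma weight_integrable_subinterval:
  assumes "weight u" "-1 \<le> a" "b \<le> 1"
  shows "u absolutely_integrable_on {a..b}"
  using assms unfolding weight_def by (auto intro: absolutely_integrable_on_subinterval)

lemma mass_eq_integral:
  assumes "weight u" "-1 \<le> a" "b \<le> 1"
  shows "mass u a b = integral {a..b} u"
  unfolding mass_def using weight_integrable_subinterval[OF assms]
  by (rule set_lebesgue_integral_eq_integral(2))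

lemma mass_mono:
  assumes "weight u" "-1 \<le> c" "c \<le> a" "b \<le> d" "d \<le> 1"
  shows "mass u a b \<le> mass u c d"
proof -
  have "integral {a..b} u \<le> integral {c..d} u"
    using assms weight_integrable_subinterval[OF assms(1), of a b] weight_integrable_subinterval[OF assms(1), of c d]
    by (intro integral_subset_le) (auto simp: weight_def set_lebesgue_integral_eq_integral(1))
  then show ?thesis using assms by (simp add: mass_eq_integral)
qed

lemma mass_nonneg:
  assumes "weight u" "-1 \<le> a" "b \<le> 1"
  shows "0 \<le> mass u a b"
  unfolding mass_eq_integral[OF assms] using assms
  by (intro integral_nonneg set_lebesgue_integral_eq_integral(1) weight_integrable_subinterval) (auto simp: weight_def)

text \<open>Doubling an interval inside \<open>[c, d]\<close> and cutting it off at \<open>c\<close> and \<open>d\<close> still multiplies its length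
  by \<open>3/2\<close>, unless it already fills \<open>[c, d]\<close>.\<close>

lemma doubling_iterate:
  assumes w: "weight u" and L: "1 \<le> L"
    and dbl: "\<And>a b. -1 \<le> a \<Longrightarrow> a \<le> b \<Longrightarrow> b \<le> 1 \<Longrightarrow>
      (LINT x:{a - (b - a) / 2 .. b + (b - a) / 2} \<inter> {-1..1}|lebesgue. u x) \<le> L * mass u a b"
    and "-1 \<le> c" "c \<le> a" "a \<le> b" "b \<le> d" "d \<le> 1" "d - c \<le> (3/2) ^ j * (b - a)"
  shows "mass u c d \<le> L ^ j * mass u a b"
  using assms(4-)
proof (induction j arbitrary: a b)
  case 0
  then have "a = c" "b = d" by auto
  then show ?case by simp
next
  case (Suc j)
  define a' where "a' = max c (a - (b - a) / 2)"
  define b' where "b' = min d (b + (b - a) / 2)"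
  have ab: "c \<le> a'" "a' \<le> b'" "b' \<le> d" "a' \<le> a" "b \<le> b'"
  proof -
    have "0 \<le> (b - a) / 2" using Suc.prems by simp
    then show "a' \<le> a" "b \<le> b'" using Suc.prems unfolding a'_def b'_def by linarith+
    then show "a' \<le> b'" using Suc.prems by linarith
  qed (auto simp: a'_def b'_def)
  have "mass u c d \<le> L ^ j * mass u a' b'"
  proof (cases "a' = c \<and> b' = d")
    case True
    have "1 * mass u c d \<le> L ^ j * mass u c d"
      using L Suc.prems w by (intro mult_right_mono mass_nonneg one_le_power) auto
    then show ?thesis using True by simp
  next
    case False
    then have "a' = a - (b - a) / 2 \<or> b' = b + (b - a) / 2" unfolding a'_def b'_def by linarith
    then have "3 / 2 * (b - a) \<le> b' - a'" using ab by (auto simp: field_simps)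
    then have "(3/2) ^ j * (3 / 2 * (b - a)) \<le> (3/2) ^ j * (b' - a')" by (intro mult_left_mono) auto
    moreover have "d - c \<le> (3/2) ^ j * (3 / 2 * (b - a))"
      using Suc.prems(6) by (simp only: power_Suc mult_ac)
    ultimately have "d - c \<le> (3/2) ^ j * (b' - a')" by (rule order.trans[rotated])
    then show ?thesis using Suc.prems ab by (intro Suc.IH) auto
  qed
  also have "mass u a' b' \<le> L * mass u a b"
  proof -
    have eq: "{a - (b - a) / 2 .. b + (b - a) / 2} \<inter> {-1..1} = {max (-1) (a - (b - a) / 2) .. min 1 (b + (b - a) / 2)}"
      by auto
    have "-1 \<le> a" "a \<le> b" "b \<le> 1" using Suc.prems by auto
    from dbl[OF this] have "mass u (max (-1) (a - (b - a) / 2)) (min 1 (b + (b - a) / 2)) \<le> L * mass u a b"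
      unfolding eq mass_def .
    moreover have "mass u a' b' \<le> mass u (max (-1) (a - (b - a) / 2)) (min 1 (b + (b - a) / 2))"
      using Suc.prems w unfolding a'_def b'_def by (intro mass_mono) auto
    ultimately show ?thesis by linarith
  qed
  finally show ?case using L by (simp add: mult_left_mono mult.assoc mult.left_commute)
qed

section \<open>Cells of the grid of cosines\<close>

lemma abs_sin_multiple_le: "\<bar>sin (real k * y)\<bar> \<le> real k * \<bar>sin y\<bar>"
proof (induction k)
  case 0 show ?case by simp
next
  case (Suc k)
  have "\<bar>sin (real (Suc k) * y)\<bar> = \<bar>sin (real k * y) * cos y + cos (real k * y) * sin y\<bar>"
  proof -
    have "real (Suc k) * y = real k * y + y" by (simp add: distrib_right)
    then show ?thesis by (simp only: sin_add)
  qed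
  also have "\<dots> \<le> \<bar>sin (real k * y)\<bar> * \<bar>cos y\<bar> + \<bar>cos (real k * y)\<bar> * \<bar>sin y\<bar>"
    by (rule order.trans[OF abs_triangle_ineq]) (simp add: abs_mult)
  also have "\<dots> \<le> \<bar>sin (real k * y)\<bar> * 1 + 1 * \<bar>sin y\<bar>" by (intro add_mono mult_mono) auto
  also have "\<dots> \<le> real (Suc k) * \<bar>sin y\<bar>" using Suc by (simp add: distrib_right)
  finally show ?case .
qed

text \<open>By the product formula the lengths of a block and of one of its cells are both
  \<open>2 * sin (midpoint) * sin (half length)\<close> in the angular variable. Each sine of the
  block exceeds that of the cell by a factor of at most \<open>\<beta> - \<alpha>\<close>. Near the
  end points of \<open>[-1, 1]\<close>, where the cells shrink, the square is the true
  order.\<close>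

lemma cos_grid_length:
  fixes M \<alpha> l \<beta> :: nat
  assumes "\<alpha> \<le> l" "l < \<beta>" "\<beta> \<le> M"
  defines "h \<equiv> pi / real M"
  shows "cos (real \<alpha> * h) - cos (real \<beta> * h) \<le> (real (\<beta> - \<alpha>))\<^sup>2 * (cos (real l * h) - cos (real (Suc l) * h))"
proof -
  have M: "0 < M" using assms by simp
  have h: "0 < h" "real M * h = pi" unfolding h_def using M by auto
  define r where "r = \<beta> - \<alpha>"
  define B where "B = (real l + 1/2) * h"
  have rr: "real r = real \<beta> - real \<alpha>" unfolding r_def using assms by simp
  have B: "h / 2 \<le> B" "B \<le> pi - h / 2"
  proof -
    have "(1/2) * h \<le> (real l + 1/2) * h" using h by (intro mult_right_mono) auto
    then show "h / 2 \<le> B" unfolding B_def by simp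
    have "(real l + 1/2) * h \<le> (real M - 1/2) * h" using h assms by (intro mult_right_mono) auto
    then show "B \<le> pi - h / 2" unfolding B_def using h by (simp add: left_diff_distrib)
  qed
  have s0: "0 < sin (h/2)" using h B by (intro sin_gt_zero) auto
  have sB: "sin (h/2) \<le> sin B"
  proof (cases "B \<le> pi / 2")
    case True then show ?thesis using B h by (intro sin_monotone_2pi_le) auto
  next
    case False
    then have "sin (h/2) \<le> sin (pi - B)" using B h by (intro sin_monotone_2pi_le) auto
    then show ?thesis by simp
  qed
  \<comment> \<open>The midpoints of the block and of the cell differ by \<open>m\<close> steps of
    length \<open>h / 2\<close>, and \<open>m + 1 \<le> \<beta> - \<alpha>\<close>.\<close>
  define m where "m = (if \<alpha> + \<beta> \<ge> 2 * l + 1 then \<alpha> + \<beta> - (2 * l + 1) else 2 * l + 1 - (\<alpha> + \<beta>))"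
  have mr: "real m + 1 \<le> real r" "\<bar>sin ((real \<alpha> + real \<beta> - 2 * real l - 1) * (h/2))\<bar> = \<bar>sin (real m * (h/2))\<bar>"
  proof -
    show "real m + 1 \<le> real r" unfolding rr m_def using assms by (auto split: if_splits simp: of_nat_diff)
    show "\<bar>sin ((real \<alpha> + real \<beta> - 2 * real l - 1) * (h/2))\<bar> = \<bar>sin (real m * (h/2))\<bar>"
    proof (cases "\<alpha> + \<beta> \<ge> 2 * l + 1")
      case True then have "real \<alpha> + real \<beta> - 2 * real l - 1 = real m" unfolding m_def by (simp add: of_nat_diff)
      then show ?thesis by simp
    next
      case False then have "(real \<alpha> + real \<beta> - 2 * real l - 1) * (h/2) = - (real m * (h/2))" unfolding m_def
        by (simp add: of_nat_diff algebra_simps)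
      then show ?thesis by (simp only: sin_minus abs_minus_cancel)
    qed
  qed
  define y where "y = (real \<alpha> + real \<beta> - 2 * real l - 1) * (h/2)"
  have "sin ((real \<alpha> + real \<beta>) * (h/2)) = sin (B + y)"
    unfolding B_def y_def by (intro arg_cong[where f=sin]) (simp add: field_simps)
  also have "\<dots> \<le> \<bar>sin B\<bar> * \<bar>cos y\<bar> + \<bar>cos B\<bar> * \<bar>sin y\<bar>"
    unfolding sin_add abs_mult[symmetric] by linarith
  also have "\<dots> \<le> \<bar>sin B\<bar> * 1 + 1 * \<bar>sin y\<bar>" by (intro add_mono mult_mono) auto
  also have "\<dots> \<le> sin B + real m * sin (h/2)"
    using mr(2) abs_sin_multiple_le[of m "h/2"] s0 sB unfolding y_def by simp
  also have "\<dots> \<le> sin B + real m * sin B" using sB by (intro add_left_mono mult_left_mono) auto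
  also have "\<dots> = (real m + 1) * sin B" by (simp add: distrib_right)
  also have "\<dots> \<le> real r * sin B" using mr(1) s0 sB by (intro mult_right_mono) auto
  finally have 1: "sin ((real \<alpha> + real \<beta>) * (h/2)) \<le> real r * sin B" .
  have 2: "\<bar>sin (real r * (h/2))\<bar> \<le> real r * sin (h/2)" using abs_sin_multiple_le[of r "h/2"] s0 by simp
  have rh: "0 \<le> real r * (h/2)" "real r * (h/2) \<le> pi"
  proof -
    have "real r * h \<le> real M * h" using assms h unfolding r_def by (intro mult_right_mono) auto
    then show "real r * (h/2) \<le> pi" using h pi_gt_zero by (simp; linarith)
  qed (use h in simp)
  have "cos (real \<alpha> * h) - cos (real \<beta> * h) = 2 * (sin ((real \<alpha> + real \<beta>) * (h/2)) * sin (real r * (h/2)))"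
  proof -
    have "(real \<alpha> * h + real \<beta> * h) / 2 = (real \<alpha> + real \<beta>) * (h/2)" "(real \<beta> * h - real \<alpha> * h) / 2 = real r * (h/2)"
      unfolding rr by (simp_all add: distrib_right left_diff_distrib)
    then show ?thesis by (simp only: cos_diff_cos mult.assoc)
  qed
  also have "\<dots> \<le> 2 * ((real r * sin B) * (real r * sin (h/2)))"
  proof -
    have "0 \<le> sin (real r * (h/2))" using rh by (intro sin_ge_zero)
    then have "sin ((real \<alpha> + real \<beta>) * (h/2)) * sin (real r * (h/2)) \<le> (real r * sin B) * (real r * sin (h/2))"
      using 1 2 s0 sB
      by (intro order.trans[OF mult_right_mono[OF 1] mult_left_mono]) auto
    then show ?thesis by simp
  qed
  also have "\<dots> = (real r)\<^sup>2 * (cos (real l * h) - cos (real (Suc l) * h))"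
  proof -
    have "(real l * h + real (Suc l) * h) / 2 = B" "(real (Suc l) * h - real l * h) / 2 = h/2"
      unfolding B_def by (simp_all add: field_simps)
    then show ?thesis by (simp only: cos_diff_cos) (simp add: power2_eq_square)
  qed
  finally show ?thesis unfolding r_def .
qed

text \<open>Reaching a block of \<open>r\<close> cells from one of them takes about
  \<open>2 * ln r / ln (3/2)\<close> doublings, because the lengths differ by a factor of at most
  \<open>r^2\<close>; so the loss \<open>L ^ j\<close> is a power of \<open>r\<close>.\<close>

lemma doubling_cos_grid:
  assumes "weight u" "doubling u"
  obtains C a where "1 \<le> C" "0 \<le> a"
    "\<And>M \<alpha> l \<beta>. \<lbrakk>\<alpha> \<le> l; l < \<beta>; \<beta> \<le> M\<rbrakk> \<Longrightarrow>
      mass u (cos (real \<beta> * (pi / real M))) (cos (real \<alpha> * (pi / real M)))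
        \<le> C * real (\<beta> - \<alpha>) powr a * mass u (cos (real (Suc l) * (pi / real M))) (cos (real l * (pi / real M)))"
proof -
  obtain L0 where L0: "\<And>a b. -1 \<le> a \<Longrightarrow> a \<le> b \<Longrightarrow> b \<le> 1 \<Longrightarrow>
      (LINT x:{a - (b - a) / 2 .. b + (b - a) / 2} \<inter> {-1..1}|lebesgue. u x) \<le> L0 * mass u a b"
    using assms(2) unfolding doubling_def mass_def by auto
  \<comment> \<open>The constant in the definition may be below 1, for instance when
    \<open>u = 0\<close>; the maximum makes \<open>L ^ j\<close> monotone in
    \<open>j\<close>.\<close>
  define L where "L = max 1 L0"
  have L: "1 \<le> L" unfolding L_def by simp
  have dbl: "(LINT x:{a - (b - a) / 2 .. b + (b - a) / 2} \<inter> {-1..1}|lebesgue. u x) \<le> L * mass u a b"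
    if "-1 \<le> a" "a \<le> b" "b \<le> 1" for a b
  proof -
    have "L0 * mass u a b \<le> L * mass u a b"
      using that assms(1) unfolding L_def by (intro mult_right_mono mass_nonneg) auto
    then show ?thesis using L0[OF that] by linarith
  qed
  define a where "a = 2 * ln L / ln (3/2)"
  have a0: "0 \<le> a" unfolding a_def using L by simp
  show ?thesis
  proof (rule that[of L a])
    fix M \<alpha> l \<beta> :: nat
    assume *: "\<alpha> \<le> l" "l < \<beta>" "\<beta> \<le> M"
    define h where "h = pi / real M"
    define r where "r = real (\<beta> - \<alpha>)"
    have r: "1 \<le> r" unfolding r_def using * by simp
    define j where "j = nat \<lceil>2 * ln r / ln (3/2)\<rceil>"
    have j0: "0 \<le> 2 * ln r / ln (3/2)" using r by simp
    have j: "2 * ln r / ln (3/2) \<le> real j" "real j \<le> 2 * ln r / ln (3/2) + 1"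
      unfolding j_def using j0 by linarith+
    have l32: "0 < ln (3/2::real)" by simp
    have "ln (r\<^sup>2) \<le> real j * ln (3/2)" using j(1) r l32 by (simp add: field_simps ln_realpow)
    then have "r\<^sup>2 \<le> (3/2) ^ j" using r by (simp add: ln_realpow[symmetric] ln_le_cancel_iff)
    have "L ^ j = exp (real j * ln L)" using L by (simp add: exp_of_nat_mult)
    also have "\<dots> \<le> exp ((2 * ln r / ln (3/2) + 1) * ln L)" using j L by (intro exp_mono mult_right_mono) auto
    also have "\<dots> = exp (a * ln r) * exp (ln L)" unfolding exp_add[symmetric] a_def by (simp add: field_simps)
    also have "\<dots> = L * r powr a" using L r unfolding powr_def by simp
    finally have Lj: "L ^ j \<le> L * r powr a" .
    have hM: "0 \<le> h" "real M * h = pi" unfolding h_def using * by auto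
    have ang: "0 \<le> real k * h" "real k * h \<le> pi" if "k \<le> M" for k
      using mult_right_mono[of "real k" "real M" h] that hM by auto
    have cosm: "cos (real k' * h) \<le> cos (real k * h)" if "k \<le> k'" "k' \<le> M" for k k'
      using that ang[of k] ang[of k'] hM by (intro cos_monotone_0_pi_le mult_right_mono) auto
    have le: "cos (real \<alpha> * h) - cos (real \<beta> * h) \<le> (3/2) ^ j * (cos (real l * h) - cos (real (Suc l) * h))"
      using cos_grid_length[OF *] mult_right_mono[OF \<open>r\<^sup>2 \<le> (3/2) ^ j\<close>, of "cos (real l * h) - cos (real (Suc l) * h)"]
        cosm[of l "Suc l"] * unfolding h_def r_def by simp
    have "mass u (cos (real \<beta> * h)) (cos (real \<alpha> * h)) \<le> L ^ j * mass u (cos (real (Suc l) * h)) (cos (real l * h))"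
      using * le by (intro doubling_iterate[OF assms(1) L dbl] cosm) auto
    also have "\<dots> \<le> (L * r powr a) * mass u (cos (real (Suc l) * h)) (cos (real l * h))"
      using Lj assms(1) by (intro mult_right_mono mass_nonneg) auto
    finally show "mass u (cos (real \<beta> * (pi / real M))) (cos (real \<alpha> * (pi / real M)))
        \<le> L * real (\<beta> - \<alpha>) powr a * mass u (cos (real (Suc l) * (pi / real M))) (cos (real l * (pi / real M)))"
      unfolding h_def r_def .
  qed (use L a0 in auto)
qed

section \<open>Pointwise bounds for admissible potentials\<close>

lemma trigp_periodic:
  assumes "trigp m f"
  shows "f (z + 2 * of_real pi) = f z"
proof -
  obtain c where c: "\<And>z. f z = (\<Sum>k\<le>2*m. c k * exp (\<i> * (of_nat k - of_nat m) * z))"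
    using trigp_expand[OF assms] by blast
  have "exp (\<i> * (of_nat k - of_nat m) * (z + 2 * of_real pi)) = exp (\<i> * (of_nat k - of_nat m) * z)" for k
  proof -
    have "\<i> * (of_nat k - of_nat m) * (z + 2 * of_real pi)
        = \<i> * (of_nat k - of_nat m) * z + 2 * of_int (int k - int m) * of_real pi * \<i>"
      by (simp add: algebra_simps)
    moreover have "exp (2 * of_int (int k - int m) * of_real pi * \<i>) = 1"
      unfolding exp_eq_1 by (auto intro!: exI[of _ "int k - int m"])
    ultimately show ?thesis by (simp add: exp_add)
  qed
  then show ?thesis by (simp only: c)
qed

text \<open>The third clause says that the potential \<open>V\<close> is touched from above at \<open>t\<close>, up to an additive constant,
  by a parabola living at a scale \<open>d\<close> that may depend on \<open>t\<close>.\<close>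

definition admissible :: "real \<Rightarrow> real \<Rightarrow> real \<Rightarrow> nat \<Rightarrow> (real \<Rightarrow> real) \<Rightarrow> bool" where
  "admissible A a0 \<kappa> n V \<longleftrightarrow>
     (\<forall>t. V (t + 2 * pi) = V t) \<and> (\<forall>t. V (- t) = V t) \<and>
     (\<forall>t. \<exists>d \<sigma>. 0 < d \<and> d \<le> 1 \<and> a0 \<le> real n * d \<and> \<bar>\<sigma>\<bar> \<le> A * real n \<and>
        (\<forall>s. \<bar>s - t\<bar> \<le> d \<longrightarrow> V s - V t \<le> \<sigma> * (s - t) + A * real n * (s - t)\<^sup>2 / d + A) \<and>
        (\<forall>s. \<bar>s - t\<bar> \<le> \<kappa> \<longrightarrow> V s - V t \<le> A * real n * d + A)) \<and>
     (\<forall>t. 0 \<le> V t \<and> V t \<le> real n)"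

text \<open>Midpoints of cells: together with their negatives they form an equidistant grid of
  \<open>2 * M\<close> points of the circle, so an even function needs only the \<open>M\<close>
  nodes in \<open>(0, pi)\<close>.\<close>

definition node :: "nat \<Rightarrow> nat \<Rightarrow> real" where
  "node M k = (real k + 1/2) * (pi / real M)"

lemma node_bounds:
  assumes "k < M"
  shows "0 < node M k" "node M k < pi"
proof -
  have "0 < pi / real M" using assms by simp
  then show "0 < node M k" unfolding node_def by (intro mult_pos_pos) auto
  have "(real k + 1/2) * (pi / real M) < real M * (pi / real M)" using assms
    by (intro mult_strict_right_mono) auto
  then show "node M k < pi" unfolding node_def using assms by simp
qed

lemma sum_symmetric_nodes:
  fixes f :: "real \<Rightarrow> real"
  assumes "0 < M"
  shows "(\<Sum>j<2 * M. f (- pi + pi / real M / 2 + 2 * pi * real j / real (2 * M))) = (\<Sum>k<M. f (node M k) + f (- node M k))"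
proof -
  define g where "g j = f (- pi + pi / real M / 2 + 2 * pi * real j / real (2 * M))" for j
  have split: "{..<2 * M} = {..<M} \<union> {M..<2 * M}" by auto
  have "sum g {..<2 * M} = sum g {..<M} + sum g {M..<2 * M}"
    unfolding split by (intro sum.union_disjoint) auto
  also have "sum g {..<M} = (\<Sum>k<M. g (M - Suc k))" by (rule sum.nat_diff_reindex[symmetric])
  also have "\<dots> = (\<Sum>k<M. f (- node M k))"
    unfolding g_def node_def
    by (intro sum.cong refl arg_cong[where f=f]) (auto simp: of_nat_diff field_simps)
  also have "sum g {M..<2 * M} = (\<Sum>k<M. g (k + M))"
    using sum.shift_bounds_nat_ivl[of g 0 M M] by (simp add: atLeast0LessThan mult_2)
  also have "\<dots> = (\<Sum>k<M. f (node M k))"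
    unfolding g_def node_def using assms
    by (intro sum.cong refl arg_cong[where f=f]) (auto simp: field_simps)
  finally show ?thesis unfolding g_def by (simp add: sum.distrib)
qed

text \<open>The constants do not depend on \<open>b\<close>, which is left free so that the grid can
  be made finer than \<open>1 / n\<close> by any factor; the sum divided by \<open>b\<close> behaves
  like \<open>n\<close> times an integral.\<close>

lemma pointwise_bound:
  fixes A a0 \<kappa> p r :: real
  assumes "1 \<le> A" "0 < a0" "a0 \<le> 1" "0 < \<kappa>" "\<kappa> \<le> 1" "0 < p" "0 < r"
  obtains c C b0 where "0 < c" "0 < C"
    "\<And>n b V P t z. \<lbrakk>1 \<le> n; b0 \<le> b; admissible A a0 \<kappa> n V; degree P \<le> n; 0 \<le> t; t \<le> pi; cmod (z - of_real t) \<le> c / real n\<rbrakk> \<Longrightarrow>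
      cmod (poly P (cos z)) powr p * exp (- V t) \<le>
        C / real b * (\<Sum>k<b * n. cmod (poly P (of_real (cos (node (b * n) k)))) powr p * exp (- V (node (b * n) k)) *
                        (1 + real n * \<bar>node (b * n) k - t\<bar>) powr (- r))"
proof -
  obtain m0 c C where c: "0 < c" "0 < C"
    and ex: "\<And>n d \<sigma> \<Delta>. \<lbrakk>1 \<le> n; 0 < d; d \<le> 1; a0 \<le> real n * d; \<bar>\<sigma>\<bar> \<le> A * real n;
        \<And>x. \<bar>x\<bar> \<le> d \<Longrightarrow> \<Delta> x \<le> \<sigma> * x + A * real n * x\<^sup>2 / d + A;
        \<And>x. \<bar>x\<bar> \<le> \<kappa> \<Longrightarrow> \<Delta> x \<le> A * real n * d + A;
        \<And>x. \<Delta> x \<le> real n\<rbrakk> \<Longrightarrow>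
      \<exists>Q. trigp (m0 * n) Q \<and> (\<forall>z. cmod z \<le> c / real n \<longrightarrow> 1 / C \<le> cmod (Q z)) \<and>
        (\<forall>x. \<bar>x\<bar> \<le> pi \<longrightarrow> cmod (Q (of_real x)) powr p \<le> C * exp (- \<Delta> x) * (1 + real n * \<bar>x\<bar>) powr (- r))"
    using peak_polynomial_exists[OF assms] by metis
  define K where "K = nat \<lceil>p\<rceil>"
  have K: "p \<le> real K" unfolding K_def by linarith
  define m where "m = 1 + m0"
  \<comment> \<open>Makes the number \<open>2 * b * n\<close> of nodes exceed twice the degree
    \<open>K * m * n\<close> of the \<open>K\<close>-th power to which the sup bound is
    applied.\<close>
  define b0 where "b0 = K * m + 1"
  define E where "E = exp (p * real m * c)"
  define C' where "C' = C powr p * E * (real (K * m) + 1) * (2 * C)"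
  show ?thesis
  proof (rule that[of c C' b0])
    have "0 < real (K * m) + 1" by (rule add_nonneg_pos) auto
    then show "0 < C'" unfolding C'_def E_def using c by (intro mult_pos_pos) auto
    fix n b :: nat and V :: "real \<Rightarrow> real" and P :: "complex poly" and t :: real and z :: complex
    assume n: "1 \<le> n" and b: "b0 \<le> b" and V: "admissible A a0 \<kappa> n V" and P: "degree P \<le> n"
      and t: "0 \<le> t" "t \<le> pi" and z: "cmod (z - of_real t) \<le> c / real n"
    define M where "M = b * n"
    have M: "0 < M" unfolding M_def using n b unfolding b0_def by simp
    have per: "V (s + 2 * pi) = V s" and even: "V (- s) = V s" and V0: "0 \<le> V s" "V s \<le> real n" for s
      using V unfolding admissible_def by blast+
    obtain d \<sigma> where d: "0 < d" "d \<le> 1" "a0 \<le> real n * d" "\<bar>\<sigma>\<bar> \<le> A * real n"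
      and l1: "\<And>s. \<bar>s - t\<bar> \<le> d \<Longrightarrow> V s - V t \<le> \<sigma> * (s - t) + A * real n * (s - t)\<^sup>2 / d + A"
      and l2: "\<And>s. \<bar>s - t\<bar> \<le> \<kappa> \<Longrightarrow> V s - V t \<le> A * real n * d + A"
      using V unfolding admissible_def by blast
    obtain Q where Q: "trigp (m0 * n) Q" "\<And>z. cmod z \<le> c / real n \<Longrightarrow> 1 / C \<le> cmod (Q z)"
      "\<And>x. \<bar>x\<bar> \<le> pi \<Longrightarrow> cmod (Q (of_real x)) powr p \<le> C * exp (- (V (t + x) - V t)) * (1 + real n * \<bar>x\<bar>) powr (- r)"
    proof -
      have "\<exists>Q. trigp (m0 * n) Q \<and> (\<forall>z. cmod z \<le> c / real n \<longrightarrow> 1 / C \<le> cmod (Q z)) \<and>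
        (\<forall>x. \<bar>x\<bar> \<le> pi \<longrightarrow> cmod (Q (of_real x)) powr p \<le> C * exp (- (V (t + x) - V t)) * (1 + real n * \<bar>x\<bar>) powr (- r))"
      proof (rule ex[OF n d])
        fix x
        show "V (t + x) - V t \<le> \<sigma> * x + A * real n * x\<^sup>2 / d + A" if "\<bar>x\<bar> \<le> d" using l1[of "t + x"] that by simp
        show "V (t + x) - V t \<le> A * real n * d + A" if "\<bar>x\<bar> \<le> \<kappa>" using l2[of "t + x"] that by simp
        show "V (t + x) - V t \<le> real n" using V0[of "t + x"] V0[of t] by linarith
      qed
      then show ?thesis using that by blast
    qed
    define R where "R z = poly P (cos z) * Q (z + of_real (- t))" for z
    have trR: "trigp (m * n) R"
    proof -
      have "trigp (n + m0 * n) R" unfolding R_def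
        by (intro trigp_mult trigp_poly_of trigp_affine Q(1) P trigp_cos1)
      then show ?thesis unfolding m_def by simp
    qed
    define a where "a s = cmod (poly P (of_real (cos s))) powr p * exp (- V s) * (1 + real n * \<bar>\<bar>s\<bar> - t\<bar>) powr (- r)" for s
    have Rs: "cmod (R (of_real s)) powr p \<le> C * exp (V t) * a s" if s: "\<bar>s\<bar> \<le> pi" for s
    proof -
      \<comment> \<open>The representative of \<open>s - t\<close> modulo \<open>2 * pi\<close> in
        \<open>[-pi, pi]\<close>; as \<open>t \<ge> 0\<close>, only the lower end can be exceeded.
        Its modulus dominates the distance from \<open>|s|\<close> to \<open>t\<close>, so negative
        nodes fold onto positive ones.\<close>
      define x where "x = (if - pi \<le> s - t then s - t else s - t + 2 * pi)"
      have x: "\<bar>x\<bar> \<le> pi" "\<bar>\<bar>s\<bar> - t\<bar> \<le> \<bar>x\<bar>" using s t unfolding x_def by (auto simp: abs_if)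
      have Qx: "Q (of_real s + of_real (- t)) = Q (of_real x)"
        using trigp_periodic[OF Q(1), of "of_real (s - t)"] unfolding x_def by simp
      have Vx: "V (t + x) = V s" using per[of s] unfolding x_def by (simp add: algebra_simps)
      have "cmod (Q (of_real x)) powr p \<le> C * exp (- (V (t + x) - V t)) * (1 + real n * \<bar>x\<bar>) powr (- r)"
        by (rule Q(3)[OF x(1)])
      also have "\<dots> \<le> C * exp (- (V (t + x) - V t)) * (1 + real n * \<bar>\<bar>s\<bar> - t\<bar>) powr (- r)"
        using x(2) c assms by (intro mult_left_mono powr_mono2') (auto intro!: mult_left_mono add_pos_nonneg)
      also have "exp (- (V (t + x) - V t)) = exp (V t) * exp (- V s)" unfolding Vx by (simp flip: exp_add)
      finally have "cmod (poly P (of_real (cos s))) powr p * cmod (Q (of_real x)) powr p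
         \<le> cmod (poly P (of_real (cos s))) powr p * (C * (exp (V t) * exp (- V s)) * (1 + real n * \<bar>\<bar>s\<bar> - t\<bar>) powr (- r))"
        by (intro mult_left_mono) auto
      then show ?thesis unfolding R_def Qx a_def by (simp add: norm_mult powr_mult cos_of_real mult_ac)
    qed
    have Nb: "2 * (K * (m * n)) < 2 * M"
    proof -
      have "K * m < b" using b unfolding b0_def by simp
      then have "K * m * n < b * n" using n by simp
      then show ?thesis unfolding M_def by (simp add: mult.assoc)
    qed
    have imz: "\<bar>Im z\<bar> \<le> c / real n" using abs_Im_le_cmod[of "z - of_real t"] z by simp
    define S where "S = (\<Sum>k<M. a (node M k))"
    have a0: "0 \<le> a s" for s unfolding a_def by simp
    have am: "a (- s) = a s" for s unfolding a_def by (simp add: even)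
    have "cmod (R z) powr p \<le> exp (p * real (m * n) * \<bar>Im z\<bar>) * (2 * real (K * (m * n)) + 1) / real (2 * M) *
        (\<Sum>j<2 * M. cmod (R (of_real (- pi + pi / real M / 2 + 2 * pi * real j / real (2 * M)))) powr p)"
      by (rule trigp_grid_bound_powr[OF trR assms(6) K Nb])
    also have "(\<Sum>j<2 * M. cmod (R (of_real (- pi + pi / real M / 2 + 2 * pi * real j / real (2 * M)))) powr p)
       = (\<Sum>k<M. cmod (R (of_real (node M k))) powr p + cmod (R (of_real (- node M k))) powr p)"
      by (rule sum_symmetric_nodes[OF M, of "\<lambda>s. cmod (R (of_real s)) powr p"])
    also have "exp (p * real (m * n) * \<bar>Im z\<bar>) * (2 * real (K * (m * n)) + 1) / real (2 * M) * \<dots>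
       \<le> E * (2 * (real (K * m) + 1) * real n) / real (2 * M) * (2 * C * exp (V t) * S)"
    proof (intro mult_mono divide_right_mono)
      have "p * real (m * n) * \<bar>Im z\<bar> \<le> p * real (m * n) * (c / real n)" using imz assms by (intro mult_left_mono) auto
      also have "\<dots> = p * real m * c" using n by simp
      finally show "exp (p * real (m * n) * \<bar>Im z\<bar>) \<le> E" unfolding E_def by simp
      show "2 * real (K * (m * n)) + 1 \<le> 2 * (real (K * m) + 1) * real n" using n by (simp add: algebra_simps)
      have "(\<Sum>k<M. cmod (R (of_real (node M k))) powr p + cmod (R (of_real (- node M k))) powr p)
         \<le> (\<Sum>k<M. 2 * C * exp (V t) * a (node M k))"
      proof (intro sum_mono)
        fix k assume "k \<in> {..<M}"
        then have "\<bar>node M k\<bar> \<le> pi" "\<bar>- node M k\<bar> \<le> pi" using node_bounds[of k M] by auto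
        from Rs[OF this(1)] Rs[OF this(2)] show "cmod (R (of_real (node M k))) powr p + cmod (R (of_real (- node M k))) powr p
          \<le> 2 * C * exp (V t) * a (node M k)" by (simp add: am)
      qed
      then show "(\<Sum>k<M. cmod (R (of_real (node M k))) powr p + cmod (R (of_real (- node M k))) powr p) \<le> 2 * C * exp (V t) * S"
        unfolding S_def by (simp add: sum_distrib_left)
    qed (auto simp: E_def intro!: sum_nonneg add_nonneg_nonneg)
    also have "\<dots> = E * (real (K * m) + 1) * (2 * C) / real b * exp (V t) * S"
      unfolding M_def using n by simp
    finally have Rz: "cmod (R z) powr p \<le> E * (real (K * m) + 1) * (2 * C) / real b * exp (V t) * S" .
    have "1 / C \<le> cmod (Q (z + of_real (- t)))" using Q(2)[of "z + of_real (- t)"] z by simp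
    then have "cmod (poly P (cos z)) * (1 / C) \<le> cmod (R z)" unfolding R_def norm_mult by (intro mult_left_mono) auto
    then have "cmod (poly P (cos z)) \<le> C * cmod (R z)" using c by (simp add: field_simps)
    then have "cmod (poly P (cos z)) powr p \<le> (C * cmod (R z)) powr p" using assms by (intro powr_mono2) auto
    also have "\<dots> = C powr p * cmod (R z) powr p" using c by (simp add: powr_mult)
    also have "\<dots> \<le> C powr p * (E * (real (K * m) + 1) * (2 * C) / real b * exp (V t) * S)"
      using Rz by (intro mult_left_mono) auto
    finally have "cmod (poly P (cos z)) powr p * exp (- V t)
      \<le> C powr p * (E * (real (K * m) + 1) * (2 * C) / real b * exp (V t) * S) * exp (- V t)"
      by (intro mult_right_mono) auto
    also have "\<dots> = C' / real b * S * (exp (V t) * exp (- V t))" unfolding C'_def by simp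
    also have "exp (V t) * exp (- V t) = 1" by (simp flip: exp_add)
    also have "S = (\<Sum>k<M. cmod (poly P (of_real (cos (node M k)))) powr p * exp (- V (node M k)) *
                        (1 + real n * \<bar>node M k - t\<bar>) powr (- r))"
      unfolding S_def a_def using node_bounds by (intro sum.cong refl) (auto simp: less_imp_le)
    finally show "cmod (poly P (cos z)) powr p * exp (- V t) \<le>
        C' / real b * (\<Sum>k<b * n. cmod (poly P (of_real (cos (node (b * n) k)))) powr p * exp (- V (node (b * n) k)) *
                        (1 + real n * \<bar>node (b * n) k - t\<bar>) powr (- r))"
      unfolding M_def by simp
  qed (rule c)
qed

section \<open>The class Omega\<close>

lemma outer_derivatives:
  assumes "Omega_outer A F" "x \<in> {0<..A}"
  shows "(F has_real_derivative nth_deriv_within {0<..A} 1 F x) (at x within {0<..A})"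
    "(nth_deriv_within {0<..A} 1 F has_real_derivative nth_deriv_within {0<..A} 2 F x) (at x within {0<..A})"
proof -
  have d: "nth_deriv_within {0<..A} n F differentiable (at x within {0<..A})" for n
    using assms unfolding Omega_outer_def smooth_on_def differentiable_on_def by blast
  show "(F has_real_derivative nth_deriv_within {0<..A} 1 F x) (at x within {0<..A})"
    using d[of 0] by (simp add: has_real_derivative_iff_has_vector_derivative vector_derivative_works)
  show "(nth_deriv_within {0<..A} 1 F has_real_derivative nth_deriv_within {0<..A} 2 F x) (at x within {0<..A})"
    using d[of 1] by (simp add: has_real_derivative_iff_has_vector_derivative vector_derivative_works numeral_2_eq_2)
qed

text \<open>Recovers the sign of \<open>F'\<close>, which the absolute values in (F4) hide.\<close>

lemma antimono_deriv_nonpos: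
  fixes f :: "real \<Rightarrow> real"
  assumes "antimono_on S f" "(f has_real_derivative D) (at x within S)" "x \<in> S" "at x within S \<noteq> bot"
  shows "D \<le> 0"
proof (rule tendsto_upperbound)
  show "((\<lambda>y. (f y - f x) / (y - x)) \<longlongrightarrow> D) (at x within S)"
    using assms(2) by (simp add: has_field_derivative_iff)
  show "\<forall>\<^sub>F y in at x within S. (f y - f x) / (y - x) \<le> 0"
    unfolding eventually_at_filter
  proof (intro always_eventually allI impI)
    fix y assume y: "y \<noteq> x" "y \<in> S"
    show "(f y - f x) / (y - x) \<le> 0"
    proof (cases "x \<le> y")
      case True
      then have "f y \<le> f x" using assms(1,3) y by (auto simp: monotone_on_def)
      then show ?thesis using True by (intro divide_nonpos_nonneg) auto
    next
      case False
      then have "f x \<le> f y" using assms(1,3) y by (auto simp: monotone_on_def)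
      then show ?thesis using False by (intro divide_nonneg_nonpos) auto
    qed
  qed
qed (use assms in auto)

text \<open>By (F4) the logarithmic derivative \<open>x * F' / F\<close> lies between two negative
  constants, so \<open>ln F + B * ln x\<close> increases and \<open>ln F + ln x / B\<close>
  decreases; hence the two power bounds.\<close>

lemma outer_growth:
  assumes "Omega_outer A F" "0 < A"
  obtains B where "1 \<le> B"
    "\<And>x y. 0 < y \<Longrightarrow> y \<le> x \<Longrightarrow> x \<le> A \<Longrightarrow> F y \<le> (x / y) powr B * F x"
    "\<And>x y. 0 < y \<Longrightarrow> y \<le> x \<Longrightarrow> x \<le> A \<Longrightarrow> (x / y) powr (1 / B) * F x \<le> F y"
    "\<And>x. x \<in> {0<..A} \<Longrightarrow> \<bar>nth_deriv_within {0<..A} 1 F x\<bar> \<le> B * F x / x"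
    "\<And>x. x \<in> {0<..A} \<Longrightarrow> \<bar>nth_deriv_within {0<..A} 2 F x\<bar> \<le> B * F x / x\<^sup>2"
proof -
  define F1 where "F1 = nth_deriv_within {0<..A} 1 F"
  have pos: "0 < F x" if "x \<in> {0<..A}" for x using assms(1) that unfolding Omega_outer_def by auto
  obtain B0 where B0: "0 < B0" and b0: "\<And>n x. 1 \<le> n \<Longrightarrow> x \<in> {0<..A} \<Longrightarrow>
      \<bar>nth_deriv_within {0<..A} n F x\<bar> \<le> B0 ^ n * real n ^ n * F x / x ^ n"
    using assms(1) unfolding Omega_outer_def by blast
  obtain A1 A2 where A12: "0 < A1" "0 < A2" and a12: "\<And>x. x \<in> {0<..A} \<Longrightarrow>
      A2 \<le> \<bar>F1 x\<bar> * x / F x \<and> \<bar>F1 x\<bar> * x / F x \<le> A1"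
    using assms(1) unfolding Omega_outer_def F1_def by blast
  have anti: "antimono_on {0<..A} F" using assms(1) unfolding Omega_outer_def by blast
  \<comment> \<open>Here \<open>4 * B0^2\<close> is the constant \<open>B0 ^ n * n ^ n\<close> of
    (F3) at \<open>n = 2\<close>.\<close>
  define B where "B = max (max 1 A1) (max (1 / A2) (4 * B0\<^sup>2))"
  have B: "1 \<le> B" "A1 \<le> B" "1 / A2 \<le> B" "4 * B0\<^sup>2 \<le> B" unfolding B_def by auto
  have BA2: "1 / B \<le> A2" using B A12 by (simp add: field_simps)
  have F1le: "F1 x \<le> 0" if x: "x \<in> {0<..A}" for x
  proof (rule antimono_deriv_nonpos[OF anti _ x])
    show "(F has_real_derivative F1 x) (at x within {0<..A})" unfolding F1_def by (rule outer_derivatives[OF assms(1) x])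
    \<comment> \<open>At \<open>x = A\<close> the derivative is one-sided, so the point has to be
      approached from below.\<close>
    have "x islimpt {0<..A}"
    proof -
      have "x islimpt {0<..<x}" using x islimpt_greaterThanLessThan2[of 0 x] by simp
      then show ?thesis by (rule islimpt_subset) (use x in auto)
    qed
    then show "at x within {0<..A} \<noteq> bot" by (simp add: trivial_limit_within)
  qed
  have lnder: "((\<lambda>x. ln (F x) + c * ln x) has_derivative (\<lambda>h. (F1 x / F x + c / x) * h)) (at x within {y..z})"
    if "0 < y" "z \<le> A" "x \<in> {y..z}" for x y z c
  proof -
    have x: "x \<in> {0<..A}" using that by auto
    have "(F has_real_derivative F1 x) (at x within {y..z})"
      unfolding F1_def by (rule DERIV_subset[OF outer_derivatives(1)[OF assms(1) x]]) (use that in auto)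
    then have "((\<lambda>x. ln (F x) + c * ln x) has_real_derivative (F1 x / F x + c / x)) (at x within {y..z})"
      using x pos[OF x] by (auto intro!: derivative_eq_intros)
    then show ?thesis by (simp add: has_field_derivative_def)
  qed
  have growth: "F y \<le> (x / y) powr B * F x" "(x / y) powr (1 / B) * F x \<le> F y" if xy: "0 < y" "y \<le> x" "x \<le> A" for x y
  proof -
    have p: "0 < F x" "0 < F y" using pos xy by auto
    obtain \<xi> where xi: "\<xi> \<in> {y..x}" "(ln (F x) + B * ln x) - (ln (F y) + B * ln y) = (F1 \<xi> / F \<xi> + B / \<xi>) * (x - y)"
      using mvt_very_simple[of y x "\<lambda>x. ln (F x) + B * ln x" "\<lambda>x h. (F1 x / F x + B / x) * h"] lnder[of y x _ B] xy by auto
    have xi': "\<xi> \<in> {0<..A}" using xi xy by auto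
    have "- F1 \<xi> * \<xi> / F \<xi> \<le> B" using a12[OF xi'] F1le[OF xi'] B by simp
    then have "0 \<le> F1 \<xi> / F \<xi> + B / \<xi>" using xi' pos[OF xi'] by (simp add: field_simps)
    then have "0 \<le> (F1 \<xi> / F \<xi> + B / \<xi>) * (x - y)" using xy by simp
    then have "ln (F y) \<le> ln (F x) + B * ln (x / y)" using xi(2) xy by (simp add: ln_div algebra_simps)
    then have "exp (ln (F y)) \<le> exp (ln (F x) + B * ln (x / y))" by simp
    then show "F y \<le> (x / y) powr B * F x" using p xy by (simp add: exp_add powr_def mult.commute)
    obtain \<xi> where xi: "\<xi> \<in> {y..x}" "(ln (F x) + (1/B) * ln x) - (ln (F y) + (1/B) * ln y) = (F1 \<xi> / F \<xi> + (1/B) / \<xi>) * (x - y)"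
      using mvt_very_simple[of y x "\<lambda>x. ln (F x) + (1/B) * ln x" "\<lambda>x h. (F1 x / F x + (1/B) / x) * h"] lnder[of y x _ "1/B"] xy by auto
    have xi': "\<xi> \<in> {0<..A}" using xi xy by auto
    have "1 / B \<le> - F1 \<xi> * \<xi> / F \<xi>" using a12[OF xi'] F1le[OF xi'] BA2 by simp
    then have "F1 \<xi> / F \<xi> + (1/B) / \<xi> \<le> 0" using xi' pos[OF xi'] B by (simp add: field_simps)
    then have "(F1 \<xi> / F \<xi> + (1/B) / \<xi>) * (x - y) \<le> 0" using xy by (intro mult_nonpos_nonneg) auto
    then have "ln (F x) + (1/B) * ln (x / y) \<le> ln (F y)" using xi(2) xy by (simp add: ln_div algebra_simps)
    then have "exp (ln (F x) + (1/B) * ln (x / y)) \<le> exp (ln (F y))" by simp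
    then show "(x / y) powr (1 / B) * F x \<le> F y" using p xy by (simp add: exp_add powr_def mult.commute)
  qed
  show ?thesis
  proof (rule that[OF B(1) growth])
    fix x assume x: "x \<in> {0<..A}"
    have "\<bar>F1 x\<bar> * x / F x \<le> B" using a12[OF x] B by simp
    then show "\<bar>nth_deriv_within {0<..A} 1 F x\<bar> \<le> B * F x / x"
      using x pos[OF x] unfolding F1_def by (simp add: field_simps)
    have "\<bar>nth_deriv_within {0<..A} 2 F x\<bar> \<le> B0 ^ 2 * real 2 ^ 2 * F x / x ^ 2" using b0[of 2 x] x by simp
    also have "\<dots> = (4 * B0\<^sup>2) * (F x / x\<^sup>2)" by simp
    also have "\<dots> \<le> B * (F x / x\<^sup>2)" using B pos[OF x] by (intro mult_right_mono) auto
    finally show "\<bar>nth_deriv_within {0<..A} 2 F x\<bar> \<le> B * F x / x\<^sup>2" by simp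
  qed auto
qed

section \<open>Periodicity and the zeros of the inner function\<close>

lemma reduce_mod_2pi:
  obtains k :: int where "t - of_int k * (2 * pi) \<in> {0..2 * pi}"
proof -
  define k where "k = \<lfloor>t / (2 * pi)\<rfloor>"
  have "real_of_int k \<le> t / (2 * pi)" "t / (2 * pi) < real_of_int k + 1" unfolding k_def by linarith+
  then have "real_of_int k * (2 * pi) \<le> t" "t < (real_of_int k + 1) * (2 * pi)" by (simp_all add: field_simps)
  then show ?thesis by (intro that[of k]) (auto simp: algebra_simps)
qed

lemma periodic_int:
  fixes f :: "real \<Rightarrow> 'a"
  assumes "\<And>t. f (t + 2 * pi) = f t"
  shows "f (t + of_int k * (2 * pi)) = f t" "f (t - of_int k * (2 * pi)) = f t"
proof -
  have nat: "f (t + real m * (2 * pi)) = f t" for m t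
  proof (induction m)
    case (Suc m)
    have "f (t + real (Suc m) * (2 * pi)) = f (t + real m * (2 * pi) + 2 * pi)" by (simp add: algebra_simps)
    then show ?case using Suc assms by simp
  qed simp
  have all: "f (t + of_int k * (2 * pi)) = f t" for k t
  proof (cases "0 \<le> k")
    case True then show ?thesis using nat[of t "nat k"] by simp
  next
    case False
    then show ?thesis using nat[of "t + of_int k * (2 * pi)" "nat (- k)"] by simp
  qed
  show "f (t + of_int k * (2 * pi)) = f t" by (rule all)
  show "f (t - of_int k * (2 * pi)) = f t" using all[of t "- k"] by simp
qed

text \<open>All zeros being simple, \<open>|g'|\<close> has a positive minimum \<open>m\<close> on
  the compact set of zeros in one period, and a second order expansion keeps \<open>|g|\<close>
  above a multiple of the distance as long as the quadratic error is below half the linear term.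
  Away from the zeros compactness and periodicity give a positive lower bound.\<close>

lemma inner_facts:
  assumes "Omega_inner A g"
  obtains D where "1 \<le> D"
    "\<And>t. (g has_real_derivative deriv g t) (at t)"
    "\<And>t. (deriv g has_real_derivative deriv (deriv g) t) (at t)"
    "\<And>t. \<bar>deriv g t\<bar> \<le> D" "\<And>t. \<bar>deriv (deriv g) t\<bar> \<le> D"
    "\<And>s t. \<bar>g s - g t\<bar> \<le> D * \<bar>s - t\<bar>"
    "\<And>\<tau> t. g \<tau> = 0 \<Longrightarrow> \<bar>t - \<tau>\<bar> \<le> 1 / D \<Longrightarrow> \<bar>t - \<tau>\<bar> / D \<le> \<bar>g t\<bar>"
    "\<And>\<eta>. 0 < \<eta> \<Longrightarrow> \<exists>c>0. \<forall>t. (\<forall>\<tau>. g \<tau> = 0 \<longrightarrow> \<eta> \<le> \<bar>t - \<tau>\<bar>) \<longrightarrow> c \<le> \<bar>g t\<bar>"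
proof -
  have per: "\<And>t. g (t + 2 * pi) = g t" and simple: "\<And>t. g t = 0 \<Longrightarrow> deriv g t \<noteq> 0"
    and fd: "\<And>n t. (deriv ^^ n) g field_differentiable (at t)" and ex: "\<exists>t. g t = 0"
    using assms unfolding Omega_inner_def by blast+
  obtain D0 where D0: "0 < D0" "\<And>n t. 1 \<le> n \<Longrightarrow> \<bar>(deriv ^^ n) g t\<bar> \<le> D0 ^ n * fact n"
    using assms unfolding Omega_inner_def by blast
  have d1: "(g has_real_derivative deriv g t) (at t)" for t
    using fd[of 0 t] by (simp add: field_differentiable_derivI)
  have d2: "(deriv g has_real_derivative deriv (deriv g) t) (at t)" for t
    using fd[of 1 t] by (simp add: field_differentiable_derivI)
  have b1: "\<bar>deriv g t\<bar> \<le> D0" for t using D0(2)[of 1 t] by simp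
  have b2: "\<bar>deriv (deriv g) t\<bar> \<le> 2 * D0\<^sup>2" for t
    using D0(2)[of 2 t] by (simp add: numeral_2_eq_2 mult.commute)
  have cg: "continuous_on S g" for S by (meson DERIV_isCont d1 continuous_at_imp_continuous_on)
  have cdg: "continuous_on S (deriv g)" for S by (meson DERIV_isCont d2 continuous_at_imp_continuous_on)
  define Z where "Z = {t \<in> {0..2*pi}. g t = 0}"
  have Zc: "compact Z"
  proof -
    have "closed ({0..2*pi} \<inter> g -` {0})" by (intro continuous_closed_preimage cg) auto
    moreover have "{0..2*pi} \<inter> g -` {0} = Z" unfolding Z_def by auto
    ultimately have "closed Z" by simp
    moreover have "bounded Z" by (rule bounded_subset[of "{0..2*pi}"]) (auto simp: Z_def)
    ultimately show ?thesis by (simp add: compact_eq_bounded_closed)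
  qed
  have Zne: "Z \<noteq> {}"
  proof -
    obtain t where t: "g t = 0" using ex by blast
    obtain k where k: "t - of_int k * (2 * pi) \<in> {0..2 * pi}" using reduce_mod_2pi by blast
    have "g (t - of_int k * (2 * pi)) = 0" using periodic_int(2)[of g, OF per] t by metis
    then show ?thesis using k unfolding Z_def by blast
  qed
  have "continuous_on Z (\<lambda>t. \<bar>deriv g t\<bar>)" by (intro continuous_intros cdg)
  from continuous_attains_inf[OF Zc Zne this] obtain \<tau>0 where t0: "\<tau>0 \<in> Z" "\<And>\<tau>. \<tau> \<in> Z \<Longrightarrow> \<bar>deriv g \<tau>0\<bar> \<le> \<bar>deriv g \<tau>\<bar>" by blast
  define m where "m = \<bar>deriv g \<tau>0\<bar>"
  have m: "0 < m" using simple t0(1) unfolding m_def Z_def by auto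
  define D where "D = max (max 1 D0) (max (2 * D0\<^sup>2) (max (2 / m) (4 * D0\<^sup>2 / m)))"
  have D: "1 \<le> D" "D0 \<le> D" "2 * D0\<^sup>2 \<le> D" "2 / m \<le> D" "4 * D0\<^sup>2 / m \<le> D" unfolding D_def by auto
  have lip: "\<bar>g s - g t\<bar> \<le> D0 * \<bar>s - t\<bar>" for s t
    using field_differentiable_bound[of UNIV g "deriv g" D0 s t] d1 b1 by simp
  have near0: "\<bar>t - \<tau>\<bar> / D \<le> \<bar>g t\<bar>" if tau: "\<tau> \<in> Z" and t: "\<bar>t - \<tau>\<bar> \<le> 1 / D" for \<tau> t
  proof -
    have g0: "g \<tau> = 0" using tau unfolding Z_def by simp
    have "norm (g t - (g \<tau> + deriv g \<tau> * (t - \<tau>))) \<le> 2 * D0\<^sup>2 * norm (t - \<tau>) ^ 2"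
    proof -
      define h where "h = (\<lambda>x. g x - deriv g \<tau> * (x - \<tau>))"
      have h': "(h has_real_derivative (deriv g x - deriv g \<tau>)) (at x within closed_segment \<tau> t)" for x
      proof -
        have "((\<lambda>x. g x - deriv g \<tau> * (x - \<tau>)) has_real_derivative (deriv g x - deriv g \<tau> * (1 - 0))) (at x)"
          by (intro DERIV_diff DERIV_cmult d1 DERIV_ident DERIV_const)
        then show ?thesis unfolding h_def using has_field_derivative_at_within by fastforce
      qed
      have hb: "norm (deriv g x - deriv g \<tau>) \<le> 2 * D0\<^sup>2 * \<bar>t - \<tau>\<bar>" if "x \<in> closed_segment \<tau> t" for x
      proof -
        have "norm (deriv g x - deriv g \<tau>) \<le> 2 * D0\<^sup>2 * norm (x - \<tau>)"
          using field_differentiable_bound[of UNIV "deriv g" "deriv (deriv g)" "2 * D0\<^sup>2" x \<tau>] d2 b2 by simp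
        also have "\<dots> \<le> 2 * D0\<^sup>2 * \<bar>t - \<tau>\<bar>"
          using that by (intro mult_left_mono) (auto simp: closed_segment_eq_real_ivl split: if_splits)
        finally show ?thesis .
      qed
      have "norm (h t - h \<tau>) \<le> 2 * D0\<^sup>2 * \<bar>t - \<tau>\<bar> * norm (t - \<tau>)"
        by (rule field_differentiable_bound[OF _ h' hb]) auto
      then show ?thesis unfolding h_def by (simp add: power2_eq_square algebra_simps)
    qed
    then have "m * \<bar>t - \<tau>\<bar> - 2 * D0\<^sup>2 * (t - \<tau>)\<^sup>2 \<le> \<bar>g t\<bar>"
      using mult_right_mono[OF t0(2)[OF tau], of "\<bar>t - \<tau>\<bar>"] g0 unfolding m_def
      by (simp add: abs_mult[symmetric])
    moreover have "2 * D0\<^sup>2 * (t - \<tau>)\<^sup>2 \<le> m / 2 * \<bar>t - \<tau>\<bar>"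
    proof -
      have "4 * D0\<^sup>2 \<le> D * m" using D(5) m by (simp add: field_simps)
      have "\<bar>t - \<tau>\<bar> * D \<le> 1" using t D(1) by (simp add: field_simps)
      have "\<bar>t - \<tau>\<bar> * (4 * D0\<^sup>2) \<le> \<bar>t - \<tau>\<bar> * (D * m)"
        by (rule mult_left_mono[OF \<open>4 * D0\<^sup>2 \<le> D * m\<close>]) simp
      also have "\<dots> = (\<bar>t - \<tau>\<bar> * D) * m" by simp
      also have "\<dots> \<le> 1 * m" using \<open>\<bar>t - \<tau>\<bar> * D \<le> 1\<close> m by (intro mult_right_mono) auto
      finally have "\<bar>t - \<tau>\<bar> * (4 * D0\<^sup>2) \<le> m" by simp
      moreover have "(t - \<tau>)\<^sup>2 = \<bar>t - \<tau>\<bar> * \<bar>t - \<tau>\<bar>" by (simp add: power2_eq_square)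
      ultimately show ?thesis using mult_right_mono[of "\<bar>t - \<tau>\<bar> * (4 * D0\<^sup>2)" m "\<bar>t - \<tau>\<bar>"]
        by (simp only:) (simp add: mult_ac)
    qed
    moreover have "\<bar>t - \<tau>\<bar> / D \<le> m / 2 * \<bar>t - \<tau>\<bar>"
    proof -
      have "1 / D \<le> m / 2" using D(1,4) m by (simp add: field_simps)
      from mult_right_mono[OF this, of "\<bar>t - \<tau>\<bar>"] show ?thesis by simp
    qed
    ultimately show ?thesis by linarith
  qed
  show ?thesis
  proof (rule that[OF D(1) d1 d2])
    fix s t
    show "\<bar>deriv g t\<bar> \<le> D" "\<bar>deriv (deriv g) t\<bar> \<le> D" using b1[of t] b2[of t] D by linarith+
    show "\<bar>g s - g t\<bar> \<le> D * \<bar>s - t\<bar>" using lip[of s t] mult_right_mono[OF D(2), of "\<bar>s - t\<bar>"] by linarith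
  next
    fix \<tau> t assume *: "g \<tau> = 0" "\<bar>t - \<tau>\<bar> \<le> 1 / D"
    obtain k where k: "\<tau> - of_int k * (2 * pi) \<in> {0..2 * pi}" using reduce_mod_2pi by blast
    have "\<tau> - of_int k * (2 * pi) \<in> Z" unfolding Z_def using k * periodic_int(2)[of g, OF per] by simp
    from near0[OF this, of "t - of_int k * (2 * pi)"] * periodic_int(2)[of g, OF per]
    show "\<bar>t - \<tau>\<bar> / D \<le> \<bar>g t\<bar>" by simp
  next
    fix \<eta> :: real assume eta: "0 < \<eta>"
    \<comment> \<open>The zeros range over the whole line, so that a zero just outside the period
      also counts in the distance.\<close>
    define S where "S = {0..2*pi} \<inter> (\<Inter>\<tau>\<in>{\<tau>. g \<tau> = 0}. {t. \<eta> \<le> \<bar>t - \<tau>\<bar>})"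
    have "closed (\<Inter>\<tau>\<in>{\<tau>. g \<tau> = 0}. {t. \<eta> \<le> \<bar>t - \<tau>\<bar>})"
      by (intro closed_INT ballI closed_Collect_le continuous_intros)
    then have Sc: "compact S" unfolding S_def by (intro compact_Int_closed) auto
    have red: "\<exists>t'\<in>S. g t' = g t" if "\<forall>\<tau>. g \<tau> = 0 \<longrightarrow> \<eta> \<le> \<bar>t - \<tau>\<bar>" for t
    proof -
      obtain k where k: "t - of_int k * (2 * pi) \<in> {0..2 * pi}" using reduce_mod_2pi by blast
      have "\<eta> \<le> \<bar>t - of_int k * (2 * pi) - \<tau>\<bar>" if "g \<tau> = 0" for \<tau>
      proof -
        have "g (\<tau> + of_int k * (2 * pi)) = 0" using that periodic_int(1)[of g, OF per] by simp
        then show ?thesis using \<open>\<forall>\<tau>. g \<tau> = 0 \<longrightarrow> \<eta> \<le> \<bar>t - \<tau>\<bar>\<close> by (fastforce simp: algebra_simps)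
      qed
      then show ?thesis using k periodic_int(2)[of g, OF per]
        by (intro bexI[of _ "t - of_int k * (2 * pi)"]) (auto simp: S_def)
    qed
    show "\<exists>c>0. \<forall>t. (\<forall>\<tau>. g \<tau> = 0 \<longrightarrow> \<eta> \<le> \<bar>t - \<tau>\<bar>) \<longrightarrow> c \<le> \<bar>g t\<bar>"
    proof (cases "S = {}")
      case True then show ?thesis using red by (intro exI[of _ 1]) auto
    next
      case False
      have "continuous_on S (\<lambda>t. \<bar>g t\<bar>)" by (intro continuous_intros cg)
      from continuous_attains_inf[OF Sc False this] obtain t1 where t1: "t1 \<in> S" "\<And>t. t \<in> S \<Longrightarrow> \<bar>g t1\<bar> \<le> \<bar>g t\<bar>" by blast
      have "g t1 \<noteq> 0"
      proof
        assume "g t1 = 0"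
        then have "\<eta> \<le> \<bar>t1 - t1\<bar>" using t1(1) unfolding S_def by blast
        then show False using eta by simp
      qed
      then show ?thesis using red t1(2) by (intro exI[of _ "\<bar>g t1\<bar>"]) (metis zero_less_abs_iff)
    qed
  qed
qed

text \<open>The only properties of \<open>g\<close> and \<open>v = F \<circ> g\<close> that matter: \<open>v\<close> grows at simple zeros of \<open>g\<close>
  between two powers, and on a neighbourhood of \<open>t\<close> of size comparable to \<open>|g t|\<close> it differs from its tangent by
  \<open>O(v t / (g t)\<^sup>2)\<close> times the square of the increment.\<close>

definition singular_factor :: "real \<Rightarrow> (real \<Rightarrow> real) \<Rightarrow> (real \<Rightarrow> real) \<Rightarrow> bool" where
  "singular_factor B g v \<longleftrightarrow> 1 \<le> B \<and>
     (\<forall>t. g (t + 2 * pi) = g t) \<and>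
     (\<forall>t. 1 / B \<le> v t \<or> g t = 0) \<and>
     (\<forall>s t. g s \<noteq> 0 \<and> \<bar>g s\<bar> \<le> \<bar>g t\<bar> \<longrightarrow>
        v s \<le> (\<bar>g t\<bar> / \<bar>g s\<bar>) powr B * v t \<and> (\<bar>g t\<bar> / \<bar>g s\<bar>) powr (1 / B) * v t \<le> v s) \<and>
     (\<forall>t. g t \<noteq> 0 \<longrightarrow> (\<exists>\<sigma>. \<bar>\<sigma>\<bar> \<le> B * v t / \<bar>g t\<bar> \<and>
        (\<forall>s. \<bar>s - t\<bar> \<le> \<bar>g t\<bar> / B \<longrightarrow> v s \<le> v t + \<sigma> * (s - t) + B * v t / (g t)\<^sup>2 * (s - t)\<^sup>2))) \<and>
     (\<forall>s t. \<bar>g s - g t\<bar> \<le> B * \<bar>s - t\<bar>) \<and>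
     (\<forall>\<tau> t. g \<tau> = 0 \<and> \<bar>t - \<tau>\<bar> \<le> 1 / B \<longrightarrow> \<bar>t - \<tau>\<bar> / B \<le> \<bar>g t\<bar>) \<and>
     (\<forall>\<eta>>0. \<exists>c>0. \<forall>t. (\<forall>\<tau>. g \<tau> = 0 \<longrightarrow> \<eta> \<le> \<bar>t - \<tau>\<bar>) \<longrightarrow> c \<le> \<bar>g t\<bar>) \<and>
     (\<forall>c>0. \<exists>hi. \<forall>t. c \<le> \<bar>g t\<bar> \<longrightarrow> v t \<le> hi) \<and>
     (\<forall>t. g t \<noteq> 0 \<longrightarrow> isCont v t) \<and> (\<exists>t. g t = 0)"

lemma singular_factorD:
  assumes "singular_factor B g v"
  shows "1 \<le> B"
    "g (t + 2 * pi) = g t"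
    "1 / B \<le> v t \<or> g t = 0"
    "g s \<noteq> 0 \<and> \<bar>g s\<bar> \<le> \<bar>g t\<bar> \<Longrightarrow> v s \<le> (\<bar>g t\<bar> / \<bar>g s\<bar>) powr B * v t \<and> (\<bar>g t\<bar> / \<bar>g s\<bar>) powr (1 / B) * v t \<le> v s"
    "g t \<noteq> 0 \<Longrightarrow> \<exists>\<sigma>. \<bar>\<sigma>\<bar> \<le> B * v t / \<bar>g t\<bar> \<and>
        (\<forall>s. \<bar>s - t\<bar> \<le> \<bar>g t\<bar> / B \<longrightarrow> v s \<le> v t + \<sigma> * (s - t) + B * v t / (g t)\<^sup>2 * (s - t)\<^sup>2)"
    "\<bar>g s - g t\<bar> \<le> B * \<bar>s - t\<bar>"
    "g \<tau> = 0 \<and> \<bar>t - \<tau>\<bar> \<le> 1 / B \<Longrightarrow> \<bar>t - \<tau>\<bar> / B \<le> \<bar>g t\<bar>"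
    "0 < \<eta> \<Longrightarrow> \<exists>c>0. \<forall>t. (\<forall>\<tau>. g \<tau> = 0 \<longrightarrow> \<eta> \<le> \<bar>t - \<tau>\<bar>) \<longrightarrow> c \<le> \<bar>g t\<bar>"
    "0 < c \<Longrightarrow> \<exists>hi. \<forall>t. c \<le> \<bar>g t\<bar> \<longrightarrow> v t \<le> hi"
    "g t \<noteq> 0 \<Longrightarrow> isCont v t"
    "\<exists>t. g t = 0"
proof -
  note S = assms[unfolded singular_factor_def]
  show "1 \<le> B"
    using conjunct1[OF S] by blast
  show "g (t + 2 * pi) = g t"
    using conjunct1[OF conjunct2[OF S]] by blast
  show "1 / B \<le> v t \<or> g t = 0"
    using conjunct1[OF conjunct2[OF conjunct2[OF S]]] by blast
  show "v s \<le> (\<bar>g t\<bar> / \<bar>g s\<bar>) powr B * v t \<and> (\<bar>g t\<bar> / \<bar>g s\<bar>) powr (1 / B) * v t \<le> v s" if "g s \<noteq> 0 \<and> \<bar>g s\<bar> \<le> \<bar>g t\<bar>"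
    using conjunct1[OF conjunct2[OF conjunct2[OF conjunct2[OF S]]]] that by blast
  show "\<exists>\<sigma>. \<bar>\<sigma>\<bar> \<le> B * v t / \<bar>g t\<bar> \<and>
        (\<forall>s. \<bar>s - t\<bar> \<le> \<bar>g t\<bar> / B \<longrightarrow> v s \<le> v t + \<sigma> * (s - t) + B * v t / (g t)\<^sup>2 * (s - t)\<^sup>2)" if "g t \<noteq> 0"
    using conjunct1[OF conjunct2[OF conjunct2[OF conjunct2[OF conjunct2[OF S]]]]] that by blast
  show "\<bar>g s - g t\<bar> \<le> B * \<bar>s - t\<bar>"
    using conjunct1[OF conjunct2[OF conjunct2[OF conjunct2[OF conjunct2[OF conjunct2[OF S]]]]]] by blast
  show "\<bar>t - \<tau>\<bar> / B \<le> \<bar>g t\<bar>" if "g \<tau> = 0 \<and> \<bar>t - \<tau>\<bar> \<le> 1 / B"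
    using conjunct1[OF conjunct2[OF conjunct2[OF conjunct2[OF conjunct2[OF conjunct2[OF conjunct2[OF S]]]]]]] that by blast
  show "\<exists>c>0. \<forall>t. (\<forall>\<tau>. g \<tau> = 0 \<longrightarrow> \<eta> \<le> \<bar>t - \<tau>\<bar>) \<longrightarrow> c \<le> \<bar>g t\<bar>" if "0 < \<eta>"
    using conjunct1[OF conjunct2[OF conjunct2[OF conjunct2[OF conjunct2[OF conjunct2[OF conjunct2[OF conjunct2[OF S]]]]]]]] that by blast
  show "\<exists>hi. \<forall>t. c \<le> \<bar>g t\<bar> \<longrightarrow> v t \<le> hi" if "0 < c"
    using conjunct1[OF conjunct2[OF conjunct2[OF conjunct2[OF conjunct2[OF conjunct2[OF conjunct2[OF conjunct2[OF conjunct2[OF S]]]]]]]]] that by blast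
  show "isCont v t" if "g t \<noteq> 0"
    using conjunct1[OF conjunct2[OF conjunct2[OF conjunct2[OF conjunct2[OF conjunct2[OF conjunct2[OF conjunct2[OF conjunct2[OF conjunct2[OF S]]]]]]]]]] that by blast
  show "\<exists>t. g t = 0"
    using conjunct2[OF conjunct2[OF conjunct2[OF conjunct2[OF conjunct2[OF conjunct2[OF conjunct2[OF conjunct2[OF conjunct2[OF conjunct2[OF S]]]]]]]]]] by blast
qed

text \<open>Finitely many factors can thus share one constant.\<close>

lemma singular_factor_mono:
  assumes "singular_factor B g v" "B \<le> B'"
  shows "singular_factor B' g v"
proof -
  note S = singular_factorD[OF assms(1)]
  have B: "1 \<le> B" "1 \<le> B'" "1 / B' \<le> 1 / B" using S(1) assms(2) by (auto intro!: frac_le)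
  have v0: "0 \<le> v t" if "g t \<noteq> 0" for t
  proof -
    have "1 / B \<le> v t" using S(3) that by blast
    moreover have "0 \<le> 1 / B" using B by simp
    ultimately show ?thesis by linarith
  qed
  have "1 / B' \<le> v t \<or> g t = 0" for t using S(3)[of t] B(3) by linarith
  moreover have "v s \<le> (\<bar>g t\<bar> / \<bar>g s\<bar>) powr B' * v t \<and> (\<bar>g t\<bar> / \<bar>g s\<bar>) powr (1 / B') * v t \<le> v s"
    if "g s \<noteq> 0" "\<bar>g s\<bar> \<le> \<bar>g t\<bar>" for s t
  proof -
    have gt: "g t \<noteq> 0" using that by auto
    have x: "1 \<le> \<bar>g t\<bar> / \<bar>g s\<bar>" using that by simp
    have "v s \<le> (\<bar>g t\<bar> / \<bar>g s\<bar>) powr B * v t" using S(4) that by blast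
    also have "\<dots> \<le> (\<bar>g t\<bar> / \<bar>g s\<bar>) powr B' * v t"
      using x assms(2) v0[OF gt] by (intro mult_right_mono powr_mono) auto
    finally have 1: "v s \<le> (\<bar>g t\<bar> / \<bar>g s\<bar>) powr B' * v t" .
    have "(\<bar>g t\<bar> / \<bar>g s\<bar>) powr (1 / B') * v t \<le> (\<bar>g t\<bar> / \<bar>g s\<bar>) powr (1 / B) * v t"
      using x B v0[OF gt] by (intro mult_right_mono powr_mono) auto
    also have "\<dots> \<le> v s" using S(4) that by blast
    finally show ?thesis using 1 by blast
  qed
  moreover have "\<exists>\<sigma>. \<bar>\<sigma>\<bar> \<le> B' * v t / \<bar>g t\<bar> \<and>
        (\<forall>s. \<bar>s - t\<bar> \<le> \<bar>g t\<bar> / B' \<longrightarrow> v s \<le> v t + \<sigma> * (s - t) + B' * v t / (g t)\<^sup>2 * (s - t)\<^sup>2)" if gt: "g t \<noteq> 0" for t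
  proof -
    obtain \<sigma> where s: "\<bar>\<sigma>\<bar> \<le> B * v t / \<bar>g t\<bar>"
      "\<And>s. \<bar>s - t\<bar> \<le> \<bar>g t\<bar> / B \<Longrightarrow> v s \<le> v t + \<sigma> * (s - t) + B * v t / (g t)\<^sup>2 * (s - t)\<^sup>2"
      using S(5)[OF gt] by blast
    have "B * v t / \<bar>g t\<bar> \<le> B' * v t / \<bar>g t\<bar>" using assms(2) v0[OF gt] by (intro divide_right_mono mult_right_mono) auto
    with s(1) have 1: "\<bar>\<sigma>\<bar> \<le> B' * v t / \<bar>g t\<bar>" by linarith
    have "v s \<le> v t + \<sigma> * (s - t) + B' * v t / (g t)\<^sup>2 * (s - t)\<^sup>2" if "\<bar>s - t\<bar> \<le> \<bar>g t\<bar> / B'" for s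
    proof -
      have "\<bar>g t\<bar> / B' \<le> \<bar>g t\<bar> / B" using B assms(2) by (intro divide_left_mono) auto
      then have "v s \<le> v t + \<sigma> * (s - t) + B * v t / (g t)\<^sup>2 * (s - t)\<^sup>2" using s(2)[of s] that by linarith
      also have "\<dots> \<le> v t + \<sigma> * (s - t) + B' * v t / (g t)\<^sup>2 * (s - t)\<^sup>2"
        using assms(2) v0[OF \<open>g t \<noteq> 0\<close>] by (intro add_left_mono mult_right_mono divide_right_mono) auto
      finally show ?thesis .
    qed
    with 1 show ?thesis by blast
  qed
  moreover have "\<bar>g s - g t\<bar> \<le> B' * \<bar>s - t\<bar>" for s t
    using S(6)[of s t] mult_right_mono[OF assms(2), of "\<bar>s - t\<bar>"] by linarith
  moreover have "\<bar>t - \<tau>\<bar> / B' \<le> \<bar>g t\<bar>" if "g \<tau> = 0" "\<bar>t - \<tau>\<bar> \<le> 1 / B'" for t \<tau>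
  proof -
    have "\<bar>t - \<tau>\<bar> / B' \<le> \<bar>t - \<tau>\<bar> / B" using B assms(2) by (intro divide_left_mono) auto
    moreover have "\<bar>t - \<tau>\<bar> \<le> 1 / B" using that B by linarith
    then have "\<bar>t - \<tau>\<bar> / B \<le> \<bar>g t\<bar>" using S(7) that by blast
    ultimately show ?thesis by linarith
  qed
  ultimately show ?thesis unfolding singular_factor_def using S(2,8-11) B(2) by (intro conjI allI impI; blast)
qed

text \<open>Up to distance \<open>|g t| / (2 * D)\<close> from \<open>t\<close> the function
  \<open>g\<close> keeps its sign and at least half its size, so \<open>v\<close> is twice
  differentiable there; the chain rule turns (F3) for \<open>n = 1, 2\<close> into
  \<open>v'' = O(v t / (g t)^2)\<close>, and a second order expansion gives the parabola.\<close>

lemma Omega_factor: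
  assumes "0 < A" "Omega_inner A g" "Omega_outer A F"
  shows "\<exists>B. singular_factor B g (\<lambda>t. F (g t))"
proof -
  obtain D where D: "1 \<le> D" and d1: "\<And>t. (g has_real_derivative deriv g t) (at t)"
    and d2: "\<And>t. (deriv g has_real_derivative deriv (deriv g) t) (at t)"
    and db: "\<And>t. \<bar>deriv g t\<bar> \<le> D" "\<And>t. \<bar>deriv (deriv g) t\<bar> \<le> D"
    and lip: "\<And>s t. \<bar>g s - g t\<bar> \<le> D * \<bar>s - t\<bar>"
    and z1: "\<And>\<tau> t. g \<tau> = 0 \<Longrightarrow> \<bar>t - \<tau>\<bar> \<le> 1 / D \<Longrightarrow> \<bar>t - \<tau>\<bar> / D \<le> \<bar>g t\<bar>"
    and z2: "\<And>\<eta>. 0 < \<eta> \<Longrightarrow> \<exists>c>0. \<forall>t. (\<forall>\<tau>. g \<tau> = 0 \<longrightarrow> \<eta> \<le> \<bar>t - \<tau>\<bar>) \<longrightarrow> c \<le> \<bar>g t\<bar>"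
    using inner_facts[OF assms(2)] by blast
  obtain B where B: "1 \<le> B"
    and gr1: "\<And>x y. 0 < y \<Longrightarrow> y \<le> x \<Longrightarrow> x \<le> A \<Longrightarrow> F y \<le> (x / y) powr B * F x"
    and gr2: "\<And>x y. 0 < y \<Longrightarrow> y \<le> x \<Longrightarrow> x \<le> A \<Longrightarrow> (x / y) powr (1 / B) * F x \<le> F y"
    and fb1: "\<And>x. x \<in> {0<..A} \<Longrightarrow> \<bar>nth_deriv_within {0<..A} 1 F x\<bar> \<le> B * F x / x"
    and fb2: "\<And>x. x \<in> {0<..A} \<Longrightarrow> \<bar>nth_deriv_within {0<..A} 2 F x\<bar> \<le> B * F x / x\<^sup>2"
    using outer_growth[OF assms(3,1)] by blast
  define F1 where "F1 = nth_deriv_within {0<..A} 1 F"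
  define F2 where "F2 = nth_deriv_within {0<..A} 2 F"
  have pos: "0 < F x" if "x \<in> {0<..A}" for x using assms(3) that unfolding Omega_outer_def by auto
  have anti: "F y \<le> F x" if "0 < x" "x \<le> y" "y \<le> A" for x y
    using assms(3) that unfolding Omega_outer_def monotone_on_def by auto
  have gA: "\<bar>g t\<bar> \<le> A" for t
  proof -
    have "g t \<in> {-A..A}" using assms(2) unfolding Omega_inner_def by blast
    then show ?thesis by auto
  qed
  have Fabs: "F (g t) = F \<bar>g t\<bar>" if "g t \<noteq> 0" for t
  proof (cases "0 \<le> g t")
    case False
    have "F (- g t) = F (g t)" using assms(3) gA[of t] that unfolding Omega_outer_def by (auto simp: abs_le_iff)
    then show ?thesis using False by simp
  qed simp
  have in': "\<bar>g t\<bar> \<in> {0<..A}" if "g t \<noteq> 0" for t using that gA by auto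
  define v where "v t = F (g t)" for t
  have vpos: "0 < v t" if "g t \<noteq> 0" for t unfolding v_def Fabs[OF that] by (rule pos[OF in'[OF that]])
  \<comment> \<open>Collects \<open>F'' * g'^2 + F' * g''\<close>, where
    \<open>1 / x \<le> A / x^2\<close> puts both terms on the same footing; \<open>2 powr B\<close>
    and 4 come from comparing \<open>F x\<close> and \<open>1 / x^2\<close> at
    \<open>x \<ge> |g t| / 2\<close> with their values at \<open>|g t|\<close>.\<close>
  define E where "E = (B * D\<^sup>2 + B * A * D) * (2 powr B * 4)"
  have E0: "0 \<le> E" unfolding E_def using B D assms(1) by simp
  have tay: "\<exists>\<sigma>. \<bar>\<sigma>\<bar> \<le> B * D * v t / \<bar>g t\<bar> \<and>
      (\<forall>s. \<bar>s - t\<bar> \<le> \<bar>g t\<bar> / (2 * D) \<longrightarrow> isCont v s \<and> v s \<le> v t + \<sigma> * (s - t) + E * v t / (g t)\<^sup>2 * (s - t)\<^sup>2)"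
    if gt: "g t \<noteq> 0" for t
  proof -
    define e where "e = sgn (g t)"
    have e: "e * e = 1" "\<bar>e\<bar> = 1" "e * g t = \<bar>g t\<bar>" using gt unfolding e_def by (auto simp: sgn_if)
    define r where "r = \<bar>g t\<bar> / (2 * D)"
    have r: "0 < r" using gt D unfolding r_def by simp
    define f1 where "f1 s = F1 (e * g s) * (e * deriv g s)" for s
    define f2 where "f2 s = F2 (e * g s) * (e * deriv g s) * (e * deriv g s) + F1 (e * g s) * (e * deriv (deriv g) s)" for s
    have loc: "\<bar>g t\<bar> / 2 \<le> e * g s" "e * g s = \<bar>g s\<bar>" if s: "\<bar>s - t\<bar> \<le> r" for s
    proof -
      have "\<bar>e * g s - e * g t\<bar> = \<bar>g s - g t\<bar>" using e(2) by (simp add: right_diff_distrib[symmetric] abs_mult)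
      also have "\<dots> \<le> D * r" using lip[of s t] s D mult_left_mono[OF s, of D] by linarith
      also have "\<dots> = \<bar>g t\<bar> / 2" using D unfolding r_def by simp
      finally show 1: "\<bar>g t\<bar> / 2 \<le> e * g s" using e(3) by linarith
      have "0 \<le> e * g s" using 1 by (rule order.trans[rotated]) simp
      then have "e * g s = \<bar>e * g s\<bar>" by simp
      then show "e * g s = \<bar>g s\<bar>" using e(2) by (simp add: abs_mult)
    qed
    have nz: "g s \<noteq> 0" if s: "\<bar>s - t\<bar> \<le> r" for s using loc[OF s] gt by auto
    have near: "\<forall>\<^sub>F x in at s. g x \<noteq> 0 \<and> e * g x = \<bar>g x\<bar> \<and> e * g x \<in> {0<..A}" if s: "\<bar>s - t\<bar> \<le> r" for s
    proof -
      have "isCont (\<lambda>x. e * g x) s" by (intro continuous_intros DERIV_isCont[OF d1])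
      then have "\<forall>\<^sub>F x in at s. 0 < e * g x"
        using loc(1)[OF s] gt by (intro order_tendstoD(1)[of _ "e * g s"]) (auto simp: isCont_def)
      then show ?thesis
      proof (rule eventually_mono)
        fix x assume x: "0 < e * g x"
        then have "e * g x = \<bar>e * g x\<bar>" by simp
        then have "e * g x = \<bar>g x\<bar>" using e(2) by (simp add: abs_mult)
        then show "g x \<noteq> 0 \<and> e * g x = \<bar>g x\<bar> \<and> e * g x \<in> {0<..A}" using x gA[of x] by auto
      qed
    qed
    \<comment> \<open>\<open>F\<close> has only a one-sided derivative at \<open>A\<close>, and
      \<open>|g|\<close> may reach \<open>A\<close>; the composition is still differentiable from
      both sides, because \<open>e * g\<close> maps a whole neighbourhood of \<open>s\<close> into
      \<open>{0<..A}\<close>.\<close>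
    have chain: "((\<lambda>x. G (e * g x)) has_real_derivative G' * (e * deriv g s)) (at s)"
      if G: "(G has_real_derivative G') (at (e * g s) within {0<..A})" and s: "\<bar>s - t\<bar> \<le> r" for G G' s
    proof -
      obtain U where U: "open U" "s \<in> U" "\<And>x. x \<in> U \<Longrightarrow> x \<noteq> s \<Longrightarrow> e * g x \<in> {0<..A}"
        using near[OF s] unfolding eventually_at_topological by blast
      have U': "e * g x \<in> {0<..A}" if "x \<in> U" for x
        using U(3)[OF that] loc[OF s] nz[OF s] gA[of s] by (cases "x = s") auto
      have "((\<lambda>x. e * g x) has_real_derivative e * deriv g s) (at s within U)"
        by (intro has_field_derivative_at_within[OF DERIV_cmult[OF d1]])
      moreover have "(G has_real_derivative G') (at (e * g s) within (\<lambda>x. e * g x) ` U)"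
        by (rule DERIV_subset[OF G]) (use U' in auto)
      ultimately have "(G \<circ> (\<lambda>x. e * g x) has_real_derivative G' * (e * deriv g s)) (at s within U)"
        by (intro DERIV_image_chain)
      then show ?thesis using at_within_open[OF U(2,1)] by (simp add: o_def)
    qed
    have ein: "e * g s \<in> {0<..A}" if s: "\<bar>s - t\<bar> \<le> r" for s using loc[OF s] nz[OF s] gA[of s] by auto
    have der1: "((\<lambda>x. F (e * g x)) has_real_derivative f1 s) (at s)" if s: "\<bar>s - t\<bar> \<le> r" for s
      unfolding f1_def F1_def by (rule chain[OF outer_derivatives(1)[OF assms(3) ein[OF s]] s])
    have der2: "(f1 has_real_derivative f2 s) (at s)" if s: "\<bar>s - t\<bar> \<le> r" for s
    proof -
      have "((\<lambda>x. F1 (e * g x)) has_real_derivative F2 (e * g s) * (e * deriv g s)) (at s)"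
        unfolding F1_def F2_def by (rule chain[OF outer_derivatives(2)[OF assms(3) ein[OF s]] s])
      from DERIV_mult[OF this DERIV_cmult[OF d2[of s], of e]]
      show ?thesis unfolding f1_def[abs_def] f2_def by (simp add: mult_ac add.commute)
    qed
    have vF: "v s = F (e * g s)" if s: "\<bar>s - t\<bar> \<le> r" for s
      unfolding v_def Fabs[OF nz[OF s]] loc(2)[OF s] ..
    have dv: "(v has_real_derivative f1 s) (at s)" if s: "\<bar>s - t\<bar> \<le> r" for s
    proof -
      have "\<forall>\<^sub>F x in at s. F (e * g x) = v x"
        using near[OF s] by (rule eventually_mono) (auto simp: v_def Fabs)
      moreover have "\<forall>\<^sub>F x in nhds s. F (e * g x) = v x"
        using calculation vF[OF s] by (auto simp: eventually_nhds_conv_at)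
      ultimately show ?thesis using der1[OF s] DERIV_cong_ev[of s s "\<lambda>x. F (e * g x)" v "f1 s" "f1 s"] by simp
    qed
    have vs: "F (e * g s) \<le> 2 powr B * v t" if s: "\<bar>s - t\<bar> \<le> r" for s
    proof (cases "\<bar>g s\<bar> \<le> \<bar>g t\<bar>")
      case True
      have "F \<bar>g s\<bar> \<le> (\<bar>g t\<bar> / \<bar>g s\<bar>) powr B * F \<bar>g t\<bar>" using True nz[OF s] gA by (intro gr1) auto
      also have "\<dots> \<le> 2 powr B * F \<bar>g t\<bar>"
        using loc[OF s] nz[OF s] B pos[OF in'[OF gt]] gt
        by (intro mult_right_mono powr_mono2) (auto simp: divide_le_eq)
      finally show ?thesis using loc(2)[OF s] Fabs[OF gt] unfolding v_def by simp
    next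
      case False
      then have "F \<bar>g s\<bar> \<le> 1 * F \<bar>g t\<bar>" using anti[of "\<bar>g t\<bar>" "\<bar>g s\<bar>"] gt gA by auto
      also have "\<dots> \<le> 2 powr B * F \<bar>g t\<bar>" using pos[OF in'[OF gt]] B by (intro mult_right_mono ge_one_powr_ge_zero) auto
      finally show ?thesis using loc(2)[OF s] Fabs[OF gt] unfolding v_def by simp
    qed
    define H where "H = E * v t / (g t)\<^sup>2"
    have H0: "0 \<le> H" unfolding H_def using E0 vpos[OF gt] by simp
    have f2b: "\<bar>f2 s\<bar> \<le> H" if s: "\<bar>s - t\<bar> \<le> r" for s
    proof -
      define x where "x = e * g s"
      have x: "\<bar>g t\<bar> / 2 \<le> x" "0 < x" "x \<in> {0<..A}" unfolding x_def using loc(1)[OF s] ein[OF s] by auto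
      have Fx: "0 < F x" "F x \<le> 2 powr B * v t" using pos[OF x(3)] vs[OF s] unfolding x_def by auto
      have gs: "(\<bar>g t\<bar>)\<^sup>2 \<le> (2 * x)\<^sup>2" using x by (intro power_mono) auto
      have g3: "1 / x\<^sup>2 \<le> 4 / (g t)\<^sup>2" using gs x gt by (simp add: field_simps power_mult_distrib)
      have ed: "\<bar>e * deriv g s\<bar> \<le> D" "\<bar>e * deriv (deriv g) s\<bar> \<le> D" using db[of s] e(2) by (simp_all add: abs_mult)
      have "\<bar>F2 x * (e * deriv g s) * (e * deriv g s)\<bar> \<le> (B * F x / x\<^sup>2) * D * D"
        unfolding abs_mult[of "F2 x * (e * deriv g s)"] abs_mult[of "F2 x"]
        using fb2[OF x(3)] ed D B Fx(1) unfolding F2_def by (intro mult_mono) auto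
      moreover have "\<bar>F1 x * (e * deriv (deriv g) s)\<bar> \<le> (B * F x / x) * D"
        unfolding abs_mult[of "F1 x"]
        using fb1[OF x(3)] ed D Fx B x unfolding F1_def by (intro mult_mono) auto
      moreover have "(B * F x / x) * D \<le> B * A * D * (F x / x\<^sup>2)"
      proof -
        have "1 / x = x * (1 / x\<^sup>2)" using x by (simp add: power2_eq_square)
        also have "\<dots> \<le> A * (1 / x\<^sup>2)" using x by (intro mult_right_mono) auto
        finally have "B * D * F x * (1 / x) \<le> B * D * F x * (A * (1 / x\<^sup>2))"
          using B D Fx by (intro mult_left_mono) auto
        then show ?thesis by (simp add: mult_ac)
      qed
      ultimately have "\<bar>f2 s\<bar> \<le> (B * F x / x\<^sup>2) * D * D + B * A * D * (F x / x\<^sup>2)"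
        unfolding f2_def x_def[symmetric] by linarith
      also have "\<dots> = (B * D\<^sup>2 + B * A * D) * (F x * (1 / x\<^sup>2))"
        using x(2) by (simp add: field_simps power2_eq_square)
      also have "\<dots> \<le> (B * D\<^sup>2 + B * A * D) * ((2 powr B * v t) * (4 / (g t)\<^sup>2))"
        using Fx g3 B D assms(1) vpos[OF gt] by (intro mult_left_mono mult_mono) auto
      also have "\<dots> = H" unfolding H_def E_def by simp
      finally show ?thesis .
    qed
    have Fb: "\<bar>f1 t\<bar> \<le> B * D * v t / \<bar>g t\<bar>"
    proof -
      have t0: "\<bar>t - t\<bar> \<le> r" using r by simp
      define x where "x = e * g t"
      have x: "x = \<bar>g t\<bar>" "x \<in> {0<..A}" unfolding x_def using e(3) ein[OF t0] by auto
      have Fx: "F x = v t" using vF[OF t0] unfolding x_def by simp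
      have "\<bar>F1 x * (e * deriv g t)\<bar> \<le> (B * F x / x) * D"
        unfolding abs_mult[of "F1 x"]
        using fb1[OF x(2)] db(1)[of t] e(2) D pos[OF x(2)] B x(2) unfolding F1_def by (intro mult_mono) (auto simp: abs_mult)
      then show ?thesis unfolding f1_def x_def[symmetric] Fx unfolding x(1) by (simp add: mult_ac)
    qed
    have T: "v s \<le> v t + f1 t * (s - t) + H * (s - t)\<^sup>2" if s: "\<bar>s - t\<bar> \<le> r" for s
    proof -
      have seg: "\<bar>x - t\<bar> \<le> \<bar>s - t\<bar>" "\<bar>x - t\<bar> \<le> r" if "x \<in> closed_segment t s" for x
        using that s by (auto simp: closed_segment_eq_real_ivl split: if_splits)
      define h where "h = (\<lambda>x. v x - f1 t * x)"
      have h': "(h has_real_derivative (f1 x - f1 t)) (at x within closed_segment t s)" if "x \<in> closed_segment t s" for x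
      proof -
        have "((\<lambda>x. v x - f1 t * x) has_real_derivative (f1 x - f1 t * 1)) (at x)"
          by (intro DERIV_diff DERIV_cmult DERIV_ident dv seg(2)[OF that])
        then show ?thesis unfolding h_def using has_field_derivative_at_within by fastforce
      qed
      have hb: "norm (f1 x - f1 t) \<le> H * \<bar>s - t\<bar>" if x: "x \<in> closed_segment t s" for x
      proof -
        have "norm (f1 x - f1 t) \<le> H * norm (x - t)"
        proof (rule field_differentiable_bound[of "closed_segment t s" f1 f2])
          fix z assume z: "z \<in> closed_segment t s"
          show "(f1 has_real_derivative f2 z) (at z within closed_segment t s)"
            by (rule has_field_derivative_at_within[OF der2[OF seg(2)[OF z]]])
          show "norm (f2 z) \<le> H" using f2b[OF seg(2)[OF z]] by simp
        qed (use x in auto)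
        also have "\<dots> \<le> H * \<bar>s - t\<bar>" using seg(1)[OF x] H0 by (intro mult_left_mono) auto
        finally show ?thesis .
      qed
      have "norm (h s - h t) \<le> H * \<bar>s - t\<bar> * norm (s - t)"
        by (rule field_differentiable_bound[OF _ h' hb]) auto
      then have "h s - h t \<le> H * (s - t)\<^sup>2" by (simp add: power2_eq_square abs_le_iff mult.assoc abs_mult_self_eq)
      then show ?thesis unfolding h_def by (simp add: algebra_simps)
    qed
    show ?thesis
      using Fb T DERIV_isCont[OF dv] unfolding H_def r_def by blast
  qed
  define B' where "B' = max (max B (2 * D)) (max (max (B * D) E) (1 / F A))"
  have FA: "0 < F A" using pos assms(1) by auto
  have B': "B \<le> B'" "2 * D \<le> B'" "B * D \<le> B'" "E \<le> B'" "1 / F A \<le> B'" unfolding B'_def by auto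
  have B'1: "1 \<le> B'" "D \<le> B'" using B B' D by linarith+
  have lo: "F A \<le> v t" if "g t \<noteq> 0" for t
    unfolding v_def Fabs[OF that] using that gA by (intro anti) auto
  have "1 / B' \<le> v t \<or> g t = 0" for t
  proof -
    have "1 / B' \<le> F A" using B'(5) FA B'1 by (simp add: field_simps)
    then show ?thesis using lo[of t] by fastforce
  qed
  moreover have "v s \<le> (\<bar>g t\<bar> / \<bar>g s\<bar>) powr B' * v t \<and> (\<bar>g t\<bar> / \<bar>g s\<bar>) powr (1 / B') * v t \<le> v s"
    if "g s \<noteq> 0" "\<bar>g s\<bar> \<le> \<bar>g t\<bar>" for s t
  proof -
    have gt: "g t \<noteq> 0" using that by auto
    have x: "1 \<le> \<bar>g t\<bar> / \<bar>g s\<bar>" using that by simp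
    have vv: "v s = F \<bar>g s\<bar>" "v t = F \<bar>g t\<bar>" unfolding v_def using Fabs that gt by auto
    have "v s \<le> (\<bar>g t\<bar> / \<bar>g s\<bar>) powr B * v t" unfolding vv using that gA by (intro gr1) auto
    also have "\<dots> \<le> (\<bar>g t\<bar> / \<bar>g s\<bar>) powr B' * v t"
      using x B' vpos[OF gt] by (intro mult_right_mono powr_mono) auto
    finally have 1: "v s \<le> (\<bar>g t\<bar> / \<bar>g s\<bar>) powr B' * v t" .
    have "1 / B' \<le> 1 / B" using B B' by (intro divide_left_mono) auto
    then have "(\<bar>g t\<bar> / \<bar>g s\<bar>) powr (1 / B') * v t \<le> (\<bar>g t\<bar> / \<bar>g s\<bar>) powr (1 / B) * v t"
      using x vpos[OF gt] by (intro mult_right_mono powr_mono) auto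
    also have "\<dots> \<le> v s" unfolding vv using that gA by (intro gr2) auto
    finally show ?thesis using 1 by blast
  qed
  moreover have "\<exists>\<sigma>. \<bar>\<sigma>\<bar> \<le> B' * v t / \<bar>g t\<bar> \<and>
        (\<forall>s. \<bar>s - t\<bar> \<le> \<bar>g t\<bar> / B' \<longrightarrow> v s \<le> v t + \<sigma> * (s - t) + B' * v t / (g t)\<^sup>2 * (s - t)\<^sup>2)" if gt: "g t \<noteq> 0" for t
  proof -
    obtain \<sigma> where s: "\<bar>\<sigma>\<bar> \<le> B * D * v t / \<bar>g t\<bar>"
      "\<And>s. \<bar>s - t\<bar> \<le> \<bar>g t\<bar> / (2 * D) \<Longrightarrow> v s \<le> v t + \<sigma> * (s - t) + E * v t / (g t)\<^sup>2 * (s - t)\<^sup>2"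
      using tay[OF gt] by blast
    have "B * D * v t / \<bar>g t\<bar> \<le> B' * v t / \<bar>g t\<bar>" using B' vpos[OF gt] by (intro divide_right_mono mult_right_mono) auto
    with s(1) have 1: "\<bar>\<sigma>\<bar> \<le> B' * v t / \<bar>g t\<bar>" by linarith
    have "v s \<le> v t + \<sigma> * (s - t) + B' * v t / (g t)\<^sup>2 * (s - t)\<^sup>2" if "\<bar>s - t\<bar> \<le> \<bar>g t\<bar> / B'" for s
    proof -
      have "\<bar>g t\<bar> / B' \<le> \<bar>g t\<bar> / (2 * D)" using D B' by (intro divide_left_mono) auto
      then have "v s \<le> v t + \<sigma> * (s - t) + E * v t / (g t)\<^sup>2 * (s - t)\<^sup>2" using s(2)[of s] that by linarith
      also have "\<dots> \<le> v t + \<sigma> * (s - t) + B' * v t / (g t)\<^sup>2 * (s - t)\<^sup>2"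
        using B' vpos[OF gt] by (intro add_left_mono mult_right_mono divide_right_mono) auto
      finally show ?thesis .
    qed
    with 1 show ?thesis by blast
  qed
  moreover have "\<bar>g s - g t\<bar> \<le> B' * \<bar>s - t\<bar>" for s t
    using lip[of s t] mult_right_mono[OF B'1(2), of "\<bar>s - t\<bar>"] by linarith
  moreover have "\<bar>t - \<tau>\<bar> / B' \<le> \<bar>g t\<bar>" if "g \<tau> = 0" "\<bar>t - \<tau>\<bar> \<le> 1 / B'" for t \<tau>
  proof -
    have "\<bar>t - \<tau>\<bar> / B' \<le> \<bar>t - \<tau>\<bar> / D" "1 / B' \<le> 1 / D" using D B'1 by (auto intro!: divide_left_mono)
    then show ?thesis using z1[OF that(1), of t] that(2) by linarith
  qed
  moreover have "\<exists>hi. \<forall>t. c \<le> \<bar>g t\<bar> \<longrightarrow> v t \<le> hi" if c: "0 < c" for c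
  proof (intro exI allI impI)
    fix t assume t: "c \<le> \<bar>g t\<bar>"
    then have gt: "g t \<noteq> 0" using c by auto
    show "v t \<le> F (min c A)" unfolding v_def Fabs[OF gt] using t c assms(1) gA by (intro anti) auto
  qed
  moreover have "isCont v t" if gt: "g t \<noteq> 0" for t
    using tay[OF gt] D by auto
  moreover have "g (t + 2 * pi) = g t" for t using assms(2) unfolding Omega_inner_def by blast
  moreover have "\<exists>t. g t = 0" using assms(2) unfolding Omega_inner_def by blast
  ultimately have "singular_factor B' g v" unfolding singular_factor_def using B'1(1) z2
    by (intro conjI allI impI; blast)
  then show ?thesis unfolding v_def[abs_def] by blast
qed

section \<open>The potential of a product\<close>

text \<open>What the sequel needs of the sum of all \<open>F \<circ> g\<close>, with the zeros of
  all factors merged into one set \<open>Z\<close> and sizes measured by the distance to a zero. At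
  points of \<open>Z\<close> the values of \<open>V\<close> are meaningless, hence the guards. The
  condition \<open>2 / \<kappa> \<le> \<Gamma>\<close> keeps the interval of radius
  \<open>1 / \<Gamma>\<close> about a point at distance at least \<kappa> from \<open>Z\<close> free
  of zeros.\<close>

definition landscape :: "real \<Rightarrow> real \<Rightarrow> real set \<Rightarrow> (real \<Rightarrow> real) \<Rightarrow> bool" where
  "landscape \<Gamma> \<kappa> Z V \<longleftrightarrow> 1 \<le> \<Gamma> \<and> 0 < \<kappa> \<and> \<kappa> \<le> 1 \<and> 2 / \<kappa> \<le> \<Gamma> \<and>
     (\<forall>t. (t + 2 * pi \<in> Z \<longleftrightarrow> t \<in> Z) \<and> (- t \<in> Z \<longleftrightarrow> t \<in> Z)) \<and>
     (\<forall>t. t \<notin> Z \<longrightarrow> V (t + 2 * pi) = V t \<and> V (- t) = V t \<and> 1 / \<Gamma> \<le> V t \<and> isCont V t) \<and>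
     (\<forall>\<tau>\<in>Z. \<forall>\<tau>'\<in>Z. \<tau> \<noteq> \<tau>' \<longrightarrow> 4 * \<kappa> \<le> \<bar>\<tau> - \<tau>'\<bar>) \<and>
     (\<forall>t. (\<forall>\<tau>\<in>Z. \<kappa> \<le> \<bar>t - \<tau>\<bar>) \<longrightarrow> V t \<le> \<Gamma> \<and> (\<exists>\<sigma>. \<bar>\<sigma>\<bar> \<le> \<Gamma> \<and>
        (\<forall>s. \<bar>s - t\<bar> \<le> 1 / \<Gamma> \<longrightarrow> V s \<le> V t + \<sigma> * (s - t) + \<Gamma> * (s - t)\<^sup>2))) \<and>
     (\<forall>\<tau>\<in>Z. \<forall>s t. 0 < \<bar>s - \<tau>\<bar> \<and> \<bar>s - \<tau>\<bar> \<le> \<bar>t - \<tau>\<bar> \<and> \<bar>t - \<tau>\<bar> \<le> \<kappa> \<longrightarrow>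
        V s \<le> \<Gamma> * (\<bar>t - \<tau>\<bar> / \<bar>s - \<tau>\<bar>) powr \<Gamma> * V t \<and> (\<bar>t - \<tau>\<bar> / \<bar>s - \<tau>\<bar>) powr (1 / \<Gamma>) * V t \<le> \<Gamma> * V s) \<and>
     (\<forall>\<tau>\<in>Z. \<forall>t. 0 < \<bar>t - \<tau>\<bar> \<and> \<bar>t - \<tau>\<bar> \<le> \<kappa> \<longrightarrow> (\<exists>\<sigma>. \<bar>\<sigma>\<bar> \<le> \<Gamma> * V t / \<bar>t - \<tau>\<bar> \<and>
        (\<forall>s. \<bar>s - t\<bar> \<le> \<bar>t - \<tau>\<bar> / \<Gamma> \<longrightarrow> V s \<le> V t + \<sigma> * (s - t) + \<Gamma> * V t / \<bar>t - \<tau>\<bar>\<^sup>2 * (s - t)\<^sup>2)))"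

text \<open>Near a zero the size of \<open>g\<close> is that of the distance to the zero, so the growth of \<open>v\<close> in terms of
  \<open>|g|\<close> turns into growth in terms of the distance.\<close>

lemma singular_factor_comparison:
  assumes S: "singular_factor B g v" and x: "0 < x" and y: "0 < y" and yx: "y \<le> x"
    and gs: "y / B \<le> \<bar>g s\<bar>" "\<bar>g s\<bar> \<le> B * y" and gt: "x / B \<le> \<bar>g t\<bar>" "\<bar>g t\<bar> \<le> B * x"
  shows "v s \<le> B powr (2 * B + 2 / B) * (x / y) powr B * v t"
    "(x / y) powr (1 / B) * v t \<le> B powr (2 * B + 2 / B) * v s"
proof -
  note D = singular_factorD[OF S]
  have B: "1 \<le> B" by (rule D(1))
  have g0: "0 < \<bar>g s\<bar>" "0 < \<bar>g t\<bar>" 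
    using less_le_trans[OF divide_pos_pos gs(1)] less_le_trans[OF divide_pos_pos gt(1)] x y B by linarith+
  then have v0: "0 < v s" "0 < v t" using D(3)[of s] D(3)[of t] B by (auto intro: less_le_trans[of 0 "1/B"])
  define X where "X = x / y"
  have X: "1 \<le> X" using x y yx unfolding X_def by simp
  have e: "1 \<le> B powr (2 * B)" "1 \<le> B powr (2 / B)" "B powr (2 * B + 2 / B) = B powr (2 * B) * B powr (2 / B)"
    using B by (auto intro: ge_one_powr_ge_zero simp: powr_add)
  have ratio1: "\<bar>g t\<bar> / \<bar>g s\<bar> \<le> B\<^sup>2 * X"
  proof -
    have "\<bar>g t\<bar> / \<bar>g s\<bar> \<le> (B * x) / (y / B)" using gs gt g0 y B by (intro frac_le) auto
    also have "(B * x) / (y / B) = B\<^sup>2 * X" unfolding X_def using y B by (simp add: field_simps power2_eq_square)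
    finally show ?thesis .
  qed
  have ratio2: "X / B\<^sup>2 \<le> \<bar>g t\<bar> / \<bar>g s\<bar>"
  proof -
    have "(x / B) / (B * y) \<le> \<bar>g t\<bar> / \<bar>g s\<bar>" using gs gt g0 x B by (intro frac_le) auto
    moreover have "(x / B) / (B * y) = X / B\<^sup>2" unfolding X_def using y B by (simp add: field_simps power2_eq_square)
    ultimately show ?thesis by (simp only:)
  qed
  have Bp: "(B\<^sup>2) powr a = B powr (2 * a)" for a using B by (simp add: powr_powr flip: powr_numeral)
  show "v s \<le> B powr (2 * B + 2 / B) * (x / y) powr B * v t"
  proof (cases "\<bar>g s\<bar> \<le> \<bar>g t\<bar>")
    case True
    have "v s \<le> (\<bar>g t\<bar> / \<bar>g s\<bar>) powr B * v t" using D(4)[of s t] True g0 by auto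
    also have "\<dots> \<le> (B\<^sup>2 * X) powr B * v t" using ratio1 B v0 by (intro mult_right_mono powr_mono2) auto
    also have "(B\<^sup>2 * X) powr B = B powr (2 * B) * 1 * X powr B" using X B by (simp add: powr_mult Bp)
    also have "\<dots> * v t \<le> B powr (2 * B) * B powr (2 / B) * X powr B * v t" using e v0 B by (intro mult_right_mono mult_left_mono) auto
    finally show ?thesis unfolding X_def e(3) .
  next
    case False
    have one: "1 \<le> \<bar>g s\<bar> / \<bar>g t\<bar>" using False g0 by simp
    have "1 * v s \<le> (\<bar>g s\<bar> / \<bar>g t\<bar>) powr (1 / B) * v s"
      using one B v0 by (intro mult_right_mono ge_one_powr_ge_zero) auto
    also have "\<dots> \<le> 1 * v t" using D(4)[of t s] False g0 by auto
    also have "\<dots> \<le> (B powr (2 * B + 2 / B) * X powr B) * v t"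
    proof -
      have "1 * 1 * 1 \<le> B powr (2 * B) * B powr (2 / B) * X powr B"
        using e X B by (intro mult_mono ge_one_powr_ge_zero) auto
      then show ?thesis using v0 unfolding e(3) by (intro mult_right_mono) auto
    qed
    finally show ?thesis unfolding X_def by simp
  qed
  show "(x / y) powr (1 / B) * v t \<le> B powr (2 * B + 2 / B) * v s"
  proof (cases "\<bar>g s\<bar> \<le> \<bar>g t\<bar>")
    case True
    have "X powr (1 / B) = (X / B\<^sup>2) powr (1 / B) * B powr (2 / B)"
      using X B by (simp add: powr_divide Bp)
    also have "\<dots> \<le> (\<bar>g t\<bar> / \<bar>g s\<bar>) powr (1 / B) * B powr (2 / B)"
      using ratio2 X B by (intro mult_right_mono powr_mono2) auto
    finally have "X powr (1 / B) * v t \<le> ((\<bar>g t\<bar> / \<bar>g s\<bar>) powr (1 / B) * B powr (2 / B)) * v t"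
      using v0 by (intro mult_right_mono) auto
    also have "\<dots> = ((\<bar>g t\<bar> / \<bar>g s\<bar>) powr (1 / B) * v t) * B powr (2 / B)" by simp
    also have "\<dots> \<le> v s * B powr (2 / B)" using D(4)[of s t] True g0 by (intro mult_right_mono) auto
    also have "\<dots> \<le> B powr (2 * B) * (v s * B powr (2 / B))"
      using mult_right_mono[OF e(1), of "v s * B powr (2 / B)"] v0 by simp
    finally show ?thesis unfolding X_def e(3) by (simp add: mult_ac)
  next
    \<comment> \<open>Here \<open>s\<close> is at most as far from the zero as \<open>t\<close>, and
      yet \<open>|g s| > |g t|\<close>: this happens only if \<open>x / y \<le> B^2\<close>, so all
      ratios are bounded.\<close>
    case False
    then have gst: "\<bar>g t\<bar> \<le> \<bar>g s\<bar>" by simp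
    have "\<bar>g t\<bar> / \<bar>g s\<bar> \<le> 1" using gst g0 by simp
    then have "X / B\<^sup>2 \<le> 1" using ratio2 by linarith
    then have "X \<le> B\<^sup>2" using B by (simp add: divide_le_eq)
    then have X1: "X powr (1 / B) \<le> B powr (2 / B)"
      using powr_mono2[of "1/B" X "B\<^sup>2"] X B by (simp add: Bp)
    have "\<bar>g s\<bar> / \<bar>g t\<bar> \<le> (B * y) / (x / B)" using gs gt g0 x B by (intro frac_le) auto
    also have "\<dots> \<le> B\<^sup>2" using x y yx B by (simp add: field_simps power2_eq_square)
    finally have r: "\<bar>g s\<bar> / \<bar>g t\<bar> \<le> B\<^sup>2" .
    have "v t \<le> (\<bar>g s\<bar> / \<bar>g t\<bar>) powr B * v s" using D(4)[of t s] gst g0 by auto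
    also have "\<dots> \<le> (B\<^sup>2) powr B * v s" using r B v0 by (intro mult_right_mono powr_mono2) auto
    finally have "v t \<le> B powr (2 * B) * v s" unfolding Bp .
    then have "X powr (1 / B) * v t \<le> B powr (2 / B) * (B powr (2 * B) * v s)"
      using X1 v0 by (intro mult_mono) auto
    then show ?thesis unfolding X_def e(3) by (simp add: mult_ac)
  qed
qed

text \<open>Simple zeros are isolated, so only finitely many lie in a compact interval, and their
  distances have a positive minimum; periodicity extends it to the line.\<close>

lemma zero_gap:
  assumes I: "finite I" and S: "\<And>i. i \<in> I \<Longrightarrow> singular_factor B (g i) (v i)"
  defines "Z \<equiv> {t. \<exists>i\<in>I. g i t = 0}"
  shows "\<exists>\<delta>>0. \<forall>\<tau>\<in>Z. \<forall>\<tau>'\<in>Z. \<tau> \<noteq> \<tau>' \<longrightarrow> \<delta> \<le> \<bar>\<tau> - \<tau>'\<bar>"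
proof -
  \<comment> \<open>One unit of margin on each side of the period keeps together a pair at distance
    below 1 that straddles its boundary.\<close>
  define ZF where "ZF = Z \<inter> {-1..2 * pi + 1}"
  have finZ: "finite ({-1..2 * pi + 1} \<inter> {t. g i t = 0})" if i: "i \<in> I" for i
  proof (rule finite_not_islimpt_in_compact)
    fix z
    have B: "1 \<le> B" by (rule singular_factorD(1)[OF S[OF i]])
    show "\<not> z islimpt {t. g i t = 0}"
    proof (rule discrete_imp_not_islimpt)
      show "0 < 1 / B" using B by simp
      fix x y assume *: "x \<in> {t. g i t = 0}" "y \<in> {t. g i t = 0}" "dist y x < 1 / B"
      then have "\<bar>y - x\<bar> / B \<le> \<bar>g i y\<bar>" using singular_factorD(7)[OF S[OF i], of x y] by (auto simp: dist_real_def)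
      then show "y = x" using * B by (simp add: divide_le_0_iff)
    qed
  qed simp
  have ZF: "ZF = (\<Union>i\<in>I. {-1..2 * pi + 1} \<inter> {t. g i t = 0})" unfolding ZF_def Z_def by auto
  have fin: "finite ZF" unfolding ZF by (intro finite_UN_I I finZ)
  define G where "G = (\<lambda>(x, y). \<bar>x - y\<bar>) ` ((ZF \<times> ZF) - Id)"
  have finG: "finite (insert 1 G)" unfolding G_def using fin by auto
  define \<delta> where "\<delta> = Min (insert 1 G)"
  have d0: "0 < \<delta>" unfolding \<delta>_def using finG by (auto simp: G_def)
  have per: "g i (t + 2 * pi) = g i t" if "i \<in> I" for i t using singular_factorD(2)[OF S[OF that]] .
  have "\<delta> \<le> \<bar>\<tau> - \<tau>'\<bar>" if t: "\<tau> \<in> Z" "\<tau>' \<in> Z" "\<tau> \<noteq> \<tau>'" for \<tau> \<tau>'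
  proof (cases "1 \<le> \<bar>\<tau> - \<tau>'\<bar>")
    case True
    have "\<delta> \<le> 1" unfolding \<delta>_def using finG by (intro Min_le) auto
    then show ?thesis using True by simp
  next
    case False
    obtain k where k: "\<tau> - of_int k * (2 * pi) \<in> {0..2 * pi}" using reduce_mod_2pi by blast
    have sh: "x - of_int k * (2 * pi) \<in> Z" if xZ: "x \<in> Z" for x
    proof -
      obtain i where i: "i \<in> I" "g i x = 0" using xZ unfolding Z_def by blast
      then have "g i (x - of_int k * (2 * pi)) = 0" using periodic_int(2)[of "g i", OF per] by metis
      then show ?thesis using i unfolding Z_def by blast
    qed
    have "\<tau> - of_int k * (2 * pi) \<in> ZF" "\<tau>' - of_int k * (2 * pi) \<in> ZF"
      using k False sh[OF t(1)] sh[OF t(2)] unfolding ZF_def by auto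
    then have "\<bar>(\<tau> - of_int k * (2 * pi)) - (\<tau>' - of_int k * (2 * pi))\<bar> \<in> G"
      unfolding G_def using t(3) by (intro image_eqI[of _ _ "(\<tau> - of_int k * (2 * pi), \<tau>' - of_int k * (2 * pi))"]) auto
    then have "\<bar>\<tau> - \<tau>'\<bar> \<in> insert 1 G" by simp
    then show ?thesis unfolding \<delta>_def using finG by (rule Min_le[rotated])
  qed
  then show ?thesis using d0 by blast
qed

text \<open>Used with \<delta> the distance to a nearby zero, and with \<open>\<delta> = 1\<close>
  far from all zeros.\<close>

lemma sum_tangent:
  assumes I: "finite I" and S: "\<And>i. i \<in> I \<Longrightarrow> singular_factor B (g i) (v i)"
    and d: "0 < \<delta>" "0 < m" and gm: "\<And>i. i \<in> I \<Longrightarrow> \<delta> * m \<le> \<bar>g i t\<bar>" and B: "1 \<le> B"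
  shows "\<exists>\<sigma>. \<bar>\<sigma>\<bar> \<le> B / m * (\<Sum>i\<in>I. v i t) / \<delta> \<and>
     (\<forall>s. \<bar>s - t\<bar> \<le> \<delta> * m / B \<longrightarrow>
        (\<Sum>i\<in>I. v i s) \<le> (\<Sum>i\<in>I. v i t) + \<sigma> * (s - t) + B / m\<^sup>2 * (\<Sum>i\<in>I. v i t) / \<delta>\<^sup>2 * (s - t)\<^sup>2)"
proof -
  have g0: "g i t \<noteq> 0" if "i \<in> I" for i using gm[OF that] mult_pos_pos[OF d] by fastforce
  have v0: "0 \<le> v i t" if "i \<in> I" for i
    using singular_factorD(3)[OF S[OF that], of t] g0[OF that] B order.trans[of 0 "1/B"] by auto
  have "\<forall>i\<in>I. \<exists>\<sigma>. \<bar>\<sigma>\<bar> \<le> B * v i t / \<bar>g i t\<bar> \<and>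
        (\<forall>s. \<bar>s - t\<bar> \<le> \<bar>g i t\<bar> / B \<longrightarrow> v i s \<le> v i t + \<sigma> * (s - t) + B * v i t / (g i t)\<^sup>2 * (s - t)\<^sup>2)"
    using singular_factorD(5)[OF S] g0 by blast
  from bchoice[OF this] obtain \<sigma> where
    s1: "\<And>i. i \<in> I \<Longrightarrow> \<bar>\<sigma> i\<bar> \<le> B * v i t / \<bar>g i t\<bar>" and
    s2: "\<And>i s. i \<in> I \<Longrightarrow> \<bar>s - t\<bar> \<le> \<bar>g i t\<bar> / B \<Longrightarrow> v i s \<le> v i t + \<sigma> i * (s - t) + B * v i t / (g i t)\<^sup>2 * (s - t)\<^sup>2"
    by blast
  have s1': "\<bar>\<sigma> i\<bar> \<le> B / m * v i t / \<delta>" if i: "i \<in> I" for i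
  proof -
    have "B * v i t / \<bar>g i t\<bar> \<le> B * v i t / (\<delta> * m)" using gm[OF i] v0[OF i] B d by (intro frac_le) auto
    then show ?thesis using s1[OF i] by (simp add: mult.commute)
  qed
  have s2': "v i s \<le> v i t + \<sigma> i * (s - t) + B / m\<^sup>2 * v i t / \<delta>\<^sup>2 * (s - t)\<^sup>2" if i: "i \<in> I" and s: "\<bar>s - t\<bar> \<le> \<delta> * m / B" for i s
  proof -
    have "\<delta> * m / B \<le> \<bar>g i t\<bar> / B" using gm[OF i] B by (intro divide_right_mono) auto
    then have "v i s \<le> v i t + \<sigma> i * (s - t) + B * v i t / (g i t)\<^sup>2 * (s - t)\<^sup>2" using s s2[OF i, of s] by linarith
    also have "\<dots> \<le> v i t + \<sigma> i * (s - t) + B * v i t / (\<delta> * m)\<^sup>2 * (s - t)\<^sup>2"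
    proof -
      have "(\<delta> * m)\<^sup>2 \<le> \<bar>g i t\<bar>\<^sup>2" using gm[OF i] d by (intro power_mono) auto
      then have "B * v i t / (g i t)\<^sup>2 \<le> B * v i t / (\<delta> * m)\<^sup>2" using v0[OF i] B d by (intro frac_le) auto
      then show ?thesis by (intro add_left_mono mult_right_mono) auto
    qed
    finally show ?thesis by (simp add: power_mult_distrib mult.commute)
  qed
  have "\<bar>\<Sum>i\<in>I. \<sigma> i\<bar> \<le> (\<Sum>i\<in>I. \<bar>\<sigma> i\<bar>)" by (rule sum_abs)
  also have "\<dots> \<le> (\<Sum>i\<in>I. B / m * v i t / \<delta>)" by (intro sum_mono s1')
  also have "\<dots> = B / m * (\<Sum>i\<in>I. v i t) / \<delta>" by (simp add: sum_distrib_left sum_divide_distrib)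
  finally have 1: "\<bar>\<Sum>i\<in>I. \<sigma> i\<bar> \<le> B / m * (\<Sum>i\<in>I. v i t) / \<delta>" .
  have 2: "(\<Sum>i\<in>I. v i s) \<le> (\<Sum>i\<in>I. v i t) + (\<Sum>i\<in>I. \<sigma> i) * (s - t) + B / m\<^sup>2 * (\<Sum>i\<in>I. v i t) / \<delta>\<^sup>2 * (s - t)\<^sup>2"
    if s: "\<bar>s - t\<bar> \<le> \<delta> * m / B" for s
  proof -
    have "(\<Sum>i\<in>I. v i s) \<le> (\<Sum>i\<in>I. v i t + \<sigma> i * (s - t) + B / m\<^sup>2 * v i t / \<delta>\<^sup>2 * (s - t)\<^sup>2)"
      by (intro sum_mono s2' s)
    also have "\<dots> = (\<Sum>i\<in>I. v i t) + (\<Sum>i\<in>I. \<sigma> i) * (s - t) + B / m\<^sup>2 * (\<Sum>i\<in>I. v i t) / \<delta>\<^sup>2 * (s - t)\<^sup>2"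
      by (simp add: sum.distrib sum_distrib_left sum_distrib_right sum_divide_distrib)
    finally show ?thesis .
  qed
  show ?thesis using 1 2 by blast
qed

text \<open>At a zero \<tau> the factors split into those vanishing at \<tau>, which obey power
  bounds in the distance, and those bounded by \<open>h\<close> near \<tau>. As every factor is at
  least \<open>1 / B\<close>, the bounded ones change the comparisons by constants only.\<close>

lemma sum_landscape:
  assumes I: "finite I" "I \<noteq> {}" and S0: "\<And>i. i \<in> I \<Longrightarrow> \<exists>B. singular_factor B (g i) (v i)"
    and vper: "\<And>i t. i \<in> I \<Longrightarrow> v i (t + 2 * pi) = v i t"
  defines "Z \<equiv> {t. \<exists>i\<in>I. g i t = 0}" and "V \<equiv> \<lambda>t. \<Sum>i\<in>I. v i t"
  assumes even: "\<And>t. - t \<in> Z \<longleftrightarrow> t \<in> Z" "\<And>t. t \<notin> Z \<Longrightarrow> V (- t) = V t"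
  shows "\<exists>\<Gamma> \<kappa>. landscape \<Gamma> \<kappa> Z V"
proof -
  from bchoice[of I "\<lambda>i B. singular_factor B (g i) (v i)"] S0 obtain b where b: "\<And>i. i \<in> I \<Longrightarrow> singular_factor (b i) (g i) (v i)" by blast
  define B where "B = (\<Sum>i\<in>I. b i)"
  have b1: "1 \<le> b i" if "i \<in> I" for i using singular_factorD(1)[OF b[OF that]] .
  have S: "singular_factor B (g i) (v i)" if i: "i \<in> I" for i
  proof (rule singular_factor_mono[OF b[OF i]])
    show "b i \<le> B" unfolding B_def using i I b1 by (intro member_le_sum) (auto intro: order.trans[of 0 1])
  qed
  obtain i0 where i0: "i0 \<in> I" using I by blast
  note D = singular_factorD[OF S]
  have B: "1 \<le> B" by (rule D(1)[OF i0])
  have nz: "g i t \<noteq> 0" if "t \<notin> Z" "i \<in> I" for i t using that unfolding Z_def by blast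
  have vlo: "1 / B \<le> v i t" if "i \<in> I" "g i t \<noteq> 0" for i t using D(3)[OF that(1), of t] that by blast
  have B0: "0 < 1 / B" using B by simp
  have v0: "0 < v i t" if "i \<in> I" "g i t \<noteq> 0" for i t using vlo[OF that] B0 by linarith
  obtain \<delta>0 where gap: "0 < \<delta>0" "\<And>\<tau> \<tau>'. \<tau> \<in> Z \<Longrightarrow> \<tau>' \<in> Z \<Longrightarrow> \<tau> \<noteq> \<tau>' \<Longrightarrow> \<delta>0 \<le> \<bar>\<tau> - \<tau>'\<bar>"
    using zero_gap[OF I(1), of B g v] S unfolding Z_def by blast
  define \<kappa> where "\<kappa> = min (\<delta>0 / 4) (1 / B)"
  have k: "0 < \<kappa>" "\<kappa> \<le> 1 / B" "\<kappa> \<le> 1" "4 * \<kappa> \<le> \<delta>0"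
  proof -
    show "0 < \<kappa>" "\<kappa> \<le> 1 / B" "4 * \<kappa> \<le> \<delta>0" unfolding \<kappa>_def using gap B0 by auto
    have "1 / B \<le> 1" using B by simp
    then show "\<kappa> \<le> 1" using \<open>\<kappa> \<le> 1 / B\<close> by linarith
  qed
  have gap4: "4 * \<kappa> \<le> \<bar>\<tau> - \<tau>'\<bar>" if "\<tau> \<in> Z" "\<tau>' \<in> Z" "\<tau> \<noteq> \<tau>'" for \<tau> \<tau>' using gap(2)[OF that] k by linarith
  have "\<forall>i\<in>I. \<exists>c>0. \<forall>t. (\<forall>\<tau>. g i \<tau> = 0 \<longrightarrow> \<kappa> \<le> \<bar>t - \<tau>\<bar>) \<longrightarrow> c \<le> \<bar>g i t\<bar>" using D(8)[OF _ k(1)] by blast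
  from bchoice[OF this] obtain ci where ci: "\<And>i. i \<in> I \<Longrightarrow> 0 < ci i"
    "\<And>i t. i \<in> I \<Longrightarrow> (\<forall>\<tau>. g i \<tau> = 0 \<longrightarrow> \<kappa> \<le> \<bar>t - \<tau>\<bar>) \<Longrightarrow> ci i \<le> \<bar>g i t\<bar>" by blast
  define c where "c = Min (ci ` I)"
  have c0: "0 < c" unfolding c_def using I ci by simp
  have cc: "c \<le> \<bar>g i t\<bar>" if "i \<in> I" "\<forall>\<tau>. g i \<tau> = 0 \<longrightarrow> \<kappa> \<le> \<bar>t - \<tau>\<bar>" for i t
  proof -
    have "c \<le> ci i" unfolding c_def using I that by simp
    then show ?thesis using ci(2)[OF that] by linarith
  qed
  have "\<forall>i\<in>I. \<exists>hi. \<forall>t. c \<le> \<bar>g i t\<bar> \<longrightarrow> v i t \<le> hi" using D(9)[OF _ c0] by blast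
  from bchoice[OF this] obtain hi where hi: "\<And>i t. i \<in> I \<Longrightarrow> c \<le> \<bar>g i t\<bar> \<Longrightarrow> v i t \<le> hi i" by blast
  define h where "h = (\<Sum>i\<in>I. \<bar>hi i\<bar>)"
  have h0: "0 \<le> h" unfolding h_def by (intro sum_nonneg) auto
  have hh: "v i t \<le> h" if "i \<in> I" "c \<le> \<bar>g i t\<bar>" for i t
  proof -
    have "\<bar>hi i\<bar> \<le> h" unfolding h_def using that I by (intro member_le_sum) auto
    then show ?thesis using hi[OF that] by linarith
  qed
  define N where "N = real (card I)"
  have N1: "1 \<le> N" unfolding N_def using I by (simp add: Suc_le_eq card_gt_0_iff)
  define m where "m = min (1 / B) c"
  have m: "0 < m" "m \<le> 1 / B" "m \<le> c" unfolding m_def using B0 c0 by auto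
  define \<Gamma>0 where "\<Gamma>0 = B powr (2 * B + 2 / B)"
  have G0: "0 \<le> \<Gamma>0" unfolding \<Gamma>0_def by simp
  define \<Gamma> where "\<Gamma> = 2 / \<kappa> + B + \<Gamma>0 + h * B + (1 + N * h * B) * \<Gamma>0 + (B / m + B / m\<^sup>2) * (1 + N * h) + N * h + 1"
  have parts: "0 \<le> 2 / \<kappa>" "0 \<le> B" "0 \<le> \<Gamma>0" "0 \<le> h * B" "0 \<le> (1 + N * h * B) * \<Gamma>0"
     "0 \<le> (B / m) * (1 + N * h)" "0 \<le> (B / m\<^sup>2) * (1 + N * h)" "0 \<le> N * h" "0 \<le> B / m" "0 \<le> B / m\<^sup>2" "0 \<le> B / m * (N * h)" "0 \<le> B / m\<^sup>2 * (N * h)"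
    using k B h0 N1 m G0 by auto
  have \<Gamma>: "1 \<le> \<Gamma>" "2 / \<kappa> \<le> \<Gamma>" "B \<le> \<Gamma>" "\<Gamma>0 \<le> \<Gamma>" "h * B \<le> \<Gamma>" "(1 + N * h * B) * \<Gamma>0 \<le> \<Gamma>"
     "B / m \<le> \<Gamma>" "B / m\<^sup>2 \<le> \<Gamma>" "B / m * (N * h) \<le> \<Gamma>" "B / m\<^sup>2 * (N * h) \<le> \<Gamma>" "N * h \<le> \<Gamma>"
    using parts unfolding \<Gamma>_def by (simp_all add: distrib_left distrib_right)
  have invG: "1 / \<Gamma> \<le> 1 / B" using \<Gamma> B by (intro divide_left_mono) auto
  have mB: "1 / \<Gamma> \<le> m / B"
  proof -
    have "B / m \<le> \<Gamma>" by (rule \<Gamma>)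
    moreover have "0 < B / m" using B m by simp
    ultimately have "1 / \<Gamma> \<le> 1 / (B / m)" by (intro frac_le) auto
    then show ?thesis by simp
  qed
  have gnear: "g i \<tau> = 0 \<Longrightarrow> \<bar>t - \<tau>\<bar> / B \<le> \<bar>g i t\<bar>" "g i \<tau> = 0 \<Longrightarrow> \<bar>g i t\<bar> \<le> B * \<bar>t - \<tau>\<bar>"
    "g i \<tau> \<noteq> 0 \<Longrightarrow> c \<le> \<bar>g i t\<bar>" if "\<tau> \<in> Z" "\<bar>t - \<tau>\<bar> \<le> \<kappa>" "i \<in> I" for \<tau> t i
  proof -
    show "\<bar>t - \<tau>\<bar> / B \<le> \<bar>g i t\<bar>" if "g i \<tau> = 0" using D(7)[OF \<open>i \<in> I\<close>, of \<tau> t] that \<open>\<bar>t - \<tau>\<bar> \<le> \<kappa>\<close> k by linarith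
    show "\<bar>g i t\<bar> \<le> B * \<bar>t - \<tau>\<bar>" if "g i \<tau> = 0" using D(6)[OF \<open>i \<in> I\<close>, of t \<tau>] that by simp
    show "c \<le> \<bar>g i t\<bar>" if n: "g i \<tau> \<noteq> 0"
    proof (rule cc[OF \<open>i \<in> I\<close>], intro allI impI)
      fix \<tau>' assume t': "g i \<tau>' = 0"
      then have "\<tau>' \<in> Z" "\<tau>' \<noteq> \<tau>" using \<open>i \<in> I\<close> n unfolding Z_def by auto
      then show "\<kappa> \<le> \<bar>t - \<tau>'\<bar>" using gap4[of \<tau> \<tau>'] \<open>\<tau> \<in> Z\<close> \<open>\<bar>t - \<tau>\<bar> \<le> \<kappa>\<close> k(1) by linarith
    qed
  qed
  have gnz: "g i t \<noteq> 0" if "\<tau> \<in> Z" "0 < \<bar>t - \<tau>\<bar>" "\<bar>t - \<tau>\<bar> \<le> \<kappa>" "i \<in> I" for \<tau> t i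
  proof (cases "g i \<tau> = 0")
    case True
    have "0 < \<bar>t - \<tau>\<bar> / B" using that B by simp
    then show ?thesis using gnear(1)[OF that(1,3,4) True] by auto
  next
    case False then show ?thesis using gnear(3)[OF that(1,3,4)] c0 by auto
  qed
  have growth: "V s \<le> \<Gamma> * (\<bar>t - \<tau>\<bar> / \<bar>s - \<tau>\<bar>) powr \<Gamma> * V t \<and> (\<bar>t - \<tau>\<bar> / \<bar>s - \<tau>\<bar>) powr (1 / \<Gamma>) * V t \<le> \<Gamma> * V s"
    if \<tau>: "\<tau> \<in> Z" and st: "0 < \<bar>s - \<tau>\<bar>" "\<bar>s - \<tau>\<bar> \<le> \<bar>t - \<tau>\<bar>" "\<bar>t - \<tau>\<bar> \<le> \<kappa>" for \<tau> s t
  proof -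
    define X where "X = \<bar>t - \<tau>\<bar> / \<bar>s - \<tau>\<bar>"
    have X: "1 \<le> X" unfolding X_def using st by simp
    have t0: "0 < \<bar>t - \<tau>\<bar>" and sk: "\<bar>s - \<tau>\<bar> \<le> \<kappa>" using st by linarith+
    note ns = gnz[OF \<tau> st(1) sk] and nt = gnz[OF \<tau> t0 st(3)]
    have nvs: "0 \<le> v i s" and nvt: "0 \<le> v i t" if "i \<in> I" for i
      using v0[OF that ns[OF that]] v0[OF that nt[OF that]] by auto
    have cmp: "v i s \<le> \<Gamma>0 * X powr B * v i t" "X powr (1 / B) * v i t \<le> \<Gamma>0 * v i s" if "i \<in> I" "g i \<tau> = 0" for i
      using singular_factor_comparison[OF S[OF that(1)] t0 st(1,2), of s t]
        gnear[OF \<tau> sk that(1)] gnear[OF \<tau> st(3) that(1)] that(2) unfolding \<Gamma>0_def X_def by auto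
    have XB: "1 \<le> X powr B" "X powr B \<le> X powr \<Gamma>" "X powr (1 / \<Gamma>) \<le> X powr (1 / B)"
      using X B \<Gamma> invG by (auto intro: ge_one_powr_ge_zero powr_mono)
    have up: "v i s \<le> \<Gamma> * X powr \<Gamma> * v i t" if i: "i \<in> I" for i
    proof (cases "g i \<tau> = 0")
      case True
      have "v i s \<le> \<Gamma>0 * X powr B * v i t" by (rule cmp(1)[OF i True])
      also have "\<dots> \<le> \<Gamma> * X powr \<Gamma> * v i t"
        using \<Gamma> XB v0[OF i nt[OF i]] by (intro mult_right_mono mult_mono) auto
      finally show ?thesis .
    next
      case False
      have "v i s \<le> h * 1" using hh[OF i gnear(3)[OF \<tau> sk i False]] by simp
      also have "\<dots> \<le> h * (B * v i t)" using vlo[OF i nt[OF i]] B h0 by (intro mult_left_mono) (auto simp: field_simps)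
      also have "\<dots> = (h * B) * 1 * v i t" by simp
      also have "\<dots> \<le> \<Gamma> * X powr \<Gamma> * v i t"
        using \<Gamma> XB v0[OF i nt[OF i]] by (intro mult_right_mono mult_mono) auto
      finally show ?thesis .
    qed
    have 1: "V s \<le> \<Gamma> * X powr \<Gamma> * V t"
      unfolding V_def sum_distrib_left by (intro sum_mono up)
    define J where "J = {i \<in> I. g i \<tau> = 0}"
    have J: "J \<subseteq> I" "finite J" "J \<noteq> {}" using \<tau> I unfolding J_def Z_def by auto
    \<comment> \<open>At least one factor vanishes at \<tau>, so the singular part of the sum is at
      least \<open>1 / B\<close> and dominates the bounded part up to a constant.\<close>
    obtain i1 where i1: "i1 \<in> J" using J by blast
    have "1 / B \<le> v i1 t" using vlo nt i1 J by blast
    also have "\<dots> \<le> (\<Sum>i\<in>J. v i t)" using i1 J nvt by (intro member_le_sum) auto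
    finally have lowJ: "1 \<le> B * (\<Sum>i\<in>J. v i t)" using B by (simp add: field_simps)
    have "V t = (\<Sum>i\<in>J. v i t) + (\<Sum>i\<in>I - J. v i t)"
      unfolding V_def using sum.subset_diff[OF J(1) I(1)] by (simp add: add.commute)
    also have "(\<Sum>i\<in>I - J. v i t) \<le> (\<Sum>i\<in>I - J. h)"
      using hh gnear(3)[OF \<tau> st(3)] unfolding J_def by (intro sum_mono) auto
    also have "(\<Sum>i\<in>I - J. h) \<le> N * h * 1" using h0 card_mono[OF I(1), of "I - J"] unfolding N_def by (simp add: mult_right_mono)
    also have "N * h * 1 \<le> N * h * (B * (\<Sum>i\<in>J. v i t))" using lowJ N1 h0 by (intro mult_left_mono) auto
    finally have VtJ: "V t \<le> (1 + N * h * B) * (\<Sum>i\<in>J. v i t)" by (simp add: algebra_simps)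
    have "X powr (1 / \<Gamma>) * V t \<le> X powr (1 / B) * ((1 + N * h * B) * (\<Sum>i\<in>J. v i t))"
    proof (intro mult_mono XB VtJ)
      show "0 \<le> V t" unfolding V_def using nvt by (intro sum_nonneg) auto
    qed auto
    also have "\<dots> = (1 + N * h * B) * (\<Sum>i\<in>J. X powr (1 / B) * v i t)"
      unfolding sum_distrib_left[symmetric] by simp
    also have "\<dots> \<le> (1 + N * h * B) * (\<Sum>i\<in>J. \<Gamma>0 * v i s)"
      using cmp(2) N1 h0 B unfolding J_def by (intro mult_left_mono sum_mono) auto
    also have "\<dots> = (1 + N * h * B) * \<Gamma>0 * (\<Sum>i\<in>J. v i s)" by (simp add: sum_distrib_left mult.assoc)
    also have "\<dots> \<le> \<Gamma> * V s"
    proof (intro mult_mono \<Gamma>)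
      show "(\<Sum>i\<in>J. v i s) \<le> V s" unfolding V_def using J I nvs by (intro sum_mono2) auto
      show "0 \<le> (\<Sum>i\<in>J. v i s)" using J nvs by (intro sum_nonneg) auto
    qed (use \<Gamma> in auto)
    finally show ?thesis using 1 unfolding X_def by blast
  qed
  have tangent: "\<exists>\<sigma>. \<bar>\<sigma>\<bar> \<le> \<Gamma> * V t / \<bar>t - \<tau>\<bar> \<and>
        (\<forall>s. \<bar>s - t\<bar> \<le> \<bar>t - \<tau>\<bar> / \<Gamma> \<longrightarrow> V s \<le> V t + \<sigma> * (s - t) + \<Gamma> * V t / \<bar>t - \<tau>\<bar>\<^sup>2 * (s - t)\<^sup>2)"
    if \<tau>: "\<tau> \<in> Z" and t: "0 < \<bar>t - \<tau>\<bar>" "\<bar>t - \<tau>\<bar> \<le> \<kappa>" for \<tau> t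
  proof -
    define \<delta> where "\<delta> = \<bar>t - \<tau>\<bar>"
    have V0: "0 \<le> V t" unfolding V_def by (intro sum_nonneg less_imp_le v0 gnz[OF \<tau> t])
    have gm: "\<delta> * m \<le> \<bar>g i t\<bar>" if i: "i \<in> I" for i
    proof (cases "g i \<tau> = 0")
      case True
      have "\<delta> * m \<le> \<delta> * (1 / B)" using m t unfolding \<delta>_def by (intro mult_left_mono) auto
      then show ?thesis using gnear(1)[OF \<tau> t(2) i True] unfolding \<delta>_def by simp
    next
      case False
      have "\<delta> * m \<le> 1 * c" using m t k unfolding \<delta>_def by (intro mult_mono) auto
      then show ?thesis using gnear(3)[OF \<tau> t(2) i False] by simp
    qed
    obtain \<sigma> where s: "\<bar>\<sigma>\<bar> \<le> B / m * V t / \<delta>"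
      "\<And>s. \<bar>s - t\<bar> \<le> \<delta> * m / B \<Longrightarrow> V s \<le> V t + \<sigma> * (s - t) + B / m\<^sup>2 * V t / \<delta>\<^sup>2 * (s - t)\<^sup>2"
    proof -
      have d0: "0 < \<delta>" using t unfolding \<delta>_def by simp
      have "\<exists>\<sigma>. \<bar>\<sigma>\<bar> \<le> B / m * V t / \<delta> \<and>
        (\<forall>s. \<bar>s - t\<bar> \<le> \<delta> * m / B \<longrightarrow> V s \<le> V t + \<sigma> * (s - t) + B / m\<^sup>2 * V t / \<delta>\<^sup>2 * (s - t)\<^sup>2)"
        unfolding V_def by (rule sum_tangent[OF I(1) S d0 m(1) gm B])
      then show ?thesis using that by blast
    qed
    have "B / m * V t / \<delta> \<le> \<Gamma> * V t / \<delta>" using \<Gamma> V0 t unfolding \<delta>_def by (intro divide_right_mono mult_right_mono) auto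
    with s(1) have 1: "\<bar>\<sigma>\<bar> \<le> \<Gamma> * V t / \<delta>" by linarith
    have "V s \<le> V t + \<sigma> * (s - t) + \<Gamma> * V t / \<delta>\<^sup>2 * (s - t)\<^sup>2" if ss: "\<bar>s - t\<bar> \<le> \<delta> / \<Gamma>" for s
    proof -
      have "\<delta> / \<Gamma> \<le> \<delta> * m / B" using mult_left_mono[OF mB, of \<delta>] unfolding \<delta>_def by simp
      then have "V s \<le> V t + \<sigma> * (s - t) + B / m\<^sup>2 * V t / \<delta>\<^sup>2 * (s - t)\<^sup>2" using s(2)[of s] ss by linarith
      also have "\<dots> \<le> V t + \<sigma> * (s - t) + \<Gamma> * V t / \<delta>\<^sup>2 * (s - t)\<^sup>2"
        using \<Gamma> V0 by (intro add_left_mono mult_right_mono divide_right_mono) auto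
      finally show ?thesis .
    qed
    with 1 show ?thesis unfolding \<delta>_def by blast
  qed
  have far: "V t \<le> \<Gamma> \<and> (\<exists>\<sigma>. \<bar>\<sigma>\<bar> \<le> \<Gamma> \<and>
        (\<forall>s. \<bar>s - t\<bar> \<le> 1 / \<Gamma> \<longrightarrow> V s \<le> V t + \<sigma> * (s - t) + \<Gamma> * (s - t)\<^sup>2))"
    if t: "\<forall>\<tau>\<in>Z. \<kappa> \<le> \<bar>t - \<tau>\<bar>" for t
  proof -
    have gc: "c \<le> \<bar>g i t\<bar>" if "i \<in> I" for i using that t unfolding Z_def by (intro cc) auto
    have "V t \<le> (\<Sum>i\<in>I. h)" unfolding V_def by (intro sum_mono hh gc)
    then have Vt: "V t \<le> N * h" unfolding N_def by simp
    have gm: "1 * m \<le> \<bar>g i t\<bar>" if "i \<in> I" for i using gc[OF that] m by simp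
    obtain \<sigma> where s: "\<bar>\<sigma>\<bar> \<le> B / m * V t / 1"
      "\<And>s. \<bar>s - t\<bar> \<le> 1 * m / B \<Longrightarrow> V s \<le> V t + \<sigma> * (s - t) + B / m\<^sup>2 * V t / 1\<^sup>2 * (s - t)\<^sup>2"
    proof -
      have "\<exists>\<sigma>. \<bar>\<sigma>\<bar> \<le> B / m * V t / 1 \<and>
        (\<forall>s. \<bar>s - t\<bar> \<le> 1 * m / B \<longrightarrow> V s \<le> V t + \<sigma> * (s - t) + B / m\<^sup>2 * V t / 1\<^sup>2 * (s - t)\<^sup>2)"
        unfolding V_def by (rule sum_tangent[OF I(1) S zero_less_one m(1) gm B])
      then show ?thesis using that by blast
    qed
    have "B / m * V t \<le> B / m * (N * h)" "B / m\<^sup>2 * V t \<le> B / m\<^sup>2 * (N * h)"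
      using parts Vt by (intro mult_left_mono; simp)+
    then have b: "B / m * V t \<le> \<Gamma>" "B / m\<^sup>2 * V t \<le> \<Gamma>" using \<Gamma> by linarith+
    have "V s \<le> V t + \<sigma> * (s - t) + \<Gamma> * (s - t)\<^sup>2" if "\<bar>s - t\<bar> \<le> 1 / \<Gamma>" for s
    proof -
      have "V s \<le> V t + \<sigma> * (s - t) + B / m\<^sup>2 * V t / 1\<^sup>2 * (s - t)\<^sup>2" using s(2)[of s] that mB by simp
      also have "\<dots> \<le> V t + \<sigma> * (s - t) + \<Gamma> * (s - t)\<^sup>2" using b by (intro add_left_mono mult_right_mono) auto
      finally show ?thesis .
    qed
    then show ?thesis using s(1) b Vt \<Gamma> by (intro conjI exI[of _ \<sigma>]) auto
  qed
  have Zper: "t + 2 * pi \<in> Z \<longleftrightarrow> t \<in> Z" for t unfolding Z_def using D(2) by auto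
  have reg: "V (t + 2 * pi) = V t \<and> V (- t) = V t \<and> 1 / \<Gamma> \<le> V t \<and> isCont V t" if t: "t \<notin> Z" for t
  proof (intro conjI)
    show "V (t + 2 * pi) = V t" unfolding V_def by (intro sum.cong vper) auto
    show "V (- t) = V t" by (rule even(2)[OF t])
    have "1 / B \<le> v i0 t" by (rule vlo[OF i0 nz[OF t i0]])
    also have "\<dots> \<le> V t" unfolding V_def using i0 I less_imp_le[OF v0[OF _ nz[OF t]]] by (intro member_le_sum) auto
    finally show "1 / \<Gamma> \<le> V t" using invG by linarith
    show "isCont V t" unfolding V_def by (intro continuous_intros D(10) nz[OF t])
  qed
  have "landscape \<Gamma> \<kappa> Z V"
    unfolding landscape_def using \<Gamma>(1,2) k(1,3) Zper even(1) reg gap4 far growth tangent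
    by (intro conjI allI impI ballI; blast)
  then show ?thesis by blast
qed

section \<open>Truncation at the critical radius\<close>

lemma landscapeD:
  assumes "landscape \<Gamma> \<kappa> Z V"
  shows "1 \<le> \<Gamma>" "0 < \<kappa>" "\<kappa> \<le> 1" "2 / \<kappa> \<le> \<Gamma>"
    "t + 2 * pi \<in> Z \<longleftrightarrow> t \<in> Z" "- t \<in> Z \<longleftrightarrow> t \<in> Z"
    "t \<notin> Z \<Longrightarrow> V (t + 2 * pi) = V t" "t \<notin> Z \<Longrightarrow> V (- t) = V t" "t \<notin> Z \<Longrightarrow> 1 / \<Gamma> \<le> V t" "t \<notin> Z \<Longrightarrow> isCont V t"
    "\<tau> \<in> Z \<Longrightarrow> \<tau>' \<in> Z \<Longrightarrow> \<tau> \<noteq> \<tau>' \<Longrightarrow> 4 * \<kappa> \<le> \<bar>\<tau> - \<tau>'\<bar>"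
    "\<forall>\<tau>\<in>Z. \<kappa> \<le> \<bar>t - \<tau>\<bar> \<Longrightarrow> V t \<le> \<Gamma>"
    "\<forall>\<tau>\<in>Z. \<kappa> \<le> \<bar>t - \<tau>\<bar> \<Longrightarrow> \<exists>\<sigma>. \<bar>\<sigma>\<bar> \<le> \<Gamma> \<and>
        (\<forall>s. \<bar>s - t\<bar> \<le> 1 / \<Gamma> \<longrightarrow> V s \<le> V t + \<sigma> * (s - t) + \<Gamma> * (s - t)\<^sup>2)"
    "\<tau> \<in> Z \<Longrightarrow> 0 < \<bar>s - \<tau>\<bar> \<Longrightarrow> \<bar>s - \<tau>\<bar> \<le> \<bar>t - \<tau>\<bar> \<Longrightarrow> \<bar>t - \<tau>\<bar> \<le> \<kappa> \<Longrightarrow>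
        V s \<le> \<Gamma> * (\<bar>t - \<tau>\<bar> / \<bar>s - \<tau>\<bar>) powr \<Gamma> * V t"
    "\<tau> \<in> Z \<Longrightarrow> 0 < \<bar>s - \<tau>\<bar> \<Longrightarrow> \<bar>s - \<tau>\<bar> \<le> \<bar>t - \<tau>\<bar> \<Longrightarrow> \<bar>t - \<tau>\<bar> \<le> \<kappa> \<Longrightarrow>
        (\<bar>t - \<tau>\<bar> / \<bar>s - \<tau>\<bar>) powr (1 / \<Gamma>) * V t \<le> \<Gamma> * V s"
    "\<tau> \<in> Z \<Longrightarrow> 0 < \<bar>t - \<tau>\<bar> \<Longrightarrow> \<bar>t - \<tau>\<bar> \<le> \<kappa> \<Longrightarrow> \<exists>\<sigma>. \<bar>\<sigma>\<bar> \<le> \<Gamma> * V t / \<bar>t - \<tau>\<bar> \<and>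
        (\<forall>s. \<bar>s - t\<bar> \<le> \<bar>t - \<tau>\<bar> / \<Gamma> \<longrightarrow> V s \<le> V t + \<sigma> * (s - t) + \<Gamma> * V t / \<bar>t - \<tau>\<bar>\<^sup>2 * (s - t)\<^sup>2)"
proof -
  obtain b: "1 \<le> \<Gamma>" "0 < \<kappa>" "\<kappa> \<le> 1" "2 / \<kappa> \<le> \<Gamma>"
    and a1: "\<forall>t. (t + 2 * pi \<in> Z \<longleftrightarrow> t \<in> Z) \<and> (- t \<in> Z \<longleftrightarrow> t \<in> Z)"
    and a2: "\<forall>t. t \<notin> Z \<longrightarrow> V (t + 2 * pi) = V t \<and> V (- t) = V t \<and> 1 / \<Gamma> \<le> V t \<and> isCont V t"
    and a3: "\<forall>\<tau>\<in>Z. \<forall>\<tau>'\<in>Z. \<tau> \<noteq> \<tau>' \<longrightarrow> 4 * \<kappa> \<le> \<bar>\<tau> - \<tau>'\<bar>"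
    and a4: "\<forall>t. (\<forall>\<tau>\<in>Z. \<kappa> \<le> \<bar>t - \<tau>\<bar>) \<longrightarrow> V t \<le> \<Gamma> \<and> (\<exists>\<sigma>. \<bar>\<sigma>\<bar> \<le> \<Gamma> \<and>
        (\<forall>s. \<bar>s - t\<bar> \<le> 1 / \<Gamma> \<longrightarrow> V s \<le> V t + \<sigma> * (s - t) + \<Gamma> * (s - t)\<^sup>2))"
    and a5: "\<forall>\<tau>\<in>Z. \<forall>s t. 0 < \<bar>s - \<tau>\<bar> \<and> \<bar>s - \<tau>\<bar> \<le> \<bar>t - \<tau>\<bar> \<and> \<bar>t - \<tau>\<bar> \<le> \<kappa> \<longrightarrow>
        V s \<le> \<Gamma> * (\<bar>t - \<tau>\<bar> / \<bar>s - \<tau>\<bar>) powr \<Gamma> * V t \<and> (\<bar>t - \<tau>\<bar> / \<bar>s - \<tau>\<bar>) powr (1 / \<Gamma>) * V t \<le> \<Gamma> * V s"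
    and a6: "\<forall>\<tau>\<in>Z. \<forall>t. 0 < \<bar>t - \<tau>\<bar> \<and> \<bar>t - \<tau>\<bar> \<le> \<kappa> \<longrightarrow> (\<exists>\<sigma>. \<bar>\<sigma>\<bar> \<le> \<Gamma> * V t / \<bar>t - \<tau>\<bar> \<and>
        (\<forall>s. \<bar>s - t\<bar> \<le> \<bar>t - \<tau>\<bar> / \<Gamma> \<longrightarrow> V s \<le> V t + \<sigma> * (s - t) + \<Gamma> * V t / \<bar>t - \<tau>\<bar>\<^sup>2 * (s - t)\<^sup>2))"
    using assms unfolding landscape_def by (elim conjE) rule
  show "1 \<le> \<Gamma>" "0 < \<kappa>" "\<kappa> \<le> 1" "2 / \<kappa> \<le> \<Gamma>" by (fact b)+
  show "t + 2 * pi \<in> Z \<longleftrightarrow> t \<in> Z" "- t \<in> Z \<longleftrightarrow> t \<in> Z" using a1 by blast+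
  show "V (t + 2 * pi) = V t" "V (- t) = V t" "1 / \<Gamma> \<le> V t" "isCont V t" if "t \<notin> Z" using a2 that by blast+
  show "4 * \<kappa> \<le> \<bar>\<tau> - \<tau>'\<bar>" if "\<tau> \<in> Z" "\<tau>' \<in> Z" "\<tau> \<noteq> \<tau>'" using a3 that by blast
  show "V t \<le> \<Gamma>" if "\<forall>\<tau>\<in>Z. \<kappa> \<le> \<bar>t - \<tau>\<bar>" using a4 that by blast
  show "\<exists>\<sigma>. \<bar>\<sigma>\<bar> \<le> \<Gamma> \<and>
        (\<forall>s. \<bar>s - t\<bar> \<le> 1 / \<Gamma> \<longrightarrow> V s \<le> V t + \<sigma> * (s - t) + \<Gamma> * (s - t)\<^sup>2)" if "\<forall>\<tau>\<in>Z. \<kappa> \<le> \<bar>t - \<tau>\<bar>" using a4 that by blast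
  show "V s \<le> \<Gamma> * (\<bar>t - \<tau>\<bar> / \<bar>s - \<tau>\<bar>) powr \<Gamma> * V t"
    "(\<bar>t - \<tau>\<bar> / \<bar>s - \<tau>\<bar>) powr (1 / \<Gamma>) * V t \<le> \<Gamma> * V s"
    if "\<tau> \<in> Z" "0 < \<bar>s - \<tau>\<bar>" "\<bar>s - \<tau>\<bar> \<le> \<bar>t - \<tau>\<bar>" "\<bar>t - \<tau>\<bar> \<le> \<kappa>"
    using a5[rule_format, OF that(1), of s t] that by blast+
  show "\<exists>\<sigma>. \<bar>\<sigma>\<bar> \<le> \<Gamma> * V t / \<bar>t - \<tau>\<bar> \<and>
        (\<forall>s. \<bar>s - t\<bar> \<le> \<bar>t - \<tau>\<bar> / \<Gamma> \<longrightarrow> V s \<le> V t + \<sigma> * (s - t) + \<Gamma> * V t / \<bar>t - \<tau>\<bar>\<^sup>2 * (s - t)\<^sup>2)"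
    if "\<tau> \<in> Z" "0 < \<bar>t - \<tau>\<bar>" "\<bar>t - \<tau>\<bar> \<le> \<kappa>"
    using a6[rule_format, OF that(1), of t] that by blast
qed

text \<open>The critical radius \<open>\<rho>\<close> at a zero \<open>\<tau>\<close> is where \<open>V\<close> equals \<open>n\<close> times the distance to \<open>\<tau>\<close>. Polynomials of
  degree \<open>n\<close> do not see the decay of the weight below that radius. Adding the values on the two sides makes the
  definition invariant under reflection.\<close>

lemma critical_radius_exists:
  assumes L: "landscape \<Gamma> \<kappa> Z V" and \<tau>: "\<tau> \<in> Z" and n: "2 * \<Gamma> / \<kappa> \<le> real n"
  shows "\<exists>\<rho>. 0 < \<rho> \<and> \<rho> \<le> \<kappa> \<and> V (\<tau> + \<rho>) + V (\<tau> - \<rho>) = real n * \<rho>"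
proof -
  note D = landscapeD[OF L]
  have G: "1 \<le> \<Gamma>" by (rule D(1))
  have k: "0 < \<kappa>" "\<kappa> \<le> 1" by (rule D(2), rule D(3))
  have n0: "0 < real n"
  proof -
    have "0 < 2 * \<Gamma> / \<kappa>" using G k by simp
    then show ?thesis using n by linarith
  qed
  have nZ: "\<tau> + r \<notin> Z" "\<tau> - r \<notin> Z" if "0 < r" "r \<le> \<kappa>" for r
    using D(11)[OF \<tau>, of "\<tau> + r"] D(11)[OF \<tau>, of "\<tau> - r"] that k by auto
  have far: "\<forall>\<tau>'\<in>Z. \<kappa> \<le> \<bar>(\<tau> + \<kappa>) - \<tau>'\<bar>" "\<forall>\<tau>'\<in>Z. \<kappa> \<le> \<bar>(\<tau> - \<kappa>) - \<tau>'\<bar>"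
    using D(11)[OF \<tau>] k by (force simp: abs_if split: if_splits)+
  \<comment> \<open>At radius \<open>a\<close> the line \<open>n * r\<close> is still below the
    lower bound \<open>1 / \<Gamma>\<close> of \<open>V\<close>; at radius \<kappa> it has passed
    the sum of both values, by the assumption on \<open>n\<close>.\<close>
  define a where "a = min \<kappa> (1 / (real n * \<Gamma>))"
  have a: "0 < a" "a \<le> \<kappa>" "real n * a \<le> 1 / \<Gamma>"
  proof -
    show "0 < a" "a \<le> \<kappa>" unfolding a_def using k n0 G by auto
    have "real n * a \<le> real n * (1 / (real n * \<Gamma>))" unfolding a_def by (intro mult_left_mono) auto
    then show "real n * a \<le> 1 / \<Gamma>" using n0 by simp
  qed
  define f where "f r = V (\<tau> + r) + V (\<tau> - r) - real n * r" for r
  have "f \<kappa> \<le> 0"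
  proof -
    have "V (\<tau> + \<kappa>) \<le> \<Gamma>" "V (\<tau> - \<kappa>) \<le> \<Gamma>" using D(12) far by blast+
    moreover have "2 * \<Gamma> \<le> real n * \<kappa>" using n k by (simp add: field_simps)
    ultimately show ?thesis unfolding f_def by linarith
  qed
  moreover have "0 \<le> f a"
  proof -
    have "1 / \<Gamma> \<le> V (\<tau> + a)" "1 / \<Gamma> \<le> V (\<tau> - a)" using D(9) nZ[OF a(1,2)] by blast+
    moreover have "0 \<le> 1 / \<Gamma>" using G by simp
    ultimately show ?thesis unfolding f_def using a(3) by linarith
  qed
  moreover have "isCont f r" if "a \<le> r" "r \<le> \<kappa>" for r
  proof -
    have r: "0 < r" "r \<le> \<kappa>" using that a by auto
    have "isCont (\<lambda>r. V (\<tau> + r)) r" "isCont (\<lambda>r. V (\<tau> - r)) r"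
      using D(10)[OF nZ(1)[OF r]] D(10)[OF nZ(2)[OF r]]
      by (auto intro!: isCont_o2[where g = V] continuous_intros)
    then show ?thesis unfolding f_def by (intro continuous_intros)
  qed
  ultimately obtain r where "a \<le> r" "r \<le> \<kappa>" "f r = 0"
    using IVT2[of f \<kappa> 0 a] a by blast
  then show ?thesis using a unfolding f_def by (intro exI[of _ r]) auto
qed

text \<open>Comparing with radius \<kappa>, where \<open>V\<close> lies between
  \<open>1 / \<Gamma>\<close> and \<Gamma>, traps \<open>n * \<rho>\<close> between multiples of
  \<open>\<rho> powr - (1 / \<Gamma>)\<close> and \<open>\<rho> powr - \<Gamma>\<close>.\<close>

lemma critical_radius_size:
  assumes L: "landscape \<Gamma> \<kappa> Z V" and \<tau>: "\<tau> \<in> Z" and n: "1 \<le> n"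
    and \<rho>: "0 < \<rho>" "\<rho> \<le> \<kappa>" "V (\<tau> + \<rho>) + V (\<tau> - \<rho>) = real n * \<rho>"
  shows "\<rho> \<le> (2 * \<Gamma>\<^sup>2) powr (1 / (1 + \<Gamma>)) * real n powr - (1 / (1 + \<Gamma>))"
    "\<kappa> powr (1 / \<Gamma>) / \<Gamma>\<^sup>2 * \<rho> powr - (1 / \<Gamma>) \<le> real n * \<rho>"
proof -
  note D = landscapeD[OF L]
  have G: "1 \<le> \<Gamma>" by (rule D(1))
  have k: "0 < \<kappa>" "\<kappa> \<le> 1" by (rule D(2), rule D(3))
  have far: "\<forall>\<tau>'\<in>Z. \<kappa> \<le> \<bar>(\<tau> + \<kappa>) - \<tau>'\<bar>"
    using D(11)[OF \<tau>] k by (force simp: abs_if split: if_splits)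
  have nZ: "\<tau> + r \<notin> Z" "\<tau> - r \<notin> Z" if "0 < r" "r \<le> \<kappa>" for r
    using D(11)[OF \<tau>, of "\<tau> + r"] D(11)[OF \<tau>, of "\<tau> - r"] that k by auto
  have G0: "0 < 1 / \<Gamma>" using G by simp
  have Vk: "1 / \<Gamma> \<le> V (\<tau> + \<kappa>)" "V (\<tau> + \<kappa>) \<le> \<Gamma>" using D(9)[OF nZ(1)] D(12)[OF far] k by auto
  have V0: "0 < V (\<tau> + \<rho>)" "0 < V (\<tau> - \<rho>)"
    using D(9)[OF nZ(1)[OF \<rho>(1,2)]] D(9)[OF nZ(2)[OF \<rho>(1,2)]] G0 by linarith+
  have up: "V (\<tau> + \<rho>) \<le> \<Gamma> * (\<kappa> / \<rho>) powr \<Gamma> * V (\<tau> + \<kappa>)" "V (\<tau> - \<rho>) \<le> \<Gamma> * (\<kappa> / \<rho>) powr \<Gamma> * V (\<tau> + \<kappa>)"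
    using D(14)[OF \<tau>, of "\<tau> + \<rho>" "\<tau> + \<kappa>"] D(14)[OF \<tau>, of "\<tau> - \<rho>" "\<tau> + \<kappa>"] \<rho> k by auto
  have "real n * \<rho> \<le> 2 * (\<Gamma> * (\<kappa> / \<rho>) powr \<Gamma> * V (\<tau> + \<kappa>))" using up \<rho>(3) by linarith
  also have "\<dots> \<le> 2 * (\<Gamma> * (1 / \<rho>) powr \<Gamma> * \<Gamma>)"
    using Vk G k \<rho> order.trans[OF less_imp_le[OF G0] Vk(1)]
    by (intro mult_left_mono mult_mono powr_mono2 divide_right_mono) auto
  also have "\<dots> = 2 * \<Gamma>\<^sup>2 * \<rho> powr - \<Gamma>" using \<rho> by (simp add: powr_divide powr_minus_divide power2_eq_square)
  finally have "real n * \<rho> * \<rho> powr \<Gamma> \<le> 2 * \<Gamma>\<^sup>2 * \<rho> powr - \<Gamma> * \<rho> powr \<Gamma>" by (intro mult_right_mono) auto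
  also have "\<dots> = 2 * \<Gamma>\<^sup>2" using \<rho> by (simp add: powr_minus)
  also have "real n * \<rho> * \<rho> powr \<Gamma> = real n * \<rho> powr (1 + \<Gamma>)" using \<rho> by (simp add: powr_add)
  finally have "\<rho> powr (1 + \<Gamma>) \<le> 2 * \<Gamma>\<^sup>2 / real n" using n by (simp add: field_simps)
  then have "(\<rho> powr (1 + \<Gamma>)) powr (1 / (1 + \<Gamma>)) \<le> (2 * \<Gamma>\<^sup>2 / real n) powr (1 / (1 + \<Gamma>))"
    using G by (intro powr_mono2) auto
  then show "\<rho> \<le> (2 * \<Gamma>\<^sup>2) powr (1 / (1 + \<Gamma>)) * real n powr - (1 / (1 + \<Gamma>))"
    using G \<rho> n by (simp add: powr_powr powr_divide powr_minus_divide)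
  have "(\<kappa> / \<rho>) powr (1 / \<Gamma>) * V (\<tau> + \<kappa>) \<le> \<Gamma> * V (\<tau> + \<rho>)"
    using D(15)[OF \<tau>, of "\<tau> + \<rho>" "\<tau> + \<kappa>"] \<rho> k by auto
  moreover have "(\<kappa> / \<rho>) powr (1 / \<Gamma>) * (1 / \<Gamma>) \<le> (\<kappa> / \<rho>) powr (1 / \<Gamma>) * V (\<tau> + \<kappa>)"
    using Vk by (intro mult_left_mono) auto
  ultimately have "(\<kappa> / \<rho>) powr (1 / \<Gamma>) * (1 / \<Gamma>) \<le> \<Gamma> * V (\<tau> + \<rho>)" by linarith
  then have "(\<kappa> / \<rho>) powr (1 / \<Gamma>) / \<Gamma>\<^sup>2 \<le> V (\<tau> + \<rho>)" using G by (simp add: field_simps power2_eq_square)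
  also have "\<dots> \<le> real n * \<rho>" using \<rho>(3) V0 by linarith
  finally show "\<kappa> powr (1 / \<Gamma>) / \<Gamma>\<^sup>2 * \<rho> powr - (1 / \<Gamma>) \<le> real n * \<rho>"
    using \<rho> k by (simp add: powr_divide powr_minus_divide mult.commute)
qed

lemma powr_eventually_le:
  assumes "0 < (a::real)" "0 < c"
  shows "\<exists>n0. \<forall>n\<ge>n0. c \<le> real n powr a"
proof (intro exI allI impI)
  fix n assume n: "nat \<lceil>c powr (1 / a)\<rceil> \<le> n"
  have "c = (c powr (1 / a)) powr a" using assms by (simp add: powr_powr)
  also have "\<dots> \<le> real n powr a" using n assms by (intro powr_mono2) (auto simp: nat_le_iff ceiling_le_iff)
  finally show "c \<le> real n powr a" .
qed

text \<open>The first bound keeps the height of truncation below \<open>n\<close>; the second makes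
  \<open>exp (- n * \<rho>)\<close> smaller than any power of \<open>n\<close>. The sizes above give
  \<open>n * \<rho> \<ge> c * n powr (2 * \<gamma>)\<close>, and half of the exponent is spent on
  the constant \<open>c\<close>.\<close>

lemma critical_radius_bounds:
  assumes L: "landscape \<Gamma> \<kappa> Z V"
  defines "\<gamma> \<equiv> 1 / (2 * (\<Gamma> * (1 + \<Gamma>)))"
  shows "\<exists>n0. \<forall>n\<ge>n0. \<forall>\<tau>\<in>Z. \<forall>\<rho>. 0 < \<rho> \<and> \<rho> \<le> \<kappa> \<and> V (\<tau> + \<rho>) + V (\<tau> - \<rho>) = real n * \<rho> \<longrightarrow>
     C * \<rho> \<le> 1 \<and> real n powr \<gamma> \<le> real n * \<rho>"
proof -
  note D = landscapeD[OF L]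
  have G: "1 \<le> \<Gamma>" by (rule D(1))
  have k: "0 < \<kappa>" "\<kappa> \<le> 1" by (rule D(2), rule D(3))
  define e where "e = 1 / (1 + \<Gamma>)"
  have e: "0 < e" unfolding e_def using G by simp
  define M where "M = (2 * \<Gamma>\<^sup>2) powr e"
  have M: "0 < M" unfolding M_def using G by simp
  define c where "c = \<kappa> powr (1 / \<Gamma>) / \<Gamma>\<^sup>2 * M powr - (1 / \<Gamma>)"
  have c: "0 < c" unfolding c_def using k G M by simp
  have g: "0 < \<gamma>" unfolding \<gamma>_def using G by simp
  obtain n1 where n1: "\<And>n. n1 \<le> n \<Longrightarrow> max 1 (C * M) \<le> real n powr e" 
  proof -
    have "0 < max 1 (C * M)" by simp
    from powr_eventually_le[OF e this] show ?thesis using that by blast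
  qed
  obtain n2 where n2: "\<And>n. n2 \<le> n \<Longrightarrow> 1 / c \<le> real n powr \<gamma>" using powr_eventually_le[OF g, of "1 / c"] c by auto
  have "C * \<rho> \<le> 1 \<and> real n powr \<gamma> \<le> real n * \<rho>"
    if n: "max 1 (max n1 n2) \<le> n" and \<tau>: "\<tau> \<in> Z" and \<rho>: "0 < \<rho>" "\<rho> \<le> \<kappa>" "V (\<tau> + \<rho>) + V (\<tau> - \<rho>) = real n * \<rho>" for n \<tau> \<rho>
  proof -
    have n': "1 \<le> n" "n1 \<le> n" "n2 \<le> n" using n by auto
    have s: "\<rho> \<le> M * real n powr - e" "\<kappa> powr (1 / \<Gamma>) / \<Gamma>\<^sup>2 * \<rho> powr - (1 / \<Gamma>) \<le> real n * \<rho>"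
      using critical_radius_size[OF L \<tau> n'(1) \<rho>] unfolding M_def e_def by auto
    have "C * \<rho> \<le> 1"
    proof (cases "0 \<le> C")
      case True
      have "C * \<rho> \<le> C * (M * real n powr - e)" using s True by (intro mult_left_mono) auto
      also have "\<dots> = (C * M) * real n powr - e" by simp
      also have "\<dots> \<le> real n powr e * real n powr - e" using n1[OF n'(2)] by (intro mult_right_mono) auto
      also have "\<dots> = 1" using n' by (simp flip: powr_add)
      finally show ?thesis .
    next
      case False
      then have "C * \<rho> \<le> 0" using \<rho> by (simp add: mult_le_0_iff)
      then show ?thesis by simp
    qed
    moreover have "real n powr \<gamma> \<le> real n * \<rho>"
    proof -
      have "(M * real n powr - e) powr - (1 / \<Gamma>) \<le> \<rho> powr - (1 / \<Gamma>)"
        using s(1) \<rho> G by (intro powr_mono2') auto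
      then have "\<kappa> powr (1 / \<Gamma>) / \<Gamma>\<^sup>2 * (M * real n powr - e) powr - (1 / \<Gamma>) \<le> real n * \<rho>"
        using s(2) mult_left_mono[of "(M * real n powr - e) powr - (1 / \<Gamma>)" "\<rho> powr - (1 / \<Gamma>)" "\<kappa> powr (1 / \<Gamma>) / \<Gamma>\<^sup>2"] by simp
      moreover have "(M * real n powr - e) powr - (1 / \<Gamma>) = M powr - (1 / \<Gamma>) * real n powr (2 * \<gamma>)"
        using M G by (simp add: powr_mult powr_powr \<gamma>_def e_def mult.commute)
      ultimately have "c * real n powr (2 * \<gamma>) \<le> real n * \<rho>" unfolding c_def by (simp add: mult_ac)
      moreover have "real n powr \<gamma> \<le> c * real n powr (2 * \<gamma>)"
      proof -
        have "1 \<le> c * real n powr \<gamma>" using n2[OF n'(3)] c by (simp add: field_simps)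
        then have "1 * real n powr \<gamma> \<le> c * real n powr \<gamma> * real n powr \<gamma>" by (intro mult_right_mono) auto
        then show ?thesis by (simp add: mult.assoc flip: powr_add)
      qed
      ultimately show ?thesis by linarith
    qed
    ultimately show ?thesis by blast
  qed
  then show ?thesis by blast
qed

text \<open>There are three kinds of points. Far from \<open>Z\<close> the fixed scale
  \<open>1 / \<Gamma>\<close> serves. Where the truncation acts, \<open>U\<close> attains its
  maximum near \<tau>, so slope 0 and scale \<rho> do. Elsewhere \<open>V t\<close> is at most the
  height, which forces \<open>\<rho> \<le> M * \<delta>\<close> for the distance \<delta> to \<tau>;
  then \<open>V t = O(n * \<delta>)\<close>, and the tangent parabola of \<open>V\<close> has the
  admissible curvature \<open>O(n / \<delta>)\<close>. The last clause records what the Remez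
  inequality needs where \<open>U\<close> differs from \<open>V\<close>.\<close>

lemma landscape_truncation:
  assumes L: "landscape \<Gamma> \<kappa> Z V" and C2: "\<Gamma> \<le> C2"
  defines "\<gamma> \<equiv> 1 / (2 * (\<Gamma> * (1 + \<Gamma>)))"
  shows "\<exists>A a0 n0. 1 \<le> A \<and> 0 < a0 \<and> a0 \<le> 1 \<and> (\<forall>n\<ge>n0. \<exists>U. admissible A a0 \<kappa> n U \<and>
     (\<forall>t. t \<notin> Z \<longrightarrow> U t \<le> V t) \<and>
     (\<forall>t. (t \<notin> Z \<and> U t = V t) \<or>
        (\<exists>\<tau> \<rho>. 0 < \<rho> \<and> \<rho> \<le> \<kappa> \<and> \<bar>t - \<tau>\<bar> \<le> \<rho> \<and> C2 * (real n * \<rho>) \<le> U t \<and> real n powr \<gamma> \<le> real n * \<rho> \<and>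
           (\<forall>s. \<rho> \<le> \<bar>s - \<tau>\<bar> \<and> \<bar>s - \<tau>\<bar> \<le> \<kappa> \<longrightarrow> U s \<le> \<Gamma> * (real n * \<rho>)))))"
proof -
  note D = landscapeD[OF L]
  have G: "1 \<le> \<Gamma>" by (rule D(1))
  have k: "0 < \<kappa>" "\<kappa> \<le> 1" "2 / \<kappa> \<le> \<Gamma>" by (rule D(2), rule D(3), rule D(4))
  have Gk: "1 / \<Gamma> \<le> \<kappa> / 2"
  proof -
    have "2 \<le> \<Gamma> * \<kappa>" using k by (simp add: field_simps)
    then show ?thesis using G by (simp add: field_simps)
  qed
  have V1: "1 / \<Gamma> \<le> V t" if "t \<notin> Z" for t by (rule D(9)[OF that])
  have G0: "0 < 1 / \<Gamma>" using G by simp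
  have V0: "0 < V t" if "t \<notin> Z" for t using V1[OF that] G0 by linarith
  have C21: "1 \<le> C2" using C2 G by linarith
  obtain n1 where n1: "\<And>n \<tau> \<rho>. n1 \<le> n \<Longrightarrow> \<tau> \<in> Z \<Longrightarrow> 0 < \<rho> \<Longrightarrow> \<rho> \<le> \<kappa> \<Longrightarrow> V (\<tau> + \<rho>) + V (\<tau> - \<rho>) = real n * \<rho> \<Longrightarrow>
     C2 * \<rho> \<le> 1 \<and> real n powr \<gamma> \<le> real n * \<rho>"
    using critical_radius_bounds[OF L, of C2] unfolding \<gamma>_def by blast
  \<comment> \<open>Towards \<tau> the potential grows at least like the power
    \<open>1 / \<Gamma>\<close>, so a point with \<open>V \<le> C2 * n * \<rho>\<close> cannot be
    closer to \<tau> than \<open>\<rho> / M\<close>.\<close>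
  define M where "M = (2 * \<Gamma> * C2) powr \<Gamma>"
  have M1: "1 \<le> M" unfolding M_def
  proof (intro ge_one_powr_ge_zero)
    have "1 * 1 \<le> (2 * \<Gamma>) * C2" using G C21 by (intro mult_mono) auto
    then show "1 \<le> 2 * \<Gamma> * C2" by simp
  qed (use G in simp)
  define A where "A = \<Gamma> * C2 * M"
  have CM: "1 \<le> C2 * M" using mult_mono[of 1 C2 1 M] C21 M1 by simp
  have A: "\<Gamma> \<le> A" "C2 * M \<le> A" "1 \<le> A"
  proof -
    show "\<Gamma> \<le> A" unfolding A_def using mult_left_mono[OF CM, of \<Gamma>] G by (simp add: mult.assoc)
    then show "1 \<le> A" using G by linarith
    show "C2 * M \<le> A" unfolding A_def using mult_right_mono[OF G, of "C2 * M"] CM by (simp add: mult.assoc)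
  qed
  define a0 where "a0 = 1 / (C2 * M * \<Gamma>\<^sup>2)"
  have G2: "\<Gamma> \<le> \<Gamma>\<^sup>2" "1 \<le> \<Gamma>\<^sup>2" using G self_le_power[of \<Gamma> 2] one_le_power[of \<Gamma> 2] by auto
  have a0: "0 < a0" "a0 \<le> 1" "a0 \<le> 1 / \<Gamma>"
  proof -
    have "0 < (C2 * M) * \<Gamma>\<^sup>2" using CM G2 by (intro mult_pos_pos[of "C2 * M"]) linarith+
    then show "0 < a0" unfolding a0_def by simp
    have *: "\<Gamma> \<le> C2 * M * \<Gamma>\<^sup>2" using mult_mono[OF CM G2(1)] CM G by simp
    then show "a0 \<le> 1 / \<Gamma>" unfolding a0_def using G by (intro divide_left_mono) auto
    moreover have "1 / \<Gamma> \<le> 1" using G by simp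
    ultimately show "a0 \<le> 1" by linarith
  qed
  define n0 where "n0 = max (max 1 n1) (nat \<lceil>2 * \<Gamma> / \<kappa>\<rceil>)"
  have "\<exists>U. admissible A a0 \<kappa> n U \<and>
     (\<forall>t. t \<notin> Z \<longrightarrow> U t \<le> V t) \<and>
     (\<forall>t. (t \<notin> Z \<and> U t = V t) \<or>
        (\<exists>\<tau> \<rho>. 0 < \<rho> \<and> \<rho> \<le> \<kappa> \<and> \<bar>t - \<tau>\<bar> \<le> \<rho> \<and> C2 * (real n * \<rho>) \<le> U t \<and> real n powr \<gamma> \<le> real n * \<rho> \<and>
           (\<forall>s. \<rho> \<le> \<bar>s - \<tau>\<bar> \<and> \<bar>s - \<tau>\<bar> \<le> \<kappa> \<longrightarrow> U s \<le> \<Gamma> * (real n * \<rho>))))" if n: "n0 \<le> n" for n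
  proof -
    have n': "1 \<le> n" "n1 \<le> n" "2 * \<Gamma> / \<kappa> \<le> real n" using n unfolding n0_def by (auto simp: nat_le_iff ceiling_le_iff)
    have nr: "1 \<le> real n" using n' by simp
    have nG: "\<Gamma> \<le> real n"
    proof -
      have "\<Gamma> * 1 \<le> \<Gamma> * (2 / \<kappa>)" using k G by (intro mult_left_mono) (auto simp: field_simps)
      then show ?thesis using n'(3) by (simp add: mult.commute)
    qed
    define R where "R \<tau> r \<longleftrightarrow> 0 < r \<and> r \<le> \<kappa> \<and> V (\<tau> + r) + V (\<tau> - r) = real n * r" for \<tau> r
    \<comment> \<open>The choice depends on \<tau> only through the predicate
      \<open>R \<tau>\<close>, which is invariant under the period and under reflection; so the
      radius is invariant as well, and with it \<open>U\<close>.\<close>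
    define \<rho> where "\<rho> \<tau> = (SOME r. R \<tau> r)" for \<tau>
    have R\<rho>: "R \<tau> (\<rho> \<tau>)" if "\<tau> \<in> Z" for \<tau>
      unfolding \<rho>_def using critical_radius_exists[OF L that n'(3)] unfolding R_def by (rule someI_ex)
    have nZ: "\<tau> + r \<notin> Z" "\<tau> - r \<notin> Z" if "\<tau> \<in> Z" "0 < r" "r \<le> \<kappa>" for \<tau> r
      using D(11)[OF that(1), of "\<tau> + r"] D(11)[OF that(1), of "\<tau> - r"] that k by auto
    have nZ': "s \<notin> Z" if "\<tau> \<in> Z" "0 < \<bar>s - \<tau>\<bar>" "\<bar>s - \<tau>\<bar> \<le> \<kappa>" for \<tau> s
      using D(11)[OF that(1), of s] that k by auto
    have \<rho>: "0 < \<rho> \<tau>" "\<rho> \<tau> \<le> \<kappa>" "V (\<tau> + \<rho> \<tau>) + V (\<tau> - \<rho> \<tau>) = real n * \<rho> \<tau>" "C2 * \<rho> \<tau> \<le> 1" "real n powr \<gamma> \<le> real n * \<rho> \<tau>" if "\<tau> \<in> Z" for \<tau>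
      using R\<rho>[OF that] n1[OF n'(2) that, of "\<rho> \<tau>"] unfolding R_def by auto
    have R_per: "R (\<tau> + 2 * pi) = R \<tau>" and R_ev: "R (- \<tau>) = R \<tau>" if "\<tau> \<in> Z" for \<tau>
    proof -
      have "V (\<tau> + 2 * pi + r) = V (\<tau> + r)" "V (\<tau> + 2 * pi - r) = V (\<tau> - r)"
        "V (- \<tau> + r) = V (\<tau> - r)" "V (- \<tau> - r) = V (\<tau> + r)" if "0 < r" "r \<le> \<kappa>" for r
        using D(7)[OF nZ(1)[OF \<open>\<tau> \<in> Z\<close> that]] D(7)[OF nZ(2)[OF \<open>\<tau> \<in> Z\<close> that]]
          D(8)[OF nZ(1)[OF \<open>\<tau> \<in> Z\<close> that]] D(8)[OF nZ(2)[OF \<open>\<tau> \<in> Z\<close> that]] by (simp_all add: algebra_simps)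
      then show "R (\<tau> + 2 * pi) = R \<tau>" "R (- \<tau>) = R \<tau>" unfolding R_def by (auto simp: fun_eq_iff add.commute)
    qed
    have \<rho>_per: "\<rho> (\<tau> + 2 * pi) = \<rho> \<tau>" and \<rho>_ev: "\<rho> (- \<tau>) = \<rho> \<tau>" if "\<tau> \<in> Z" for \<tau>
      unfolding \<rho>_def R_per[OF that] R_ev[OF that] by auto
    define nr where "nr t \<tau> \<longleftrightarrow> \<tau> \<in> Z \<and> \<bar>t - \<tau>\<bar> < \<kappa>" for t \<tau>
    have nr_unique: "\<tau> = \<tau>'" if "nr t \<tau>" "nr t \<tau>'" for t \<tau> \<tau>'
    proof (rule ccontr)
      assume "\<tau> \<noteq> \<tau>'"
      then have "4 * \<kappa> \<le> \<bar>\<tau> - \<tau>'\<bar>" using D(11) that unfolding nr_def by blast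
      then show False using that k unfolding nr_def by linarith
    qed
    define H where "H \<tau> = C2 * (real n * \<rho> \<tau>)" for \<tau>
    \<comment> \<open>At a point of \<open>Z\<close>, where \<open>V\<close> has no meaning, the
      height itself is taken.\<close>
    define U where "U t = (if \<exists>\<tau>. nr t \<tau> then let h = H (THE \<tau>. nr t \<tau>) in if t \<in> Z then h else min (V t) h else V t)" for t
    have U_near: "U t = (if t \<in> Z then H \<tau> else min (V t) (H \<tau>))" if "nr t \<tau>" for t \<tau>
    proof -
      have "(THE \<tau>. nr t \<tau>) = \<tau>" using that nr_unique by blast
      then show ?thesis unfolding U_def using that by (auto simp: Let_def)
    qed
    have U_far: "U t = V t" "t \<notin> Z" "V t \<le> \<Gamma>" if "\<nexists>\<tau>. nr t \<tau>" for t
    proof -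
      show "U t = V t" unfolding U_def using that by auto
      show "t \<notin> Z" using that k unfolding nr_def by force
      show "V t \<le> \<Gamma>" using that unfolding nr_def by (intro D(12)) (auto simp: not_less)
    qed
    have UV: "U t \<le> V t" if "t \<notin> Z" for t
      using U_near[of t] U_far[of t] that by (cases "\<exists>\<tau>. nr t \<tau>") auto
    have H0: "0 \<le> H \<tau>" "H \<tau> \<le> real n" if "\<tau> \<in> Z" for \<tau>
    proof -
      show "0 \<le> H \<tau>" unfolding H_def using \<rho>[OF that] C21 by simp
      have "real n * (C2 * \<rho> \<tau>) \<le> real n * 1" using \<rho>[OF that] by (intro mult_left_mono) auto
      then show "H \<tau> \<le> real n" unfolding H_def by (simp add: mult_ac)
    qed
    have U0: "0 \<le> U t \<and> U t \<le> real n" for t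
    proof (cases "\<exists>\<tau>. nr t \<tau>")
      case True
      then obtain \<tau> where \<tau>: "nr t \<tau>" by blast
      then show ?thesis using U_near[OF \<tau>] H0[of \<tau>] V0[of t] unfolding nr_def by (auto simp: min_def)
    next
      case False
      then show ?thesis using U_far[OF False] V0[of t] nG by auto
    qed
    have nr_per: "nr (t + 2 * pi) (\<tau> + 2 * pi) \<longleftrightarrow> nr t \<tau>" and nr_ev: "nr (- t) (- \<tau>) \<longleftrightarrow> nr t \<tau>" for t \<tau>
      unfolding nr_def using D(5)[of \<tau>] D(6)[of \<tau>] by (auto simp: abs_minus_commute)
    have nr_per': "(\<exists>\<tau>. nr (t + 2 * pi) \<tau>) \<longleftrightarrow> (\<exists>\<tau>. nr t \<tau>)" for t
      using nr_per by (metis diff_add_cancel)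
    have nr_ev': "(\<exists>\<tau>. nr (- t) \<tau>) \<longleftrightarrow> (\<exists>\<tau>. nr t \<tau>)" for t
      using nr_ev by (metis add.inverse_inverse)
    have U_per: "U (t + 2 * pi) = U t" for t
    proof (cases "\<exists>\<tau>. nr t \<tau>")
      case True
      then obtain \<tau> where \<tau>: "nr t \<tau>" by blast
      have "H (\<tau> + 2 * pi) = H \<tau>" unfolding H_def using \<rho>_per \<tau> unfolding nr_def by simp
      then show ?thesis using U_near[OF \<tau>] U_near[of "t + 2 * pi" "\<tau> + 2 * pi"] nr_per \<tau> D(5)[of t] D(7)[of t] by auto
    next
      case False
      then show ?thesis using U_far[OF False] U_far(1)[of "t + 2 * pi"] nr_per' D(7)[of t] by auto
    qed
    have U_ev: "U (- t) = U t" for t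
    proof (cases "\<exists>\<tau>. nr t \<tau>")
      case True
      then obtain \<tau> where \<tau>: "nr t \<tau>" by blast
      have "H (- \<tau>) = H \<tau>" unfolding H_def using \<rho>_ev \<tau> unfolding nr_def by simp
      then show ?thesis using U_near[OF \<tau>] U_near[of "- t" "- \<tau>"] nr_ev \<tau> D(6)[of t] D(8)[of t] by auto
    next
      case False
      then show ?thesis using U_far[OF False] U_far(1)[of "- t"] nr_ev' D(8)[of t] by auto
    qed
    \<comment> \<open>Beyond the critical radius \<open>V\<close> is at most
      \<open>\<Gamma> * n * \<rho>\<close>, hence at most the height, so the truncation acts only
      inside it.\<close>
    have outer: "V s \<le> \<Gamma> * (real n * \<rho> \<tau>)" if \<tau>: "\<tau> \<in> Z" and s: "\<rho> \<tau> \<le> \<bar>s - \<tau>\<bar>" "\<bar>s - \<tau>\<bar> \<le> \<kappa>" for \<tau> s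
    proof -
      note r = \<rho>[OF \<tau>]
      have "(\<bar>s - \<tau>\<bar> / \<rho> \<tau>) powr (1 / \<Gamma>) * V s \<le> \<Gamma> * V (\<tau> + \<rho> \<tau>)"
        using D(15)[OF \<tau>, of "\<tau> + \<rho> \<tau>" s] s r by auto
      moreover have "1 * V s \<le> (\<bar>s - \<tau>\<bar> / \<rho> \<tau>) powr (1 / \<Gamma>) * V s"
      proof (intro mult_right_mono ge_one_powr_ge_zero)
        show "1 \<le> \<bar>s - \<tau>\<bar> / \<rho> \<tau>" using s r by simp
        have "0 < \<bar>s - \<tau>\<bar>" using s r by linarith
        then show "0 \<le> V s" using V0[OF nZ'[OF \<tau> _ s(2)]] by simp
      qed (use G in simp)
      moreover have "\<Gamma> * V (\<tau> + \<rho> \<tau>) \<le> \<Gamma> * (real n * \<rho> \<tau>)"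
        using r V0[OF nZ(2)[OF \<tau> r(1,2)]] G by (intro mult_left_mono) linarith+
      ultimately show ?thesis by linarith
    qed
    \<comment> \<open>Leaving the neighbourhood of \<tau> does not lead near another zero, because
      zeros are at least \<open>4 * \<kappa>\<close> apart.\<close>
    have away: "U s \<le> \<Gamma>" if \<tau>: "\<tau> \<in> Z" and "\<kappa> \<le> \<bar>s - \<tau>\<bar>" "\<bar>s - \<tau>\<bar> \<le> 2 * \<kappa>" for \<tau> s
    proof -
      have "\<nexists>\<tau>'. nr s \<tau>'"
      proof
        assume "\<exists>\<tau>'. nr s \<tau>'"
        then obtain \<tau>' where t': "\<tau>' \<in> Z" "\<bar>s - \<tau>'\<bar> < \<kappa>" unfolding nr_def by blast
        then have "\<tau>' \<noteq> \<tau>" using that by auto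
        then show False using D(11)[OF \<tau> t'(1)] t'(2) that k by linarith
      qed
      then show ?thesis using U_far by auto
    qed
    have local: "\<exists>d \<sigma>. 0 < d \<and> d \<le> 1 \<and> a0 \<le> real n * d \<and> \<bar>\<sigma>\<bar> \<le> A * real n \<and>
        (\<forall>s. \<bar>s - t\<bar> \<le> d \<longrightarrow> U s - U t \<le> \<sigma> * (s - t) + A * real n * (s - t)\<^sup>2 / d + A) \<and>
        (\<forall>s. \<bar>s - t\<bar> \<le> \<kappa> \<longrightarrow> U s - U t \<le> A * real n * d + A)" for t
    proof (cases "\<exists>\<tau>. nr t \<tau>")
      case False
      note f = U_far[OF False]
      have ft: "\<forall>\<tau>\<in>Z. \<kappa> \<le> \<bar>t - \<tau>\<bar>" using False unfolding nr_def by (auto simp: not_less)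
      obtain \<sigma> where s: "\<bar>\<sigma>\<bar> \<le> \<Gamma>" "\<And>s. \<bar>s - t\<bar> \<le> 1 / \<Gamma> \<Longrightarrow> V s \<le> V t + \<sigma> * (s - t) + \<Gamma> * (s - t)\<^sup>2"
        using D(13)[OF ft] by blast
      show ?thesis
      proof (rule exI[of _ "1 / \<Gamma>"], rule exI[of _ \<sigma>], intro conjI allI impI)
        show "0 < 1 / \<Gamma>" "1 / \<Gamma> \<le> 1" using G by auto
        have "1 * (1 / \<Gamma>) \<le> real n * (1 / \<Gamma>)" using nr G by (intro mult_right_mono) auto
        then show "a0 \<le> real n * (1 / \<Gamma>)" using a0 by linarith
        have "\<Gamma> * 1 \<le> A * real n" using A nr G by (intro mult_mono) auto
        then show "\<bar>\<sigma>\<bar> \<le> A * real n" using s by linarith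
      next
        fix u assume u: "\<bar>u - t\<bar> \<le> 1 / \<Gamma>"
        have "u \<notin> Z"
        proof
          assume "u \<in> Z"
          then have "\<kappa> \<le> \<bar>t - u\<bar>" using ft by blast
          then show False using u Gk k by linarith
        qed
        then have "U u - U t \<le> \<sigma> * (u - t) + \<Gamma> * (u - t)\<^sup>2" using UV[of u] s(2)[OF u] f by linarith
        also have "\<Gamma> * (u - t)\<^sup>2 \<le> A * real n * (u - t)\<^sup>2 / (1 / \<Gamma>)"
        proof -
          have "\<Gamma> * 1 * 1 \<le> A * real n * \<Gamma>" using A nr G by (intro mult_mono) auto
          then show ?thesis using mult_right_mono[of \<Gamma> "A * real n * \<Gamma>" "(u - t)\<^sup>2"] by (simp add: mult_ac)
        qed
        finally show "U u - U t \<le> \<sigma> * (u - t) + A * real n * (u - t)\<^sup>2 / (1 / \<Gamma>) + A" using A by linarith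
      next
        fix u assume "\<bar>u - t\<bar> \<le> \<kappa>"
        have "U u - U t \<le> real n" using U0[of u] U0[of t] by linarith
        also have "\<dots> \<le> A * real n * (1 / \<Gamma>)"
          using mult_right_mono[OF A(1), of "real n * (1 / \<Gamma>)"] G by simp
        finally show "U u - U t \<le> A * real n * (1 / \<Gamma>) + A" using A by linarith
      qed
    next
      case True
      then obtain \<tau> where \<tau>: "nr t \<tau>" by blast
      then have \<tau>Z: "\<tau> \<in> Z" and tk: "\<bar>t - \<tau>\<bar> < \<kappa>" unfolding nr_def by auto
      note r = \<rho>[OF \<tau>Z]
      define \<delta> where "\<delta> = \<bar>t - \<tau>\<bar>"
      have UH: "U s \<le> H \<tau>" if "\<bar>s - \<tau>\<bar> < \<kappa>" for s
        using U_near[of s \<tau>] that \<tau>Z unfolding nr_def by auto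
      show ?thesis
      proof (cases "t \<in> Z \<or> H \<tau> < V t")
        case True
        then have UtH: "U t = H \<tau>" using U_near[OF \<tau>] by auto
        have diff: "U s - U t \<le> A" if s: "\<bar>s - t\<bar> \<le> \<kappa>" for s
        proof (cases "\<bar>s - \<tau>\<bar> < \<kappa>")
          case True then show ?thesis using UH[OF True] UtH A by linarith
        next
          case False
          then have "U s \<le> \<Gamma>" using s tk by (intro away[OF \<tau>Z]) linarith+
          then show ?thesis using UtH H0[OF \<tau>Z] A by linarith
        qed
        have A0: "0 \<le> A * real n" using A by simp
        show ?thesis
        proof (rule exI[of _ "\<rho> \<tau>"], rule exI[of _ 0], intro conjI allI impI)
          show "0 < \<rho> \<tau>" "\<rho> \<tau> \<le> 1" using r k by auto
          have "1 / \<Gamma> + 1 / \<Gamma> \<le> real n * \<rho> \<tau>"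
            using V1[OF nZ(1)[OF \<tau>Z r(1,2)]] V1[OF nZ(2)[OF \<tau>Z r(1,2)]] r(3) by linarith
          then show "a0 \<le> real n * \<rho> \<tau>" using a0 G0 by linarith
          show "\<bar>0\<bar> \<le> A * real n" using A0 by simp
        next
          fix s assume "\<bar>s - t\<bar> \<le> \<rho> \<tau>"
          then have "U s - U t \<le> A" using r by (intro diff) linarith
          moreover have "0 \<le> A * real n * (s - t)\<^sup>2 / \<rho> \<tau>" using A0 r by simp
          ultimately show "U s - U t \<le> 0 * (s - t) + A * real n * (s - t)\<^sup>2 / \<rho> \<tau> + A" by simp
        next
          fix s assume "\<bar>s - t\<bar> \<le> \<kappa>"
          from diff[OF this] show "U s - U t \<le> A * real n * \<rho> \<tau> + A" using A0 r mult_nonneg_nonneg[of "A * real n" "\<rho> \<tau>"] by linarith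
        qed
      next
        case F: False
        then have tZ: "t \<notin> Z" and VH: "V t \<le> H \<tau>" by auto
        then have UtV: "U t = V t" using U_near[OF \<tau>] by auto
        have d0: "0 < \<delta>" unfolding \<delta>_def using tZ \<tau>Z by auto
        have dk: "\<delta> < \<kappa>" "\<delta> \<le> 1" using tk k unfolding \<delta>_def by auto
        have \<rho>M: "\<rho> \<tau> \<le> M * \<delta>"
        proof (cases "\<rho> \<tau> \<le> \<delta>")
          case True
          have "1 * \<delta> \<le> M * \<delta>" using M1 d0 by (intro mult_right_mono) auto
          then show ?thesis using True by linarith
        next
          case False
          define X where "X = (\<rho> \<tau> / \<delta>) powr (1 / \<Gamma>)"
          have "X * V (\<tau> + \<rho> \<tau>) \<le> \<Gamma> * V t" "X * V (\<tau> - \<rho> \<tau>) \<le> \<Gamma> * V t"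
            using D(15)[OF \<tau>Z, of t "\<tau> + \<rho> \<tau>"] D(15)[OF \<tau>Z, of t "\<tau> - \<rho> \<tau>"] False r d0
            unfolding X_def \<delta>_def by auto
          then have "X * (V (\<tau> + \<rho> \<tau>) + V (\<tau> - \<rho> \<tau>)) \<le> 2 * (\<Gamma> * V t)" unfolding distrib_left by linarith
          also have "\<dots> \<le> 2 * (\<Gamma> * H \<tau>)" using VH G by (intro mult_left_mono) auto
          finally have "X * (real n * \<rho> \<tau>) \<le> (2 * \<Gamma> * C2) * (real n * \<rho> \<tau>)" unfolding r(3) H_def by simp
          moreover have "0 < real n * \<rho> \<tau>" using nr r by simp
          ultimately have "X \<le> 2 * \<Gamma> * C2" by (rule mult_right_le_imp_le)
          then have "X powr \<Gamma> \<le> M" unfolding M_def using G by (intro powr_mono2) (auto simp: X_def)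
          moreover have "X powr \<Gamma> = \<rho> \<tau> / \<delta>" unfolding X_def using G r d0 by (simp add: powr_powr)
          ultimately show ?thesis using d0 by (simp add: field_simps)
        qed
        have HM: "H \<tau> \<le> C2 * M * (real n * \<delta>)"
        proof -
          have "C2 * (real n * \<rho> \<tau>) \<le> C2 * (real n * (M * \<delta>))" using \<rho>M C21 by (intro mult_left_mono) auto
          then show ?thesis unfolding H_def by (simp add: mult_ac)
        qed
        then have VM: "V t \<le> C2 * M * (real n * \<delta>)" using VH by linarith
        obtain \<sigma> where s: "\<bar>\<sigma>\<bar> \<le> \<Gamma> * V t / \<delta>"
          "\<And>s. \<bar>s - t\<bar> \<le> \<delta> / \<Gamma> \<Longrightarrow> V s \<le> V t + \<sigma> * (s - t) + \<Gamma> * V t / \<delta>\<^sup>2 * (s - t)\<^sup>2"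
          using D(16)[OF \<tau>Z, of t] d0 dk unfolding \<delta>_def by auto
        have VMd: "\<Gamma> * V t / \<delta> \<le> A * real n"
        proof -
          have "\<Gamma> * V t \<le> \<Gamma> * (C2 * M * (real n * \<delta>))" using VM G by (intro mult_left_mono) auto
          then have "\<Gamma> * V t / \<delta> \<le> \<Gamma> * (C2 * M * (real n * \<delta>)) / \<delta>" using d0 by (intro divide_right_mono) auto
          also have "\<dots> = A * real n" unfolding A_def using d0 by simp
          finally show ?thesis .
        qed
        have dG: "\<delta> / \<Gamma> \<le> \<delta>" using d0 G by (simp add: field_simps)
        show ?thesis
        proof (rule exI[of _ "\<delta> / \<Gamma>"], rule exI[of _ \<sigma>], intro conjI allI impI)
          show "0 < \<delta> / \<Gamma>" using d0 G by simp
          show "\<delta> / \<Gamma> \<le> 1" using dG dk by linarith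
          show "\<bar>\<sigma>\<bar> \<le> A * real n" using s(1) VMd by linarith
          have "1 / \<Gamma> \<le> C2 * M * (real n * \<delta>)" using V1[OF tZ] VM by linarith
          then have "1 / \<Gamma> * (1 / (C2 * M * \<Gamma>)) \<le> C2 * M * (real n * \<delta>) * (1 / (C2 * M * \<Gamma>))"
            using CM G by (intro mult_right_mono) auto
          also have "\<dots> = real n * (\<delta> / \<Gamma>)" using C21 M1 by (simp add: field_simps)
          finally show "a0 \<le> real n * (\<delta> / \<Gamma>)" unfolding a0_def by (simp add: power2_eq_square mult_ac)
        next
          fix u assume u: "\<bar>u - t\<bar> \<le> \<delta> / \<Gamma>"
          have "u \<notin> Z"
          proof
            assume uZ: "u \<in> Z"
            show False
            proof (cases "u = \<tau>")
              case True
              then have "\<delta> \<le> \<delta> / \<Gamma>" using u unfolding \<delta>_def by (simp add: abs_minus_commute)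
              moreover have "\<delta> / \<Gamma> \<le> \<delta> * (\<kappa> / 2)" using mult_left_mono[OF Gk, of \<delta>] d0 by simp
              moreover have "\<delta> * (\<kappa> / 2) < \<delta> * 1" using d0 k by (intro mult_strict_left_mono) auto
              ultimately show False by linarith
            next
              case False
              then have "4 * \<kappa> \<le> \<bar>\<tau> - u\<bar>" using D(11)[OF \<tau>Z uZ] by auto
              then show False using u dG dk tk k unfolding \<delta>_def by linarith
            qed
          qed
          then have "U u - U t \<le> \<sigma> * (u - t) + \<Gamma> * V t / \<delta>\<^sup>2 * (u - t)\<^sup>2" using UV[of u] s(2)[OF u] UtV by linarith
          also have "\<Gamma> * V t / \<delta>\<^sup>2 * (u - t)\<^sup>2 \<le> A * real n * (u - t)\<^sup>2 / (\<delta> / \<Gamma>)"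
          proof -
            have "\<Gamma> * V t / \<delta> / \<delta> \<le> A * real n / (\<delta> / \<Gamma>)"
              using VMd d0 G A dG nr by (intro frac_le) auto
            then have "\<Gamma> * V t / \<delta>\<^sup>2 \<le> A * real n / (\<delta> / \<Gamma>)" by (simp add: power2_eq_square)
            from mult_right_mono[OF this, of "(u - t)\<^sup>2"] show ?thesis by (simp add: mult_ac)
          qed
          finally show "U u - U t \<le> \<sigma> * (u - t) + A * real n * (u - t)\<^sup>2 / (\<delta> / \<Gamma>) + A" using A by linarith
        next
          fix u assume u: "\<bar>u - t\<bar> \<le> \<kappa>"
          have Ut0: "0 \<le> U t" using U0 by blast
          have And: "0 \<le> A * real n * (\<delta> / \<Gamma>)" using A d0 G by simp
          show "U u - U t \<le> A * real n * (\<delta> / \<Gamma>) + A"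
          proof (cases "\<bar>u - \<tau>\<bar> < \<kappa>")
            case True
            have "C2 * M * (real n * \<delta>) = A * real n * (\<delta> / \<Gamma>)" unfolding A_def using G by simp
            then show ?thesis using UH[OF True] HM Ut0 A by linarith
          next
            case False
            then have "U u \<le> \<Gamma>" using u tk by (intro away[OF \<tau>Z]) linarith+
            then show ?thesis using Ut0 A And by linarith
          qed
        qed
      qed
    qed
    have adm: "admissible A a0 \<kappa> n U" unfolding admissible_def using U_per U_ev U0 local by blast
    have bad: "(t \<notin> Z \<and> U t = V t) \<or>
        (\<exists>\<tau> r. 0 < r \<and> r \<le> \<kappa> \<and> \<bar>t - \<tau>\<bar> \<le> r \<and> C2 * (real n * r) \<le> U t \<and> real n powr \<gamma> \<le> real n * r \<and>
           (\<forall>s. r \<le> \<bar>s - \<tau>\<bar> \<and> \<bar>s - \<tau>\<bar> \<le> \<kappa> \<longrightarrow> U s \<le> \<Gamma> * (real n * r)))" for t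
    proof (cases "t \<notin> Z \<and> U t = V t")
      case False
      have "\<exists>\<tau>. nr t \<tau>" using False U_far by blast
      then obtain \<tau> where \<tau>: "nr t \<tau>" by blast
      then have \<tau>Z: "\<tau> \<in> Z" and tk: "\<bar>t - \<tau>\<bar> < \<kappa>" unfolding nr_def by auto
      note r = \<rho>[OF \<tau>Z]
      have UtH: "U t = H \<tau>" "t \<in> Z \<or> H \<tau> < V t" using U_near[OF \<tau>] False by (auto simp: min_def split: if_splits)
      have tr: "\<bar>t - \<tau>\<bar> \<le> \<rho> \<tau>"
      proof (rule ccontr)
        assume c: "\<not> \<bar>t - \<tau>\<bar> \<le> \<rho> \<tau>"
        then have "t \<noteq> \<tau>" using r by auto
        then have "t \<notin> Z" using nZ'[OF \<tau>Z, of t] tk by auto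
        then have "H \<tau> < V t" using UtH by blast
        moreover have "V t \<le> \<Gamma> * (real n * \<rho> \<tau>)" using c tk by (intro outer[OF \<tau>Z]) auto
        moreover have "\<Gamma> * (real n * \<rho> \<tau>) \<le> H \<tau>" unfolding H_def using C2 r by (intro mult_right_mono) auto
        ultimately show False by linarith
      qed
      have Us: "U s \<le> \<Gamma> * (real n * \<rho> \<tau>)" if "\<rho> \<tau> \<le> \<bar>s - \<tau>\<bar>" "\<bar>s - \<tau>\<bar> \<le> \<kappa>" for s
        using outer[OF \<tau>Z that] UV[OF nZ'[OF \<tau>Z _ that(2)]] that r by force
      show ?thesis
        by (rule disjI2, rule exI[of _ \<tau>], rule exI[of _ "\<rho> \<tau>"]) (use tr Us r UtH in \<open>auto simp: H_def\<close>)
    qed auto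
    show ?thesis using adm UV bad by blast
  qed
  then show ?thesis using A a0 by blast
qed

section \<open>From values in the complex plane to the derivative\<close>

lemma Arcsin_near_zero: "\<exists>e>0. \<forall>v. cmod v \<le> e \<longrightarrow> cmod (Arcsin v) \<le> 2 * cmod v"
proof -
  have "(Arcsin has_field_derivative inverse (cos (Arcsin 0))) (at 0)"
    by (rule has_field_derivative_Arcsin) simp
  then have "((\<lambda>v. Arcsin v / v) \<longlongrightarrow> 1) (at 0)"
    by (simp add: has_field_derivative_iff)
  then have "\<forall>\<^sub>F v in at 0. dist (Arcsin v / v) 1 < 1" by (rule tendstoD) simp
  then obtain d where d: "d > 0" "\<And>v. v \<noteq> 0 \<Longrightarrow> dist v 0 < d \<Longrightarrow> dist (Arcsin v / v) 1 < 1"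
    unfolding eventually_at by blast
  have "cmod (Arcsin v) \<le> 2 * cmod v" if "cmod v \<le> d / 2" for v
  proof (cases "v = 0")
    case False
    have "cmod (Arcsin v / v - 1) < 1" using d(2)[OF False] that d(1) by (simp add: dist_norm)
    then have "cmod (Arcsin v / v) \<le> 2" using norm_triangle_sub[of "Arcsin v / v" 1] by simp
    then show ?thesis using False by (simp add: norm_divide divide_le_eq)
  qed simp
  then show ?thesis using d(1) by (intro exI[of _ "d / 2"]) auto
qed

lemma small_sin_near_multiple_pi:
  "\<exists>e>0. \<forall>a. cmod (sin a) \<le> e \<longrightarrow> (\<exists>k::int. cmod (a - of_int k * of_real pi) \<le> 2 * cmod (sin a))"
proof -
  obtain e where e: "0 < e" "\<And>v. cmod v \<le> e \<Longrightarrow> cmod (Arcsin v) \<le> 2 * cmod v" using Arcsin_near_zero by blast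
  have "\<exists>k::int. cmod (a - of_int k * of_real pi) \<le> 2 * cmod (sin a)" if a: "cmod (sin a) \<le> e" for a
  proof -
    have "sin a = sin (Arcsin (sin a))" by simp
    then obtain r :: real where "r \<in> \<int>" and
      r: "a = Arcsin (sin a) + of_real (2 * r * pi) \<or> a = - Arcsin (sin a) + of_real ((2 * r + 1) * pi)"
      using complex_sin_eq[of a "Arcsin (sin a)"] by blast
    then obtain i where i: "r = of_int i" by (auto elim: Ints_cases)
    have b: "cmod (Arcsin (sin a)) \<le> 2 * cmod (sin a)" by (rule e(2)[OF a])
    from r show ?thesis
    proof
      assume "a = Arcsin (sin a) + of_real (2 * r * pi)"
      then have "a - of_int (2 * i) * of_real pi = Arcsin (sin a)" unfolding i by (simp add: algebra_simps)
      then show ?thesis using b by (metis)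
    next
      assume "a = - Arcsin (sin a) + of_real ((2 * r + 1) * pi)"
      then have "a - of_int (2 * i + 1) * of_real pi = - Arcsin (sin a)" unfolding i by (simp add: algebra_simps)
      then show ?thesis using b by (metis norm_minus_cancel)
    qed
  qed
  then show ?thesis using e(1) by blast
qed

text \<open>If \<open>cos z0 = w\<close>, then \<open>w - cos t\<close> is twice the product of the
  sines of \<open>(z0 + t) / 2\<close> and \<open>(t - z0) / 2\<close>; a product of size
  \<open>\<delta>^2\<close> has a factor of size \<delta>, so \<open>z0\<close> is close to
  \<open>t\<close> or to \<open>- t\<close> modulo \<open>2 * pi\<close>. The square reflects the
  critical points of the cosine.\<close>

lemma cos_preimage_near:
  assumes "0 < c"
  obtains \<epsilon> where "0 < \<epsilon>"
    "\<And>\<delta> t w. 0 < \<delta> \<Longrightarrow> \<delta> \<le> 1 \<Longrightarrow> cmod (w - cos t) \<le> \<epsilon> * \<delta>\<^sup>2 \<Longrightarrow> \<exists>z. cos z = w \<and> cmod (z - t) \<le> c * \<delta>"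
proof -
  obtain e where e: "0 < e" "\<And>a. cmod (sin a) \<le> e \<Longrightarrow> \<exists>k::int. cmod (a - of_int k * of_real pi) \<le> 2 * cmod (sin a)"
    using small_sin_near_multiple_pi by blast
  define \<eta> where "\<eta> = min e (c / 4)"
  have \<eta>: "0 < \<eta>" "\<eta> \<le> e" "4 * \<eta> \<le> c" unfolding \<eta>_def using e assms by auto
  show ?thesis
  proof (rule that[of "2 * \<eta>\<^sup>2"])
    show "0 < 2 * \<eta>\<^sup>2" using \<eta> by simp
    fix \<delta> :: real and t w :: complex assume d: "0 < \<delta>" "\<delta> \<le> 1" and w: "cmod (w - cos t) \<le> 2 * \<eta>\<^sup>2 * \<delta>\<^sup>2"
    define z0 where "z0 = Arccos w"
    have z0: "cos z0 = w" unfolding z0_def by simp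
    have period: "cos (s * z0 + of_int k * (2 * of_real pi)) = w" if "s = 1 \<or> s = -1" for s and k :: int
    proof -
      have "cos (s * z0 + of_int k * (2 * of_real pi)) = cos z0"
        unfolding complex_cos_eq using that by (intro bexI[of _ "of_int k"]) (auto simp: mult_ac)
      then show ?thesis using z0 by simp
    qed
    have "cmod (sin ((z0 + t) / 2)) * cmod (sin ((t - z0) / 2)) \<le> (\<eta> * \<delta>) * (\<eta> * \<delta>)"
    proof -
      have "w - cos t = 2 * (sin ((z0 + t) / 2) * sin ((t - z0) / 2))"
        unfolding z0[symmetric] cos_diff_cos by simp
      then have "2 * (cmod (sin ((z0 + t) / 2)) * cmod (sin ((t - z0) / 2))) \<le> 2 * \<eta>\<^sup>2 * \<delta>\<^sup>2"
        using w by (simp add: norm_mult)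
      then show ?thesis by (simp add: power2_eq_square mult_ac)
    qed
    then have "cmod (sin ((z0 + t) / 2)) \<le> \<eta> * \<delta> \<or> cmod (sin ((t - z0) / 2)) \<le> \<eta> * \<delta>"
      using mult_strict_mono[of "\<eta> * \<delta>" "cmod (sin ((z0 + t) / 2))" "\<eta> * \<delta>" "cmod (sin ((t - z0) / 2))"] \<eta> d
      by (force simp: not_le)
    moreover have \<eta>\<delta>: "\<eta> * \<delta> \<le> e" using mult_mono[of \<eta> e \<delta> 1] \<eta> d e by simp
    have c\<delta>: "4 * (\<eta> * \<delta>) \<le> c * \<delta>" using mult_right_mono[OF \<eta>(3), of \<delta>] d by simp
    ultimately show "\<exists>z. cos z = w \<and> cmod (z - t) \<le> c * \<delta>"
    proof (elim disjE)
      assume a: "cmod (sin ((z0 + t) / 2)) \<le> \<eta> * \<delta>"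
      then obtain k :: int where k: "cmod ((z0 + t) / 2 - of_int k * of_real pi) \<le> 2 * (\<eta> * \<delta>)"
        using e(2)[of "(z0 + t) / 2"] \<eta>\<delta> by (meson order.trans mult_left_mono zero_le_numeral)
      define z where "z = (-1) * z0 + of_int k * (2 * of_real pi)"
      have "z - t = - (2 * ((z0 + t) / 2 - of_int k * of_real pi))" unfolding z_def by (simp add: field_simps)
      then have "cmod (z - t) = 2 * cmod ((z0 + t) / 2 - of_int k * of_real pi)" by (simp only: norm_minus_cancel norm_mult) simp
      then show ?thesis using k c\<delta> period[of "-1" k] unfolding z_def by (intro exI[of _ z]) (auto simp: z_def)
    next
      assume a: "cmod (sin ((t - z0) / 2)) \<le> \<eta> * \<delta>"
      then obtain k :: int where k: "cmod ((t - z0) / 2 - of_int k * of_real pi) \<le> 2 * (\<eta> * \<delta>)"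
        using e(2)[of "(t - z0) / 2"] \<eta>\<delta> by (meson order.trans mult_left_mono zero_le_numeral)
      define z where "z = 1 * z0 + of_int k * (2 * of_real pi)"
      have "z - t = - (2 * ((t - z0) / 2 - of_int k * of_real pi))" unfolding z_def by (simp add: field_simps)
      then have "cmod (z - t) = 2 * cmod ((t - z0) / 2 - of_int k * of_real pi)" by (simp only: norm_minus_cancel norm_mult) simp
      then show ?thesis using k c\<delta> period[of 1 k] unfolding z_def by (intro exI[of _ z]) (auto simp: z_def)
    qed
  qed
qed

text \<open>The image under \<open>cos\<close> of a disc of radius \<open>c / n\<close> contains a disc of radius \<open>\<epsilon> / n\<^sup>2\<close>, so Cauchy's estimate
  gives the factor \<open>n\<^sup>2\<close> uniformly up to the end points.\<close>

lemma pderiv_bound: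
  assumes "0 < c"
  obtains C where "0 < C"
    "\<And>n P t B. \<lbrakk>1 \<le> n; \<And>z. cmod (z - of_real t) \<le> c / real n \<Longrightarrow> cmod (poly P (cos z)) \<le> B\<rbrakk> \<Longrightarrow>
       cmod (poly (pderiv P) (of_real (cos t))) \<le> C * (real n)\<^sup>2 * B"
proof -
  obtain \<epsilon> where \<epsilon>: "0 < \<epsilon>" "\<And>\<delta> t w. 0 < \<delta> \<Longrightarrow> \<delta> \<le> 1 \<Longrightarrow> cmod (w - cos t) \<le> \<epsilon> * \<delta>\<^sup>2 \<Longrightarrow> \<exists>z. cos z = w \<and> cmod (z - t) \<le> c * \<delta>"
    using cos_preimage_near[OF assms] by blast
  show ?thesis
  proof (rule that[of "1 / \<epsilon>"])
    show "0 < 1 / \<epsilon>" using \<epsilon> by simp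
    fix n :: nat and P :: "complex poly" and t B :: real
    assume n: "1 \<le> n" and B: "\<And>z. cmod (z - of_real t) \<le> c / real n \<Longrightarrow> cmod (poly P (cos z)) \<le> B"
    define r where "r = \<epsilon> * (1 / real n)\<^sup>2"
    have r: "0 < r" unfolding r_def using \<epsilon> n by simp
    have "cmod ((deriv ^^ 1) (poly P) (of_real (cos t))) \<le> fact 1 * B / r ^ 1"
    proof (rule Cauchy_inequality[OF _ _ r])
      fix w assume w: "cmod (of_real (cos t) - w) = r"
      have "cmod (w - cos (of_real t)) \<le> \<epsilon> * (1 / real n)\<^sup>2"
        using w unfolding r_def by (simp add: cos_of_real norm_minus_commute)
      then obtain z where "cos z = w" "cmod (z - of_real t) \<le> c * (1 / real n)"
        using \<epsilon>(2)[of "1 / real n" w "of_real t"] n by auto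
      then show "cmod (poly P w) \<le> B" using B[of z] by simp
    qed (auto intro!: holomorphic_intros continuous_intros)
    then show "cmod (poly (pderiv P) (of_real (cos t))) \<le> 1 / \<epsilon> * (real n)\<^sup>2 * B"
      using \<epsilon> n unfolding r_def by (simp add: DERIV_imp_deriv[OF poly_DERIV] field_simps power2_eq_square)
  qed
qed

text \<open>In the angular variable Cauchy's estimate in discs of radius \<open>c / n\<close> costs
  only one factor \<open>n\<close>.\<close>

lemma cos_poly_lipschitz:
  assumes "1 \<le> n" "0 < c" and I: "convex I" "s \<in> I" "t \<in> I"
    and B: "\<And>x z. x \<in> I \<Longrightarrow> cmod (z - of_real x) \<le> c / real n \<Longrightarrow> cmod (poly P (cos z)) \<le> B"
  shows "cmod (poly P (of_real (cos s)) - poly P (of_real (cos t))) \<le> real n / c * B * \<bar>s - t\<bar>"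
proof -
  define f where "f = (\<lambda>z. poly P (cos z))"
  have d: "(f has_field_derivative deriv f z) (at z)" for z
    unfolding f_def by (rule holomorphic_derivI[of _ UNIV]) (auto intro!: holomorphic_intros)
  have cn: "0 < c / real n" using assms by simp
  have db: "cmod (deriv f (of_real x)) \<le> real n / c * B" if x: "x \<in> I" for x
  proof -
    have "cmod ((deriv ^^ 1) f (of_real x)) \<le> fact 1 * B / (c / real n) ^ 1"
    proof (rule Cauchy_inequality[OF _ _ cn])
      fix w assume "cmod (of_real x - w) = c / real n"
      then show "cmod (f w) \<le> B" unfolding f_def by (intro B[OF x]) (simp add: norm_minus_commute)
    qed (auto simp: f_def intro!: holomorphic_intros continuous_intros)
    then show ?thesis by (simp add: mult.commute)
  qed
  have conv: "convex (of_real ` I :: complex set)"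
    using I(1) by (intro convex_linear_image linear_of_real)
  have "cmod (f (of_real s) - f (of_real t)) \<le> real n / c * B * cmod (of_real s - of_real t)"
  proof (rule field_differentiable_bound[OF conv, of f "deriv f"])
    fix z :: complex assume "z \<in> of_real ` I"
    then show "cmod (deriv f z) \<le> real n / c * B" using db by auto
    show "(f has_field_derivative deriv f z) (at z within of_real ` I)" by (rule has_field_derivative_at_within[OF d])
  qed (use I in auto)
  then show ?thesis unfolding f_def by (simp add: cos_of_real flip: of_real_diff)
qed

section \<open>Growth below the critical radius\<close>

lemma powr_add_le: "(x + y) powr p \<le> 2 powr p * (x powr p + y powr p)" if "0 \<le> x" "0 \<le> y" "0 \<le> p" for x y p :: real
proof -
  have "(x + y) powr p \<le> (2 * max x y) powr p" using that by (intro powr_mono2) auto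
  also have "\<dots> = 2 powr p * (max x y) powr p" using that by (simp add: powr_mult)
  also have "(max x y) powr p \<le> x powr p + y powr p" by (auto simp: max_def)
  finally show ?thesis by (simp add: mult_left_mono)
qed

text \<open>Below the critical radius the even-odd decomposition about \<open>\<tau>\<close> reduces the estimate to the Remez inequality
  for even trigonometric polynomials.\<close>

lemma remez_growth:
  fixes \<kappa> p \<Gamma> :: real
  assumes "0 < \<kappa>" "\<kappa> \<le> 1" "0 < p" "0 \<le> \<Gamma>"
  obtains C0 C where "0 < C0" "0 < C"
    "\<And>n P U S \<tau> \<rho> t. \<lbrakk>1 \<le> n; degree P \<le> n; \<And>s. U s \<le> real n;
       \<And>s. cmod (poly P (of_real (cos s))) powr p \<le> S * exp (U s);
       0 < \<rho>; \<rho> \<le> \<kappa>; \<bar>t - \<tau>\<bar> \<le> \<rho>;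
       \<And>s. \<rho> \<le> \<bar>s - \<tau>\<bar> \<Longrightarrow> \<bar>s - \<tau>\<bar> \<le> \<kappa> \<Longrightarrow> U s \<le> \<Gamma> * (real n * \<rho>)\<rbrakk> \<Longrightarrow>
       cmod (poly P (of_real (cos t))) powr p \<le> C * real n powr p * exp (C0 * (real n * \<rho>)) * S"
proof -
  obtain b :: nat where
    b: "\<And>n x. \<kappa> \<le> \<bar>x\<bar> \<Longrightarrow> \<bar>x\<bar> \<le> pi \<Longrightarrow> (((1 + cos x) / 2) ^ (b * n)) powr p \<le> exp (- real n)"
    using cosine_kernel_decay[OF assms(1-3)] by blast
  \<comment> \<open>\<open>4 * (1 + b)\<close> is the Remez growth at degree
    \<open>(1 + b) * n\<close>, the extra \<open>b\<close> undoes the damping factor, and \<Gamma>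
    bounds \<open>U\<close> outside the critical radius.\<close>
  define C0 where "C0 = p * (real b + 4 * (1 + real b)) + \<Gamma>"
  define C where "C = (10 * (1 + real b)) powr p"
  show ?thesis
  proof (rule that[of C0 C])
    have "0 < p * (real b + 4 * (1 + real b))" using assms by (intro mult_pos_pos) auto
    then show "0 < C0" unfolding C0_def using assms by linarith
    have "0 < 10 * (1 + real b)" by simp
    then show "0 < C" unfolding C_def by simp
    fix n :: nat and P :: "complex poly" and U :: "real \<Rightarrow> real" and S \<tau> \<rho> t :: real
    assume n: "1 \<le> n" and P: "degree P \<le> n" and Un: "\<And>s. U s \<le> real n"
      and S: "\<And>s. cmod (poly P (of_real (cos s))) powr p \<le> S * exp (U s)"
      and \<rho>: "0 < \<rho>" "\<rho> \<le> \<kappa>" and t: "\<bar>t - \<tau>\<bar> \<le> \<rho>"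
      and Unear: "\<And>s. \<rho> \<le> \<bar>s - \<tau>\<bar> \<Longrightarrow> \<bar>s - \<tau>\<bar> \<le> \<kappa> \<Longrightarrow> U s \<le> \<Gamma> * (real n * \<rho>)"
    have S0: "0 \<le> S" using order.trans[OF powr_ge_zero S[of 0]] by (simp add: zero_le_mult_iff)
    define m where "m = (1 + b) * n"
    \<comment> \<open>Damping about \<tau>: beyond distance \<kappa> only \<open>U \<le> n\<close>
      is known, and the \<open>p\<close>-th power of the cosine factor is at most
      \<open>exp (- n)\<close> there.\<close>
    define R where "R = (\<lambda>z. poly P (cos z) * ((1 + cos (z + of_real (- \<tau>))) / 2) ^ (b * n))"
    have trR: "trigp m R"
    proof -
      have "trigp 1 (\<lambda>z. 1/2 * (1 + cos (z + of_real (- \<tau>))))"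
        by (intro trigp_cmult trigp_add trigp_affine[of 1 cos] trigp_cos1 trigp_mono[OF trigp_const]) auto
      from trigp_power[OF this, of "b * n"]
      have "trigp (b * n) (\<lambda>z. ((1 + cos (z + of_real (- \<tau>))) / 2) ^ (b * n))" by simp
      from trigp_mult[OF trigp_poly_of[OF trigp_cos1 P] this]
      show ?thesis unfolding R_def m_def by simp
    qed
    have Rreal: "cmod (R (of_real s)) = cmod (poly P (of_real (cos s))) * ((1 + cos (s - \<tau>)) / 2) ^ (b * n)" for s
    proof -
      have "(1 + cos (complex_of_real s + of_real (- \<tau>))) / 2 = of_real ((1 + cos (s - \<tau>)) / 2)"
      proof -
        have "complex_of_real s + of_real (- \<tau>) = of_real (s - \<tau>)" by simp
        then show ?thesis by (simp only: cos_of_real of_real_add of_real_divide of_real_1 of_real_numeral)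
      qed
      then have "cmod ((1 + cos (complex_of_real s + of_real (- \<tau>))) / 2) = \<bar>(1 + cos (s - \<tau>)) / 2\<bar>" by (simp only: norm_of_real)
      moreover have "0 \<le> 1 + cos (s - \<tau>)" using cos_ge_minus_one[of "s - \<tau>"] by linarith
      ultimately show ?thesis unfolding R_def norm_mult norm_power by (simp add: cos_of_real)
    qed
    have q01: "0 \<le> (1 + cos x) / 2" "(1 + cos x) / 2 \<le> 1" for x :: real
      using cos_ge_minus_one[of x] cos_le_one[of x] by (auto simp del: cos_ge_minus_one cos_le_one)
    define S' where "S' = (exp (\<Gamma> * (real n * \<rho>)) * S) powr (1 / p)"
    have S'0: "0 \<le> S'" unfolding S'_def by simp
    have S'p: "S' powr p = exp (\<Gamma> * (real n * \<rho>)) * S" unfolding S'_def using assms S0 by (simp add: powr_powr)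
    have outer: "cmod (R (of_real s)) \<le> S'" if s: "\<rho> \<le> \<bar>s - \<tau>\<bar>" "\<bar>s - \<tau>\<bar> \<le> pi" for s
    proof -
      have "cmod (R (of_real s)) powr p \<le> exp (\<Gamma> * (real n * \<rho>)) * S"
      proof (cases "\<bar>s - \<tau>\<bar> \<le> \<kappa>")
        case True
        have "cmod (R (of_real s)) \<le> cmod (poly P (of_real (cos s))) * 1"
          unfolding Rreal using q01 by (intro mult_left_mono power_le_one) auto
        then have "cmod (R (of_real s)) powr p \<le> cmod (poly P (of_real (cos s))) powr p"
          using assms by (intro powr_mono2) auto
        also have "\<dots> \<le> S * exp (U s)" by (rule S)
        also have "\<dots> \<le> S * exp (\<Gamma> * (real n * \<rho>))" using Unear[OF s(1) True] S0 by (intro mult_left_mono) auto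
        finally show ?thesis by (simp add: mult.commute)
      next
        case False
        have "cmod (R (of_real s)) powr p
            = cmod (poly P (of_real (cos s))) powr p * (((1 + cos (s - \<tau>)) / 2) ^ (b * n)) powr p"
          unfolding Rreal using q01 by (simp add: powr_mult)
        also have "\<dots> \<le> (S * exp (U s)) * exp (- real n)"
          using b[of "s - \<tau>" n] False s S[of s] S0 by (intro mult_mono) auto
        also have "\<dots> = S * exp (U s - real n)" by (simp add: exp_add[symmetric])
        also have "\<dots> \<le> S * exp (\<Gamma> * (real n * \<rho>))"
        proof -
          have "0 \<le> \<Gamma> * (real n * \<rho>)" using assms \<rho> by simp
          then show ?thesis using Un[of s] S0 by (intro mult_left_mono) auto
        qed
        finally show ?thesis by (simp add: mult.commute)
      qed
      then have "(cmod (R (of_real s)) powr p) powr (1 / p) \<le> S'" unfolding S'_def using assms by (intro powr_mono2) auto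
      then show ?thesis using assms by (simp add: powr_powr)
    qed
    define A where "A = (\<lambda>z. 1/2 * (R (z + of_real \<tau>) + R (- z + of_real \<tau>)))"
    \<comment> \<open>The odd part is squared, which makes it even at the price of doubling the
      degree; taking the root afterwards restores the growth rate.\<close>
    define D where "D = (\<lambda>z. (1/2 * (R (z + of_real \<tau>) - R (- z + of_real \<tau>))) ^ 2)"
    have trm: "trigp m (\<lambda>z. R (z + of_real \<tau>))" "trigp m (\<lambda>z. R (- z + of_real \<tau>))"
      using trigp_affine[OF trR, of "of_real \<tau>"] trigp_minus[OF trigp_affine[OF trR, of "of_real \<tau>"]] by auto
    have trA: "trigp m A" unfolding A_def by (intro trigp_cmult trigp_add trm)
    have trD: "trigp (2 * m) D" unfolding D_def by (intro trigp_power trigp_cmult trigp_diff trm)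
    have evA: "A (- z) = A z" for z unfolding A_def by (simp add: add.commute)
    have evD: "D (- z) = D z" for z unfolding D_def by (simp add: power2_eq_square algebra_simps)
    have two: "cmod (R (of_real s + of_real \<tau>)) \<le> S'" "cmod (R (- of_real s + of_real \<tau>)) \<le> S'" if s: "\<rho> \<le> s" "s \<le> pi" for s
      using outer[of "s + \<tau>"] outer[of "- s + \<tau>"] s \<rho> by auto
    have bA: "cmod (A (of_real s)) \<le> S'" if s: "\<rho> \<le> s" "s \<le> pi" for s
      using two[OF s] norm_triangle_ineq[of "R (of_real s + of_real \<tau>)" "R (- of_real s + of_real \<tau>)"] unfolding A_def norm_mult by simp
    have bD: "cmod (D (of_real s)) \<le> S'\<^sup>2" if s: "\<rho> \<le> s" "s \<le> pi" for s
    proof -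
      have "cmod (1/2 * (R (of_real s + of_real \<tau>) - R (- of_real s + of_real \<tau>))) \<le> S'"
        using two[OF s] norm_triangle_ineq4[of "R (of_real s + of_real \<tau>)" "R (- of_real s + of_real \<tau>)"] unfolding norm_mult by simp
      then show ?thesis unfolding D_def norm_power by (intro power_mono) auto
    qed
    have \<rho>1: "\<rho> \<le> 1" using \<rho> assms by linarith
    define x where "x = t - \<tau>"
    define N where "N = 4 * real m + 1"
    define E where "E = exp (4 * real m * \<rho>)"
    have E1: "1 \<le> E" unfolding E_def using \<rho> by simp
    have N1: "1 \<le> N" unfolding N_def by simp
    have "cmod (A (of_real x)) \<le> (2 * real m + 1) * exp (4 * real m * \<rho>) * S'"
      using t unfolding x_def by (intro even_trigp_remez[OF trA evA \<rho>(1) \<rho>1 bA]) auto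
    also have "\<dots> \<le> N * E * S'" unfolding N_def E_def using S'0 by (intro mult_right_mono) auto
    finally have eA: "cmod (A (of_real x)) \<le> N * E * S'" .
    have "cmod (D (of_real x)) \<le> (2 * real (2 * m) + 1) * exp (4 * real (2 * m) * \<rho>) * S'\<^sup>2"
      using t unfolding x_def by (intro even_trigp_remez[OF trD evD \<rho>(1) \<rho>1 bD]) auto
    also have "\<dots> = N * E\<^sup>2 * S'\<^sup>2" unfolding N_def E_def by (simp add: exp_double[symmetric] mult_ac)
    \<comment> \<open>Weakening \<open>N\<close> to \<open>N^2\<close> turns the right side into a
      square, ready for the root.\<close>
    also have "\<dots> \<le> N\<^sup>2 * E\<^sup>2 * S'\<^sup>2" using self_le_power[OF N1, of 2] by (intro mult_right_mono) auto
    also have "\<dots> = (N * E * S')\<^sup>2" by (simp add: power_mult_distrib)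
    finally have "(cmod (1/2 * (R (of_real x + of_real \<tau>) - R (- of_real x + of_real \<tau>))))\<^sup>2 \<le> (N * E * S')\<^sup>2"
      unfolding D_def norm_power .
    then have eD: "cmod (1/2 * (R (of_real x + of_real \<tau>) - R (- of_real x + of_real \<tau>))) \<le> N * E * S'"
    proof (rule power2_le_imp_le)
      show "0 \<le> N * E * S'" using order.trans[OF zero_le_one N1] order.trans[OF zero_le_one E1] S'0
        by (intro mult_nonneg_nonneg)
    qed
    have "R (of_real t) = A (of_real x) + 1/2 * (R (of_real x + of_real \<tau>) - R (- of_real x + of_real \<tau>))"
      unfolding A_def x_def by (simp add: algebra_simps)
    then have "cmod (R (of_real t)) \<le> cmod (A (of_real x)) + cmod (1/2 * (R (of_real x + of_real \<tau>) - R (- of_real x + of_real \<tau>)))"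
      by (simp only: norm_triangle_ineq)
    then have "cmod (R (of_real t)) \<le> 2 * (N * E * S')" using eA eD by linarith
    moreover have "cmod (poly P (of_real (cos t))) \<le> exp (real b * (real n * \<rho>)) * cmod (R (of_real t))"
    proof -
      \<comment> \<open>Within \<rho> of \<tau> the damping factor is at least
        \<open>exp (- b * n * \<rho>)\<close>, a loss of the same kind as the Remez growth.\<close>
      have "exp (- \<rho>) \<le> (1 + cos (t - \<tau>)) / 2"
      proof -
        have s1: "(sin ((t - \<tau>) / 2))\<^sup>2 \<le> ((t - \<tau>) / 2)\<^sup>2"
          using abs_sin_x_le_abs_x[of "(t - \<tau>) / 2"] abs_le_square_iff by blast
        have s2: "((t - \<tau>) / 2)\<^sup>2 \<le> (\<rho> / 2)\<^sup>2"
          using t \<rho> abs_le_square_iff[of "(t - \<tau>) / 2" "\<rho> / 2"] by simp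
        have s3: "(\<rho> / 2)\<^sup>2 \<le> \<rho> / 4" using mult_left_mono[OF \<rho>1, of \<rho>] \<rho> by (simp add: power2_eq_square)
        have "2 * ((t - \<tau>) / 2) = t - \<tau>" by simp
        then have "cos (t - \<tau>) = 1 - 2 * (sin ((t - \<tau>) / 2))\<^sup>2" using cos_double_sin[of "(t - \<tau>) / 2"] by (simp only:)
        then have "1 - \<rho> / 4 \<le> (1 + cos (t - \<tau>)) / 2" using order.trans[OF s1 order.trans[OF s2 s3]] by simp
        moreover have "exp (- \<rho>) \<le> 1 / (1 + \<rho>)"
          using exp_ge_add_one_self[of \<rho>] \<rho> by (simp add: exp_minus field_simps)
        moreover have "1 / (1 + \<rho>) \<le> 1 - \<rho> / 4"
        proof -
          have "1 \<le> (1 - \<rho> / 4) * (1 + \<rho>)" using mult_left_mono[OF \<rho>1, of \<rho>] \<rho> by (simp add: algebra_simps)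
          then show ?thesis using \<rho> by (simp add: divide_le_eq)
        qed
        ultimately show ?thesis by linarith
      qed
      then have "exp (- \<rho>) ^ (b * n) \<le> ((1 + cos (t - \<tau>)) / 2) ^ (b * n)" by (intro power_mono) auto
      then have "cmod (poly P (of_real (cos t))) * exp (- \<rho>) ^ (b * n) \<le> cmod (R (of_real t))"
        unfolding Rreal by (intro mult_left_mono) auto
      moreover have "exp (- \<rho>) ^ (b * n) = exp (- (real b * (real n * \<rho>)))"
        by (simp add: exp_of_nat_mult[symmetric] mult_ac)
      ultimately show ?thesis by (simp add: exp_minus field_simps)
    qed
    ultimately have "cmod (poly P (of_real (cos t))) \<le> exp (real b * (real n * \<rho>)) * (2 * (N * E * S'))"
      by (meson exp_ge_zero mult_left_mono order.trans)
    also have "\<dots> \<le> exp (real b * (real n * \<rho>)) * (2 * ((5 * (1 + real b) * real n) * E * S'))"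
    proof -
      have "1 \<le> (1 + real b) * real n" using mult_mono[of 1 "1 + real b" 1 "real n"] n by simp
      then have "N \<le> 5 * (1 + real b) * real n" unfolding N_def m_def by (simp add: algebra_simps)
      then show ?thesis using E1 S'0 by (intro mult_left_mono mult_right_mono) auto
    qed
    also have "\<dots> = (10 * (1 + real b)) * real n * exp ((real b + 4 * (1 + real b)) * (real n * \<rho>)) * S'"
      unfolding E_def m_def by (simp add: exp_add[symmetric] algebra_simps)
    finally have "cmod (poly P (of_real (cos t))) powr p
       \<le> ((10 * (1 + real b)) * real n * exp ((real b + 4 * (1 + real b)) * (real n * \<rho>)) * S') powr p"
      using assms by (intro powr_mono2) auto
    also have "\<dots> = C * real n powr p * exp (p * (real b + 4 * (1 + real b)) * (real n * \<rho>)) * (S' powr p)"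
      unfolding C_def using S'0 by (simp add: powr_mult exp_powr_real mult_ac)
    also have "\<dots> = C * real n powr p * exp (C0 * (real n * \<rho>)) * S"
    proof -
      have "exp (C0 * (real n * \<rho>)) = exp (p * (real b + 4 * (1 + real b)) * (real n * \<rho>)) * exp (\<Gamma> * (real n * \<rho>))"
        unfolding C0_def by (simp only: distrib_right exp_add)
      then show ?thesis unfolding S'p by simp
    qed
    finally show "cmod (poly P (of_real (cos t))) powr p \<le> C * real n powr p * exp (C0 * (real n * \<rho>)) * S" .
  qed
qed

section \<open>Sums over cells\<close>

definition idist :: "nat \<Rightarrow> nat \<Rightarrow> nat" where
  "idist i j = nat \<bar>int i - int j\<bar>"

text \<open>On either side of \<open>j\<close> the index distance is injective.\<close>

lemma sum_idist_le:
  fixes g :: "nat \<Rightarrow> real"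
  assumes "\<And>i. 0 \<le> g i" "j < n"
  shows "(\<Sum>l<n. g (idist l j)) \<le> 2 * (\<Sum>i<n. g i)"
proof -
  have part: "(\<Sum>l\<in>A. g (idist l j)) \<le> (\<Sum>i<n. g i)" if A: "A \<subseteq> {..<n}" "inj_on (\<lambda>l. idist l j) A" for A
  proof -
    have "(\<Sum>l\<in>A. g (idist l j)) = sum g ((\<lambda>l. idist l j) ` A)" using sum.reindex[OF A(2), of g] by simp
    also have "\<dots> \<le> (\<Sum>i<n. g i)"
      using A(1) assms by (intro sum_mono2) (auto simp: idist_def)
    finally show ?thesis .
  qed
  have "{..<n} = {..j} \<union> {j<..<n}" using assms(2) by auto
  then have "(\<Sum>l<n. g (idist l j)) = (\<Sum>l\<le>j. g (idist l j)) + (\<Sum>l\<in>{j<..<n}. g (idist l j))"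
    by (simp add: sum.union_disjoint ivl_disj_int)
  moreover have "(\<Sum>l\<le>j. g (idist l j)) \<le> (\<Sum>i<n. g i)"
    using assms(2) by (intro part) (auto simp: inj_on_def idist_def)
  moreover have "(\<Sum>l\<in>{j<..<n}. g (idist l j)) \<le> (\<Sum>i<n. g i)"
    by (intro part) (auto simp: inj_on_def idist_def)
  ultimately show ?thesis by simp
qed

lemma sum_inverse_squares_le: "(\<Sum>i<n. (1 + real i) powr - 2) \<le> 2"
proof -
  have "(\<Sum>i<Suc n. (1 + real i) powr - 2) \<le> 2 - 1 / (1 + real n)" for n
  proof (induction n)
    case (Suc n)
    define x where "x = 1 + real n"
    have x: "1 \<le> x" unfolding x_def by simp
    have "(1 + real (Suc n)) powr - 2 = 1 / (x + 1)\<^sup>2"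
      unfolding x_def by (simp add: powr_minus_divide add.commute flip: powr_numeral)
    also have "\<dots> \<le> 1 / (x * (x + 1))"
      using x by (intro divide_left_mono) (auto simp: power2_eq_square mult_right_mono)
    also have "\<dots> = 1 / x - 1 / (x + 1)" using x by (simp add: field_simps)
    finally show ?case using Suc unfolding x_def by (simp add: add.commute)
  qed simp
  then have "(\<Sum>i<Suc n. (1 + real i) powr - 2) \<le> 2" by (meson diff_left_mono diff_zero divide_nonneg_nonneg le_add_same_cancel1 of_nat_0_le_iff order.trans zero_le_one add_nonneg_nonneg diff_le_eq le_diff_eq)
  moreover have "(\<Sum>i<n. (1 + real i) powr - 2) \<le> (\<Sum>i<Suc n. (1 + real i) powr - 2)" by simp
  ultimately show ?thesis by linarith
qed

lemma sum_div_blocks: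
  fixes f :: "nat \<Rightarrow> real"
  assumes "0 < b"
  shows "(\<Sum>k<b * n. f (k div b)) = real b * (\<Sum>l<n. f l)"
proof -
  have "(\<Sum>k<n * b. f (k div b)) = (\<Sum>m<n. \<Sum>i = m * b..<m * b + b. f (i div b))"
    by (rule sum.nat_group[symmetric])
  also have "\<dots> = (\<Sum>m<n. \<Sum>i = m * b..<m * b + b. f m)"
  proof (intro sum.cong refl)
    fix m i assume "i \<in> {m * b..<m * b + b}"
    then have "i div b = m" using assms by (intro div_nat_eqI) (auto simp: algebra_simps)
    then show "f (i div b) = f m" by simp
  qed
  also have "\<dots> = real b * (\<Sum>l<n. f l)" by (simp add: sum_distrib_left)
  finally show ?thesis by (simp add: mult.commute)
qed

section \<open>Cell masses on two nested grids\<close>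

definition cell_mass :: "(real \<Rightarrow> real) \<Rightarrow> nat \<Rightarrow> nat \<Rightarrow> real" where
  "cell_mass u M k = mass u (cos (real (Suc k) * (pi / real M))) (cos (real k * (pi / real M)))"

lemma cell_mass_nonneg: "weight u \<Longrightarrow> 0 \<le> cell_mass u M k"
  unfolding cell_mass_def by (intro mass_nonneg) auto

lemma cos_grid_mono:
  assumes "k \<le> k'" "k' \<le> M"
  shows "cos (real k' * (pi / real M)) \<le> cos (real k * (pi / real M))"
proof (cases "M = 0")
  case False
  have "real k' * (pi / real M) \<le> real M * (pi / real M)" using assms by (intro mult_right_mono) auto
  then show ?thesis using assms False
    by (intro cos_monotone_0_pi_le mult_right_mono) auto
qed (use assms in simp)

text \<open>A coarse cell is a block of \<open>b\<close> fine cells, and two coarse cells lie in a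
  block of length one more than their index distance; so both doubling comparisons are instances of
  one estimate for blocks.\<close>

lemma cell_mass_comparison:
  assumes w: "weight u" "doubling u"
  obtains C a where "1 \<le> C" "0 \<le> a"
    "\<And>n l l'. l < n \<Longrightarrow> l' < n \<Longrightarrow> cell_mass u n l \<le> C * (1 + real (idist l l')) powr a * cell_mass u n l'"
    "\<And>n b k. 0 < b \<Longrightarrow> k < b * n \<Longrightarrow> cell_mass u n (k div b) \<le> C * real b powr a * cell_mass u (b * n) k"
    "\<And>n b k. 0 < b \<Longrightarrow> k < b * n \<Longrightarrow> cell_mass u (b * n) k \<le> cell_mass u n (k div b)"
proof -
  obtain C a where C: "1 \<le> C" "0 \<le> a"
    and D: "\<And>M \<alpha> l \<beta>. \<lbrakk>\<alpha> \<le> l; l < \<beta>; \<beta> \<le> M\<rbrakk> \<Longrightarrow>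
      mass u (cos (real \<beta> * (pi / real M))) (cos (real \<alpha> * (pi / real M)))
        \<le> C * real (\<beta> - \<alpha>) powr a * mass u (cos (real (Suc l) * (pi / real M))) (cos (real l * (pi / real M)))"
    using doubling_cos_grid[OF w] by metis
  have coarse: "real l * (pi / real n) = real (b * l) * (pi / real (b * n))" if "0 < b" for b l n :: nat
    using that by simp
  show ?thesis
  proof (rule that[OF C])
    fix n l l' :: nat assume l: "l < n" "l' < n"
    define \<alpha> where "\<alpha> = min l l'"
    define \<beta> where "\<beta> = Suc (max l l')"
    have ab: "\<alpha> \<le> l'" "l' < \<beta>" "\<beta> \<le> n" "\<alpha> \<le> l" "Suc l \<le> \<beta>" "real (\<beta> - \<alpha>) = 1 + real (idist l l')"
      using l unfolding \<alpha>_def \<beta>_def idist_def by (auto simp: min_def max_def)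
    have "cell_mass u n l \<le> mass u (cos (real \<beta> * (pi / real n))) (cos (real \<alpha> * (pi / real n)))"
      unfolding cell_mass_def using ab l by (intro mass_mono[OF w(1)] cos_grid_mono) auto
    also have "\<dots> \<le> C * (1 + real (idist l l')) powr a * cell_mass u n l'"
      using D[OF ab(1-3)] unfolding cell_mass_def ab(6) .
    finally show "cell_mass u n l \<le> C * (1 + real (idist l l')) powr a * cell_mass u n l'" .
  next
    fix n b k :: nat assume b: "0 < b" and k: "k < b * n"
    define l where "l = k div b"
    have l: "b * l \<le> k" "k < b * Suc l" "b * Suc l \<le> b * n"
    proof -
      show "b * l \<le> k" unfolding l_def by simp
      show "k < b * Suc l" unfolding l_def using b by (metis div_less_iff_less_mult lessI mult.commute)
      have "l < n" unfolding l_def using k b by (simp add: less_mult_imp_div_less mult.commute)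
      then show "b * Suc l \<le> b * n" by (intro mult_le_mono2) simp
    qed
    have eq: "cell_mass u n l = mass u (cos (real (b * Suc l) * (pi / real (b * n)))) (cos (real (b * l) * (pi / real (b * n))))"
      unfolding cell_mass_def using coarse[OF b, of l n] coarse[OF b, of "Suc l" n] by (simp only:)
    have rb: "real (b * Suc l - b * l) = real b" by simp
    show "cell_mass u n (k div b) \<le> C * real b powr a * cell_mass u (b * n) k"
      unfolding l_def[symmetric] eq unfolding cell_mass_def using D[OF l] unfolding rb .
    show "cell_mass u (b * n) k \<le> cell_mass u n (k div b)"
      unfolding l_def[symmetric] eq unfolding cell_mass_def using l k by (intro mass_mono[OF w(1)] cos_grid_mono) auto
  qed
qed

lemma idist_div:
  assumes "0 < b"
  shows "real b * real (idist (k div b) (j div b)) \<le> \<bar>real k - real j\<bar> + real b"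
proof -
  have k: "real b * real (k div b) \<le> real k" "real k \<le> real b * real (k div b) + real b" for k
  proof -
    have "b * (k div b) \<le> k" "k \<le> b * (k div b) + b"
      using assms by (simp_all add: mult_div_mod_eq[symmetric] less_imp_le) (metis add_le_cancel_left mod_less_divisor mult_div_mod_eq less_imp_le)
    then show "real b * real (k div b) \<le> real k" "real k \<le> real b * real (k div b) + real b"
      by (simp_all flip: of_nat_mult of_nat_add)
  qed
  have "real (idist (k div b) (j div b)) = \<bar>real (k div b) - real (j div b)\<bar>"
    unfolding idist_def by simp
  then have "real b * real (idist (k div b) (j div b)) = \<bar>real b * real (k div b) - real b * real (j div b)\<bar>"
    by (simp add: right_diff_distrib[symmetric] abs_mult)
  then show ?thesis using k[of k] k[of j] by linarith
qed

lemma exp_beats_powr: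
  fixes K q \<gamma> :: real
  assumes "0 < \<gamma>"
  shows "\<exists>n0. \<forall>n\<ge>n0. K * real n powr q * exp (- (real n powr \<gamma>)) \<le> 1 / 4"
proof -
  have "((\<lambda>n. K * real n powr q * exp (- (real n powr \<gamma>))) \<longlongrightarrow> 0) sequentially"
    using assms by real_asymp
  then have "\<forall>\<^sub>F n in sequentially. K * real n powr q * exp (- (real n powr \<gamma>)) < 1 / 4"
    by (rule order_tendstoD) simp
  then show ?thesis unfolding eventually_sequentially by (auto intro: less_imp_le)
qed

section \<open>The discrete inequality\<close>

lemma admissibleD:
  assumes "admissible A a0 \<kappa> n V"
  shows "V (t + 2 * pi) = V t" "V (- t) = V t" "0 \<le> V t" "V t \<le> real n"
    "\<exists>d \<sigma>. 0 < d \<and> d \<le> 1 \<and> a0 \<le> real n * d \<and> \<bar>\<sigma>\<bar> \<le> A * real n \<and>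
        (\<forall>s. \<bar>s - t\<bar> \<le> d \<longrightarrow> V s - V t \<le> \<sigma> * (s - t) + A * real n * (s - t)\<^sup>2 / d + A) \<and>
        (\<forall>s. \<bar>s - t\<bar> \<le> \<kappa> \<longrightarrow> V s - V t \<le> A * real n * d + A)"
  using assms unfolding admissible_def by blast+

text \<open>Whatever the scale \<open>d\<close> at \<open>t\<close>, it is at least
  \<open>a0 / n\<close>; up to that distance the linear, the quadratic and the constant term of the
  parabola are at most \<open>A\<close> each.\<close>

lemma admissible_slowly_varying:
  assumes V: "admissible A a0 \<kappa> n V" and n: "1 \<le> n" and A: "1 \<le> A" "a0 \<le> 1" and s: "\<bar>s - t\<bar> \<le> a0 / real n"
  shows "V s \<le> V t + 3 * A"
proof -
  obtain d \<sigma> where d: "0 < d" "d \<le> 1" "a0 \<le> real n * d" "\<bar>\<sigma>\<bar> \<le> A * real n"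
    "\<And>s. \<bar>s - t\<bar> \<le> d \<Longrightarrow> V s - V t \<le> \<sigma> * (s - t) + A * real n * (s - t)\<^sup>2 / d + A"
    using admissibleD(5)[OF V, of t] by blast
  have n0: "0 < real n" using n by simp
  have "a0 / real n \<le> d" using d(3) n0 by (simp add: field_simps)
  then have sd: "\<bar>s - t\<bar> \<le> d" using s by linarith
  have "a0 / real n \<le> 1 / real n" using A n0 by (intro divide_right_mono) auto
  then have s1: "\<bar>s - t\<bar> \<le> 1 / real n" using s by linarith
  have An: "0 \<le> A * real n" using A by simp
  have "\<sigma> * (s - t) \<le> \<bar>\<sigma>\<bar> * \<bar>s - t\<bar>" by (metis abs_ge_self abs_mult)
  also have "\<dots> \<le> (A * real n) * (1 / real n)" using d(4) s1 An by (intro mult_mono) auto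
  also have "\<dots> = A" using n0 by simp
  finally have 1: "\<sigma> * (s - t) \<le> A" .
  have "(s - t)\<^sup>2 / d \<le> 1 / real n"
  proof -
    have "(s - t)\<^sup>2 = \<bar>s - t\<bar> * \<bar>s - t\<bar>" by (simp add: power2_eq_square)
    also have "\<dots> \<le> d * (1 / real n)" using sd s1 d(1) by (intro mult_mono) auto
    finally show ?thesis using d(1) by (simp add: divide_le_eq mult.commute)
  qed
  then have "(A * real n) * ((s - t)\<^sup>2 / d) \<le> (A * real n) * (1 / real n)" using An by (intro mult_left_mono) auto
  also have "\<dots> = A" using n0 by simp
  finally have "A * real n * (s - t)\<^sup>2 / d \<le> A" by simp
  then show ?thesis using d(5)[OF sd] 1 by linarith
qed

lemma even_periodic_reduce:
  assumes "\<And>t. f (t + 2 * pi) = f (t::real)" "\<And>t. f (- t) = f t" "\<And>t. 0 \<le> t \<Longrightarrow> t \<le> pi \<Longrightarrow> f t \<le> (B::real)"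
  shows "f t \<le> B"
proof -
  obtain k where k: "t - of_int k * (2 * pi) \<in> {0..2 * pi}" using reduce_mod_2pi by blast
  define x where "x = t - of_int k * (2 * pi)"
  have ft: "f t = f x" unfolding x_def using periodic_int(2)[of f, OF assms(1)] by simp
  show ?thesis
  proof (cases "x \<le> pi")
    case True then show ?thesis using assms(3)[of x] k ft unfolding x_def by simp
  next
    case False
    have "f x = f (- x + 2 * pi)" using assms(1)[of "- x"] assms(2)[of x] by simp
    also have "\<dots> \<le> B" using False k unfolding x_def[symmetric] by (intro assms(3)) auto
    finally show ?thesis using ft by simp
  qed
qed

section \<open>Cells in the angular variable\<close>

definition cell :: "nat \<Rightarrow> nat \<Rightarrow> real set" where
  "cell M k = {real k * (pi / real M)..real (Suc k) * (pi / real M)}"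

lemma node_in_cell: "node M k \<in> cell M k"
  unfolding node_def cell_def atLeastAtMost_iff by (intro conjI mult_right_mono) auto

lemma cell_bounds:
  assumes "k < M" "t \<in> cell M k"
  shows "0 \<le> t" "t \<le> pi"
proof -
  have t: "real k * (pi / real M) \<le> t" "t \<le> real (Suc k) * (pi / real M)"
    using assms(2) unfolding cell_def atLeastAtMost_iff by blast+
  have "0 \<le> real k * (pi / real M)" by simp
  then show "0 \<le> t" using t(1) by (rule order.trans)
  have "real (Suc k) * (pi / real M) \<le> real M * (pi / real M)" using assms by (intro mult_right_mono) auto
  also have "\<dots> = pi" using assms by simp
  finally show "t \<le> pi" using t(2) by (rule order.trans[rotated])
qed

lemma cell_diameter:
  assumes "s \<in> cell M k" "t \<in> cell M k"
  shows "\<bar>s - t\<bar> \<le> pi / real M"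
proof -
  define h where "h = pi / real M"
  have "real (Suc k) * h = real k * h + h" by (simp add: distrib_right)
  then show ?thesis using assms unfolding cell_def h_def[symmetric] atLeastAtMost_iff by linarith
qed

text \<open>The factor 10 must not depend on \<open>b\<close>: index distances of coarse cells are
  counted in units of \<open>pi / n\<close>, and rounding to coarse cells loses at most one
  unit.\<close>

lemma cell_node_distance:
  assumes "0 < b" "1 \<le> n" "t \<in> cell (b * n) k"
  shows "1 + real (idist (k div b) (j div b)) \<le> 10 * (1 + real n * \<bar>node (b * n) j - t\<bar>)"
proof -
  define d where "d = real (idist (k div b) (j div b))"
  define h where "h = pi / real (b * n)"
  have h: "real n * h = pi / real b" unfolding h_def using assms by simp
  define X where "X = real n * \<bar>node (b * n) j - t\<bar>"
  have X0: "0 \<le> X" unfolding X_def by simp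
  have t: "real k * h \<le> t" "t \<le> (real k + 1) * h" using assms(3) unfolding cell_def h_def by (auto simp: algebra_simps)
  have "(\<bar>real k - real j\<bar> - 1/2) * h \<le> \<bar>node (b * n) j - t\<bar>"
  proof (cases "j \<le> k")
    case True
    have "(\<bar>real k - real j\<bar> - 1/2) * h = real k * h - (real j + 1/2) * h" using True by (simp add: algebra_simps)
    then show ?thesis using t(1) unfolding node_def h_def[symmetric] by linarith
  next
    case False
    have "(\<bar>real k - real j\<bar> - 1/2) * h = (real j + 1/2) * h - (real k + 1) * h" using False by (simp add: algebra_simps)
    then show ?thesis using t(2) unfolding node_def h_def[symmetric] by linarith
  qed
  then have "real n * ((\<bar>real k - real j\<bar> - 1/2) * h) \<le> X" unfolding X_def by (intro mult_left_mono) auto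
  then have "(\<bar>real k - real j\<bar> - 1/2) * (real n * h) \<le> X" by (simp add: mult_ac)
  then have X: "(\<bar>real k - real j\<bar> - 1/2) * (pi / real b) \<le> X" unfolding h .
  have b: "1 \<le> real b" using assms by simp
  have "real b * d - real b - 1/2 \<le> \<bar>real k - real j\<bar> - 1/2"
    using idist_div[OF assms(1), of k j] unfolding d_def by linarith
  then have "(real b * d - real b - 1/2) * (pi / real b) \<le> (\<bar>real k - real j\<bar> - 1/2) * (pi / real b)"
    by (intro mult_right_mono) auto
  also have "(real b * d - real b - 1/2) * (pi / real b) = pi * (d - 1) - pi / (2 * real b)" using b by (simp add: field_simps)
  finally have "pi * (d - 1) - pi / (2 * real b) \<le> X" using X by linarith
  moreover have "pi / (2 * real b) \<le> pi / 2" using b by (intro divide_left_mono) auto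
  ultimately have Xd: "pi * (d - 1) - pi / 2 \<le> X" by linarith
  show ?thesis
  proof (cases "d \<le> 1")
    case True
    then have "1 + d \<le> 10 + 10 * X" using X0 by linarith
    then show ?thesis unfolding d_def X_def by (simp add: distrib_left)
  next
    case False
    then have "2 \<le> d" unfolding d_def by simp
    then have "3 * (d - 1) \<le> pi * (d - 1)" using pi_gt3 by (intro mult_right_mono) auto
    then have "3 * d - 3 \<le> pi * (d - 1)" by (simp only: right_diff_distrib mult_1_right)
    then have "1 + d \<le> 10 + 10 * X" using Xd \<open>2 \<le> d\<close> pi_less_4 by linarith
    then show ?thesis unfolding d_def X_def by (simp add: distrib_left)
  qed
qed

text \<open>Here \<open>I k\<close> and \<open>D k\<close> stand for the integrals of \<open>|P|\<^sup>p\<close> and \<open>|P'|\<^sup>p\<close> against the weight over the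
  \<open>k\<close>-th cell; only the two bounds by pointwise values are used. Cells of length \<open>\<pi> / (b n)\<close> are compared with the
  masses of cells of length \<open>\<pi> / n\<close>, so that the oscillation of \<open>P\<close> on a small cell is absorbed for large \<open>b\<close>.\<close>

lemma discrete_markov:
  fixes p :: real and u V W :: "real \<Rightarrow> real"
  assumes p: "0 < p" and u: "weight u" "doubling u" and L: "landscape \<Gamma> \<kappa> Z V"
    and W: "\<And>t. W t = (if t \<in> Z then 0 else exp (- V t))"
  shows "\<exists>C b n0. 0 < b \<and> 0 < C \<and> (\<forall>n P I D. 1 \<le> n \<and> n0 \<le> n \<and> degree P \<le> n \<and>
       (\<forall>k m. k < b * n \<and> 0 \<le> m \<and> (\<forall>t\<in>cell (b * n) k. m \<le> cmod (poly P (of_real (cos t))) powr p * W t)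
          \<longrightarrow> m * cell_mass u (b * n) k \<le> I k) \<and>
       (\<forall>k m. k < b * n \<and> 0 \<le> m \<and> (\<forall>t\<in>cell (b * n) k. cmod (poly (pderiv P) (of_real (cos t))) powr p * W t \<le> m)
          \<longrightarrow> D k \<le> m * cell_mass u (b * n) k)
       \<longrightarrow> (\<Sum>k<b * n. D k) \<le> C * real n powr (2 * p) * (\<Sum>k<b * n. (I k :: real)))"
proof -
  note LD = landscapeD[OF L]
  have G: "1 \<le> \<Gamma>" by (rule LD(1))
  have k: "0 < \<kappa>" "\<kappa> \<le> 1" by (rule LD(2), rule LD(3))
  obtain Cd a where Cd: "1 \<le> Cd" and a: "0 \<le> a"
    and m1: "\<And>n l l'. l < n \<Longrightarrow> l' < n \<Longrightarrow> cell_mass u n l \<le> Cd * (1 + real (idist l l')) powr a * cell_mass u n l'"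
    and m2: "\<And>n b k. 0 < b \<Longrightarrow> k < b * n \<Longrightarrow> cell_mass u n (k div b) \<le> Cd * real b powr a * cell_mass u (b * n) k"
    and m3: "\<And>n b k. 0 < b \<Longrightarrow> k < b * n \<Longrightarrow> cell_mass u (b * n) k \<le> cell_mass u n (k div b)"
    using cell_mass_comparison[OF u] by blast
  \<comment> \<open>Masses of cells may grow like the power \<open>a\<close> of their distance; two
    further powers of decay make the sum over cells converge.\<close>
  define r where "r = a + 2"
  have r: "0 < r" unfolding r_def using a by simp
  obtain C0 CR where C0: "0 < C0" and CR: "0 < CR"
    and remez: "\<And>n P U S \<tau> \<rho> t. \<lbrakk>1 \<le> n; degree P \<le> n; \<And>s. U s \<le> real n;
       \<And>s. cmod (poly P (of_real (cos s))) powr p \<le> S * exp (U s);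
       0 < \<rho>; \<rho> \<le> \<kappa>; \<bar>t - \<tau>\<bar> \<le> \<rho>;
       \<And>s. \<rho> \<le> \<bar>s - \<tau>\<bar> \<Longrightarrow> \<bar>s - \<tau>\<bar> \<le> \<kappa> \<Longrightarrow> U s \<le> \<Gamma> * (real n * \<rho>)\<rbrakk> \<Longrightarrow>
       cmod (poly P (of_real (cos t))) powr p \<le> CR * real n powr p * exp (C0 * (real n * \<rho>)) * S"
  proof -
    have "0 \<le> \<Gamma>" using G by linarith
    from remez_growth[OF k p this] show ?thesis using that by blast
  qed
  \<comment> \<open>Exceeding \<open>C0\<close> by 1 lets the height \<open>C2 * n * \<rho>\<close>
    beat the Remez growth with \<open>n * \<rho>\<close> to spare.\<close>
  define C2 where "C2 = max \<Gamma> (C0 + 1)"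
  define \<gamma> where "\<gamma> = 1 / (2 * (\<Gamma> * (1 + \<Gamma>)))"
  have \<gamma>: "0 < \<gamma>" unfolding \<gamma>_def using G by simp
  obtain A a0 n1 where A: "1 \<le> A" and a0: "0 < a0" "a0 \<le> 1"
    and trunc: "\<And>n. n1 \<le> n \<Longrightarrow> \<exists>U. admissible A a0 \<kappa> n U \<and>
     (\<forall>t. t \<notin> Z \<longrightarrow> U t \<le> V t) \<and>
     (\<forall>t. (t \<notin> Z \<and> U t = V t) \<or>
        (\<exists>\<tau> \<rho>. 0 < \<rho> \<and> \<rho> \<le> \<kappa> \<and> \<bar>t - \<tau>\<bar> \<le> \<rho> \<and> C2 * (real n * \<rho>) \<le> U t \<and> real n powr \<gamma> \<le> real n * \<rho> \<and>
           (\<forall>s. \<rho> \<le> \<bar>s - \<tau>\<bar> \<and> \<bar>s - \<tau>\<bar> \<le> \<kappa> \<longrightarrow> U s \<le> \<Gamma> * (real n * \<rho>))))"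
    using landscape_truncation[OF L, of C2] unfolding C2_def \<gamma>_def by auto
  obtain c C1 b0 where c: "0 < c" and C1: "0 < C1"
    and pw: "\<And>n b V P t z. \<lbrakk>1 \<le> n; b0 \<le> b; admissible A a0 \<kappa> n V; degree P \<le> n; 0 \<le> t; t \<le> pi; cmod (z - of_real t) \<le> c / real n\<rbrakk> \<Longrightarrow>
      cmod (poly P (cos z)) powr p * exp (- V t) \<le>
        C1 / real b * (\<Sum>k<b * n. cmod (poly P (of_real (cos (node (b * n) k)))) powr p * exp (- V (node (b * n) k)) *
                        (1 + real n * \<bar>node (b * n) k - t\<bar>) powr (- r))"
    using pointwise_bound[OF A a0 k p r] by blast
  obtain CM where CM: "0 < CM"
    and pd: "\<And>n P t B. \<lbrakk>1 \<le> n; \<And>z. cmod (z - of_real t) \<le> c / real n \<Longrightarrow> cmod (poly P (cos z)) \<le> B\<rbrakk> \<Longrightarrow>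
       cmod (poly (pderiv P) (of_real (cos t))) \<le> CM * (real n)\<^sup>2 * B"
    using pderiv_bound[OF c] by blast
  define E0 where "E0 = exp (3 * A)"
  have E0: "1 \<le> E0" unfolding E0_def using A by simp
  define C3 where "C3 = C1 * 10 powr r * (4 * Cd)"
  have C3: "0 < C3" unfolding C3_def using C1 Cd by simp
  \<comment> \<open>\<open>C3\<close> is free of \<open>b\<close>, so the oscillation of
    \<open>P\<close> on a cell, of relative size \<open>pi / (b * c)\<close>, can be made small
    against it.\<close>
  obtain b where b: "0 < b" "b0 \<le> b" "pi / real b \<le> a0" "2 powr p * (pi / (real b * c)) powr p * E0 * C3 \<le> 1 / 4"
  proof -
    have "((\<lambda>b. 2 powr p * (pi / (real b * c)) powr p * E0 * C3) \<longlongrightarrow> 0) sequentially"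
      using p c by real_asymp
    then have e1: "\<forall>\<^sub>F b in sequentially. 2 powr p * (pi / (real b * c)) powr p * E0 * C3 < 1 / 4"
      by (rule order_tendstoD) simp
    have "((\<lambda>b. pi / real b) \<longlongrightarrow> 0) sequentially" by real_asymp
    then have e2: "\<forall>\<^sub>F b in sequentially. pi / real b < a0" by (rule order_tendstoD) (rule a0)
    have "\<forall>\<^sub>F b in sequentially. 0 < b \<and> b0 \<le> b \<and> pi / real b < a0 \<and> 2 powr p * (pi / (real b * c)) powr p * E0 * C3 < 1 / 4"
      using e1 e2 eventually_gt_at_top[of 0] eventually_ge_at_top[of b0] by eventually_elim auto
    then show ?thesis using that by (auto simp: eventually_sequentially intro: less_imp_le)
  qed
  obtain n2 where n2: "\<And>n. n2 \<le> n \<Longrightarrow> (2 powr p * E0 * CR * C1 * Cd) * real n powr (p + (1 + a)) * exp (- (real n powr \<gamma>)) \<le> 1 / 4"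
    using exp_beats_powr[OF \<gamma>, of "2 powr p * E0 * CR * C1 * Cd" "p + (1 + a)"] by blast
  define K1 where "K1 = 2 powr p * E0 * (Cd * real b powr a)"
  have K1: "0 < K1" unfolding K1_def using E0 Cd b by simp
  define C where "C = CM powr p * C3 * (2 * K1)"
  show ?thesis
  proof (rule exI[of _ C], rule exI[of _ b], rule exI[of _ "max n1 n2"], intro conjI allI impI)
    show "0 < b" by (rule b)
    show "0 < C" unfolding C_def using CM C3 K1 by simp
    fix n :: nat and P :: "complex poly" and I D :: "nat \<Rightarrow> real"
    assume *: "1 \<le> n \<and> max n1 n2 \<le> n \<and> degree P \<le> n \<and>
       (\<forall>k m. k < b * n \<and> 0 \<le> m \<and> (\<forall>t\<in>cell (b * n) k. m \<le> cmod (poly P (of_real (cos t))) powr p * W t)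
          \<longrightarrow> m * cell_mass u (b * n) k \<le> I k) \<and>
       (\<forall>k m. k < b * n \<and> 0 \<le> m \<and> (\<forall>t\<in>cell (b * n) k. cmod (poly (pderiv P) (of_real (cos t))) powr p * W t \<le> m)
          \<longrightarrow> D k \<le> m * cell_mass u (b * n) k)"
    then have n: "1 \<le> n" "max n1 n2 \<le> n" and P: "degree P \<le> n" by blast+
    have I: "m * cell_mass u (b * n) k \<le> I k"
      if "k < b * n" "0 \<le> m" "\<And>t. t \<in> cell (b * n) k \<Longrightarrow> m \<le> cmod (poly P (of_real (cos t))) powr p * W t" for k m
      using * that by blast
    have D: "D k \<le> m * cell_mass u (b * n) k"
      if "k < b * n" "0 \<le> m" "\<And>t. t \<in> cell (b * n) k \<Longrightarrow> cmod (poly (pderiv P) (of_real (cos t))) powr p * W t \<le> m" for k m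
      using * that by blast
    define M where "M = b * n"
    have M: "0 < M" unfolding M_def using b n by simp
    have nr: "1 \<le> real n" using n by simp
    obtain U where U: "admissible A a0 \<kappa> n U" and UV: "\<And>t. t \<notin> Z \<Longrightarrow> U t \<le> V t"
      and bad: "\<And>t. (t \<notin> Z \<and> U t = V t) \<or>
        (\<exists>\<tau> \<rho>. 0 < \<rho> \<and> \<rho> \<le> \<kappa> \<and> \<bar>t - \<tau>\<bar> \<le> \<rho> \<and> C2 * (real n * \<rho>) \<le> U t \<and> real n powr \<gamma> \<le> real n * \<rho> \<and>
           (\<forall>s. \<rho> \<le> \<bar>s - \<tau>\<bar> \<and> \<bar>s - \<tau>\<bar> \<le> \<kappa> \<longrightarrow> U s \<le> \<Gamma> * (real n * \<rho>)))"
      using trunc[of n] n by auto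
    note UD = admissibleD[OF U]
    have WU: "0 \<le> W t" "W t \<le> exp (- U t)" for t using UV[of t] by (auto simp: W)
    define T where "T t = cmod (poly P (of_real (cos t)))" for t
    define \<alpha> where "\<alpha> j = T (node M j) powr p * exp (- U (node M j))" for j
    have \<alpha>0: "0 \<le> \<alpha> j" for j unfolding \<alpha>_def by simp
    define v where "v k = cell_mass u n (k div b)" for k
    have v0: "0 \<le> v k" for k unfolding v_def by (rule cell_mass_nonneg[OF u(1)])
    define dl where "dl k j = 1 + real (idist (k div b) (j div b))" for k j
    have dl1: "1 \<le> dl k j" for k j unfolding dl_def by simp
    have divn: "k div b < n" if "k < M" for k using that unfolding M_def by (simp add: less_mult_imp_div_less mult.commute)
    have vv: "v k \<le> Cd * dl k j powr a * v j" if "k < M" "j < M" for k j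
      unfolding v_def dl_def using m1[OF divn[OF that(1)] divn[OF that(2)]] .
    \<comment> \<open>A discrete norm of \<open>P\<close> with the truncated weight and coarse
      masses: it dominates the derivative and is in turn to be dominated by the cell integrals
      \<open>I\<close>.\<close>
    define \<Lambda> where "\<Lambda> = (\<Sum>j<M. \<alpha> j * v j)"
    have \<Lambda>0: "0 \<le> \<Lambda>" unfolding \<Lambda>_def using \<alpha>0 v0 by (intro sum_nonneg) auto
    define Y where "Y k = C1 / real b * (10 powr r * (\<Sum>j<M. \<alpha> j * dl k j powr (- r)))" for k
    have Y0: "0 \<le> Y k" for k unfolding Y_def using C1 \<alpha>0 by (intro mult_nonneg_nonneg sum_nonneg) auto
    have Y: "cmod (poly P (cos z)) powr p * exp (- U t) \<le> Y k"
      if k: "k < M" "t \<in> cell M k" and z: "cmod (z - of_real t) \<le> c / real n" for k t z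
    proof -
      have "cmod (poly P (cos z)) powr p * exp (- U t) \<le>
        C1 / real b * (\<Sum>j<M. \<alpha> j * (1 + real n * \<bar>node M j - t\<bar>) powr (- r))"
        using pw[OF n(1) b(2) U P cell_bounds[OF k] z] unfolding \<alpha>_def T_def M_def .
      also have "\<dots> \<le> C1 / real b * (\<Sum>j<M. \<alpha> j * (10 powr r * dl k j powr (- r)))"
      proof (intro mult_left_mono sum_mono)
        fix j
        have "dl k j / 10 \<le> 1 + real n * \<bar>node M j - t\<bar>"
          using cell_node_distance[OF b(1) n(1), of t k j] k(2) unfolding dl_def M_def by simp
        then have "(1 + real n * \<bar>node M j - t\<bar>) powr (- r) \<le> (dl k j / 10) powr (- r)"
          using r dl1[of k j] by (intro powr_mono2') auto
        also have "\<dots> = 10 powr r * dl k j powr (- r)" using dl1[of k j] by (simp add: powr_divide powr_minus_divide)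
        finally show "(1 + real n * \<bar>node M j - t\<bar>) powr (- r) \<le> 10 powr r * dl k j powr (- r)" .
      qed (use \<alpha>0 C1 in auto)
      also have "\<dots> = Y k" unfolding Y_def by (simp add: sum_distrib_left mult_ac)
      finally show ?thesis .
    qed
    \<comment> \<open>A Schur-type estimate: the growth of the masses uses up all but two powers of
      the decay, and the \<open>b\<close> fine cells in each coarse cell cancel the
      \<open>1 / b\<close> in \<open>Y\<close>.\<close>
    have sumY: "(\<Sum>k<M. v k * Y k) \<le> C3 * \<Lambda>"
    proof -
      have inner: "(\<Sum>k<M. v k * dl k j powr (- r)) \<le> 4 * Cd * real b * v j" if j: "j < M" for j
      proof -
        have "(\<Sum>k<M. v k * dl k j powr (- r)) \<le> (\<Sum>k<M. Cd * v j * dl k j powr (- 2))"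
        proof (intro sum_mono)
          fix k assume "k \<in> {..<M}"
          then have "v k * dl k j powr (- r) \<le> (Cd * dl k j powr a * v j) * dl k j powr (- r)"
            using vv[of k j] j by (intro mult_right_mono) auto
          also have "\<dots> = Cd * v j * (dl k j powr a * dl k j powr (- r))" by simp
          also have "dl k j powr a * dl k j powr (- r) = dl k j powr (- 2)" unfolding r_def by (simp flip: powr_add)
          finally show "v k * dl k j powr (- r) \<le> Cd * v j * dl k j powr (- 2)" .
        qed
        also have "\<dots> = Cd * v j * (\<Sum>k<b * n. (1 + real (idist (k div b) (j div b))) powr (- 2))"
          unfolding dl_def M_def by (simp add: sum_distrib_left)
        also have "(\<Sum>k<b * n. (1 + real (idist (k div b) (j div b))) powr (- 2))
            = real b * (\<Sum>l<n. (1 + real (idist l (j div b))) powr (- 2))"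
          by (rule sum_div_blocks[OF b(1), of "\<lambda>l. (1 + real (idist l (j div b))) powr (- 2)"])
        also have "Cd * v j * (real b * (\<Sum>l<n. (1 + real (idist l (j div b))) powr (- 2))) \<le> Cd * v j * (real b * 4)"
        proof -
          have "(\<Sum>l<n. (1 + real (idist l (j div b))) powr (- 2)) \<le> 2 * (\<Sum>i<n. (1 + real i) powr (- 2))"
            by (rule sum_idist_le[of "\<lambda>i. (1 + real i) powr (- 2)"]) (use divn[OF j] in auto)
          also have "2 * (\<Sum>i<n. (1 + real i) powr (- 2)) \<le> 2 * 2" by (intro mult_left_mono sum_inverse_squares_le) auto
          finally show ?thesis using Cd v0[of j] by (intro mult_left_mono) auto
        qed
        finally show ?thesis by (simp add: mult_ac)
      qed
      have "(\<Sum>k<M. v k * Y k) = C1 / real b * 10 powr r * (\<Sum>k<M. \<Sum>j<M. \<alpha> j * (v k * dl k j powr (- r)))"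
        unfolding Y_def by (simp add: sum_distrib_left mult_ac)
      also have "\<dots> = C1 / real b * 10 powr r * (\<Sum>j<M. \<alpha> j * (\<Sum>k<M. v k * dl k j powr (- r)))"
        by (subst sum.swap) (simp add: sum_distrib_left)
      also have "\<dots> \<le> C1 / real b * 10 powr r * (\<Sum>j<M. \<alpha> j * (4 * Cd * real b * v j))"
        using inner \<alpha>0 C1 by (intro mult_left_mono sum_mono) auto
      also have "\<dots> = C1 / real b * 10 powr r * (4 * Cd * real b) * \<Lambda>"
        unfolding \<Lambda>_def by (simp add: sum_distrib_left mult_ac)
      also have "\<dots> = C3 * \<Lambda>" unfolding C3_def using b by simp
      finally show ?thesis .
    qed
    define S where "S = C1 / real b * (\<Sum>j<M. \<alpha> j)"
    have S0: "0 \<le> S" unfolding S_def using C1 \<alpha>0 by (intro mult_nonneg_nonneg sum_nonneg) auto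
    \<comment> \<open>The decay is dropped here: the Remez inequality needs one bound valid at all
      points.\<close>
    have TS: "T t powr p \<le> S * exp (U t)" for t
    proof -
      define f where "f t = T t powr p * exp (- U t)" for t
      have "f t \<le> S"
      proof (rule even_periodic_reduce[of f])
        show "f (t + 2 * pi) = f t" "f (- t) = f t" for t unfolding f_def T_def using UD(1,2) by auto
        fix t assume t: "0 \<le> t" "t \<le> pi"
        have "cmod (poly P (cos (of_real t))) powr p * exp (- U t) \<le>
          C1 / real b * (\<Sum>j<M. \<alpha> j * (1 + real n * \<bar>node M j - t\<bar>) powr (- r))"
          using pw[OF n(1) b(2) U P t, of "of_real t"] c unfolding \<alpha>_def T_def M_def by simp
        also have "\<dots> \<le> C1 / real b * (\<Sum>j<M. \<alpha> j * 1)"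
        proof (intro mult_left_mono sum_mono)
          fix j
          have "(1 + real n * \<bar>node M j - t\<bar>) powr (- r) \<le> (1 + real n * \<bar>node M j - t\<bar>) powr 0"
            using r by (intro powr_mono) auto
          also have "\<dots> = 1"
          proof -
            have "0 \<le> real n * \<bar>node M j - t\<bar>" by simp
            then have "1 + real n * \<bar>node M j - t\<bar> \<noteq> 0" by linarith
            then show ?thesis by simp
          qed
          finally show "(1 + real n * \<bar>node M j - t\<bar>) powr (- r) \<le> 1" .
        qed (use \<alpha>0 C1 in auto)
        finally show "f t \<le> S" unfolding f_def T_def S_def by (simp add: cos_of_real)
      qed
      then have "f t * exp (U t) \<le> S * exp (U t)" by (intro mult_right_mono) auto
      then show ?thesis unfolding f_def by (simp add: mult.assoc flip: exp_add)
    qed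
    have slow: "exp (- U s) \<le> E0 * exp (- U t)" if "s \<in> cell M k" "t \<in> cell M k" for s t k
    proof -
      have "pi / real M = (pi / real b) / real n" unfolding M_def by simp
      also have "\<dots> \<le> a0 / real n" using b by (intro divide_right_mono) auto
      finally have "\<bar>t - s\<bar> \<le> a0 / real n" using cell_diameter[OF that(2,1)] by linarith
      from admissible_slowly_varying[OF U n(1) A a0(2) this]
      have "- U s \<le> 3 * A - U t" by linarith
      then have "exp (- U s) \<le> exp (3 * A - U t)" by simp
      then show ?thesis unfolding E0_def by (simp flip: exp_add)
    qed
    define q where "q = 2 powr p * (pi / (real b * c)) powr p * E0"
    have q0: "0 \<le> q" unfolding q_def using E0 by simp
    \<comment> \<open>The value at the node is compared with that at an arbitrary point of the cell,
      which gives access to the minimum over the cell; the error is the Lipschitz constant times the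
      cell length, measured by \<open>Y k\<close>.\<close>
    have osc: "\<alpha> k \<le> 2 powr p * E0 * (T t powr p * exp (- U t)) + q * Y k" if k: "k < M" and t: "t \<in> cell M k" for k t
    proof -
      define s where "s = node M k"
      have s: "s \<in> cell M k" unfolding s_def by (rule node_in_cell)
      define B where "B = (E0 * Y k * exp (U s)) powr (1 / p)"
      have Bp: "B powr p = E0 * Y k * exp (U s)" unfolding B_def using p E0 Y0[of k] by (simp add: powr_powr)
      have B0: "0 \<le> B" unfolding B_def by simp
      have PB: "cmod (poly P (cos z)) \<le> B" if x: "x \<in> cell M k" "cmod (z - of_real x) \<le> c / real n" for x z
      proof -
        have "cmod (poly P (cos z)) powr p * exp (- U s) \<le> cmod (poly P (cos z)) powr p * (E0 * exp (- U x))"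
          using slow[OF s x(1)] by (intro mult_left_mono) auto
        also have "\<dots> = E0 * (cmod (poly P (cos z)) powr p * exp (- U x))" by simp
        also have "\<dots> \<le> E0 * Y k" using Y[OF k x] E0 by (intro mult_left_mono) auto
        finally have "cmod (poly P (cos z)) powr p * exp (- U s) * exp (U s) \<le> E0 * Y k * exp (U s)" by (intro mult_right_mono) auto
        then have "cmod (poly P (cos z)) powr p \<le> E0 * Y k * exp (U s)" by (simp add: mult.assoc flip: exp_add)
        then have "(cmod (poly P (cos z)) powr p) powr (1 / p) \<le> B" unfolding B_def using p by (intro powr_mono2) auto
        then show ?thesis using p by (simp add: powr_powr)
      qed
      have "convex (cell M k)" unfolding cell_def by simp
      then have "cmod (poly P (of_real (cos s)) - poly P (of_real (cos t))) \<le> real n / c * B * \<bar>s - t\<bar>"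
        by (rule cos_poly_lipschitz[OF n(1) c _ s t PB])
      also have "\<dots> \<le> real n / c * B * (pi / real M)" using cell_diameter[OF s t] c B0 by (intro mult_left_mono) auto
      also have "\<dots> = pi / (real b * c) * B" unfolding M_def using nr by (simp add: mult_ac)
      finally have "T s \<le> T t + pi / (real b * c) * B"
        unfolding T_def using norm_triangle_sub[of "poly P (of_real (cos s))" "poly P (of_real (cos t))"] by linarith
      then have "T s powr p \<le> (T t + pi / (real b * c) * B) powr p" unfolding T_def using p by (intro powr_mono2) auto
      also have "\<dots> \<le> 2 powr p * (T t powr p + (pi / (real b * c) * B) powr p)"
        using p c B0 by (intro powr_add_le) (auto simp: T_def)
      also have "(pi / (real b * c) * B) powr p = (pi / (real b * c)) powr p * (E0 * Y k * exp (U s))"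
        using c B0 by (simp only: powr_mult Bp)
      finally have "T s powr p * exp (- U s) \<le> 2 powr p * (T t powr p + (pi / (real b * c)) powr p * (E0 * Y k * exp (U s))) * exp (- U s)"
        by (intro mult_right_mono) auto
      also have "\<dots> = 2 powr p * (T t powr p * exp (- U s)) + q * Y k * (exp (U s) * exp (- U s))"
        unfolding q_def by (simp add: algebra_simps)
      also have "exp (U s) * exp (- U s) = 1" by (simp flip: exp_add)
      also have "2 powr p * (T t powr p * exp (- U s)) \<le> 2 powr p * (T t powr p * (E0 * exp (- U t)))"
        using slow[OF s t] by (intro mult_left_mono) auto
      finally show ?thesis unfolding \<alpha>_def s_def by (simp add: mult_ac)
    qed
    define \<epsilon> where "\<epsilon> = CR * real n powr p * exp (- (real n powr \<gamma>))"
    have \<epsilon>0: "0 \<le> \<epsilon>" unfolding \<epsilon>_def using CR by simp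
    have I0: "0 \<le> I k" if "k < M" for k using I[of k 0] that WU(1) unfolding M_def by simp
    have each: "\<alpha> k * v k \<le> K1 * I k + q * (v k * Y k) + 2 powr p * E0 * \<epsilon> * (S * v k)" if k: "k < M" for k
    proof (cases "\<forall>t\<in>cell M k. t \<notin> Z \<and> U t = V t")
      case True
      \<comment> \<open>By \<open>osc\<close> this is a lower bound for
        \<open>|P| powr p * W\<close> on the whole cell; the maximum with 0 covers cells where the
        error term prevails.\<close>
      define m where "m = max 0 ((\<alpha> k - q * Y k) / (2 powr p * E0))"
      have pE: "0 < 2 powr p * E0" using E0 by simp
      have "m * cell_mass u M k \<le> I k"
        unfolding M_def
      proof (rule I)
        show "k < b * n" using k unfolding M_def .
        show "0 \<le> m" unfolding m_def by simp
        fix t assume t: "t \<in> cell (b * n) k"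
        then have tt: "t \<in> cell M k" unfolding M_def .
        have "W t = exp (- U t)" using True tt by (simp add: W)
        moreover have "(\<alpha> k - q * Y k) / (2 powr p * E0) \<le> T t powr p * exp (- U t)"
          using osc[OF k tt] pE by (simp add: divide_le_eq mult_ac)
        ultimately show "m \<le> cmod (poly P (of_real (cos t))) powr p * W t" unfolding m_def T_def by auto
      qed
      then have mI: "Cd * real b powr a * (m * cell_mass u M k) \<le> Cd * real b powr a * I k" using Cd by (intro mult_left_mono) auto
      have "m * v k \<le> m * (Cd * real b powr a * cell_mass u M k)"
        unfolding v_def M_def using m2[OF b(1)] k unfolding M_def by (intro mult_left_mono) (auto simp: m_def)
      then have mv: "m * v k \<le> Cd * real b powr a * I k" using mI by (simp add: mult_ac)
      have "\<alpha> k \<le> 2 powr p * E0 * m + q * Y k"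
      proof -
        have "(\<alpha> k - q * Y k) / (2 powr p * E0) \<le> m" unfolding m_def by simp
        then have "\<alpha> k - q * Y k \<le> m * (2 powr p * E0)" using pE by (simp only: divide_le_eq if_True)
        then show ?thesis by (simp add: mult_ac)
      qed
      then have "\<alpha> k * v k \<le> (2 powr p * E0 * m + q * Y k) * v k" using v0 by (intro mult_right_mono) auto
      also have "\<dots> = 2 powr p * E0 * (m * v k) + q * (v k * Y k)" by (simp add: algebra_simps)
      also have "2 powr p * E0 * (m * v k) \<le> 2 powr p * E0 * (Cd * real b powr a * I k)" using mv pE by (intro mult_left_mono) auto
      also have "\<dots> = K1 * I k" unfolding K1_def by simp
      finally have "\<alpha> k * v k \<le> K1 * I k + q * (v k * Y k)" by simp
      moreover have "0 \<le> 2 powr p * E0 * \<epsilon> * (S * v k)" using pE \<epsilon>0 S0 v0[of k] by simp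
      ultimately show ?thesis by linarith
    next
      case False
      \<comment> \<open>A cell meeting the truncated set: at one of its points
        \<open>|P| powr p\<close> times the truncated weight is tiny compared with the global
        quantity \<open>S\<close>, and \<open>osc\<close> carries this to the node.\<close>
      then obtain t where t: "t \<in> cell M k" "\<not> (t \<notin> Z \<and> U t = V t)" by blast
      then obtain \<tau> \<rho> where \<rho>: "0 < \<rho>" "\<rho> \<le> \<kappa>" "\<bar>t - \<tau>\<bar> \<le> \<rho>" "C2 * (real n * \<rho>) \<le> U t" "real n powr \<gamma> \<le> real n * \<rho>"
        "\<And>s. \<rho> \<le> \<bar>s - \<tau>\<bar> \<Longrightarrow> \<bar>s - \<tau>\<bar> \<le> \<kappa> \<Longrightarrow> U s \<le> \<Gamma> * (real n * \<rho>)"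
        using bad[of t] by blast
      have "T t powr p \<le> CR * real n powr p * exp (C0 * (real n * \<rho>)) * S"
        unfolding T_def by (rule remez[OF n(1) P UD(4) TS[unfolded T_def] \<rho>(1-3,6)])
      then have "T t powr p * exp (- U t) \<le> CR * real n powr p * exp (C0 * (real n * \<rho>)) * S * exp (- U t)" by (intro mult_right_mono) auto
      also have "\<dots> = CR * real n powr p * S * exp (C0 * (real n * \<rho>) - U t)" by (simp add: exp_diff exp_minus field_simps)
      also have "\<dots> \<le> CR * real n powr p * S * exp (- (real n powr \<gamma>))"
      proof -
        have "(C0 + 1) * (real n * \<rho>) \<le> C2 * (real n * \<rho>)" unfolding C2_def using \<rho> by (intro mult_right_mono) auto
        then have "C0 * (real n * \<rho>) - U t \<le> - (real n powr \<gamma>)" using \<rho>(4,5) by (simp add: distrib_right)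
        then show ?thesis using CR S0 by (intro mult_left_mono) auto
      qed
      also have "\<dots> = \<epsilon> * S" unfolding \<epsilon>_def by simp
      finally have "2 powr p * E0 * (T t powr p * exp (- U t)) \<le> 2 powr p * E0 * (\<epsilon> * S)" using E0 by (intro mult_left_mono) auto
      then have "\<alpha> k \<le> 2 powr p * E0 * (\<epsilon> * S) + q * Y k" using osc[OF k t(1)] by linarith
      then have "\<alpha> k * v k \<le> (2 powr p * E0 * (\<epsilon> * S) + q * Y k) * v k" using v0 by (intro mult_right_mono) auto
      also have "\<dots> = q * (v k * Y k) + 2 powr p * E0 * \<epsilon> * (S * v k)" by (simp add: algebra_simps)
      finally show ?thesis using K1 I0[OF k] mult_nonneg_nonneg[of K1 "I k"] by linarith
    qed
    \<comment> \<open>Even all cells together are harmless: comparing masses across the whole range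
      costs \<open>n powr a\<close> and the number of cells another \<open>n\<close>, against
      \<open>exp (- (n powr \<gamma>))\<close>.\<close>
    have badsum: "2 powr p * E0 * \<epsilon> * (\<Sum>k<M. S * v k) \<le> \<Lambda> / 4"
    proof -
      have vn: "v k \<le> Cd * real n powr a * v j" if "k < M" "j < M" for k j
      proof -
        have "real (idist (k div b) (j div b)) + 1 \<le> real n"
          using divn[OF that(1)] divn[OF that(2)] unfolding idist_def by linarith
        then have "dl k j powr a \<le> real n powr a" unfolding dl_def using a by (intro powr_mono2) auto
        then have "Cd * dl k j powr a * v j \<le> Cd * real n powr a * v j" using Cd v0 by (intro mult_right_mono mult_left_mono) auto
        then show ?thesis using vv[OF that] by linarith
      qed
      have "S * v k = C1 / real b * (\<Sum>j<M. \<alpha> j * v k)" for k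
        unfolding S_def by (simp add: sum_distrib_right mult.assoc)
      then have "(\<Sum>k<M. S * v k) = C1 / real b * (\<Sum>k<M. \<Sum>j<M. \<alpha> j * v k)"
        by (simp only: sum_distrib_left[symmetric])
      also have "\<dots> \<le> C1 / real b * (\<Sum>k<M. \<Sum>j<M. \<alpha> j * (Cd * real n powr a * v j))"
        using vn \<alpha>0 C1 by (intro mult_left_mono sum_mono) auto
      also have "\<dots> = C1 / real b * (real M * (Cd * real n powr a * \<Lambda>))"
        unfolding \<Lambda>_def by (simp add: sum_distrib_left mult_ac)
      also have "\<dots> = C1 * Cd * (real n * real n powr a) * \<Lambda>" unfolding M_def using b by simp
      also have "real n * real n powr a = real n powr (1 + a)" using nr by (simp add: powr_add)
      finally have "2 powr p * E0 * \<epsilon> * (\<Sum>k<M. S * v k) \<le> 2 powr p * E0 * \<epsilon> * (C1 * Cd * real n powr (1 + a) * \<Lambda>)"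
        using E0 \<epsilon>0 by (intro mult_left_mono) auto
      also have "\<dots> = ((2 powr p * E0 * CR * C1 * Cd) * real n powr (p + (1 + a)) * exp (- (real n powr \<gamma>))) * \<Lambda>"
        unfolding \<epsilon>_def powr_add[of _ p] by simp
      also have "\<dots> \<le> 1 / 4 * \<Lambda>" using n2[of n] n \<Lambda>0 by (intro mult_right_mono) auto
      finally show ?thesis by simp
    qed
    \<comment> \<open>Two quarters of \<Lambda> return on the right; as \<Lambda> is a finite sum,
      they can be subtracted.\<close>
    have "\<Lambda> \<le> (\<Sum>k<M. K1 * I k + q * (v k * Y k) + 2 powr p * E0 * \<epsilon> * (S * v k))"
      unfolding \<Lambda>_def using each by (intro sum_mono) auto
    also have "\<dots> = K1 * (\<Sum>k<M. I k) + q * (\<Sum>k<M. v k * Y k) + 2 powr p * E0 * \<epsilon> * (\<Sum>k<M. S * v k)"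
      by (simp only: sum.distrib sum_distrib_left)
    also have "q * (\<Sum>k<M. v k * Y k) \<le> q * (C3 * \<Lambda>)" using sumY q0 by (intro mult_left_mono) auto
    also have "q * (C3 * \<Lambda>) = (q * C3) * \<Lambda>" by simp
    also have "\<dots> \<le> 1 / 4 * \<Lambda>" using b(4) \<Lambda>0 unfolding q_def by (intro mult_right_mono) auto
    finally have \<Lambda>I: "\<Lambda> \<le> 2 * K1 * (\<Sum>k<M. I k)" using badsum by linarith
    \<comment> \<open>\<open>Y k\<close> bounds \<open>|P| powr p * exp (- U)\<close> in a whole
      disc about each point of the cell, so Cauchy's estimate is applied first and
      \<open>W \<le> exp (- U)\<close> inserted afterwards.\<close>
    have Dk: "D k \<le> (CM * (real n)\<^sup>2) powr p * (v k * Y k)" if k: "k < M" for k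
    proof -
      define m where "m = (CM * (real n)\<^sup>2) powr p * Y k"
      have m0: "0 \<le> m" unfolding m_def using Y0 by simp
      have "D k \<le> m * cell_mass u M k"
        unfolding M_def
      proof (rule D)
        show "k < b * n" using k unfolding M_def .
        show "0 \<le> m" by (rule m0)
        fix t assume t: "t \<in> cell (b * n) k"
        then have tt: "t \<in> cell M k" unfolding M_def .
        define B where "B = (Y k * exp (U t)) powr (1 / p)"
        have Bp: "B powr p = Y k * exp (U t)" unfolding B_def using p Y0[of k] by (simp add: powr_powr)
        have B0: "0 \<le> B" unfolding B_def by simp
        have "cmod (poly P (cos z)) \<le> B" if z: "cmod (z - of_real t) \<le> c / real n" for z
        proof -
          have "cmod (poly P (cos z)) powr p * exp (- U t) * exp (U t) \<le> Y k * exp (U t)"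
            using Y[OF k tt z] by (intro mult_right_mono) auto
          then have "cmod (poly P (cos z)) powr p \<le> Y k * exp (U t)" by (simp add: mult.assoc flip: exp_add)
          then have "(cmod (poly P (cos z)) powr p) powr (1 / p) \<le> B" unfolding B_def using p by (intro powr_mono2) auto
          then show ?thesis using p by (simp add: powr_powr)
        qed
        from pd[OF n(1) this]
        have "cmod (poly (pderiv P) (of_real (cos t))) powr p \<le> (CM * (real n)\<^sup>2 * B) powr p" using p by (intro powr_mono2) auto
        also have "\<dots> = (CM * (real n)\<^sup>2) powr p * (Y k * exp (U t))" using CM B0 by (simp only: powr_mult Bp) 
        finally have "cmod (poly (pderiv P) (of_real (cos t))) powr p * W t \<le> (CM * (real n)\<^sup>2) powr p * (Y k * exp (U t)) * exp (- U t)"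
          using WU[of t] Y0[of k] by (intro mult_mono) auto
        also have "\<dots> = m" unfolding m_def by (simp add: mult.assoc flip: exp_add)
        finally show "cmod (poly (pderiv P) (of_real (cos t))) powr p * W t \<le> m" .
      qed
      also have "\<dots> \<le> m * v k" using m0 m3[OF b(1)] k unfolding v_def M_def by (intro mult_left_mono) auto
      finally show ?thesis unfolding m_def by (simp add: mult_ac)
    qed
    have "(\<Sum>k<M. D k) \<le> (\<Sum>k<M. (CM * (real n)\<^sup>2) powr p * (v k * Y k))" using Dk by (intro sum_mono) auto
    also have "\<dots> = (CM * (real n)\<^sup>2) powr p * (\<Sum>k<M. v k * Y k)" by (simp add: sum_distrib_left)
    also have "\<dots> \<le> (CM * (real n)\<^sup>2) powr p * (C3 * (2 * K1 * (\<Sum>k<M. I k)))"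
    proof (rule mult_left_mono)
      show "(\<Sum>k<M. v k * Y k) \<le> C3 * (2 * K1 * (\<Sum>k<M. I k))"
        by (rule order.trans[OF sumY mult_left_mono[OF \<Lambda>I]]) (use C3 in simp)
    qed simp
    also have "(CM * (real n)\<^sup>2) powr p = CM powr p * real n powr (2 * p)"
      using CM nr by (simp add: powr_mult powr_powr flip: powr_numeral)
    finally show "(\<Sum>k<b * n. D k) \<le> C * real n powr (2 * p) * (\<Sum>k<b * n. I k)"
      unfolding C_def M_def by (simp add: mult_ac)
  qed
qed

section \<open>The theorem\<close>

lemma landscape_closed_zeros:
  assumes "landscape \<Gamma> \<kappa> Z V"
  shows "closed Z"
proof (rule discrete_imp_closed)
  show "0 < \<kappa>" by (rule landscapeD(2)[OF assms])
  show "\<forall>x\<in>Z. \<forall>y\<in>Z. dist y x < \<kappa> \<longrightarrow> y = x"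
    using landscapeD(11)[OF assms] landscapeD(2)[OF assms] by (force simp: dist_real_def)
qed

text \<open>Borel, not merely Lebesgue measurability, so that it survives composition with
  \<open>arccos\<close>.\<close>

lemma landscape_weight_measurable:
  assumes L: "landscape \<Gamma> \<kappa> Z V" and W: "\<And>t. W t = (if t \<in> Z then 0 else exp (- V t))"
  shows "W \<in> borel_measurable borel"
proof -
  have "- Z \<in> sets borel" using landscape_closed_zeros[OF L] by (intro borel_open) (simp add: open_Compl)
  moreover have "continuous_on (- Z) (\<lambda>t. exp (- V t))"
    using landscapeD(10)[OF L] by (intro continuous_intros continuous_at_imp_continuous_on) auto
  ultimately have "(\<lambda>t. indicator (- Z) t *\<^sub>R exp (- V t)) \<in> borel_measurable borel"
    by (rule borel_measurable_continuous_on_indicator)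
  moreover have "(\<lambda>t. indicator (- Z) t *\<^sub>R exp (- V t)) = W"
    by (auto simp: fun_eq_iff W indicator_def)
  ultimately show ?thesis by simp
qed

lemma weight_times_bounded_integrable:
  assumes u: "weight u" and f: "f \<in> borel_measurable (lebesgue_on {-1..1})" and b: "\<And>x. x \<in> {-1..1} \<Longrightarrow> \<bar>f x\<bar> \<le> B"
  shows "(\<lambda>x. f x * u x) absolutely_integrable_on {-1..1::real}"
proof (rule absolutely_integrable_bounded_measurable_product_real)
  show "bounded (f ` {-1..1})" using b by (intro boundedI[of _ B]) auto
  show "u absolutely_integrable_on {-1..1}" using u unfolding weight_def by blast
qed (use f in auto)

text \<open>The cosine reverses the order, so cell 0 ends at 1 and the induction extends the
  interval from 1 downwards.\<close>

lemma integral_cells: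
  fixes f :: "real \<Rightarrow> real"
  assumes f: "f integrable_on {-1..1::real}" and M: "0 < M"
  shows "integral {-1..1} f = (\<Sum>k<M. integral {cos (real (Suc k) * (pi / real M))..cos (real k * (pi / real M))} f)"
proof -
  have "integral {cos (real m * (pi / real M))..1} f
      = (\<Sum>k<m. integral {cos (real (Suc k) * (pi / real M))..cos (real k * (pi / real M))} f)" if "m \<le> M" for m
    using that
  proof (induction m)
    case (Suc m)
    have le: "cos (real (Suc m) * (pi / real M)) \<le> cos (real m * (pi / real M))" using Suc by (intro cos_grid_mono) auto
    have "f integrable_on {cos (real (Suc m) * (pi / real M))..1}"
      by (rule integrable_subinterval_real[OF f]) auto
    then have "integral {cos (real (Suc m) * (pi / real M))..cos (real m * (pi / real M))} f + integral {cos (real m * (pi / real M))..1} f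
      = integral {cos (real (Suc m) * (pi / real M))..1} f"
      by (intro Henstock_Kurzweil_Integration.integral_combine le cos_le_one)
    then show ?case using Suc by simp
  qed simp
  from this[of M] M show ?thesis by simp
qed

text \<open>Symmetry is read off from the product, a function of \<open>cos t\<close>:
  \<open>exp\<close> being injective and positive, evenness of the weight passes to \<open>Z\<close>
  and to \<open>V\<close>.\<close>

lemma Omega_product_landscape:
  fixes s :: nat and \<omega>s :: "nat \<Rightarrow> real \<Rightarrow> real"
  assumes s: "1 \<le> s" and w: "\<forall>i\<in>{1..s}. (\<lambda>t. \<omega>s i (cos t)) \<in> Omega"
  obtains \<Gamma> \<kappa> Z V where "landscape \<Gamma> \<kappa> Z V"
    "\<And>t. (\<Prod>i=1..s. \<omega>s i (cos t)) = (if t \<in> Z then 0 else exp (- V t))"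
proof -
  have "\<forall>i\<in>{1..s}. \<exists>g F. (\<exists>A>0. Omega_inner A g \<and> Omega_outer A F) \<and> (\<forall>t. \<omega>s i (cos t) = (if g t = 0 then 0 else exp (- F (g t))))"
    using w unfolding Omega_def by blast
  from bchoice[OF this] obtain g where "\<forall>i\<in>{1..s}. \<exists>F. (\<exists>A>0. Omega_inner A (g i) \<and> Omega_outer A F) \<and> (\<forall>t. \<omega>s i (cos t) = (if g i t = 0 then 0 else exp (- F (g i t))))" by blast
  from bchoice[OF this] obtain F where
    gF: "\<And>i. i \<in> {1..s} \<Longrightarrow> \<exists>A>0. Omega_inner A (g i) \<and> Omega_outer A (F i)" and
    wi: "\<And>i t. i \<in> {1..s} \<Longrightarrow> \<omega>s i (cos t) = (if g i t = 0 then 0 else exp (- F i (g i t)))" by blast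
  define v where "v = (\<lambda>i t. F i (g i t))"
  define Z where "Z = {t. \<exists>i\<in>{1..s}. g i t = 0}"
  define V where "V = (\<lambda>t. \<Sum>i\<in>{1..s}. v i t)"
  have W: "(\<Prod>i=1..s. \<omega>s i (cos t)) = (if t \<in> Z then 0 else exp (- V t))" for t
  proof (cases "t \<in> Z")
    case True
    then obtain i where "i \<in> {1..s}" "\<omega>s i (cos t) = 0" using wi unfolding Z_def by auto
    then have "(\<Prod>i=1..s. \<omega>s i (cos t)) = 0" by (intro prod_zero) auto
    then show ?thesis using True by simp
  next
    case False
    then have "(\<Prod>i=1..s. \<omega>s i (cos t)) = (\<Prod>i=1..s. exp (- v i t))"
      using wi unfolding Z_def v_def by (intro prod.cong) auto
    also have "\<dots> = exp (- V t)" unfolding V_def by (simp add: exp_sum sum_negf[symmetric])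
    finally show ?thesis using False by simp
  qed
  have ev: "(\<Prod>i=1..s. \<omega>s i (cos (- t))) = (\<Prod>i=1..s. \<omega>s i (cos t))" for t by simp
  have evZ: "- t \<in> Z \<longleftrightarrow> t \<in> Z" for t using ev[of t] unfolding W by (auto split: if_splits)
  have evV: "V (- t) = V t" if "t \<notin> Z" for t using ev[of t] that evZ[of t] unfolding W by auto
  have "\<exists>\<Gamma> \<kappa>. landscape \<Gamma> \<kappa> {t. \<exists>i\<in>{1..s}. g i t = 0} (\<lambda>t. \<Sum>i\<in>{1..s}. v i t)"
  proof (rule sum_landscape)
    show "\<exists>B. singular_factor B (g i) (v i)" if "i \<in> {1..s}" for i
      using gF[OF that] Omega_factor unfolding v_def by blast
    show "v i (t + 2 * pi) = v i t" if "i \<in> {1..s}" for i t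
      using gF[OF that] unfolding v_def Omega_inner_def by auto
  qed (use s evZ evV in \<open>auto simp: Z_def V_def\<close>)
  then show ?thesis using that W unfolding Z_def V_def by blast
qed

theorem theorem7p3:
  fixes p :: real and s :: nat and \<omega> u :: "real \<Rightarrow> real" and \<omega>s :: "nat \<Rightarrow> real \<Rightarrow> real"
  assumes "0 < p"
    and "1 \<le> s"
    and "\<forall>i\<in>{1..s}. (\<lambda>t. \<omega>s i (cos t)) \<in> Omega"
    and "\<forall>x\<in>{-1..1}. \<omega> x = (\<Prod>i=1..s. \<omega>s i x)"
    and "weight u"
    and "doubling u"
  shows "\<exists>C::real. \<forall>n\<ge>1. \<forall>P :: complex poly. degree P \<le> n \<longrightarrow>
    (LINT x:{-1..1}|lebesgue. cmod (poly (pderiv P) (complex_of_real x)) powr p * \<omega> x * u x)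
      \<le> C * real n powr (2 * p) *
        (LINT x:{-1..1}|lebesgue. cmod (poly P (complex_of_real x)) powr p * \<omega> x * u x)"
proof -
  obtain \<Gamma> \<kappa> Z V where L: "landscape \<Gamma> \<kappa> Z V"
    and WV: "\<And>t. (\<Prod>i=1..s. \<omega>s i (cos t)) = (if t \<in> Z then 0 else exp (- V t))"
    using Omega_product_landscape[OF assms(2,3)] by blast
  define W where "W t = (\<Prod>i=1..s. \<omega>s i (cos t))" for t
  have W: "W t = (if t \<in> Z then 0 else exp (- V t))" for t unfolding W_def by (rule WV)
  have W01: "0 \<le> W t" "W t \<le> 1" for t
  proof -
    show "0 \<le> W t" unfolding W by simp
    have "0 < 1 / \<Gamma>" using landscapeD(1)[OF L] by simp
    then have "0 \<le> V t" if "t \<notin> Z" using landscapeD(9)[OF L that] by linarith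
    then show "W t \<le> 1" unfolding W by auto
  qed
  have \<omega>: "\<omega> x = W (arccos x)" if "x \<in> {-1..1}" for x
    using assms(4) that unfolding W_def by (auto intro!: prod.cong)
  have meas\<omega>: "\<omega> \<in> borel_measurable (lebesgue_on {-1..1})"
  proof -
    have "arccos \<in> borel_measurable (lebesgue_on {-1..1})"
      by (intro continuous_imp_measurable_on_sets_lebesgue continuous_on_arccos') auto
    then have "(\<lambda>x. W (arccos x)) \<in> borel_measurable (lebesgue_on {-1..1})"
      by (rule measurable_compose[OF _ landscape_weight_measurable[OF L W]])
    then show ?thesis by (rule measurable_cong[THEN iffD1, rotated]) (use \<omega> in \<open>auto simp: space_restrict_space\<close>)
  qed
  define h where "h Q x = cmod (poly Q (complex_of_real x)) powr p * \<omega> x" for Q x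
  have hint: "(\<lambda>x. h Q x * u x) absolutely_integrable_on {-1..1}" for Q
  proof -
    have cont: "continuous_on {-1..1} (\<lambda>x. cmod (poly Q (complex_of_real x)) powr p)"
      using assms(1) by (intro continuous_on_powr' continuous_intros) auto
    then have hm: "h Q \<in> borel_measurable (lebesgue_on {-1..1})"
      unfolding h_def by (intro borel_measurable_times meas\<omega> continuous_imp_measurable_on_sets_lebesgue) auto
    have "bounded ((\<lambda>x. cmod (poly Q (complex_of_real x)) powr p) ` {-1..1})"
      by (intro compact_imp_bounded compact_continuous_image cont) auto
    then obtain B where B: "\<And>x. x \<in> {-1..1} \<Longrightarrow> \<bar>cmod (poly Q (complex_of_real x)) powr p\<bar> \<le> B"
      unfolding bounded_iff real_norm_def by blast
    have "\<bar>h Q x\<bar> \<le> B" if x: "x \<in> {-1..1}" for x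
    proof -
      have "\<bar>h Q x\<bar> = \<bar>cmod (poly Q (complex_of_real x)) powr p\<bar> * W (arccos x)"
        unfolding h_def \<omega>[OF x] abs_mult using W01 by simp
      also have "\<dots> \<le> B * 1" using B[OF x] W01 order.trans[OF abs_ge_zero B[OF x]] by (intro mult_mono) auto
      finally show ?thesis by simp
    qed
    then show "(\<lambda>x. h Q x * u x) absolutely_integrable_on {-1..1}"
      by (rule weight_times_bounded_integrable[OF assms(5) hm])
  qed
  have LI: "(LINT x:{-1..1}|lebesgue. h Q x * u x) = integral {-1..1} (\<lambda>x. h Q x * u x)" for Q
    by (rule set_lebesgue_integral_eq_integral(2)[OF hint])
  have int: "(\<lambda>x. h Q x * u x) integrable_on {-1..1}" for Q
    by (rule set_lebesgue_integral_eq_integral(1)[OF hint])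
  obtain C b n0 where b: "0 < b" and C: "0 < C"
    and main: "\<forall>n P I D. 1 \<le> n \<and> n0 \<le> n \<and> degree P \<le> n \<and>
       (\<forall>k m. k < b * n \<and> 0 \<le> m \<and> (\<forall>t\<in>cell (b * n) k. m \<le> cmod (poly P (of_real (cos t))) powr p * W t)
          \<longrightarrow> m * cell_mass u (b * n) k \<le> I k) \<and>
       (\<forall>k m. k < b * n \<and> 0 \<le> m \<and> (\<forall>t\<in>cell (b * n) k. cmod (poly (pderiv P) (of_real (cos t))) powr p * W t \<le> m)
          \<longrightarrow> D k \<le> m * cell_mass u (b * n) k)
       \<longrightarrow> (\<Sum>k<b * n. D k) \<le> C * real n powr (2 * p) * (\<Sum>k<b * n. (I k :: real))"
    using discrete_markov[OF assms(1,5,6) L W] by (elim exE conjE) rule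
  define J where "J Q = integral {-1..1} (\<lambda>x. h Q x * u x)" for Q
  have J0: "0 \<le> J Q" for Q
    unfolding J_def using assms(5) W01 \<omega> int by (intro integral_nonneg) (auto simp: h_def weight_def)
  have large: "J (pderiv P) \<le> C * real n powr (2 * p) * J P" if n: "1 \<le> n" "n0 \<le> n" and P: "degree P \<le> n" for n P
  proof -
    define M where "M = b * n"
    have M: "0 < M" unfolding M_def using b n by simp
    define X where "X k = {cos (real (Suc k) * (pi / real M))..cos (real k * (pi / real M))}" for k
    have X1: "X k \<subseteq> {-1..1}" for k unfolding X_def by auto
    have arc: "arccos x \<in> cell M k" if x: "x \<in> X k" and k: "k < M" for x k
    proof -
      have a: "real j * (pi / real M) = arccos (cos (real j * (pi / real M)))" if "j \<le> M" for j
      proof -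
        have "real j * (pi / real M) \<le> real M * (pi / real M)" using that by (intro mult_right_mono) auto
        then show ?thesis using M by (intro arccos_cos[symmetric]) auto
      qed
      have x1: "-1 \<le> x" "x \<le> 1" using x X1[of k] by auto
      have b: "cos (real (Suc k) * (pi / real M)) \<le> x" "x \<le> cos (real k * (pi / real M))"
        using x unfolding X_def atLeastAtMost_iff by blast+
      have "arccos (cos (real k * (pi / real M))) \<le> arccos x" "arccos x \<le> arccos (cos (real (Suc k) * (pi / real M)))"
        by (rule arccos_le_arccos[OF x1(1) b(2) cos_le_one], rule arccos_le_arccos[OF cos_ge_minus_one b(1) x1(2)])
      moreover have "k \<le> M" "Suc k \<le> M" using k by auto
      ultimately show ?thesis unfolding cell_def atLeastAtMost_iff using a[of k] a[of "Suc k"] by (simp only:)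
    qed
    have hW: "h Q x = cmod (poly Q (of_real (cos (arccos x)))) powr p * W (arccos x)" if "x \<in> X k" for Q x k
    proof -
      have "x \<in> {-1..1}" using that X1 by blast
      then show ?thesis unfolding h_def using \<omega>[of x] by simp
    qed
    have intX: "(\<lambda>x. h Q x * u x) integrable_on X k" for Q k
      unfolding X_def by (rule integrable_subinterval_real[OF int]) auto
    have uX: "u integrable_on X k" for k
      unfolding X_def by (rule set_lebesgue_integral_eq_integral(1)[OF weight_integrable_subinterval[OF assms(5)]]) auto
    have muX: "(\<lambda>x. m * u x) integrable_on X k" for m k
      using integrable_on_cmult_left[OF uX, of m] by simp
    have cm: "cell_mass u M k = integral (X k) u" for k
      unfolding cell_mass_def X_def by (rule mass_eq_integral[OF assms(5)]) auto
    have u0: "0 \<le> u x" if "x \<in> X k" for x k using assms(5) X1[of k] that unfolding weight_def by auto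
    have "(\<Sum>k<b * n. integral (X k) (\<lambda>x. h (pderiv P) x * u x))
        \<le> C * real n powr (2 * p) * (\<Sum>k<b * n. integral (X k) (\<lambda>x. h P x * u x))"
    proof (rule main[rule_format], intro conjI allI impI)
      show "1 \<le> n" "n0 \<le> n" "degree P \<le> n" by (fact n P)+
    next
      fix k m assume "k < b * n \<and> 0 \<le> m \<and> (\<forall>t\<in>cell (b * n) k. m \<le> cmod (poly P (of_real (cos t))) powr p * W t)"
      then have k: "k < b * n" and m: "0 \<le> m"
        and low: "\<And>t. t \<in> cell (b * n) k \<Longrightarrow> m \<le> cmod (poly P (of_real (cos t))) powr p * W t" by auto
      have kM: "k < M" using k unfolding M_def .
      have "integral (X k) (\<lambda>x. m * u x) \<le> integral (X k) (\<lambda>x. h P x * u x)"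
      proof (rule integral_le[OF muX intX])
        fix x assume x: "x \<in> X k"
        have "m \<le> h P x" unfolding hW[OF x] using low arc[OF x kM] unfolding M_def by blast
        then show "m * u x \<le> h P x * u x" using u0[OF x] by (intro mult_right_mono)
      qed
      then show "m * cell_mass u (b * n) k \<le> integral (X k) (\<lambda>x. h P x * u x)"
        using cm[of k] unfolding M_def by simp
    next
      fix k m assume "k < b * n \<and> 0 \<le> m \<and> (\<forall>t\<in>cell (b * n) k. cmod (poly (pderiv P) (of_real (cos t))) powr p * W t \<le> m)"
      then have k: "k < b * n" and m: "0 \<le> m"
        and up: "\<And>t. t \<in> cell (b * n) k \<Longrightarrow> cmod (poly (pderiv P) (of_real (cos t))) powr p * W t \<le> m" by auto
      have kM: "k < M" using k unfolding M_def .
      have "integral (X k) (\<lambda>x. h (pderiv P) x * u x) \<le> integral (X k) (\<lambda>x. m * u x)"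
      proof (rule integral_le[OF intX muX])
        fix x assume x: "x \<in> X k"
        have "h (pderiv P) x \<le> m" unfolding hW[OF x] using up arc[OF x kM] unfolding M_def by blast
        then show "h (pderiv P) x * u x \<le> m * u x" using u0[OF x] by (intro mult_right_mono)
      qed
      then show "integral (X k) (\<lambda>x. h (pderiv P) x * u x) \<le> m * cell_mass u (b * n) k"
        using cm[of k] unfolding M_def by simp
    qed
    then show ?thesis unfolding J_def integral_cells[OF int M] X_def M_def .
  qed
  \<comment> \<open>For \<open>n < n0\<close> the polynomial is regarded as one of degree at most
    \<open>N\<close>; these cases are covered by the factor \<open>N powr (2 * p)\<close> in
    \<open>K\<close>.\<close>
  define N where "N = max 1 n0"
  define K where "K = C * real N powr (2 * p)"
  have "J (pderiv P) \<le> K * real n powr (2 * p) * J P" if n: "1 \<le> n" and P: "degree P \<le> n" for n P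
  proof -
    have N1: "1 \<le> real N" unfolding N_def by simp
    have n1: "1 \<le> real n" using n by simp
    have pN: "1 \<le> real N powr (2 * p)" "1 \<le> real n powr (2 * p)"
      using N1 n1 assms(1) by (auto intro!: ge_one_powr_ge_zero)
    show ?thesis
    proof (cases "n0 \<le> n")
      case True
      have "J (pderiv P) \<le> (C * 1) * real n powr (2 * p) * J P" using large[OF n True P] by simp
      also have "\<dots> \<le> K * real n powr (2 * p) * J P"
        unfolding K_def using pN C J0 by (intro mult_right_mono mult_left_mono) auto
      finally show ?thesis .
    next
      case False
      have "J (pderiv P) \<le> (C * real N powr (2 * p)) * 1 * J P"
        using large[of N P] P False unfolding N_def by simp
      also have "\<dots> \<le> K * real n powr (2 * p) * J P"
        unfolding K_def using pN C J0 by (intro mult_right_mono mult_left_mono) auto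
      finally show ?thesis .
    qed
  qed
  then show ?thesis using LI unfolding J_def h_def by (intro exI[of _ K]) auto
qed

end
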